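(* Let $A$ and $B$ be stably equivalent Artin algebras. Then $\mathrm{ext.dim}(A)=\mathrm{ext.dim}(B)$.
   Context: Let $k$ be a fixed commutative Artin ring. All algebras are Artin $k$-algebras with unit, modules are finitely generated unitary left modules, and all functors are $k$-functors. $A\text{-mod}$ is the category of finitely generated left $A$-modules. The stable module category $A\text{-}\underline{\mathrm{mod}}$ has the same objects as $A\text{-mod}$, with morphism sets $\underline{\mathrm{Hom}}_A(X,Y)=\mathrm{Hom}_A(X,Y)/\mathscr{P}(X,Y)$, where $\mathscr{P}(X,Y)$ consists of the homomorphisms factoring through a projective $A$-module. $A$ and $B$ are stably equivalent if $A\text{-}\underline{\mathrm{mod}}$ and $B\text{-}\underline{\mathrm{mod}}$ are equivalent as additive categories. Extension dimension: for a class $\mathcal{T}$ of $A$-modules, $\mathrm{add}(\mathcal{T})$ is the smallest full subcategory of $A\text{-mod}$ containing $\mathcal{T}$ and closed under finite direct sums and direct summands. For subcategories $\mathcal{T}_1,\mathcal{T}_2$ of $A\text{-mod}$, $\mathcal{T}_1\bullet\mathcal{T}_2$ is $\mathrm{add}$ of the class of modules $X$ for which there is an exact sequence $0\to T_1\to X\to T_2\to 0$ with $T_1\in\mathcal{T}_1$, $T_2\in\mathcal{T}_2$. For $T\in A\text{-mod}$ put $[T]_0=\{0\}$, $[T]_1=\mathrm{add}(T)$, and $[T]_n=[T]_1\bullet[T]_{n-1}$ for $n\ge 2$. Then $\mathrm{ext.dim}(A):=\inf\{n\ge 0\mid A\text{-mod}=[T]_{n+1}\text{ for some }T\in A\text{-mod}\}$.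 *)

theory Defs
  imports "HOL-Algebra.Module" "HOL-Algebra.Ideal" "HOL-Library.Extended_Nat"
begin

section \<open>Artin algebras and their finitely generated modules\<close>

locale artinian_cring = cring +
  assumes descending_chain: "\<And>I :: nat \<Rightarrow> 'a set.
    (\<And>n. ideal (I n) R) \<Longrightarrow> (\<And>n. I (Suc n) \<subseteq> I n) \<Longrightarrow> \<exists>N. \<forall>n\<ge>N. I n = I N"

text \<open>The locale \<^locale>\<open>Module.module\<close> of HOL-Algebra requires a commutative ring of scalars. The
  predicate \<^const>\<open>Module.submodule\<close> does not. As in \<^locale>\<open>Module.module\<close>, the fields \<open>mult\<close> and \<open>one\<close>
  of the module record are not used.\<close>

locale left_module = R?: ring R + M?: abelian_group M for R (structure) and M (structure) +
  assumes smult_closed [simp, intro]: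
      "\<lbrakk>a \<in> carrier R; x \<in> carrier M\<rbrakk> \<Longrightarrow> a \<odot>\<^bsub>M\<^esub> x \<in> carrier M"
    and smult_l_distr:
      "\<lbrakk>a \<in> carrier R; b \<in> carrier R; x \<in> carrier M\<rbrakk> \<Longrightarrow>
        (a \<oplus> b) \<odot>\<^bsub>M\<^esub> x = a \<odot>\<^bsub>M\<^esub> x \<oplus>\<^bsub>M\<^esub> b \<odot>\<^bsub>M\<^esub> x"
    and smult_r_distr:
      "\<lbrakk>a \<in> carrier R; x \<in> carrier M; y \<in> carrier M\<rbrakk> \<Longrightarrow>
        a \<odot>\<^bsub>M\<^esub> (x \<oplus>\<^bsub>M\<^esub> y) = a \<odot>\<^bsub>M\<^esub> x \<oplus>\<^bsub>M\<^esub> a \<odot>\<^bsub>M\<^esub> y"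
    and smult_assoc1:
      "\<lbrakk>a \<in> carrier R; b \<in> carrier R; x \<in> carrier M\<rbrakk> \<Longrightarrow>
        (a \<otimes> b) \<odot>\<^bsub>M\<^esub> x = a \<odot>\<^bsub>M\<^esub> (b \<odot>\<^bsub>M\<^esub> x)"
    and smult_one [simp]: "x \<in> carrier M \<Longrightarrow> \<one> \<odot>\<^bsub>M\<^esub> x = x"

definition fin_gen :: "('r, 'rx) ring_scheme \<Rightarrow> ('r, 'm, 'mx) module_scheme \<Rightarrow> bool" where
  "fin_gen R M \<longleftrightarrow> (\<exists>S. finite S \<and> S \<subseteq> carrier M \<and>
     (\<forall>N. submodule N R M \<longrightarrow> S \<subseteq> N \<longrightarrow> N = carrier M))"

text \<open>A \<open>k\<close>-algebra is a ring \<open>A\<close> whose record also carries the action of \<open>k\<close>. The two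
  associativity laws say that \<open>k\<close> acts through the centre of \<open>A\<close>.\<close>

locale artin_algebra = artinian_cring k + Module.module k A + ring A
  for k (structure) and A (structure) +
  assumes smult_mult_left:
      "\<lbrakk>c \<in> carrier k; x \<in> carrier A; y \<in> carrier A\<rbrakk> \<Longrightarrow>
        (c \<odot>\<^bsub>A\<^esub> x) \<otimes>\<^bsub>A\<^esub> y = c \<odot>\<^bsub>A\<^esub> (x \<otimes>\<^bsub>A\<^esub> y)"
    and smult_mult_right:
      "\<lbrakk>c \<in> carrier k; x \<in> carrier A; y \<in> carrier A\<rbrakk> \<Longrightarrow>
        x \<otimes>\<^bsub>A\<^esub> (c \<odot>\<^bsub>A\<^esub> y) = c \<odot>\<^bsub>A\<^esub> (x \<otimes>\<^bsub>A\<^esub> y)"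
    and fin_gen_over_base: "fin_gen k A"

text \<open>Homomorphisms are extensional functions, so that equality of homomorphisms is equality
  on the carrier.\<close>

definition mod_hom ::
  "('a, 'ax) ring_scheme \<Rightarrow> ('a, 'm, 'mx) module_scheme \<Rightarrow> ('a, 'n, 'nx) module_scheme \<Rightarrow> ('m \<Rightarrow> 'n) set"
where
  "mod_hom A X Y = {f \<in> carrier X \<rightarrow>\<^sub>E carrier Y.
     (\<forall>x\<in>carrier X. \<forall>y\<in>carrier X. f (x \<oplus>\<^bsub>X\<^esub> y) = f x \<oplus>\<^bsub>Y\<^esub> f y) \<and>
     (\<forall>a\<in>carrier A. \<forall>x\<in>carrier X. f (a \<odot>\<^bsub>X\<^esub> x) = a \<odot>\<^bsub>Y\<^esub> f x)}"

definition mod_isomorphic ::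
  "('a, 'ax) ring_scheme \<Rightarrow> ('a, 'm, 'mx) module_scheme \<Rightarrow> ('a, 'n, 'nx) module_scheme \<Rightarrow> bool"
where
  "mod_isomorphic A X Y \<longleftrightarrow> (\<exists>f\<in>mod_hom A X Y. bij_betw f (carrier X) (carrier Y))"

definition mod_dsum ::
  "('a, 'm, 'mx) module_scheme \<Rightarrow> ('a, 'n, 'nx) module_scheme \<Rightarrow> ('a, 'm \<times> 'n) module"
where
  "mod_dsum X Y = \<lparr>carrier = carrier X \<times> carrier Y, mult = undefined, one = undefined,
     zero = (\<zero>\<^bsub>X\<^esub>, \<zero>\<^bsub>Y\<^esub>),
     add = (\<lambda>(x, y) (x', y'). (x \<oplus>\<^bsub>X\<^esub> x', y \<oplus>\<^bsub>Y\<^esub> y')),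
     smult = (\<lambda>a (x, y). (a \<odot>\<^bsub>X\<^esub> x, a \<odot>\<^bsub>Y\<^esub> y))\<rparr>"

text \<open>The objects of \<open>A\<close>-mod are the finitely generated left modules whose carrier lies in the
  type of sets of sequences in \<open>A\<close>. Quotients of the free modules of finite rank live there, so
  every finitely generated left \<open>A\<close>-module, on whatever type, is isomorphic to such an object:
  see the lemma \<open>fg_modules_representative\<close> below.\<close>

type_synonym 'a amod = "('a, (nat \<Rightarrow> 'a) set) module"

definition fg_modules :: "('a, 'ax) ring_scheme \<Rightarrow> 'a amod set" where
  "fg_modules A = {M. left_module A M \<and> fin_gen A M}"

lemma (in left_module) smult_l_null: "x \<in> carrier M \<Longrightarrow> \<zero> \<odot>\<^bsub>M\<^esub> x = \<zero>\<^bsub>M\<^esub>"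
  by (metis M.add.r_cancel_one' R.l_zero R.zero_closed smult_closed smult_l_distr)

lemma (in left_module) smult_r_null: "a \<in> carrier R \<Longrightarrow> a \<odot>\<^bsub>M\<^esub> \<zero>\<^bsub>M\<^esub> = \<zero>\<^bsub>M\<^esub>"
  by (metis M.add.r_cancel_one' M.l_zero M.zero_closed smult_closed smult_r_distr)

lemma (in left_module) smult_l_minus:
  assumes "a \<in> carrier R" "x \<in> carrier M"
  shows "(\<ominus> a) \<odot>\<^bsub>M\<^esub> x = \<ominus>\<^bsub>M\<^esub> (a \<odot>\<^bsub>M\<^esub> x)"
proof -
  have "(\<ominus> a) \<odot>\<^bsub>M\<^esub> x \<oplus>\<^bsub>M\<^esub> a \<odot>\<^bsub>M\<^esub> x = \<zero>\<^bsub>M\<^esub>"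
    using assms smult_l_distr[of "\<ominus> a" a x] by (simp add: R.l_neg smult_l_null)
  then show ?thesis
    using assms by (metis M.minus_equality R.a_inv_closed smult_closed)
qed

lemma (in left_module) fin_gen_combinations:
  assumes "fin_gen R M"
  obtains n :: nat and s where "s \<in> {..<n} \<rightarrow> carrier M"
    and "\<And>x. x \<in> carrier M \<Longrightarrow>
      \<exists>c. c \<in> UNIV \<rightarrow> carrier R \<and> x = (\<Oplus>\<^bsub>M\<^esub>i\<in>{..<n}. c i \<odot>\<^bsub>M\<^esub> s i)"
proof -
  obtain S where S: "finite S" "S \<subseteq> carrier M"
      "\<And>N. submodule N R M \<Longrightarrow> S \<subseteq> N \<Longrightarrow> N = carrier M"
    using assms unfolding fin_gen_def by blast
  obtain s and n :: nat where s: "S = s ` {i. i < n}"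
    using finite_imp_nat_seg_image_inj_on[OF S(1)] by blast
  define L where "L c = (\<Oplus>\<^bsub>M\<^esub>i\<in>{..<n}. c i \<odot>\<^bsub>M\<^esub> s i)" for c
  define N where "N = L ` (UNIV \<rightarrow> carrier R)"
  have sM: "s \<in> {..<n} \<rightarrow> carrier M" using S(2) s by auto
  have LM: "L c \<in> carrier M" if "c \<in> UNIV \<rightarrow> carrier R" for c
    unfolding L_def using that sM by (intro M.finsum_closed) auto
  have Ladd: "L c \<oplus>\<^bsub>M\<^esub> L d = L (\<lambda>i. c i \<oplus> d i)"
    if "c \<in> UNIV \<rightarrow> carrier R" "d \<in> UNIV \<rightarrow> carrier R" for c d
  proof -
    have "L (\<lambda>i. c i \<oplus> d i) = (\<Oplus>\<^bsub>M\<^esub>i\<in>{..<n}. c i \<odot>\<^bsub>M\<^esub> s i \<oplus>\<^bsub>M\<^esub> d i \<odot>\<^bsub>M\<^esub> s i)"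
      unfolding L_def using that sM
      by (intro M.add.finprod_cong') (auto simp: Pi_iff smult_l_distr)
    also have "\<dots> = L c \<oplus>\<^bsub>M\<^esub> L d"
      unfolding L_def using that sM by (intro M.finsum_addf) (auto simp: Pi_iff)
    finally show ?thesis by simp
  qed
  have Lzero: "L (\<lambda>_. \<zero>) = \<zero>\<^bsub>M\<^esub>"
    unfolding L_def using sM
    by (intro M.add.finprod_one_eqI) (auto simp: Pi_iff smult_l_null)
  have Lsm: "a \<odot>\<^bsub>M\<^esub> L c = L (\<lambda>i. a \<otimes> c i)" if "a \<in> carrier R" "c \<in> UNIV \<rightarrow> carrier R" for a c
  proof -
    have "a \<odot>\<^bsub>M\<^esub> (\<Oplus>\<^bsub>M\<^esub>i\<in>F. c i \<odot>\<^bsub>M\<^esub> s i) = (\<Oplus>\<^bsub>M\<^esub>i\<in>F. (a \<otimes> c i) \<odot>\<^bsub>M\<^esub> s i)"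
      if "finite F" "F \<subseteq> {..<n}" for F
      using that
    proof (induction F)
      case empty
      then show ?case using \<open>a \<in> carrier R\<close> by (simp add: smult_r_null)
    next
      case (insert j F)
      have cM: "\<And>i. i \<in> insert j F \<Longrightarrow> c i \<in> carrier R \<and> s i \<in> carrier M"
        using insert.prems sM \<open>c \<in> UNIV \<rightarrow> carrier R\<close> by auto
      then have *: "(\<lambda>i. c i \<odot>\<^bsub>M\<^esub> s i) \<in> F \<rightarrow> carrier M" "(\<lambda>i. (a \<otimes> c i) \<odot>\<^bsub>M\<^esub> s i) \<in> F \<rightarrow> carrier M"
        using \<open>a \<in> carrier R\<close> by auto
      show ?case
        using insert * cM \<open>a \<in> carrier R\<close>
        by (simp add: smult_r_distr smult_assoc1 M.finsum_closed)
    qed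
    then show ?thesis unfolding L_def by simp
  qed
  have "submodule N R M"
  proof (intro submodule.intro M.add.subgroupI)
    show "N \<subseteq> carrier M" using LM by (auto simp: N_def)
    show "N \<noteq> {}" by (auto simp: N_def Pi_def)
    show "\<ominus>\<^bsub>M\<^esub> x \<in> N" if x: "x \<in> N" for x
    proof -
      obtain c where c: "c \<in> UNIV \<rightarrow> carrier R" "x = L c" using x by (auto simp: N_def)
      have "(\<lambda>i. \<ominus> \<one> \<otimes> c i) \<in> UNIV \<rightarrow> carrier R" using c by auto
      moreover have "\<ominus>\<^bsub>M\<^esub> x = L (\<lambda>i. \<ominus> \<one> \<otimes> c i)"
        using c Lsm[of "\<ominus> \<one>" c] LM smult_l_minus[of "\<one>" x] by simp
      ultimately show ?thesis by (auto simp: N_def)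
    qed
    show "x \<oplus>\<^bsub>M\<^esub> y \<in> N" if xy: "x \<in> N" "y \<in> N" for x y
    proof -
      obtain c d where c: "c \<in> UNIV \<rightarrow> carrier R" "x = L c" and d: "d \<in> UNIV \<rightarrow> carrier R" "y = L d"
        using xy by (auto simp: N_def)
      then show ?thesis unfolding N_def using Ladd[of c d]
        by (auto intro!: image_eqI[where x = "\<lambda>i. c i \<oplus> d i"])
    qed
    show "submodule_axioms N R M"
    proof
      fix a x assume a: "a \<in> carrier R" and "x \<in> N"
      then obtain c where c: "c \<in> UNIV \<rightarrow> carrier R" "x = L c" by (auto simp: N_def)
      then show "a \<odot>\<^bsub>M\<^esub> x \<in> N" unfolding N_def using a Lsm[of a c]
        by (auto intro!: image_eqI[where x = "\<lambda>i. a \<otimes> c i"])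
    qed
  qed
  moreover have "S \<subseteq> N"
  proof
    fix x assume x: "x \<in> S"
    then obtain j where j: "j < n" "x = s j" using s by auto
    have xM: "x \<in> carrier M" using x S(2) by auto
    have "L (\<lambda>i. if i = j then \<one> else \<zero>) = (\<Oplus>\<^bsub>M\<^esub>i\<in>{..<n}. if j = i then s i else \<zero>\<^bsub>M\<^esub>)"
      unfolding L_def using sM
      by (intro M.add.finprod_cong') (auto simp: Pi_iff smult_l_null)
    also have "\<dots> = x"
      using j sM by (simp add: M.add.finprod_singleton)
    finally show "x \<in> N" unfolding N_def by (auto intro!: image_eqI[where x = "\<lambda>i. if i = j then \<one> else \<zero>"])
  qed
  ultimately have "N = carrier M" using S(3) by blast
  then show thesis using that[OF sM] unfolding N_def L_def by blast
qed

lemma fg_modules_representative: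
  fixes M :: "('a, 'm, 'mx) module_scheme"
  assumes M: "left_module A M" and fg: "fin_gen A M"
  shows "\<exists>X\<in>fg_modules A. mod_isomorphic A M X"
proof -
  interpret left_module A M by (rule M)
  obtain n :: nat and s where s: "s \<in> {..<n} \<rightarrow> carrier M"
    and gen: "\<And>x. x \<in> carrier M \<Longrightarrow>
      \<exists>c. c \<in> UNIV \<rightarrow> carrier A \<and> x = (\<Oplus>\<^bsub>M\<^esub>i\<in>{..<n}. c i \<odot>\<^bsub>M\<^esub> s i)"
    by (rule fin_gen_combinations[OF fg]) (rule that)
  define e where "e x = {c. c \<in> UNIV \<rightarrow> carrier A \<and> x = (\<Oplus>\<^bsub>M\<^esub>i\<in>{..<n}. c i \<odot>\<^bsub>M\<^esub> s i)}" for x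
  have inj: "inj_on e (carrier M)"
  proof (rule inj_onI)
    fix x y assume x: "x \<in> carrier M" and "y \<in> carrier M" and "e x = e y"
    then obtain c where "c \<in> e x" "c \<in> e y" using gen[OF x] by (auto simp: e_def)
    then show "x = y" by (simp add: e_def)
  qed
  define d where "d = the_inv_into (carrier M) e"
  have de: "d (e x) = x" if "x \<in> carrier M" for x
    unfolding d_def using inj that by (rule the_inv_into_f_f)
  define X :: "'a amod" where "X = \<lparr>carrier = e ` carrier M, mult = undefined, one = undefined,
     zero = e \<zero>\<^bsub>M\<^esub>, add = (\<lambda>u v. e (d u \<oplus>\<^bsub>M\<^esub> d v)), smult = (\<lambda>a u. e (a \<odot>\<^bsub>M\<^esub> d u))\<rparr>"
  have "abelian_group X"
  proof (rule abelian_groupI)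
    fix u assume "u \<in> carrier X"
    then obtain x where x: "x \<in> carrier M" "u = e x" by (auto simp: X_def)
    show "\<exists>v\<in>carrier X. v \<oplus>\<^bsub>X\<^esub> u = \<zero>\<^bsub>X\<^esub>"
      using x by (intro bexI[of _ "e (\<ominus>\<^bsub>M\<^esub> x)"]) (auto simp: X_def de M.l_neg)
  qed (auto simp: X_def de M.a_ac)
  then interpret X: abelian_group X .
  have X: "left_module A X"
    by unfold_locales (auto simp: X_def de smult_l_distr smult_r_distr smult_assoc1)
  interpret X: left_module A X by (rule X)
  have hom: "e (x \<oplus>\<^bsub>M\<^esub> y) = e x \<oplus>\<^bsub>X\<^esub> e y" "e (a \<odot>\<^bsub>M\<^esub> x) = a \<odot>\<^bsub>X\<^esub> e x"
    if "x \<in> carrier M" "y \<in> carrier M" for a x y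
    using that by (auto simp: X_def de)
  have "fin_gen A X"
  proof -
    obtain S where S: "finite S" "S \<subseteq> carrier M"
        "\<And>N. submodule N A M \<Longrightarrow> S \<subseteq> N \<Longrightarrow> N = carrier M"
      using fg unfolding fin_gen_def by blast
    have "N = carrier X" if N: "submodule N A X" and SN: "e ` S \<subseteq> N" for N
    proof -
      interpret N: submodule N A X by (rule N)
      have NX: "N \<subseteq> e ` carrier M" using N.subset by (simp add: X_def)
      define N' where "N' = {x \<in> carrier M. e x \<in> N}"
      have cl: "u \<oplus>\<^bsub>X\<^esub> v \<in> N" if "u \<in> N" "v \<in> N" for u v
        using N.m_closed[OF that] by simp
      have N0: "e \<zero>\<^bsub>M\<^esub> \<in> N" using N.one_closed by (simp add: X_def)
      have "submodule N' A M"
      proof (intro submodule.intro M.add.subgroupI)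
        show "N' \<subseteq> carrier M" by (auto simp: N'_def)
        show "N' \<noteq> {}" using N0 by (auto simp: N'_def)
        show "x \<oplus>\<^bsub>M\<^esub> y \<in> N'" if "x \<in> N'" "y \<in> N'" for x y
          using that cl[of "e x" "e y"] by (auto simp: N'_def hom)
        have sm: "a \<odot>\<^bsub>M\<^esub> x \<in> N'" if "a \<in> carrier A" "x \<in> N'" for a x
          using that N.smult_closed[of a "e x"] by (auto simp: N'_def hom)
        show "\<ominus>\<^bsub>M\<^esub> x \<in> N'" if "x \<in> N'" for x
          using that sm[of "\<ominus>\<^bsub>A\<^esub> \<one>\<^bsub>A\<^esub>" x] smult_l_minus[of "\<one>\<^bsub>A\<^esub>" x] by (auto simp: N'_def)
        show "submodule_axioms N' A M" using sm by unfold_locales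
      qed
      moreover have "S \<subseteq> N'" using S(2) SN by (auto simp: N'_def)
      ultimately have "N' = carrier M" using S(3) by blast
      then show ?thesis using NX by (auto simp: N'_def X_def)
    qed
    then show ?thesis unfolding fin_gen_def using S
      by (intro exI[of _ "e ` S"]) (auto simp: X_def)
  qed
  then have "X \<in> fg_modules A" using X by (simp add: fg_modules_def)
  moreover have "restrict e (carrier M) \<in> mod_hom A M X"
    using hom by (auto simp: mod_hom_def) (simp add: X_def)
  moreover have "bij_betw (restrict e (carrier M)) (carrier M) (carrier X)"
    using inj by (auto simp: bij_betw_def X_def)
  ultimately show ?thesis unfolding mod_isomorphic_def by blast
qed

section \<open>Linear categories and their equivalences\<close>

text \<open>The module \<open>Hom C X Y\<close> consists of the morphisms from \<open>X\<close> to \<open>Y\<close>. Hom sets for different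
  pairs of objects may overlap, so composition takes the objects as arguments:
  \<open>Comp C X Y Z g f\<close> is the composite of \<open>f\<close> from \<open>X\<close> to \<open>Y\<close> and \<open>g\<close> from \<open>Y\<close> to \<open>Z\<close>.\<close>

record ('k, 'o, 'h) lin_cat =
  Obj :: "'o set"
  Hom :: "'o \<Rightarrow> 'o \<Rightarrow> ('k, 'h) module"
  Comp :: "'o \<Rightarrow> 'o \<Rightarrow> 'o \<Rightarrow> 'h \<Rightarrow> 'h \<Rightarrow> 'h"
  Ident :: "'o \<Rightarrow> 'h"

record ('o, 'h, 'p, 'i) cat_map =
  omap :: "'o \<Rightarrow> 'p"
  amap :: "'o \<Rightarrow> 'o \<Rightarrow> 'h \<Rightarrow> 'i"

definition k_functor ::
  "'k ring \<Rightarrow> ('k, 'o, 'h) lin_cat \<Rightarrow> ('k, 'p, 'i) lin_cat \<Rightarrow> ('o, 'h, 'p, 'i) cat_map \<Rightarrow> bool"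
where
  "k_functor k C D F \<longleftrightarrow>
     (\<forall>X\<in>Obj C. omap F X \<in> Obj D) \<and>
     (\<forall>X\<in>Obj C. \<forall>Y\<in>Obj C.
        \<forall>f\<in>carrier (Hom C X Y). amap F X Y f \<in> carrier (Hom D (omap F X) (omap F Y))) \<and>
     (\<forall>X\<in>Obj C. \<forall>Y\<in>Obj C. \<forall>f\<in>carrier (Hom C X Y). \<forall>g\<in>carrier (Hom C X Y).
        amap F X Y (f \<oplus>\<^bsub>Hom C X Y\<^esub> g) =
          amap F X Y f \<oplus>\<^bsub>Hom D (omap F X) (omap F Y)\<^esub> amap F X Y g) \<and>
     (\<forall>X\<in>Obj C. \<forall>Y\<in>Obj C. \<forall>c\<in>carrier k. \<forall>f\<in>carrier (Hom C X Y).
        amap F X Y (c \<odot>\<^bsub>Hom C X Y\<^esub> f) = c \<odot>\<^bsub>Hom D (omap F X) (omap F Y)\<^esub> amap F X Y f) \<and>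
     (\<forall>X\<in>Obj C. amap F X X (Ident C X) = Ident D (omap F X)) \<and>
     (\<forall>X\<in>Obj C. \<forall>Y\<in>Obj C. \<forall>Z\<in>Obj C. \<forall>f\<in>carrier (Hom C X Y). \<forall>g\<in>carrier (Hom C Y Z).
        amap F X Z (Comp C X Y Z g f) =
          Comp D (omap F X) (omap F Y) (omap F Z) (amap F Y Z g) (amap F X Y f))"

definition id_functor :: "('o, 'h, 'o, 'h) cat_map" where
  "id_functor = \<lparr>omap = \<lambda>X. X, amap = \<lambda>X Y f. f\<rparr>"

definition comp_functor ::
  "('p, 'i, 'q, 'j) cat_map \<Rightarrow> ('o, 'h, 'p, 'i) cat_map \<Rightarrow> ('o, 'h, 'q, 'j) cat_map"
where
  "comp_functor G F = \<lparr>omap = \<lambda>X. omap G (omap F X),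
     amap = \<lambda>X Y f. amap G (omap F X) (omap F Y) (amap F X Y f)\<rparr>"

definition cat_iso :: "('k, 'o, 'h) lin_cat \<Rightarrow> 'o \<Rightarrow> 'o \<Rightarrow> 'h \<Rightarrow> bool" where
  "cat_iso C X Y f \<longleftrightarrow> f \<in> carrier (Hom C X Y) \<and>
     (\<exists>g\<in>carrier (Hom C Y X). Comp C X Y X g f = Ident C X \<and> Comp C Y X Y f g = Ident C Y)"

definition naturally_isomorphic ::
  "('k, 'o, 'h) lin_cat \<Rightarrow> ('k, 'p, 'i) lin_cat \<Rightarrow>
   ('o, 'h, 'p, 'i) cat_map \<Rightarrow> ('o, 'h, 'p, 'i) cat_map \<Rightarrow> bool"
where
  "naturally_isomorphic C D F G \<longleftrightarrow>
     (\<exists>\<eta>. (\<forall>X\<in>Obj C. cat_iso D (omap F X) (omap G X) (\<eta> X)) \<and>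
          (\<forall>X\<in>Obj C. \<forall>Y\<in>Obj C. \<forall>f\<in>carrier (Hom C X Y).
             Comp D (omap F X) (omap F Y) (omap G Y) (\<eta> Y) (amap F X Y f) =
             Comp D (omap F X) (omap G X) (omap G Y) (amap G X Y f) (\<eta> X)))"

definition k_equivalent :: "'k ring \<Rightarrow> ('k, 'o, 'h) lin_cat \<Rightarrow> ('k, 'p, 'i) lin_cat \<Rightarrow> bool" where
  "k_equivalent k C D \<longleftrightarrow> (\<exists>F G. k_functor k C D F \<and> k_functor k D C G \<and>
     naturally_isomorphic C C (comp_functor G F) id_functor \<and>
     naturally_isomorphic D D (comp_functor F G) id_functor)"

section \<open>The stable module category\<close>

text \<open>A scalar \<open>c\<close> in \<open>k\<close> acts on an \<open>A\<close>-module as the element \<open>c \<cdot> 1\<close> of \<open>A\<close>.\<close>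

definition hom_module ::
  "('k, 'a) module \<Rightarrow> ('a, 'm) module \<Rightarrow> ('a, 'n) module \<Rightarrow> ('k, 'm \<Rightarrow> 'n) module"
where
  "hom_module A X Y = \<lparr>carrier = mod_hom A X Y, mult = undefined, one = undefined,
     zero = (\<lambda>x\<in>carrier X. \<zero>\<^bsub>Y\<^esub>),
     add = (\<lambda>f g. \<lambda>x\<in>carrier X. f x \<oplus>\<^bsub>Y\<^esub> g x),
     smult = (\<lambda>c f. \<lambda>x\<in>carrier X. (c \<odot>\<^bsub>A\<^esub> \<one>\<^bsub>A\<^esub>) \<odot>\<^bsub>Y\<^esub> f x)\<rparr>"

definition projective :: "('a, 'ax) ring_scheme \<Rightarrow> 'a amod \<Rightarrow> bool" where
  "projective A P \<longleftrightarrow> P \<in> fg_modules A \<and>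
     (\<forall>X\<in>fg_modules A. \<forall>Y\<in>fg_modules A. \<forall>g\<in>mod_hom A X Y. \<forall>f\<in>mod_hom A P Y.
        g ` carrier X = carrier Y \<longrightarrow> (\<exists>h\<in>mod_hom A P X. compose (carrier P) g h = f))"

definition proj_hom ::
  "('a, 'ax) ring_scheme \<Rightarrow> 'a amod \<Rightarrow> 'a amod \<Rightarrow> ((nat \<Rightarrow> 'a) set \<Rightarrow> (nat \<Rightarrow> 'a) set) set"
where
  "proj_hom A X Y = {compose (carrier X) h g | P g h.
     projective A P \<and> g \<in> mod_hom A X P \<and> h \<in> mod_hom A P Y}"

definition stable_class ::
  "('k, 'a) module \<Rightarrow> 'a amod \<Rightarrow> 'a amod \<Rightarrow> ((nat \<Rightarrow> 'a) set \<Rightarrow> (nat \<Rightarrow> 'a) set) \<Rightarrow>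
   ((nat \<Rightarrow> 'a) set \<Rightarrow> (nat \<Rightarrow> 'a) set) set"
where
  "stable_class A X Y f = proj_hom A X Y +>\<^bsub>hom_module A X Y\<^esub> f"

text \<open>The quotient of \<open>Hom(X, Y)\<close> by \<open>P(X, Y)\<close>. Scalar multiplication and composition below are
  induced from representatives: all sets in the unions coincide.\<close>

definition stable_hom ::
  "('k, 'a) module \<Rightarrow> 'a amod \<Rightarrow> 'a amod \<Rightarrow>
   ('k, ((nat \<Rightarrow> 'a) set \<Rightarrow> (nat \<Rightarrow> 'a) set) set) module"
where
  "stable_hom A X Y = \<lparr>carrier = a_rcosets\<^bsub>hom_module A X Y\<^esub> (proj_hom A X Y),
     mult = undefined, one = undefined,
     zero = proj_hom A X Y,
     add = (\<lambda>F G. F <+>\<^bsub>hom_module A X Y\<^esub> G),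
     smult = (\<lambda>c F. \<Union>f\<in>F. stable_class A X Y (c \<odot>\<^bsub>hom_module A X Y\<^esub> f))\<rparr>"

definition stable_cat ::
  "('k, 'a) module \<Rightarrow> ('k, 'a amod, ((nat \<Rightarrow> 'a) set \<Rightarrow> (nat \<Rightarrow> 'a) set) set) lin_cat"
where
  "stable_cat A = \<lparr>Obj = fg_modules A,
     Hom = stable_hom A,
     Comp = (\<lambda>X Y Z G F. \<Union>g\<in>G. \<Union>f\<in>F. stable_class A X Z (compose (carrier X) g f)),
     Ident = (\<lambda>X. stable_class A X X (\<lambda>x\<in>carrier X. x))\<rparr>"

definition stably_equivalent :: "'k ring \<Rightarrow> ('k, 'a) module \<Rightarrow> ('k, 'b) module \<Rightarrow> bool" where
  "stably_equivalent k A B \<longleftrightarrow> k_equivalent k (stable_cat A) (stable_cat B)"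

section \<open>Extension dimension\<close>

text \<open>Full subcategories of \<open>A\<close>-mod are given by their sets of objects. Direct sums are only
  determined up to isomorphism, so the closure under them contains all isomorphic copies.\<close>

definition zero_modules :: "('a, 'ax) ring_scheme \<Rightarrow> 'a amod set" where
  "zero_modules A = {X \<in> fg_modules A. carrier X = {\<zero>\<^bsub>X\<^esub>}}"

inductive_set add_closure :: "('a, 'ax) ring_scheme \<Rightarrow> 'a amod set \<Rightarrow> 'a amod set"
  for A :: "('a, 'ax) ring_scheme" and \<T> :: "'a amod set"
where
  base: "X \<in> \<T> \<Longrightarrow> X \<in> fg_modules A \<Longrightarrow> X \<in> add_closure A \<T>"
| empty_sum: "X \<in> zero_modules A \<Longrightarrow> X \<in> add_closure A \<T>"
| direct_sum: "M \<in> add_closure A \<T> \<Longrightarrow> N \<in> add_closure A \<T> \<Longrightarrow> X \<in> fg_modules A \<Longrightarrow>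
    mod_isomorphic A X (mod_dsum M N) \<Longrightarrow> X \<in> add_closure A \<T>"
| summand: "Y \<in> add_closure A \<T> \<Longrightarrow> X \<in> fg_modules A \<Longrightarrow> Z \<in> fg_modules A \<Longrightarrow>
    mod_isomorphic A Y (mod_dsum X Z) \<Longrightarrow> X \<in> add_closure A \<T>"

definition short_exact ::
  "('a, 'ax) ring_scheme \<Rightarrow> ('a, 'l) module \<Rightarrow> ('a, 'm) module \<Rightarrow> ('a, 'n) module \<Rightarrow>
   ('l \<Rightarrow> 'm) \<Rightarrow> ('m \<Rightarrow> 'n) \<Rightarrow> bool"
where
  "short_exact A L M N f g \<longleftrightarrow> f \<in> mod_hom A L M \<and> g \<in> mod_hom A M N \<and>
     inj_on f (carrier L) \<and> g ` carrier M = carrier N \<and>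
     f ` carrier L = {x \<in> carrier M. g x = \<zero>\<^bsub>N\<^esub>}"

definition ext_product ::
  "('a, 'ax) ring_scheme \<Rightarrow> 'a amod set \<Rightarrow> 'a amod set \<Rightarrow> 'a amod set"
where
  "ext_product A \<T>\<^sub>1 \<T>\<^sub>2 = add_closure A
     {X \<in> fg_modules A. \<exists>T\<^sub>1\<in>\<T>\<^sub>1. \<exists>T\<^sub>2\<in>\<T>\<^sub>2. \<exists>f g. short_exact A T\<^sub>1 X T\<^sub>2 f g}"

fun ext_power :: "('a, 'ax) ring_scheme \<Rightarrow> 'a amod \<Rightarrow> nat \<Rightarrow> 'a amod set" where
  "ext_power A T 0 = zero_modules A"
| "ext_power A T (Suc 0) = add_closure A {T}"
| "ext_power A T (Suc (Suc n)) = ext_product A (add_closure A {T}) (ext_power A T (Suc n))"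

definition ext_dim :: "('a, 'ax) ring_scheme \<Rightarrow> enat" where
  "ext_dim A = Inf {enat n | n. \<exists>T\<in>fg_modules A. fg_modules A = ext_power A T (n + 1)}"

end

theory Submission
  imports Defs
begin

text \<open>Let \<open>F\<close> be a stable equivalence. In an exact sequence \<open>0 \<rightarrow> X \<rightarrow> Y \<rightarrow> Z \<rightarrow> 0\<close> the module \<open>Y\<close> is
  determined, up to stable isomorphism and summands of \<open>X\<close>, by the set of stable maps to \<open>Z\<close> that
  factor through \<open>Y\<close>: this set is the kernel of \<open>Hom(-, Z) \<rightarrow> Ext(-, X)\<close>. For fixed \<open>T\<close> there is an
  embedding \<open>T \<rightarrow> I\<close> into a finitely generated injective module, so every extension of \<open>Z\<close> by \<open>T\<close> is a
  pull-back of \<open>0 \<rightarrow> T \<rightarrow> I \<rightarrow> C \<rightarrow> 0\<close>. Lifting the stable map \<open>F I \<rightarrow> F C\<close> to a surjection with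
  kernel \<open>K\<close>, every such extension corresponds to an extension of \<open>F Z\<close> by \<open>K\<close> through which the
  corresponding stable maps factor. Hence \<open>F\<close> maps \<open>[T]\<^sub>n\<close> into \<open>[F T \<oplus> B \<oplus> K]\<^sub>n\<close>, by induction on \<open>n\<close>.
  The injective module \<open>I\<close> is a maximal essential extension of \<open>T\<close>: the lengths over \<open>k\<close> of the
  essential extensions of \<open>T\<close> are bounded.\<close>

section \<open>Submodules and homomorphisms\<close>

text \<open>Nothing in the definition of a stable equivalence mentions short exact sequences, so an
  extension cannot simply be sent through it. What can be expressed stably is whether a map into
  \<open>Z\<close> factors through a given surjection onto \<open>Z\<close>: a map through a
  projective always lifts, so the answer depends only on the stable class. This is how the kernel of
  \<open>Hom(-, Z) \<rightarrow> Ext(-, X)\<close> becomes stable data. The other obstacle is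
  uniformity: one module has to serve all extensions by \<open>T\<close> at once. A single universal
  sequence starting in \<open>T\<close> achieves this, and it is the reason for the injective
  module: the kernel \<open>K\<close> obtained from it depends on \<open>T\<close> alone. The
  regular module \<open>B\<close> puts all projectives into the classes in question, so that they
  are closed under stable retracts, and \<open>F T\<close> accounts for the summands coming from the
  kernel term, which the set of factoring maps cannot see. The reverse inequality is the same
  statement for the inverse equivalence.\<close>

definition subm :: "('a, 'ax) ring_scheme \<Rightarrow> ('a, 'm, 'mx) module_scheme \<Rightarrow> 'm set \<Rightarrow> bool" where
  "subm R M N \<longleftrightarrow> N \<subseteq> carrier M \<and> \<zero>\<^bsub>M\<^esub> \<in> N \<and> (\<forall>x\<in>N. \<forall>y\<in>N. x \<oplus>\<^bsub>M\<^esub> y \<in> N) \<and>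
     (\<forall>a\<in>carrier R. \<forall>x\<in>N. a \<odot>\<^bsub>M\<^esub> x \<in> N)"

lemma (in abelian_group) diff_add_cancel:
  "x \<in> carrier G \<Longrightarrow> y \<in> carrier G \<Longrightarrow> (x \<ominus> y) \<oplus> y = x"
  by (simp add: a_minus_def a_assoc l_neg)

lemma (in abelian_group) diff_eq_zero_iff:
  assumes "x \<in> carrier G" "y \<in> carrier G"
  shows "x \<ominus> y = \<zero> \<longleftrightarrow> x = y"
proof
  assume "x \<ominus> y = \<zero>"
  then show "x = y" using diff_add_cancel[OF assms] assms by simp
qed (use assms in \<open>simp add: a_minus_def r_neg\<close>)

lemma submI:
  assumes "N \<subseteq> carrier M" "\<zero>\<^bsub>M\<^esub> \<in> N" "\<And>x y. x \<in> N \<Longrightarrow> y \<in> N \<Longrightarrow> x \<oplus>\<^bsub>M\<^esub> y \<in> N"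
    "\<And>a x. a \<in> carrier R \<Longrightarrow> x \<in> N \<Longrightarrow> a \<odot>\<^bsub>M\<^esub> x \<in> N"
  shows "subm R M N"
  using assms by (simp add: subm_def)

lemma submD:
  assumes "subm R M N"
  shows "N \<subseteq> carrier M" "\<zero>\<^bsub>M\<^esub> \<in> N" "\<And>x y. x \<in> N \<Longrightarrow> y \<in> N \<Longrightarrow> x \<oplus>\<^bsub>M\<^esub> y \<in> N"
    "\<And>a x. a \<in> carrier R \<Longrightarrow> x \<in> N \<Longrightarrow> a \<odot>\<^bsub>M\<^esub> x \<in> N"
    "\<And>x. x \<in> N \<Longrightarrow> x \<in> carrier M"
  using assms by (auto simp: subm_def)

lemma (in left_module) neg_eq_smult: "x \<in> carrier M \<Longrightarrow> \<ominus>\<^bsub>M\<^esub> x = (\<ominus> \<one>) \<odot>\<^bsub>M\<^esub> x"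
  by (simp add: smult_l_minus)

lemma subm_neg:
  assumes "left_module R M" "subm R M N" "x \<in> N"
  shows "\<ominus>\<^bsub>M\<^esub> x \<in> N"
proof -
  interpret left_module R M by fact
  show ?thesis using assms(2,3) submD[OF assms(2)] by (simp add: neg_eq_smult)
qed

lemma subm_diff:
  assumes "left_module R M" "subm R M N" "x \<in> N" "y \<in> N"
  shows "x \<ominus>\<^bsub>M\<^esub> y \<in> N"
  using submD(3)[OF assms(2,3) subm_neg[OF assms(1,2,4)]] by (simp add: a_minus_def)

text \<open>Negation is multiplication by \<open>\<ominus> \<one>\<close>, so closure under sums and
  scalars already gives a subgroup. The predicate \<open>subm\<close> is the form in which
  submodules are built and used from here on.\<close>

lemma submodule_iff_subm:
  assumes "left_module R M"
  shows "submodule N R M \<longleftrightarrow> subm R M N"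
proof -
  interpret left_module R M by fact
  show ?thesis
  proof
    assume "submodule N R M"
    then interpret N: submodule N R M .
    show "subm R M N"
      using N.subset N.one_closed N.m_closed by (intro submI) auto
  next
    assume N: "subm R M N"
    show "submodule N R M"
    proof (intro submodule.intro M.add.subgroupI)
      show "submodule_axioms N R M" using submD[OF N] by unfold_locales
    qed (use submD[OF N] subm_neg[OF assms N] in auto)
  qed
qed

lemma fin_gen_iff:
  assumes "left_module R M"
  shows "fin_gen R M \<longleftrightarrow> (\<exists>S. finite S \<and> S \<subseteq> carrier M \<and>
    (\<forall>N. subm R M N \<longrightarrow> S \<subseteq> N \<longrightarrow> N = carrier M))"
  unfolding fin_gen_def submodule_iff_subm[OF assms] ..

lemma subm_carrier: "left_module R M \<Longrightarrow> subm R M (carrier M)"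
  by (intro submI) (auto simp: left_module_def abelian_group_def abelian_monoid.a_closed
    abelian_monoid.zero_closed left_module.smult_closed)

lemma subm_zero: "left_module R M \<Longrightarrow> subm R M {\<zero>\<^bsub>M\<^esub>}"
proof -
  assume "left_module R M"
  then interpret left_module R M .
  show ?thesis by (intro submI) (auto simp: smult_r_null)
qed

lemma subm_Int: "subm R M N \<Longrightarrow> subm R M N' \<Longrightarrow> subm R M (N \<inter> N')"
  by (auto simp: subm_def)

lemma mod_homI:
  assumes "f \<in> extensional (carrier X)" "\<And>x. x \<in> carrier X \<Longrightarrow> f x \<in> carrier Y"
    "\<And>x y. x \<in> carrier X \<Longrightarrow> y \<in> carrier X \<Longrightarrow> f (x \<oplus>\<^bsub>X\<^esub> y) = f x \<oplus>\<^bsub>Y\<^esub> f y"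
    "\<And>a x. a \<in> carrier A \<Longrightarrow> x \<in> carrier X \<Longrightarrow> f (a \<odot>\<^bsub>X\<^esub> x) = a \<odot>\<^bsub>Y\<^esub> f x"
  shows "f \<in> mod_hom A X Y"
  using assms by (auto simp: mod_hom_def PiE_def)

lemma mod_hom_restrictI:
  assumes "left_module A X" "\<And>x. x \<in> carrier X \<Longrightarrow> f x \<in> carrier Y"
    "\<And>x y. x \<in> carrier X \<Longrightarrow> y \<in> carrier X \<Longrightarrow> f (x \<oplus>\<^bsub>X\<^esub> y) = f x \<oplus>\<^bsub>Y\<^esub> f y"
    "\<And>a x. a \<in> carrier A \<Longrightarrow> x \<in> carrier X \<Longrightarrow> f (a \<odot>\<^bsub>X\<^esub> x) = a \<odot>\<^bsub>Y\<^esub> f x"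
  shows "restrict f (carrier X) \<in> mod_hom A X Y"
proof -
  interpret left_module A X by fact
  show ?thesis using assms by (intro mod_homI) auto
qed

lemma hom_closed: "f \<in> mod_hom A X Y \<Longrightarrow> x \<in> carrier X \<Longrightarrow> f x \<in> carrier Y"
  and hom_add: "f \<in> mod_hom A X Y \<Longrightarrow> x \<in> carrier X \<Longrightarrow> y \<in> carrier X \<Longrightarrow>
    f (x \<oplus>\<^bsub>X\<^esub> y) = f x \<oplus>\<^bsub>Y\<^esub> f y"
  and hom_smult: "f \<in> mod_hom A X Y \<Longrightarrow> a \<in> carrier A \<Longrightarrow> x \<in> carrier X \<Longrightarrow>
    f (a \<odot>\<^bsub>X\<^esub> x) = a \<odot>\<^bsub>Y\<^esub> f x"
  and hom_ext: "f \<in> mod_hom A X Y \<Longrightarrow> f \<in> extensional (carrier X)"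
  by (auto simp: mod_hom_def PiE_def)

lemma hom_eqI:
  assumes "f \<in> mod_hom A X Y" "g \<in> mod_hom A X Y'" "\<And>x. x \<in> carrier X \<Longrightarrow> f x = g x"
  shows "f = g"
  using assms by (intro extensionalityI[of f "carrier X" g]) (auto dest: hom_ext)

lemma hom_zero:
  assumes "left_module A X" "left_module A Y" "f \<in> mod_hom A X Y"
  shows "f \<zero>\<^bsub>X\<^esub> = \<zero>\<^bsub>Y\<^esub>"
proof -
  interpret X: left_module A X by fact
  interpret Y: left_module A Y by fact
  have "f (\<zero>\<^bsub>A\<^esub> \<odot>\<^bsub>X\<^esub> \<zero>\<^bsub>X\<^esub>) = \<zero>\<^bsub>A\<^esub> \<odot>\<^bsub>Y\<^esub> f \<zero>\<^bsub>X\<^esub>"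
    using assms(3) by (intro hom_smult) auto
  then show ?thesis using hom_closed[OF assms(3)] by (simp add: X.smult_l_null Y.smult_l_null)
qed

lemma hom_neg:
  assumes "left_module A X" "left_module A Y" "f \<in> mod_hom A X Y" "x \<in> carrier X"
  shows "f (\<ominus>\<^bsub>X\<^esub> x) = \<ominus>\<^bsub>Y\<^esub> f x"
proof -
  interpret X: left_module A X by fact
  interpret Y: left_module A Y by fact
  show ?thesis using assms hom_closed[OF assms(3)]
    by (simp add: X.neg_eq_smult Y.neg_eq_smult hom_smult[OF assms(3)])
qed

lemma hom_diff:
  assumes "left_module A X" "left_module A Y" "f \<in> mod_hom A X Y" "x \<in> carrier X" "y \<in> carrier X"
  shows "f (x \<ominus>\<^bsub>X\<^esub> y) = f x \<ominus>\<^bsub>Y\<^esub> f y"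
proof -
  interpret X: left_module A X by fact
  show ?thesis using assms by (simp add: a_minus_def hom_add[OF assms(3)] hom_neg)
qed

lemma hom_comp:
  assumes "left_module A X" "f \<in> mod_hom A X Y" "g \<in> mod_hom A Y Z"
  shows "compose (carrier X) g f \<in> mod_hom A X Z"
  unfolding compose_def using assms
  by (intro mod_hom_restrictI) (auto simp: hom_closed hom_add hom_smult)

lemma hom_id: "left_module A X \<Longrightarrow> (\<lambda>x\<in>carrier X. x) \<in> mod_hom A X X"
  by (intro mod_hom_restrictI) auto

section \<open>Pointwise operations on homomorphisms\<close>

definition hadd :: "('a, 'm, 'mx) module_scheme \<Rightarrow> ('a, 'n, 'nx) module_scheme \<Rightarrow>
    ('m \<Rightarrow> 'n) \<Rightarrow> ('m \<Rightarrow> 'n) \<Rightarrow> 'm \<Rightarrow> 'n" where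
  "hadd X Y f g = (\<lambda>x\<in>carrier X. f x \<oplus>\<^bsub>Y\<^esub> g x)"

definition hneg :: "('a, 'm, 'mx) module_scheme \<Rightarrow> ('a, 'n, 'nx) module_scheme \<Rightarrow>
    ('m \<Rightarrow> 'n) \<Rightarrow> 'm \<Rightarrow> 'n" where
  "hneg X Y f = (\<lambda>x\<in>carrier X. \<ominus>\<^bsub>Y\<^esub> f x)"

definition hzero :: "('a, 'm, 'mx) module_scheme \<Rightarrow> ('a, 'n, 'nx) module_scheme \<Rightarrow> 'm \<Rightarrow> 'n" where
  "hzero X Y = (\<lambda>x\<in>carrier X. \<zero>\<^bsub>Y\<^esub>)"

lemma hadd_apply: "x \<in> carrier X \<Longrightarrow> hadd X Y f g x = f x \<oplus>\<^bsub>Y\<^esub> g x"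
  and hneg_apply: "x \<in> carrier X \<Longrightarrow> hneg X Y f x = \<ominus>\<^bsub>Y\<^esub> f x"
  and hzero_apply: "x \<in> carrier X \<Longrightarrow> hzero X Y x = \<zero>\<^bsub>Y\<^esub>"
  by (simp_all add: hadd_def hneg_def hzero_def)

lemma hom_hadd:
  assumes "left_module A X" "left_module A Y" "f \<in> mod_hom A X Y" "g \<in> mod_hom A X Y"
  shows "hadd X Y f g \<in> mod_hom A X Y"
proof -
  interpret X: left_module A X by fact
  interpret Y: left_module A Y by fact
  note [simp] = hom_closed[OF assms(3)] hom_closed[OF assms(4)] hom_add[OF assms(3)]
    hom_add[OF assms(4)] hom_smult[OF assms(3)] hom_smult[OF assms(4)]
  show ?thesis unfolding hadd_def
    by (intro mod_hom_restrictI) (auto simp: assms Y.a_ac Y.smult_r_distr)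
qed

lemma hom_hneg:
  assumes "left_module A X" "left_module A Y" "f \<in> mod_hom A X Y"
  shows "hneg X Y f \<in> mod_hom A X Y"
proof -
  interpret X: left_module A X by fact
  interpret Y: left_module A Y by fact
  note [simp] = hom_closed[OF assms(3)] hom_add[OF assms(3)] hom_smult[OF assms(3)]
  have "\<ominus>\<^bsub>Y\<^esub> (a \<odot>\<^bsub>Y\<^esub> y) = a \<odot>\<^bsub>Y\<^esub> (\<ominus>\<^bsub>Y\<^esub> y)" if "a \<in> carrier A" "y \<in> carrier Y" for a y
    using that by (metis Y.M.minus_equality Y.M.add.inv_closed Y.M.l_neg Y.smult_closed Y.smult_r_distr Y.smult_r_null)
  then show ?thesis unfolding hneg_def
    by (intro mod_hom_restrictI) (auto simp: assms Y.minus_add)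
qed

lemma hom_hzero: "left_module A X \<Longrightarrow> left_module A Y \<Longrightarrow> hzero X Y \<in> mod_hom A X Y"
proof -
  assume X: "left_module A X" and "left_module A Y"
  then interpret Y: left_module A Y by simp
  show ?thesis unfolding hzero_def by (intro mod_hom_restrictI) (auto simp: X Y.smult_r_null)
qed

text \<open>A total and single-valued relation that respects the operations is the graph of a
  homomorphism. Inverses, factorizations and maps into pull-backs are all obtained from this by
  naming the relation.\<close>

lemma hom_choice:
  assumes X: "left_module A X"
    and ex: "\<And>x. x \<in> carrier X \<Longrightarrow> \<exists>y\<in>carrier Y. P x y"
    and uniq: "\<And>x y y'. x \<in> carrier X \<Longrightarrow> y \<in> carrier Y \<Longrightarrow> y' \<in> carrier Y \<Longrightarrow> P x y \<Longrightarrow> P x y' \<Longrightarrow> y = y'"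
    and Y: "left_module A Y"
    and add: "\<And>x x' y y'. x \<in> carrier X \<Longrightarrow> x' \<in> carrier X \<Longrightarrow> y \<in> carrier Y \<Longrightarrow> y' \<in> carrier Y \<Longrightarrow>
        P x y \<Longrightarrow> P x' y' \<Longrightarrow> P (x \<oplus>\<^bsub>X\<^esub> x') (y \<oplus>\<^bsub>Y\<^esub> y')"
    and smult: "\<And>a x y. a \<in> carrier A \<Longrightarrow> x \<in> carrier X \<Longrightarrow> y \<in> carrier Y \<Longrightarrow> P x y \<Longrightarrow>
        P (a \<odot>\<^bsub>X\<^esub> x) (a \<odot>\<^bsub>Y\<^esub> y)"
  obtains h where "h \<in> mod_hom A X Y" "\<And>x. x \<in> carrier X \<Longrightarrow> P x (h x)"
proof -
  interpret X: left_module A X by fact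
  interpret Y: left_module A Y by fact
  obtain h where h: "\<And>x. x \<in> carrier X \<Longrightarrow> h x \<in> carrier Y \<and> P x (h x)"
    using ex by metis
  have "restrict h (carrier X) \<in> mod_hom A X Y"
  proof (rule mod_hom_restrictI[OF X])
    fix x y assume "x \<in> carrier X" "y \<in> carrier X"
    then show "h (x \<oplus>\<^bsub>X\<^esub> y) = h x \<oplus>\<^bsub>Y\<^esub> h y"
      using h add by (intro uniq[of "x \<oplus>\<^bsub>X\<^esub> y"]) auto
  next
    fix a x assume "a \<in> carrier A" "x \<in> carrier X"
    then show "h (a \<odot>\<^bsub>X\<^esub> x) = a \<odot>\<^bsub>Y\<^esub> h x"
      using h smult by (intro uniq[of "a \<odot>\<^bsub>X\<^esub> x"]) auto
  qed (use h in auto)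
  then show thesis using that[of "restrict h (carrier X)"] h by auto
qed

lemma subm_image:
  assumes "left_module A X" "left_module A Y" "f \<in> mod_hom A X Y" "subm A X N"
  shows "subm A Y (f ` N)"
proof (rule submI)
  note N = submD[OF assms(4)]
  show "f ` N \<subseteq> carrier Y" using N(5) hom_closed[OF assms(3)] by auto
  show "\<zero>\<^bsub>Y\<^esub> \<in> f ` N" using N(2) hom_zero[OF assms(1-3)] by force
  show "x \<oplus>\<^bsub>Y\<^esub> y \<in> f ` N" if "x \<in> f ` N" "y \<in> f ` N" for x y
    using that N hom_add[OF assms(3)] by (auto simp flip: hom_add[OF assms(3)])
  show "a \<odot>\<^bsub>Y\<^esub> x \<in> f ` N" if "a \<in> carrier A" "x \<in> f ` N" for a x
    using that N by (auto simp flip: hom_smult[OF assms(3)])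
qed

lemma subm_vimage:
  assumes "left_module A X" "left_module A Y" "f \<in> mod_hom A X Y" "subm A Y N"
  shows "subm A X {x \<in> carrier X. f x \<in> N}"
proof -
  interpret X: left_module A X by fact
  interpret Y: left_module A Y by fact
  show ?thesis using submD[OF assms(4)] hom_zero[OF assms(1-3)]
    by (intro submI) (auto simp: hom_add[OF assms(3)] hom_smult[OF assms(3)])
qed

lemma subm_kernel:
  assumes "left_module A X" "left_module A Y" "f \<in> mod_hom A X Y"
  shows "subm A X {x \<in> carrier X. f x = \<zero>\<^bsub>Y\<^esub>}"
  using subm_vimage[OF assms subm_zero[OF assms(2)]] by simp

lemma inj_on_iff_kernel:
  assumes "left_module A X" "left_module A Y" "f \<in> mod_hom A X Y"
  shows "inj_on f (carrier X) \<longleftrightarrow> (\<forall>x\<in>carrier X. f x = \<zero>\<^bsub>Y\<^esub> \<longrightarrow> x = \<zero>\<^bsub>X\<^esub>)"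
proof -
  interpret X: left_module A X by fact
  interpret Y: left_module A Y by fact
  show ?thesis
  proof
    assume "inj_on f (carrier X)"
    then show "\<forall>x\<in>carrier X. f x = \<zero>\<^bsub>Y\<^esub> \<longrightarrow> x = \<zero>\<^bsub>X\<^esub>"
      using hom_zero[OF assms] by (metis X.M.zero_closed inj_onD)
  next
    assume *: "\<forall>x\<in>carrier X. f x = \<zero>\<^bsub>Y\<^esub> \<longrightarrow> x = \<zero>\<^bsub>X\<^esub>"
    show "inj_on f (carrier X)"
    proof (rule inj_onI)
      fix x y assume xy: "x \<in> carrier X" "y \<in> carrier X" "f x = f y"
      then have "f (x \<ominus>\<^bsub>X\<^esub> y) = \<zero>\<^bsub>Y\<^esub>"
        using hom_diff[OF assms xy(1,2)] hom_closed[OF assms(3)] by (simp add: Y.diff_eq_zero_iff)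
      then show "x = y" using * xy X.diff_eq_zero_iff[of x y] by auto
    qed
  qed
qed

section \<open>Finite rank\<close>

text \<open>A strictly monotone bounded function on the submodules replaces composition length. Its
  relative form looks only at the traces on \<open>N\<close>.\<close>

definition ranked :: "('a, 'ax) ring_scheme \<Rightarrow> ('a, 'm, 'mx) module_scheme \<Rightarrow> 'm set \<Rightarrow> nat \<Rightarrow> bool" where
  "ranked R M N n \<longleftrightarrow> (\<exists>r :: 'm set \<Rightarrow> nat. \<forall>U. subm R M U \<longrightarrow> r U \<le> n \<and>
     (\<forall>V. subm R M V \<longrightarrow> U \<subseteq> V \<longrightarrow> r U \<le> r V \<and> (r U = r V \<longrightarrow> V \<inter> N \<subseteq> U)))"

lemma rankedI:
  fixes r :: "'m set \<Rightarrow> nat"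
  assumes "\<And>U. subm R M U \<Longrightarrow> r U \<le> n"
    "\<And>U V. subm R M U \<Longrightarrow> subm R M V \<Longrightarrow> U \<subseteq> V \<Longrightarrow> r U \<le> r V"
    "\<And>U V. subm R M U \<Longrightarrow> subm R M V \<Longrightarrow> U \<subseteq> V \<Longrightarrow> r U = r V \<Longrightarrow> V \<inter> N \<subseteq> U"
  shows "ranked R M N n"
  using assms unfolding ranked_def by blast

lemma rankedE:
  assumes "ranked R M N n"
  obtains r :: "'m set \<Rightarrow> nat" where "\<And>U. subm R M U \<Longrightarrow> r U \<le> n"
    "\<And>U V. subm R M U \<Longrightarrow> subm R M V \<Longrightarrow> U \<subseteq> V \<Longrightarrow> r U \<le> r V"
    "\<And>U V. subm R M U \<Longrightarrow> subm R M V \<Longrightarrow> U \<subseteq> V \<Longrightarrow> r U = r V \<Longrightarrow> V \<inter> N \<subseteq> U"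
proof -
  obtain r :: "'m set \<Rightarrow> nat" where "\<forall>U. subm R M U \<longrightarrow> r U \<le> n \<and>
     (\<forall>V. subm R M V \<longrightarrow> U \<subseteq> V \<longrightarrow> r U \<le> r V \<and> (r U = r V \<longrightarrow> V \<inter> N \<subseteq> U))"
    using assms unfolding ranked_def by (elim exE)
  then show thesis by (intro that[of r]) simp_all
qed

lemma ranked_zero: "ranked R M {\<zero>\<^bsub>M\<^esub>} 0"
  by (rule rankedI[where r = "\<lambda>_. 0"]) (auto simp: subm_def)

text \<open>The rank of \<open>W\<close> is that of \<open>W \<inter> N\<close> plus that of \<open>(W + N) \<inter> N'\<close>.\<close>

lemma ranked_sum:
  assumes M: "left_module R M" and N: "subm R M N" and N': "subm R M N'"
    and rN: "ranked R M N n" and rN': "ranked R M N' m"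
  shows "ranked R M {x \<oplus>\<^bsub>M\<^esub> y | x y. x \<in> N \<and> y \<in> N'} (n + m)"
proof -
  interpret M: left_module R M by fact
  note NN = submD[OF N] and NN' = submD[OF N']
  obtain r where r: "\<And>U. subm R M U \<Longrightarrow> r U \<le> m"
    "\<And>U V. subm R M U \<Longrightarrow> subm R M V \<Longrightarrow> U \<subseteq> V \<Longrightarrow> r U \<le> r V"
    "\<And>U V. subm R M U \<Longrightarrow> subm R M V \<Longrightarrow> U \<subseteq> V \<Longrightarrow> r U = r V \<Longrightarrow> V \<inter> N' \<subseteq> U"
    using rN' by (elim rankedE) blast
  obtain s where s: "\<And>U. subm R M U \<Longrightarrow> s U \<le> n"
    "\<And>U V. subm R M U \<Longrightarrow> subm R M V \<Longrightarrow> U \<subseteq> V \<Longrightarrow> s U \<le> s V"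
    "\<And>U V. subm R M U \<Longrightarrow> subm R M V \<Longrightarrow> U \<subseteq> V \<Longrightarrow> s U = s V \<Longrightarrow> V \<inter> N \<subseteq> U"
    using rN by (elim rankedE) blast
  define T where "T W = {y \<in> N'. \<exists>x\<in>N. y \<oplus>\<^bsub>M\<^esub> x \<in> W}" for W
  have T: "subm R M (T W)" if W: "subm R M W" for W
  proof (rule submI)
    note W' = submD[OF W]
    show "\<zero>\<^bsub>M\<^esub> \<in> T W" unfolding T_def using NN(2) NN'(2) W'(2)
      by (auto intro!: bexI[of _ "\<zero>\<^bsub>M\<^esub>"])
    show "p \<oplus>\<^bsub>M\<^esub> q \<in> T W" if pq: "p \<in> T W" "q \<in> T W" for p q
    proof -
      obtain x y where xy: "x \<in> N" "p \<oplus>\<^bsub>M\<^esub> x \<in> W" "y \<in> N" "q \<oplus>\<^bsub>M\<^esub> y \<in> W"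
        "p \<in> N'" "q \<in> N'" using pq by (auto simp: T_def)
      then have "(p \<oplus>\<^bsub>M\<^esub> q) \<oplus>\<^bsub>M\<^esub> (x \<oplus>\<^bsub>M\<^esub> y) = (p \<oplus>\<^bsub>M\<^esub> x) \<oplus>\<^bsub>M\<^esub> (q \<oplus>\<^bsub>M\<^esub> y)"
        using NN NN' by (simp add: M.a_ac)
      then show ?thesis unfolding T_def using xy NN(3) NN'(3) W'(3)
        by (auto intro!: bexI[of _ "x \<oplus>\<^bsub>M\<^esub> y"])
    qed
    show "a \<odot>\<^bsub>M\<^esub> p \<in> T W" if a: "a \<in> carrier R" and p: "p \<in> T W" for a p
    proof -
      obtain x where x: "x \<in> N" "p \<oplus>\<^bsub>M\<^esub> x \<in> W" "p \<in> N'" using p by (auto simp: T_def)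
      have "a \<odot>\<^bsub>M\<^esub> p \<oplus>\<^bsub>M\<^esub> a \<odot>\<^bsub>M\<^esub> x = a \<odot>\<^bsub>M\<^esub> (p \<oplus>\<^bsub>M\<^esub> x)"
        using x a NN NN' by (simp add: M.smult_r_distr)
      then show ?thesis unfolding T_def using x a NN(4) NN'(4) W'(4)
        by (auto intro!: bexI[of _ "a \<odot>\<^bsub>M\<^esub> x"])
    qed
  qed (use NN' in \<open>auto simp: T_def\<close>)
  have Tm: "T U \<subseteq> T V" if "U \<subseteq> V" for U V using that by (auto simp: T_def)
  show ?thesis
  proof (rule rankedI[where r = "\<lambda>W. s W + r (T W)"])
    show "s U + r (T U) \<le> n + m" if "subm R M U" for U
      using s(1)[OF that] r(1)[OF T[OF that]] by simp
    show "s U + r (T U) \<le> s V + r (T V)" if "subm R M U" "subm R M V" "U \<subseteq> V" for U V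
      using s(2)[OF that] r(2)[OF T[OF that(1)] T[OF that(2)] Tm[OF that(3)]] by simp
    fix U V assume U: "subm R M U" and V: "subm R M V" and UV: "U \<subseteq> V"
      and eq: "s U + r (T U) = s V + r (T V)"
    have "s U \<le> s V" "r (T U) \<le> r (T V)"
      using s(2)[OF U V UV] r(2)[OF T[OF U] T[OF V] Tm[OF UV]] by auto
    then have "s U = s V" "r (T U) = r (T V)" using eq by auto
    then have sub: "V \<inter> N \<subseteq> U" "T V \<subseteq> T U"
      using s(3)[OF U V UV] r(3)[OF T[OF U] T[OF V] Tm[OF UV]] by (auto simp: T_def)
    show "V \<inter> {x \<oplus>\<^bsub>M\<^esub> y |x y. x \<in> N \<and> y \<in> N'} \<subseteq> U"
    proof
      fix v assume "v \<in> V \<inter> {x \<oplus>\<^bsub>M\<^esub> y |x y. x \<in> N \<and> y \<in> N'}"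
      then obtain x p where v: "v \<in> V" "x \<in> N" "p \<in> N'" "v = x \<oplus>\<^bsub>M\<^esub> p" by auto
      have c: "x \<in> carrier M" "p \<in> carrier M" "v \<in> carrier M" using v NN NN' submD[OF V] by auto
      have "p \<in> T V" unfolding T_def using v c M.a_comm[of x p] by auto
      \<comment> \<open>An element \<open>y\<close> of \<open>N\<close> moves \<open>p\<close> into
        \<open>U\<close>. The error \<open>v - (p + y) = x - y\<close> lies in \<open>N\<close> and
        in \<open>V\<close>, hence in \<open>U\<close> by the equality of the first ranks.\<close>
      then obtain y where y: "y \<in> N" "p \<oplus>\<^bsub>M\<^esub> y \<in> U" using sub(2) by (auto simp: T_def)
      have yc: "y \<in> carrier M" using y NN by auto
      have "v \<ominus>\<^bsub>M\<^esub> (p \<oplus>\<^bsub>M\<^esub> y) = (p \<oplus>\<^bsub>M\<^esub> \<ominus>\<^bsub>M\<^esub> p) \<oplus>\<^bsub>M\<^esub> (x \<ominus>\<^bsub>M\<^esub> y)"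
        using v c yc by (simp add: a_minus_def M.minus_add M.a_ac del: M.r_neg)
      also have "\<dots> = x \<ominus>\<^bsub>M\<^esub> y"
        using v c yc by (simp add: M.r_neg)
      finally have "v \<ominus>\<^bsub>M\<^esub> (p \<oplus>\<^bsub>M\<^esub> y) \<in> N" using v y subm_diff[OF M N] by simp
      moreover have "v \<ominus>\<^bsub>M\<^esub> (p \<oplus>\<^bsub>M\<^esub> y) \<in> V" using v y UV subm_diff[OF M V] by auto
      ultimately have "v \<ominus>\<^bsub>M\<^esub> (p \<oplus>\<^bsub>M\<^esub> y) \<in> U" using sub(1) by auto
      then have "(v \<ominus>\<^bsub>M\<^esub> (p \<oplus>\<^bsub>M\<^esub> y)) \<oplus>\<^bsub>M\<^esub> (p \<oplus>\<^bsub>M\<^esub> y) \<in> U" using y submD(3)[OF U] by blast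
      then show "v \<in> U" using c yc M.diff_add_cancel[of v "p \<oplus>\<^bsub>M\<^esub> y"] by simp
    qed
  qed
qed

text \<open>Measure a submodule \<open>W\<close> of the target by the rank of its preimage: equal
  preimages force equal traces on the image of \<open>\<phi>\<close>.\<close>

lemma ranked_image:
  assumes P: "left_module R P" and M: "left_module R M" and phi: "\<phi> \<in> mod_hom R P M"
    and rP: "ranked R P (carrier P) m"
  shows "ranked R M (\<phi> ` carrier P) m"
proof -
  obtain r where r: "\<And>U. subm R P U \<Longrightarrow> r U \<le> m"
    "\<And>U V. subm R P U \<Longrightarrow> subm R P V \<Longrightarrow> U \<subseteq> V \<Longrightarrow> r U \<le> r V"
    "\<And>U V. subm R P U \<Longrightarrow> subm R P V \<Longrightarrow> U \<subseteq> V \<Longrightarrow> r U = r V \<Longrightarrow> V \<inter> carrier P \<subseteq> U"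
    using rP by (elim rankedE) blast
  note T = subm_vimage[OF P M phi]
  show ?thesis
  proof (rule rankedI[where r = "\<lambda>W. r {p \<in> carrier P. \<phi> p \<in> W}"])
    show "r {p \<in> carrier P. \<phi> p \<in> U} \<le> m" if "subm R M U" for U
      using r(1) T[OF that] by blast
    show "r {p \<in> carrier P. \<phi> p \<in> U} \<le> r {p \<in> carrier P. \<phi> p \<in> V}"
      if "subm R M U" "subm R M V" "U \<subseteq> V" for U V
      using that by (intro r(2) T) auto
    fix U V assume UV: "subm R M U" "subm R M V" "U \<subseteq> V"
      "r {p \<in> carrier P. \<phi> p \<in> U} = r {p \<in> carrier P. \<phi> p \<in> V}"
    have "{p \<in> carrier P. \<phi> p \<in> V} \<inter> carrier P \<subseteq> {p \<in> carrier P. \<phi> p \<in> U}"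
      using UV by (intro r(3) T) auto
    then show "V \<inter> \<phi> ` carrier P \<subseteq> U" by auto
  qed
qed

lemma ranked_subset: "ranked R M N n \<Longrightarrow> N' \<subseteq> N \<Longrightarrow> ranked R M N' n"
  unfolding ranked_def by (meson Int_mono order.trans subset_refl)

text \<open>Additivity of length along \<open>\<phi>\<close>: \<open>s\<close> measures
  \<open>W\<close> on the kernel and \<open>r\<close> measures the image of
  \<open>W \<inter> N\<close>. If neither changes from \<open>U\<close> to \<open>V\<close>, an
  element \<open>v\<close> of \<open>V \<inter> N\<close> has the same image as some
  \<open>u\<close> of \<open>U \<inter> N\<close>, and \<open>v - u\<close> lies in the kernel,
  hence in \<open>U\<close>.\<close>

lemma ranked_kernel_image:
  assumes M: "left_module R M" and M': "left_module R M'" and phi: "\<phi> \<in> mod_hom R M M'"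
    and N: "subm R M N" and rK: "ranked R M {x \<in> N. \<phi> x = \<zero>\<^bsub>M'\<^esub>} n" and rI: "ranked R M' (\<phi> ` N) m"
  shows "ranked R M N (n + m)"
proof -
  interpret M: left_module R M by fact
  interpret M': left_module R M' by fact
  obtain r where r: "\<And>U. subm R M' U \<Longrightarrow> r U \<le> m"
    "\<And>U V. subm R M' U \<Longrightarrow> subm R M' V \<Longrightarrow> U \<subseteq> V \<Longrightarrow> r U \<le> r V"
    "\<And>U V. subm R M' U \<Longrightarrow> subm R M' V \<Longrightarrow> U \<subseteq> V \<Longrightarrow> r U = r V \<Longrightarrow> V \<inter> \<phi> ` N \<subseteq> U"
    using rI by (elim rankedE) blast
  obtain s where s: "\<And>U. subm R M U \<Longrightarrow> s U \<le> n"
    "\<And>U V. subm R M U \<Longrightarrow> subm R M V \<Longrightarrow> U \<subseteq> V \<Longrightarrow> s U \<le> s V"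
    "\<And>U V. subm R M U \<Longrightarrow> subm R M V \<Longrightarrow> U \<subseteq> V \<Longrightarrow> s U = s V \<Longrightarrow> V \<inter> {x \<in> N. \<phi> x = \<zero>\<^bsub>M'\<^esub>} \<subseteq> U"
    using rK by (elim rankedE) blast
  have T: "subm R M' (\<phi> ` (W \<inter> N))" if "subm R M W" for W
    by (rule subm_image[OF M M' phi subm_Int[OF that N]])
  show ?thesis
  proof (rule rankedI[where r = "\<lambda>W. s W + r (\<phi> ` (W \<inter> N))"])
    show "s U + r (\<phi> ` (U \<inter> N)) \<le> n + m" if "subm R M U" for U
      using s(1)[OF that] r(1)[OF T[OF that]] by simp
    show "s U + r (\<phi> ` (U \<inter> N)) \<le> s V + r (\<phi> ` (V \<inter> N))" if "subm R M U" "subm R M V" "U \<subseteq> V" for U V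
      using that by (intro add_mono s(2) r(2) T) auto
    fix U V assume U: "subm R M U" and V: "subm R M V" and UV: "U \<subseteq> V"
      and eq: "s U + r (\<phi> ` (U \<inter> N)) = s V + r (\<phi> ` (V \<inter> N))"
    have UV': "\<phi> ` (U \<inter> N) \<subseteq> \<phi> ` (V \<inter> N)" using UV by auto
    have "s U \<le> s V" "r (\<phi> ` (U \<inter> N)) \<le> r (\<phi> ` (V \<inter> N))"
      using s(2)[OF U V UV] r(2)[OF T[OF U] T[OF V] UV'] by auto
    then have *: "s U = s V" "r (\<phi> ` (U \<inter> N)) = r (\<phi> ` (V \<inter> N))" using eq by auto
    have sub: "V \<inter> {x \<in> N. \<phi> x = \<zero>\<^bsub>M'\<^esub>} \<subseteq> U" "\<phi> ` (V \<inter> N) \<subseteq> \<phi> ` (U \<inter> N)"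
      using s(3)[OF U V UV *(1)] r(3)[OF T[OF U] T[OF V] UV' *(2)] by auto
    show "V \<inter> N \<subseteq> U"
    proof
      fix v assume v: "v \<in> V \<inter> N"
      then obtain u where u: "u \<in> U" "u \<in> N" "\<phi> v = \<phi> u" using sub(2) by auto
      have c: "u \<in> carrier M" "v \<in> carrier M" using u v submD(5)[OF N] by auto
      have "\<phi> (v \<ominus>\<^bsub>M\<^esub> u) = \<zero>\<^bsub>M'\<^esub>"
        using c u hom_diff[OF M M' phi c(2,1)] hom_closed[OF phi] by (simp add: M'.diff_eq_zero_iff)
      moreover have "v \<ominus>\<^bsub>M\<^esub> u \<in> V" "v \<ominus>\<^bsub>M\<^esub> u \<in> N"
        using u v UV subm_diff[OF M V] subm_diff[OF M N] by auto
      ultimately have "v \<ominus>\<^bsub>M\<^esub> u \<in> U" using sub(1) by auto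
      then have "(v \<ominus>\<^bsub>M\<^esub> u) \<oplus>\<^bsub>M\<^esub> u \<in> U" using u submD(3)[OF U] by blast
      then show "v \<in> U" using c M.diff_add_cancel[of v u] by simp
    qed
  qed
qed

section \<open>Artinian rings and finitely generated modules have finite rank\<close>

text \<open>The regular module. With it the ideals of a commutative ring and the left ideals of an
  algebra are instances of \<open>subm\<close>, and rings have a rank.\<close>

definition reg :: "('a, 'ax) ring_scheme \<Rightarrow> ('a, 'a) module" where
  "reg R = \<lparr>carrier = carrier R, mult = undefined, one = undefined, zero = \<zero>\<^bsub>R\<^esub>,
     add = add R, smult = mult R\<rparr>"

lemma reg_simps [simp]: "carrier (reg R) = carrier R" "\<zero>\<^bsub>reg R\<^esub> = \<zero>\<^bsub>R\<^esub>"
    "x \<oplus>\<^bsub>reg R\<^esub> y = x \<oplus>\<^bsub>R\<^esub> y" "a \<odot>\<^bsub>reg R\<^esub> x = a \<otimes>\<^bsub>R\<^esub> x"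
  by (simp_all add: reg_def)

lemma reg_module: "ring R \<Longrightarrow> left_module R (reg R)"
proof -
  assume "ring R"
  then interpret R: ring R .
  have "abelian_group (reg R)"
    by (rule abelian_groupI) (auto simp: R.a_ac intro: R.l_neg)
  then interpret abelian_group "reg R" .
  show ?thesis by unfold_locales (auto simp: R.l_distr R.r_distr R.m_assoc)
qed

lemma subm_reg_ideal: "cring R \<Longrightarrow> subm R (reg R) I \<longleftrightarrow> ideal I R"
proof -
  assume "cring R"
  then interpret R: cring R .
  have M: "left_module R (reg R)" using reg_module R.ring_axioms by blast
  show ?thesis
  proof
    assume I: "subm R (reg R) I"
    note I' = submD[OF I, simplified]
    show "ideal I R"
    proof (rule idealI[OF R.ring_axioms])
      have "\<ominus>\<^bsub>R\<^esub> x \<in> I" if "x \<in> I" for x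
        using I'(4)[of "\<ominus>\<^bsub>R\<^esub> \<one>\<^bsub>R\<^esub>" x] I'(5) that by (simp add: R.l_minus)
      then show "subgroup I (add_monoid R)"
        using I' by (intro R.add.subgroupI) (auto simp: a_inv_def)
      show "x \<otimes>\<^bsub>R\<^esub> a \<in> I" "a \<otimes>\<^bsub>R\<^esub> x \<in> I" if "a \<in> I" "x \<in> carrier R" for a x
        using that I' R.m_comm[of a x] by auto
    qed
  next
    assume "ideal I R"
    then interpret I: ideal I R .
    show "subm R (reg R) I"
      using I.a_subset I.I_l_closed by (intro submI) (auto simp: I.a_closed I.zero_closed)
  qed
qed

lemma (in artinian_cring) minimal_ideal:
  assumes "P I" "subm R (reg R) I"
  obtains J where "P J" "subm R (reg R) J" "\<And>J'. subm R (reg R) J' \<Longrightarrow> J' \<subset> J \<Longrightarrow> \<not> P J'"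
proof (rule ccontr)
  assume neg: "\<not> thesis"
  let ?Q = "\<lambda>J. P J \<and> subm R (reg R) J"
  have "\<exists>f :: nat \<Rightarrow> 'a set. \<forall>n. ?Q (f n) \<and> f (Suc n) \<subset> f n"
    using assms neg that by (intro dependent_nat_choice) blast+
  then obtain f :: "nat \<Rightarrow> 'a set" where f: "\<And>n. ?Q (f n)" "\<And>n. f (Suc n) \<subset> f n" by blast
  have "\<exists>N. \<forall>n\<ge>N. f n = f N"
    using f by (intro descending_chain) (auto simp flip: subm_reg_ideal[OF is_cring])
  then obtain N where "\<forall>n\<ge>N. f n = f N" by blast
  then have "f (Suc N) = f N" by (rule allE[of _ "Suc N"]) auto
  then show False using f(2)[of N] by blast
qed

lemma sum_subm:
  assumes M: "left_module R M" and N: "subm R M N" and N': "subm R M N'"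
  shows "subm R M {x \<oplus>\<^bsub>M\<^esub> y | x y. x \<in> N \<and> y \<in> N'}" (is "subm R M ?S")
    and "N \<subseteq> {x \<oplus>\<^bsub>M\<^esub> y | x y. x \<in> N \<and> y \<in> N'}" "N' \<subseteq> {x \<oplus>\<^bsub>M\<^esub> y | x y. x \<in> N \<and> y \<in> N'}"
proof -
  interpret left_module R M by fact
  note N = submD[OF N] and N' = submD[OF N']
  show "subm R M ?S"
  proof (rule submI)
    show "?S \<subseteq> carrier M" using N(5) N'(5) by auto
    show "\<zero>\<^bsub>M\<^esub> \<in> ?S" using N(2) N'(2) by (auto intro!: exI[of _ "\<zero>\<^bsub>M\<^esub>"])
    show "p \<oplus>\<^bsub>M\<^esub> q \<in> ?S" if pq: "p \<in> ?S" "q \<in> ?S" for p q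
    proof -
      obtain u v u' v' where *: "u \<in> N" "v \<in> N'" "u' \<in> N" "v' \<in> N'" "p = u \<oplus>\<^bsub>M\<^esub> v" "q = u' \<oplus>\<^bsub>M\<^esub> v'"
        using pq by auto
      then have "p \<oplus>\<^bsub>M\<^esub> q = (u \<oplus>\<^bsub>M\<^esub> u') \<oplus>\<^bsub>M\<^esub> (v \<oplus>\<^bsub>M\<^esub> v')"
        using N(5) N'(5) by (simp add: M.a_ac)
      then show ?thesis using * N(3) N'(3) by blast
    qed
    show "a \<odot>\<^bsub>M\<^esub> p \<in> ?S" if "a \<in> carrier R" "p \<in> ?S" for a p
      using that N(4,5) N'(4,5) by (force simp: smult_r_distr)
  qed
  have "x \<in> ?S" if "x \<in> N" for x
    using that N(5) N'(2) by (intro CollectI exI[of _ x] exI[of _ "\<zero>\<^bsub>M\<^esub>"]) simp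
  then show "N \<subseteq> ?S" by blast
  have "x \<in> ?S" if "x \<in> N'" for x
    using that N'(5) N(2) by (intro CollectI exI[of _ "\<zero>\<^bsub>M\<^esub>"] exI[of _ x]) simp
  then show "N' \<subseteq> ?S" by blast
qed

text \<open>An ideal \<open>\<aa>\<close> minimal among those of infinite rank is a vector space over a residue field:
  every scalar kills \<open>\<aa>\<close> or acts invertibly on it. A maximal ideal inside \<open>\<aa>\<close> avoiding a nonzero
  \<open>x\<close> is then a complement of a line, and so \<open>\<aa>\<close> has finite rank after all.\<close>

theorem (in artinian_cring) finite_rank: "\<exists>n. ranked R (reg R) (carrier R) n"
proof (rule ccontr)
  let ?M = "reg R"
  have M: "left_module R ?M" by (rule reg_module[OF ring_axioms])
  interpret M: left_module R ?M by (rule M)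
  assume "\<not> ?thesis"
  then have "\<nexists>n. ranked R ?M (carrier R) n" by blast
  then obtain A where bad: "\<nexists>n. ranked R ?M A n" and A: "subm R ?M A"
    and min: "\<And>J. subm R ?M J \<Longrightarrow> J \<subset> A \<Longrightarrow> \<exists>n. ranked R ?M J n"
    using minimal_ideal[of "\<lambda>J. \<nexists>n. ranked R ?M J n" "carrier R"] subm_carrier[OF M] by auto
  note A' = submD[OF A, simplified]
  define h where "h c = (\<lambda>x\<in>carrier R. c \<otimes> x)" for c
  have h: "h c \<in> mod_hom R ?M ?M" if "c \<in> carrier R" for c
  proof -
    have "(\<lambda>x\<in>carrier ?M. c \<otimes> x) \<in> mod_hom R ?M ?M"
      using that by (intro mod_hom_restrictI[OF M]) (auto simp: r_distr m_lcomm)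
    then show ?thesis by (simp add: h_def)
  qed
  \<comment> \<open>If both the kernel of multiplication by \<open>c\<close> on \<open>A\<close> and
    the image \<open>c A\<close> were proper submodules of \<open>A\<close>, they would have finite
    rank by minimality, and then so would \<open>A\<close>.\<close>
  have alt: "(\<forall>x\<in>A. c \<otimes> x = \<zero>) \<or> (\<forall>x\<in>A. \<exists>y\<in>A. x = c \<otimes> y)" if c: "c \<in> carrier R" for c
  proof (rule ccontr)
    assume neg: "\<not> ?thesis"
    have hA: "h c ` A = (\<lambda>x. c \<otimes> x) ` A" using A'(5) by (auto simp: h_def)
    have "h c ` A \<subset> A" using neg A'(4) c by (auto simp: hA)
    then obtain m where m: "ranked R ?M (h c ` A) m"
      using min subm_image[OF M M h[OF c] A] by blast
    let ?K = "{x \<in> A. h c x = \<zero>\<^bsub>?M\<^esub>}"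
    have "?K = A \<inter> {x \<in> carrier ?M. h c x = \<zero>\<^bsub>?M\<^esub>}" using A'(5) by auto
    then have "subm R ?M ?K" using subm_Int[OF A subm_kernel[OF M M h[OF c]]] by simp
    moreover have "?K \<subset> A" using neg A'(5) by (auto simp: h_def)
    ultimately obtain n where "ranked R ?M ?K n" using min by blast
    from ranked_kernel_image[OF M M h[OF c] A this m] show False using bad by blast
  qed
  \<comment> \<open>The ideals generated by the powers of \<open>c\<close> become stationary, so
    \<open>c [^] N = c [^] Suc N \<otimes> d\<close> for some \<open>N\<close> and \<open>d\<close>.
    Every \<open>x\<close> in \<open>A\<close> is divisible by \<open>c [^] N\<close>, and therefore
    \<open>d\<close> inverts \<open>c\<close> on \<open>A\<close>.\<close>
  have inv: "\<exists>d\<in>carrier R. \<forall>x\<in>A. d \<otimes> (c \<otimes> x) = x" if c: "c \<in> carrier R" "\<exists>x\<in>A. c \<otimes> x \<noteq> \<zero>" for c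
  proof -
    have div: "\<forall>x\<in>A. \<exists>y\<in>A. x = c \<otimes> y" using alt[OF c(1)] c(2) by blast
    have pow: "\<exists>y\<in>A. x = (c [^] n) \<otimes> y" if "x \<in> A" for x and n :: nat
      using that
    proof (induction n arbitrary: x)
      case (Suc n)
      obtain y where y: "y \<in> A" "x = (c [^] n) \<otimes> y" using Suc by blast
      then obtain z where "z \<in> A" "y = c \<otimes> z" using div by blast
      then show ?case using y c A'(5) by (intro bexI[of _ z]) (auto simp: m_assoc)
    qed (use A'(5) in auto)
    define I where "I n = {c [^] n \<otimes> d | d. d \<in> carrier R}" for n :: nat
    have "subm R ?M (I n)" for n
    proof (rule submI)
      show "\<zero>\<^bsub>?M\<^esub> \<in> I n" using c by (auto simp: I_def intro!: exI[of _ \<zero>])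
      show "x \<oplus>\<^bsub>?M\<^esub> y \<in> I n" if "x \<in> I n" "y \<in> I n" for x y
        using that c by (auto simp: I_def simp flip: r_distr)
      show "a \<odot>\<^bsub>?M\<^esub> x \<in> I n" if "a \<in> carrier R" "x \<in> I n" for a x
      proof -
        obtain d where "d \<in> carrier R" "x = c [^] n \<otimes> d" using \<open>x \<in> I n\<close> by (auto simp: I_def)
        then have "a \<otimes> x = c [^] n \<otimes> (a \<otimes> d)" "a \<otimes> d \<in> carrier R"
          using that c by (simp_all add: m_lcomm)
        then show ?thesis by (auto simp: I_def)
      qed
    qed (use c in \<open>auto simp: I_def\<close>)
    moreover have "I (Suc n) \<subseteq> I n" for n
      using c by (auto simp: I_def m_assoc)
    ultimately have "\<exists>N. \<forall>n\<ge>N. I n = I N"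
      by (intro descending_chain) (auto simp flip: subm_reg_ideal[OF is_cring])
    then obtain N where "\<forall>n\<ge>N. I n = I N" by blast
    then have "I (Suc N) = I N" by (rule allE[of _ "Suc N"]) auto
    moreover have "c [^] N \<in> I N" using c by (auto simp: I_def intro!: exI[of _ \<one>])
    ultimately have "c [^] N \<in> I (Suc N)" by simp
    then obtain d where d: "d \<in> carrier R" "c [^] N = c [^] (Suc N) \<otimes> d" by (auto simp: I_def)
    have "d \<otimes> (c \<otimes> x) = x" if x: "x \<in> A" for x
    proof -
      obtain y where y: "y \<in> A" "x = c [^] N \<otimes> y" using pow[OF x] by blast
      have yc: "y \<in> carrier R" using y A'(5) by auto
      have "d \<otimes> (c \<otimes> x) = (c [^] (Suc N) \<otimes> d) \<otimes> y"
        using c d(1) yc y(2) by (simp add: m_ac)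
      also have "\<dots> = c [^] N \<otimes> y" by (simp only: d(2)[symmetric])
      finally show ?thesis using y by simp
    qed
    then show ?thesis using d by blast
  qed
  have "\<exists>x\<in>A. x \<noteq> \<zero>"
  proof (rule ccontr)
    assume "\<not> ?thesis"
    then have "A = {\<zero>\<^bsub>?M\<^esub>}" using A'(2) unfolding reg_simps by blast
    then have "ranked R ?M A 0" using ranked_zero[of R ?M] by (simp only:)
    then show False using bad by blast
  qed
  then obtain x where x: "x \<in> A" "x \<noteq> \<zero>" by blast
  have xc: "x \<in> carrier R" using x A'(5) by blast
  \<comment> \<open>A maximal member \<open>W\<close> is proper in \<open>A\<close>, so it has
    finite rank by the choice of \<open>A\<close>. It remains to see that \<open>W\<close> and the
    line through \<open>x\<close> together span \<open>A\<close>.\<close>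
  define F where "F = {W. subm R ?M W \<and> W \<subseteq> A \<and> x \<notin> W}"
  have "\<exists>W\<in>F. \<forall>V\<in>F. W \<subseteq> V \<longrightarrow> V = W"
  proof (rule subset_Zorn_nonempty)
    have "{\<zero>\<^bsub>?M\<^esub>} \<in> F" using subm_zero[OF M] A'(2) x by (auto simp: F_def)
    then show "F \<noteq> {}" by blast
    fix C assume C: "C \<noteq> {}" "subset.chain F C"
    then have CF: "C \<subseteq> F" by (simp add: subset_chain_def)
    have "subm R ?M (\<Union>C)"
    proof (rule submI)
      show "\<Union>C \<subseteq> carrier ?M" using CF submD(1) by (auto simp: F_def subm_def)
      show "\<zero>\<^bsub>?M\<^esub> \<in> \<Union>C" using C CF submD(2) by (fastforce simp: F_def)
      show "u \<oplus>\<^bsub>?M\<^esub> v \<in> \<Union>C" if uv: "u \<in> \<Union>C" "v \<in> \<Union>C" for u v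
      proof -
        obtain U V where UV: "u \<in> U" "U \<in> C" "v \<in> V" "V \<in> C" using uv by blast
        then have "U \<subseteq> V \<or> V \<subseteq> U" using C by (simp add: subset_chain_def)
        then obtain W where W: "W \<in> C" "u \<in> W" "v \<in> W" using UV by blast
        then have "subm R ?M W" using CF by (auto simp: F_def)
        from submD(3)[OF this W(2,3)] show ?thesis using W(1) by blast
      qed
      show "a \<odot>\<^bsub>?M\<^esub> u \<in> \<Union>C" if au: "a \<in> carrier R" "u \<in> \<Union>C" for a u
      proof -
        obtain U where U: "u \<in> U" "U \<in> C" using au by blast
        then have "subm R ?M U" using CF by (auto simp: F_def)
        from submD(4)[OF this au(1) U(1)] show ?thesis using U(2) by blast
      qed
    qed
    then show "\<Union>C \<in> F" using CF by (auto simp: F_def)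
  qed
  then obtain W where W: "subm R ?M W" "W \<subseteq> A" "x \<notin> W"
    and Wmax: "\<And>V. subm R ?M V \<Longrightarrow> V \<subseteq> A \<Longrightarrow> x \<notin> V \<Longrightarrow> W \<subseteq> V \<Longrightarrow> V = W"
    by (auto simp: F_def)
  note W' = submD[OF W(1), simplified]
  have line: "subm R ?M {c \<otimes> y | c. c \<in> carrier R}" if "y \<in> carrier R" for y
  proof (rule submI)
    show "\<zero>\<^bsub>?M\<^esub> \<in> {c \<otimes> y | c. c \<in> carrier R}" using that by (auto intro!: exI[of _ \<zero>])
    show "u \<oplus>\<^bsub>?M\<^esub> v \<in> {c \<otimes> y | c. c \<in> carrier R}"
      if "u \<in> {c \<otimes> y | c. c \<in> carrier R}" "v \<in> {c \<otimes> y | c. c \<in> carrier R}" for u v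
      using that \<open>y \<in> carrier R\<close> by (auto simp flip: l_distr)
    show "a \<odot>\<^bsub>?M\<^esub> u \<in> {c \<otimes> y | c. c \<in> carrier R}"
      if "a \<in> carrier R" "u \<in> {c \<otimes> y | c. c \<in> carrier R}" for a u
      using that \<open>y \<in> carrier R\<close> by (auto simp flip: m_assoc)
  qed (use that in auto)
  let ?L = "{c \<otimes> x | c. c \<in> carrier R}"
  have "ranked R ?M ?L 1"
  \<comment> \<open>The line is simple: a submodule containing a nonzero multiple of
    \<open>x\<close> contains \<open>x\<close>, because the scalar acts invertibly on
    \<open>A\<close>. So the rank function only has to record whether \<open>x\<close> is
    contained.\<close>
  proof (rule rankedI[where r = "\<lambda>V. if x \<in> V then 1 else 0"])
    fix U V assume U: "subm R ?M U" and V: "subm R ?M V" and "U \<subseteq> V"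
      and eq: "(if x \<in> U then 1 else 0) = (if x \<in> V then 1 else (0::nat))"
    show "V \<inter> ?L \<subseteq> U"
    proof
      fix v assume v: "v \<in> V \<inter> ?L"
      then obtain c where c: "c \<in> carrier R" "v = c \<otimes> x" by blast
      show "v \<in> U"
      proof (cases "x \<in> V")
        case True
        then have "x \<in> U" using eq by (auto split: if_splits)
        then show ?thesis using submD(4)[OF U] c by auto
      next
        case False
        have "c \<otimes> x = \<zero>"
        proof (rule ccontr)
          assume "c \<otimes> x \<noteq> \<zero>"
          then obtain d where "d \<in> carrier R" "d \<otimes> (c \<otimes> x) = x" using inv c x by blast
          then show False using submD(4)[OF V, of d v] v c False by auto
        qed
        then show ?thesis using c submD(2)[OF U] by simp
      qed
    qed
  qed auto
  moreover have "W \<subset> A" using W x by blast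
  then obtain n where "ranked R ?M W n" using min W(1) by blast
  ultimately have "ranked R ?M {u \<oplus>\<^bsub>?M\<^esub> v | u v. u \<in> W \<and> v \<in> ?L} (n + 1)"
    by (intro ranked_sum M W(1) line xc)
  moreover have "A \<subseteq> {u \<oplus>\<^bsub>?M\<^esub> v | u v. u \<in> W \<and> v \<in> ?L}"
  proof
    fix y assume y: "y \<in> A"
    have yc: "y \<in> carrier R" using y A'(5) by blast
    show "y \<in> {u \<oplus>\<^bsub>?M\<^esub> v | u v. u \<in> W \<and> v \<in> ?L}"
    proof (cases "y \<in> W")
      case True
      then show ?thesis using sum_subm(2)[OF M W(1) line[OF xc]] by blast
    next
      case False
      let ?V = "{u \<oplus>\<^bsub>?M\<^esub> v | u v. u \<in> W \<and> v \<in> {c \<otimes> y | c. c \<in> carrier R}}"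
      note V = sum_subm[OF M W(1) line[OF yc]]
      have "y \<in> {c \<otimes> y | c. c \<in> carrier R}" using yc by (auto intro!: exI[of _ \<one>])
      then have "y \<in> ?V" using V(3) by blast
      then have "?V \<noteq> W" using False by blast
      moreover have "?V \<subseteq> A" using W(2) y A'(3,4) by auto
      \<comment> \<open>By maximality of \<open>W\<close> the sum of \<open>W\<close> and the line
        through \<open>y\<close> contains \<open>x\<close>. In \<open>x = u + c y\<close> the scalar
        \<open>c\<close> does not kill \<open>y\<close>, as \<open>x\<close> is not in
        \<open>W\<close>; its inverse \<open>d\<close> on \<open>A\<close> gives
        \<open>y = d x - d u\<close>.\<close>
      ultimately have "x \<in> ?V" using Wmax[OF V(1) _ _ V(2)] by blast
      then obtain u c where uc: "u \<in> W" "c \<in> carrier R" "x = u \<oplus> c \<otimes> y" by auto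
      have ucar: "u \<in> carrier R" using uc W'(5) by blast
      have cy: "c \<otimes> y = x \<oplus> \<ominus> u" using uc yc ucar by (simp add: a_ac r_neg r_neg2)
      have "c \<otimes> y \<noteq> \<zero>" using uc W(3) ucar by auto
      then obtain d where d: "d \<in> carrier R" "d \<otimes> (c \<otimes> y) = y" using inv uc(2) y by blast
      have "y = (\<ominus> d) \<otimes> u \<oplus> d \<otimes> x"
        using d cy xc ucar by (simp add: r_distr r_minus l_minus a_ac)
      moreover have "\<ominus> d \<otimes> u \<in> W" using d uc W'(4) by blast
      ultimately show ?thesis using d(1) by (simp only: mem_Collect_eq reg_simps) blast
    qed
  qed
  ultimately show False using ranked_subset bad by blast
qed

section \<open>Restriction of scalars and finite rank over the base ring\<close>

definition restr :: "('k, 'a, 'ax) module_scheme \<Rightarrow> ('a, 'm, 'mx) module_scheme \<Rightarrow> ('k, 'm) module" where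
  "restr A M = \<lparr>carrier = carrier M, mult = undefined, one = undefined, zero = \<zero>\<^bsub>M\<^esub>,
     add = add M, smult = (\<lambda>c x. (c \<odot>\<^bsub>A\<^esub> \<one>\<^bsub>A\<^esub>) \<odot>\<^bsub>M\<^esub> x)\<rparr>"

lemma restr_simps [simp]: "carrier (restr A M) = carrier M" "\<zero>\<^bsub>restr A M\<^esub> = \<zero>\<^bsub>M\<^esub>"
    "x \<oplus>\<^bsub>restr A M\<^esub> y = x \<oplus>\<^bsub>M\<^esub> y" "c \<odot>\<^bsub>restr A M\<^esub> x = (c \<odot>\<^bsub>A\<^esub> \<one>\<^bsub>A\<^esub>) \<odot>\<^bsub>M\<^esub> x"
  by (simp_all add: restr_def)

lemma restr_module:
  assumes "artin_algebra k A" "left_module A M"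
  shows "left_module k (restr A M)"
proof -
  interpret artin_algebra k A by fact
  interpret M: left_module A M by fact
  have "abelian_group (restr A M)"
    by (rule abelian_groupI) (auto simp: M.a_ac intro: M.l_neg)
  then interpret N: abelian_group "restr A M" .
  show ?thesis
  proof unfold_locales
    fix a b x assume *: "a \<in> carrier k" "b \<in> carrier k" "x \<in> carrier (restr A M)"
    then have "(a \<otimes>\<^bsub>k\<^esub> b) \<odot>\<^bsub>A\<^esub> \<one>\<^bsub>A\<^esub> = (a \<odot>\<^bsub>A\<^esub> \<one>\<^bsub>A\<^esub>) \<otimes>\<^bsub>A\<^esub> (b \<odot>\<^bsub>A\<^esub> \<one>\<^bsub>A\<^esub>)"
      by (simp add: smult_mult_left smult_assoc1)
    then show "(a \<otimes>\<^bsub>k\<^esub> b) \<odot>\<^bsub>restr A M\<^esub> x = a \<odot>\<^bsub>restr A M\<^esub> (b \<odot>\<^bsub>restr A M\<^esub> x)"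
      using * by (simp add: M.smult_assoc1)
  qed (auto simp: M.smult_l_distr M.smult_r_distr smult_l_distr)
qed

lemma subm_restr:
  assumes "artin_algebra k A" "subm A M N"
  shows "subm k (restr A M) N"
proof -
  interpret artin_algebra k A by fact
  show ?thesis using submD[OF assms(2)] by (intro submI) auto
qed

lemma hom_restr:
  assumes "artin_algebra k A" "f \<in> mod_hom A X Y"
  shows "f \<in> mod_hom k (restr A X) (restr A Y)"
proof -
  interpret artin_algebra k A by fact
  show ?thesis using hom_ext[OF assms(2)]
    by (intro mod_homI) (auto simp: hom_closed[OF assms(2)] hom_add[OF assms(2)] hom_smult[OF assms(2)])
qed

lemma hom_orbit:
  assumes "left_module R M" "s \<in> carrier M"
  shows "(\<lambda>a\<in>carrier R. a \<odot>\<^bsub>M\<^esub> s) \<in> mod_hom R (reg R) M"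
proof -
  interpret M: left_module R M by fact
  have "restrict (\<lambda>a. a \<odot>\<^bsub>M\<^esub> s) (carrier (reg R)) \<in> mod_hom R (reg R) M"
    using assms(2) by (intro mod_hom_restrictI reg_module M.R.ring_axioms)
      (auto simp: M.smult_l_distr M.smult_assoc1)
  then show ?thesis by simp
qed

text \<open>A finitely generated module is a finite sum of cyclic submodules, and a cyclic submodule
  is an image of the regular module. The induction runs over a finite generating set and keeps a
  submodule that contains the generators treated so far.\<close>

lemma fin_gen_subm_induct:
  assumes M: "left_module R M" and fg: "fin_gen R M" and zero: "P {\<zero>\<^bsub>M\<^esub>}"
    and add: "\<And>N N'. subm R M N \<Longrightarrow> subm R M N' \<Longrightarrow> P N \<Longrightarrow> P N' \<Longrightarrow>
      P {x \<oplus>\<^bsub>M\<^esub> y | x y. x \<in> N \<and> y \<in> N'}"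
    and orbit: "\<And>s. s \<in> carrier M \<Longrightarrow> P ((\<lambda>a\<in>carrier R. a \<odot>\<^bsub>M\<^esub> s) ` carrier R)"
  shows "P (carrier M)"
proof -
  interpret M: left_module R M by fact
  have "\<exists>N. subm R M N \<and> S \<subseteq> N \<and> P N" if "finite S" "S \<subseteq> carrier M" for S
    using that
  proof (induction S)
    case empty
    then show ?case using zero subm_zero[OF M] by blast
  next
    case (insert s S)
    then obtain N where N: "subm R M N" "S \<subseteq> N" "P N" by auto
    have s: "s \<in> carrier M" using insert by blast
    let ?N' = "(\<lambda>a\<in>carrier R. a \<odot>\<^bsub>M\<^esub> s) ` carrier R"
    have N': "subm R M ?N'"
      using subm_image[OF reg_module M hom_orbit[OF M s] subm_carrier[OF reg_module]] M.R.ring_axioms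
      by simp
    have "s \<in> ?N'" using s by (auto intro!: image_eqI[of _ _ "\<one>\<^bsub>R\<^esub>"])
    then show ?case using sum_subm[OF M N(1) N'] add[OF N(1) N' N(3) orbit[OF s]] N(2) by blast
  qed
  moreover obtain S where "finite S" "S \<subseteq> carrier M" "\<And>N. subm R M N \<Longrightarrow> S \<subseteq> N \<Longrightarrow> N = carrier M"
    using fg unfolding fin_gen_iff[OF M] by blast
  ultimately show ?thesis by metis
qed

lemma module_left_module: "Module.module R M \<Longrightarrow> left_module R M"
proof -
  assume "Module.module R M"
  then interpret Module.module R M .
  show ?thesis
    by unfold_locales (auto simp: smult_l_distr smult_r_distr smult_assoc1)
qed

lemma artin_algebraD:
  assumes "artin_algebra k A"
  shows "ring A" "ring k" "artinian_cring k" "Module.module k A" "fin_gen k A"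
  using assms unfolding artin_algebra_def artin_algebra_axioms_def artinian_cring_def cring_def by simp_all

text \<open>\<open>A\<close> is a finite sum of cyclic \<open>k\<close>-submodules, and each of
  these is an image of the regular module of \<open>k\<close>, whose rank is finite.\<close>

lemma rank_algebra:
  assumes AA: "artin_algebra k A"
  shows "\<exists>n. ranked k (restr A (reg A)) (carrier A) n"
proof -
  interpret artin_algebra k A by fact
  have A: "left_module k A" using module_left_module module_axioms .
  have rA: "left_module k (restr A (reg A))"
    by (rule restr_module[OF AA reg_module[OF artin_algebraD(1)[OF AA]]])
  obtain n where n: "ranked k (reg k) (carrier k) n" using finite_rank by blast
  have "\<exists>n. ranked k A (carrier A) n"
  proof (rule fin_gen_subm_induct[OF A fin_gen_over_base])
    show "\<exists>n. ranked k A {\<zero>\<^bsub>A\<^esub>} n" using ranked_zero by blast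
    show "\<exists>n. ranked k A {x \<oplus>\<^bsub>A\<^esub> y | x y. x \<in> N \<and> y \<in> N'} n"
      if "subm k A N" "subm k A N'" "\<exists>n. ranked k A N n" "\<exists>n. ranked k A N' n" for N N'
      using ranked_sum[OF A that(1,2)] that(3,4) by blast
    show "\<exists>n. ranked k A ((\<lambda>a\<in>carrier k. a \<odot>\<^bsub>A\<^esub> s) ` carrier k) n" if "s \<in> carrier A" for s
      using ranked_image[OF reg_module[OF artin_algebraD(2)[OF AA]] A hom_orbit[OF A that]] n by auto
  qed
  then obtain m where m: "ranked k A (carrier A) m" by blast
  \<comment> \<open>There are two \<open>k\<close>-structures on the carrier of \<open>A\<close>:
    the given one, and left multiplication by \<open>c \<odot> \<one>\<close>. The law
    \<open>smult_mult_left\<close> identifies them.\<close>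
  have "(\<lambda>x\<in>carrier A. x) \<in> mod_hom k A (restr A (reg A))"
    by (rule mod_hom_restrictI[OF A]) (auto simp: smult_mult_left)
  from ranked_image[OF A rA this m] show ?thesis by (intro exI[of _ m]) simp
qed

text \<open>The same induction one level up: cyclic \<open>A\<close>-submodules are images of the
  regular module of \<open>A\<close>. The rank is taken over \<open>k\<close>, because
  multiplication by a ring element, to which ranks will be applied, is \<open>k\<close>-linear but
  in general not \<open>A\<close>-linear.\<close>

lemma rank_module:
  assumes AA: "artin_algebra k A" and M: "left_module A M" and fg: "fin_gen A M"
  shows "\<exists>n. ranked k (restr A M) (carrier M) n"
proof -
  interpret artin_algebra k A by fact
  have rA: "left_module A (reg A)" by (rule reg_module[OF artin_algebraD(1)[OF AA]])
  note rM = restr_module[OF AA M]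
  obtain n where n: "ranked k (restr A (reg A)) (carrier A) n" using rank_algebra[OF AA] by blast
  show ?thesis
  proof (rule fin_gen_subm_induct[OF M fg])
    show "\<exists>n. ranked k (restr A M) {\<zero>\<^bsub>M\<^esub>} n"
      using ranked_zero[of k "restr A M"] by auto
    show "\<exists>n. ranked k (restr A M) {x \<oplus>\<^bsub>M\<^esub> y | x y. x \<in> N \<and> y \<in> N'} n"
      if "subm A M N" "subm A M N'" "\<exists>n. ranked k (restr A M) N n" "\<exists>n. ranked k (restr A M) N' n" for N N'
      using ranked_sum[OF rM subm_restr[OF AA that(1)] subm_restr[OF AA that(2)]] that(3,4)
      unfolding restr_simps by blast
    show "\<exists>n. ranked k (restr A M) ((\<lambda>a\<in>carrier A. a \<odot>\<^bsub>M\<^esub> s) ` carrier A) n" if "s \<in> carrier M" for s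
      using ranked_image[OF restr_module[OF AA rA] rM hom_restr[OF AA hom_orbit[OF M that]]] n by auto
  qed
qed

text \<open>Among the finite subsets of \<open>N\<close> take one whose generated submodule
  \<open>G S\<close> has greatest rank. Adjoining a further element of \<open>N\<close> cannot raise
  the rank, so that element already lies in \<open>G S\<close>.\<close>

lemma fin_gen_submodule:
  assumes AA: "artin_algebra k A" and M: "left_module A M" and fg: "fin_gen A M" and N: "subm A M N"
  shows "\<exists>S. finite S \<and> S \<subseteq> N \<and> (\<forall>N'. subm A M N' \<longrightarrow> S \<subseteq> N' \<longrightarrow> N \<subseteq> N')"
proof -
  obtain n where "ranked k (restr A M) (carrier M) n" using rank_module[OF AA M fg] by blast
  then obtain r where r: "\<And>U. subm k (restr A M) U \<Longrightarrow> r U \<le> n"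
    "\<And>U V. subm k (restr A M) U \<Longrightarrow> subm k (restr A M) V \<Longrightarrow> U \<subseteq> V \<Longrightarrow> r U = r V \<Longrightarrow> V \<inter> carrier M \<subseteq> U"
    "\<And>U V. subm k (restr A M) U \<Longrightarrow> subm k (restr A M) V \<Longrightarrow> U \<subseteq> V \<Longrightarrow> r U \<le> r V"
    by (elim rankedE) blast
  define G where "G S = \<Inter>{N'. subm A M N' \<and> S \<subseteq> N'}" for S
  have G: "subm A M (G S)" "S \<subseteq> G S" if "S \<subseteq> carrier M" for S
  proof -
    show "subm A M (G S)"
      using that subm_carrier[OF M] unfolding G_def subm_def by blast
    show "S \<subseteq> G S" by (auto simp: G_def)
  qed
  have Gm: "G S \<subseteq> N'" if "subm A M N'" "S \<subseteq> N'" for S N'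
    using that by (auto simp: G_def)
  note NM = submD(1)[OF N]
  have "\<exists>S. (finite S \<and> S \<subseteq> N) \<and> (\<forall>S'. finite S' \<and> S' \<subseteq> N \<longrightarrow> r (G S') \<le> r (G S))"
  proof (rule Lattices_Big.ex_has_greatest_nat)
    show "finite {} \<and> {} \<subseteq> N" by simp
    show "\<forall>S. finite S \<and> S \<subseteq> N \<longrightarrow> r (G S) < Suc n"
      using r(1)[OF subm_restr[OF AA G(1)[OF subset_trans[OF _ NM]]]] by (simp add: less_Suc_eq_le)
  qed
  then obtain S where *: "(finite S \<and> S \<subseteq> N) \<and> (\<forall>S'. finite S' \<and> S' \<subseteq> N \<longrightarrow> r (G S') \<le> r (G S))"
    by (elim exE)
  then have S: "finite S" "S \<subseteq> N" by simp_all
  have max: "r (G S') \<le> r (G S)" if "finite S'" "S' \<subseteq> N" for S' using * that by simp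
  have "N \<subseteq> G S"
  proof
    fix x assume x: "x \<in> N"
    let ?S = "insert x S"
    have c: "?S \<subseteq> carrier M" "S \<subseteq> carrier M" using x S NM by auto
    have sub: "G S \<subseteq> G ?S" using G(2)[OF c(1)] by (intro Gm G(1) c) auto
    have "r (G S) = r (G ?S)"
      using max[of ?S] x S r(3)[OF subm_restr[OF AA G(1)[OF c(2)]] subm_restr[OF AA G(1)[OF c(1)]] sub]
      by auto
    from r(2)[OF subm_restr[OF AA G(1)[OF c(2)]] subm_restr[OF AA G(1)[OF c(1)]] sub this]
    have "G ?S \<inter> carrier M \<subseteq> G S" .
    then show "x \<in> G S" using G(2)[OF c(1)] c(1) by blast
  qed
  then show ?thesis using S Gm by (intro exI[of _ S]) blast
qed

section \<open>Kernels, cokernels and direct sums of finitely generated modules\<close>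

lemma fgD: "X \<in> fg_modules A \<Longrightarrow> left_module A X" "X \<in> fg_modules A \<Longrightarrow> fin_gen A X"
  by (simp_all add: fg_modules_def)

lemma sub_module:
  assumes M: "left_module A M" and N: "subm A M N"
  shows "left_module A (M\<lparr>carrier := N\<rparr>)"
proof -
  interpret M: left_module A M by fact
  note N' = submD[OF N]
  have "abelian_group (M\<lparr>carrier := N\<rparr>)"
  proof (rule abelian_groupI)
    show "\<exists>y\<in>carrier (M\<lparr>carrier := N\<rparr>). y \<oplus>\<^bsub>M\<lparr>carrier := N\<rparr>\<^esub> x = \<zero>\<^bsub>M\<lparr>carrier := N\<rparr>\<^esub>"
      if "x \<in> carrier (M\<lparr>carrier := N\<rparr>)" for x
      using that subm_neg[OF M N] N'(5) by (intro bexI[of _ "\<ominus>\<^bsub>M\<^esub> x"]) (auto simp: M.l_neg)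
  qed (use N' in \<open>auto simp: M.a_ac\<close>)
  then interpret S: abelian_group "M\<lparr>carrier := N\<rparr>" .
  show ?thesis
    using N' by unfold_locales (auto simp: M.smult_l_distr M.smult_r_distr M.smult_assoc1)
qed

lemma sub_incl:
  assumes M: "left_module A M" and N: "subm A M N"
  shows "(\<lambda>x\<in>N. x) \<in> mod_hom A (M\<lparr>carrier := N\<rparr>) M"
  using mod_hom_restrictI[OF sub_module[OF M N], of "\<lambda>x. x" M] submD(1)[OF N] by auto

lemma sub_fg:
  assumes AA: "artin_algebra k A" and M: "M \<in> fg_modules A" and N: "subm A M N"
  shows "M\<lparr>carrier := N\<rparr> \<in> fg_modules A"
proof -
  let ?N = "M\<lparr>carrier := N\<rparr>"
  note M' = fgD[OF M]
  note N' = sub_module[OF M'(1) N]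
  obtain S where S: "finite S" "S \<subseteq> N" "\<And>N'. subm A M N' \<Longrightarrow> S \<subseteq> N' \<Longrightarrow> N \<subseteq> N'"
    using fin_gen_submodule[OF AA M' N] by blast
  have "fin_gen A ?N"
    unfolding fin_gen_iff[OF N']
  proof (intro exI[of _ S] conjI allI impI)
    fix U assume U: "subm A ?N U" "S \<subseteq> U"
    then have UN: "U \<subseteq> N" by (auto simp: subm_def)
    then have "subm A M U" using U(1) submD(1)[OF N] by (auto simp: subm_def)
    then show "U = carrier ?N" using S(3) U UN by auto
  qed (use S in auto)
  then show ?thesis using N' by (simp add: fg_modules_def)
qed

text \<open>Submodules reappear as injective homomorphisms from an object of the category, so that
  later constructions can be phrased with maps alone.\<close>

lemma subobject:
  assumes AA: "artin_algebra k A" and M: "M \<in> fg_modules A" and N: "subm A M N"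
  obtains K i where "K \<in> fg_modules A" "i \<in> mod_hom A K M" "inj_on i (carrier K)" "i ` carrier K = N"
proof -
  have "inj_on (\<lambda>x\<in>N. x) (carrier (M\<lparr>carrier := N\<rparr>))" by (auto simp: inj_on_def)
  moreover have "(\<lambda>x\<in>N. x) ` carrier (M\<lparr>carrier := N\<rparr>) = N" by auto
  ultimately show thesis using that sub_fg[OF AA M N] sub_incl[OF fgD(1)[OF M] N] by blast
qed

lemma fin_gen_image:
  assumes M: "left_module A M" "fin_gen A M" and Y: "left_module A Y"
    and f: "f \<in> mod_hom A M Y" "f ` carrier M = carrier Y"
  shows "fin_gen A Y"
proof -
  obtain S where S: "finite S" "S \<subseteq> carrier M" "\<And>N. subm A M N \<Longrightarrow> S \<subseteq> N \<Longrightarrow> N = carrier M"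
    using M(2) unfolding fin_gen_iff[OF M(1)] by blast
  show ?thesis unfolding fin_gen_iff[OF Y]
  proof (intro exI[of _ "f ` S"] conjI allI impI)
    fix N assume N: "subm A Y N" "f ` S \<subseteq> N"
    have "{x \<in> carrier M. f x \<in> N} = carrier M"
      using N(2) S(2) by (intro S(3) subm_vimage[OF M(1) Y f(1) N(1)]) auto
    then have "f x \<in> N" if "x \<in> carrier M" for x using that by blast
    then have "carrier Y \<subseteq> N" unfolding f(2)[symmetric] by blast
    then show "N = carrier Y" using submD(1)[OF N(1)] by (intro subset_antisym)
  qed (use S f in auto)
qed

text \<open>The elements are the cosets \<open>e x\<close>, with operations taken on chosen
  representatives \<open>d u\<close>; \<open>eq\<close> makes the result independent of the choice.
  The carrier lives one power set above that of \<open>M\<close>, so this module is not yet on the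
  type \<open>amod\<close>.\<close>

lemma quotient_module:
  fixes M :: "('a, 'm, 'mx) module_scheme"
  assumes M: "left_module A M" and N: "subm A M N"
  obtains Z :: "('a, 'm set) module" and c where "left_module A Z" "c \<in> mod_hom A M Z"
    "c ` carrier M = carrier Z" "\<And>x. x \<in> carrier M \<Longrightarrow> c x = \<zero>\<^bsub>Z\<^esub> \<longleftrightarrow> x \<in> N"
proof -
  interpret M: left_module A M by fact
  note N' = submD[OF N]
  define e where "e x = {y \<in> carrier M. y \<ominus>\<^bsub>M\<^esub> x \<in> N}" for x
  have eq: "e x = e y \<longleftrightarrow> x \<ominus>\<^bsub>M\<^esub> y \<in> N" if xy: "x \<in> carrier M" "y \<in> carrier M" for x y
  proof
    have "x \<ominus>\<^bsub>M\<^esub> x = \<zero>\<^bsub>M\<^esub>" using xy by (simp add: M.diff_eq_zero_iff)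
    then have "x \<in> e x" using xy N'(2) by (simp add: e_def)
    moreover assume "e x = e y"
    ultimately have "x \<in> e y" by simp
    then show "x \<ominus>\<^bsub>M\<^esub> y \<in> N" by (simp add: e_def)
  next
    assume d: "x \<ominus>\<^bsub>M\<^esub> y \<in> N"
    have "z \<ominus>\<^bsub>M\<^esub> x \<in> N \<longleftrightarrow> z \<ominus>\<^bsub>M\<^esub> y \<in> N" if z: "z \<in> carrier M" for z
    proof -
      have 1: "z \<ominus>\<^bsub>M\<^esub> y = (z \<ominus>\<^bsub>M\<^esub> x) \<oplus>\<^bsub>M\<^esub> (x \<ominus>\<^bsub>M\<^esub> y)"
        using z xy by (simp add: a_minus_def M.a_assoc M.r_neg1 M.r_neg2)
      have 2: "z \<ominus>\<^bsub>M\<^esub> x = (z \<ominus>\<^bsub>M\<^esub> y) \<oplus>\<^bsub>M\<^esub> (y \<ominus>\<^bsub>M\<^esub> x)"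
        using z xy by (simp add: a_minus_def M.a_assoc M.r_neg1 M.r_neg2)
      have "y \<ominus>\<^bsub>M\<^esub> x = \<ominus>\<^bsub>M\<^esub> (x \<ominus>\<^bsub>M\<^esub> y)"
        using xy by (simp add: a_minus_def M.minus_add M.a_comm)
      then have "y \<ominus>\<^bsub>M\<^esub> x \<in> N" using subm_neg[OF M N d] by simp
      then show ?thesis using 1 2 d N'(3) by metis
    qed
    then show "e x = e y" by (auto simp: e_def)
  qed
  define d where "d u = (SOME x. x \<in> carrier M \<and> e x = u)" for u
  have d: "d (e x) \<in> carrier M" "e (d (e x)) = e x" if "x \<in> carrier M" for x
    using someI[of "\<lambda>y. y \<in> carrier M \<and> e y = e x" x] that by (auto simp: d_def)
  define Z :: "('a, 'm set) module" where "Z = \<lparr>carrier = e ` carrier M, mult = undefined, one = undefined,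
     zero = e \<zero>\<^bsub>M\<^esub>, add = (\<lambda>u v. e (d u \<oplus>\<^bsub>M\<^esub> d v)), smult = (\<lambda>a u. e (a \<odot>\<^bsub>M\<^esub> d u))\<rparr>"
  have add: "e x \<oplus>\<^bsub>Z\<^esub> e y = e (x \<oplus>\<^bsub>M\<^esub> y)" if xy: "x \<in> carrier M" "y \<in> carrier M" for x y
  proof -
    have "(d (e x) \<oplus>\<^bsub>M\<^esub> d (e y)) \<ominus>\<^bsub>M\<^esub> (x \<oplus>\<^bsub>M\<^esub> y) = (d (e x) \<ominus>\<^bsub>M\<^esub> x) \<oplus>\<^bsub>M\<^esub> (d (e y) \<ominus>\<^bsub>M\<^esub> y)"
      using xy d by (simp add: a_minus_def M.a_ac M.minus_add)
    then show ?thesis using xy d eq N'(3) by (simp add: Z_def)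
  qed
  have smult: "a \<odot>\<^bsub>Z\<^esub> e x = e (a \<odot>\<^bsub>M\<^esub> x)" if ax: "a \<in> carrier A" "x \<in> carrier M" for a x
  proof -
    have "(a \<odot>\<^bsub>M\<^esub> d (e x)) \<ominus>\<^bsub>M\<^esub> (a \<odot>\<^bsub>M\<^esub> x) = (a \<odot>\<^bsub>M\<^esub> d (e x)) \<oplus>\<^bsub>M\<^esub> (a \<odot>\<^bsub>M\<^esub> (\<ominus>\<^bsub>M\<^esub> x))"
      using ax d M.smult_r_distr[of a x "\<ominus>\<^bsub>M\<^esub> x"] M.minus_equality[of "a \<odot>\<^bsub>M\<^esub> (\<ominus>\<^bsub>M\<^esub> x)" "a \<odot>\<^bsub>M\<^esub> x"]
      by (simp add: a_minus_def M.r_neg M.smult_r_null M.a_comm)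
    also have "\<dots> = a \<odot>\<^bsub>M\<^esub> (d (e x) \<ominus>\<^bsub>M\<^esub> x)"
      using ax d by (simp add: a_minus_def M.smult_r_distr)
    finally show ?thesis using ax d eq N'(4) by (simp add: Z_def)
  qed
  have carr: "carrier Z = e ` carrier M" and zero: "\<zero>\<^bsub>Z\<^esub> = e \<zero>\<^bsub>M\<^esub>" by (simp_all add: Z_def)
  have "abelian_group Z"
  proof (rule abelian_groupI)
    fix u assume "u \<in> carrier Z"
    then obtain x where x: "x \<in> carrier M" "u = e x" by (auto simp: carr)
    show "\<exists>v\<in>carrier Z. v \<oplus>\<^bsub>Z\<^esub> u = \<zero>\<^bsub>Z\<^esub>"
      using x by (intro bexI[of _ "e (\<ominus>\<^bsub>M\<^esub> x)"]) (auto simp: carr zero add M.l_neg)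
  qed (auto simp: carr zero add M.a_ac)
  then interpret Z: abelian_group Z .
  have "left_module A Z"
    by unfold_locales (auto simp: carr add smult M.smult_l_distr M.smult_r_distr M.smult_assoc1)
  moreover have "restrict e (carrier M) \<in> mod_hom A M Z"
    by (rule mod_hom_restrictI[OF M]) (auto simp: carr add smult)
  moreover have "restrict e (carrier M) x = \<zero>\<^bsub>Z\<^esub> \<longleftrightarrow> x \<in> N" if "x \<in> carrier M" for x
    using that M.M.diff_add_cancel[of x "\<zero>\<^bsub>M\<^esub>"] by (simp add: zero eq)
  ultimately show thesis using that[of Z "restrict e (carrier M)"] by (simp add: carr)
qed

lemma representative:
  fixes M :: "('a, 'm, 'mx) module_scheme"
  assumes "left_module A M" "fin_gen A M"
  obtains X f where "X \<in> fg_modules A" "f \<in> mod_hom A M X" "inj_on f (carrier M)" "f ` carrier M = carrier X"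
  using fg_modules_representative[OF assms] unfolding mod_isomorphic_def bij_betw_def by blast

text \<open>The quotient is carried back into \<open>fg_modules\<close> along an isomorphism with a
  representative. For this reason it is presented by a surjection and its kernel, not by
  cosets.\<close>

lemma cokernel:
  assumes M: "M \<in> fg_modules A" and N: "subm A M N"
  obtains C c where "C \<in> fg_modules A" "c \<in> mod_hom A M C" "c ` carrier M = carrier C"
    "\<And>x. x \<in> carrier M \<Longrightarrow> c x = \<zero>\<^bsub>C\<^esub> \<longleftrightarrow> x \<in> N"
proof -
  note M' = fgD[OF M]
  obtain Z :: "('a, (nat \<Rightarrow> 'a) set set) module" and c where Z: "left_module A Z" "c \<in> mod_hom A M Z"
    "c ` carrier M = carrier Z" "\<And>x. x \<in> carrier M \<Longrightarrow> c x = \<zero>\<^bsub>Z\<^esub> \<longleftrightarrow> x \<in> N"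
    by (rule quotient_module[OF M'(1) N]) (rule that)
  obtain C f where C: "C \<in> fg_modules A" "f \<in> mod_hom A Z C" "inj_on f (carrier Z)" "f ` carrier Z = carrier C"
    by (rule representative[OF Z(1) fin_gen_image[OF M' Z(1,2,3)]]) (rule that)
  have f0: "f u = \<zero>\<^bsub>C\<^esub> \<longleftrightarrow> u = \<zero>\<^bsub>Z\<^esub>" if "u \<in> carrier Z" for u
    using C(3) that hom_zero[OF Z(1) fgD(1)[OF C(1)] C(2)] inj_on_iff_kernel[OF Z(1) fgD(1)[OF C(1)] C(2)] by blast
  have "compose (carrier M) f c ` carrier M = f ` c ` carrier M"
    by (simp add: compose_def image_image)
  then have "compose (carrier M) f c ` carrier M = carrier C" unfolding Z(3) C(4) .
  moreover have "compose (carrier M) f c x = \<zero>\<^bsub>C\<^esub> \<longleftrightarrow> x \<in> N" if "x \<in> carrier M" for x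
    using that f0 Z(4) hom_closed[OF Z(2)] by (simp add: compose_eq)
  ultimately show thesis by (rule that[OF C(1) hom_comp[OF M'(1) Z(2) C(2)]])
qed

text \<open>\<open>mod_dsum\<close> lives on pairs, outside the type \<open>amod\<close>. The
  equations between injections and projections characterize a direct sum for an arbitrary module
  \<open>D\<close>, and they are the form in which maps into and out of sums are built.\<close>

definition biprod :: "('a, 'ax) ring_scheme \<Rightarrow> ('a, 'd, 'dx) module_scheme \<Rightarrow> ('a, 'm, 'mx) module_scheme \<Rightarrow>
    ('a, 'n, 'nx) module_scheme \<Rightarrow> ('m \<Rightarrow> 'd) \<Rightarrow> ('n \<Rightarrow> 'd) \<Rightarrow> ('d \<Rightarrow> 'm) \<Rightarrow> ('d \<Rightarrow> 'n) \<Rightarrow> bool" where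
  "biprod A D X Y i j p q \<longleftrightarrow> i \<in> mod_hom A X D \<and> j \<in> mod_hom A Y D \<and> p \<in> mod_hom A D X \<and> q \<in> mod_hom A D Y \<and>
     (\<forall>x\<in>carrier X. p (i x) = x \<and> q (i x) = \<zero>\<^bsub>Y\<^esub>) \<and> (\<forall>y\<in>carrier Y. q (j y) = y \<and> p (j y) = \<zero>\<^bsub>X\<^esub>) \<and>
     (\<forall>d\<in>carrier D. i (p d) \<oplus>\<^bsub>D\<^esub> j (q d) = d)"

lemma biprodD:
  assumes "biprod A D X Y i j p q"
  shows "i \<in> mod_hom A X D" "j \<in> mod_hom A Y D" "p \<in> mod_hom A D X" "q \<in> mod_hom A D Y"
    "\<And>x. x \<in> carrier X \<Longrightarrow> p (i x) = x" "\<And>x. x \<in> carrier X \<Longrightarrow> q (i x) = \<zero>\<^bsub>Y\<^esub>"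
    "\<And>y. y \<in> carrier Y \<Longrightarrow> q (j y) = y" "\<And>y. y \<in> carrier Y \<Longrightarrow> p (j y) = \<zero>\<^bsub>X\<^esub>"
    "\<And>d. d \<in> carrier D \<Longrightarrow> i (p d) \<oplus>\<^bsub>D\<^esub> j (q d) = d"
  using assms by (simp_all add: biprod_def)

lemma dsum_simps [simp]: "carrier (mod_dsum X Y) = carrier X \<times> carrier Y"
    "\<zero>\<^bsub>mod_dsum X Y\<^esub> = (\<zero>\<^bsub>X\<^esub>, \<zero>\<^bsub>Y\<^esub>)" "u \<oplus>\<^bsub>mod_dsum X Y\<^esub> v = (fst u \<oplus>\<^bsub>X\<^esub> fst v, snd u \<oplus>\<^bsub>Y\<^esub> snd v)"
    "a \<odot>\<^bsub>mod_dsum X Y\<^esub> u = (a \<odot>\<^bsub>X\<^esub> fst u, a \<odot>\<^bsub>Y\<^esub> snd u)"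
  by (simp_all add: mod_dsum_def case_prod_unfold)

lemma dsum_module:
  assumes "left_module A X" "left_module A Y"
  shows "left_module A (mod_dsum X Y)"
proof -
  interpret X: left_module A X by fact
  interpret Y: left_module A Y by fact
  have "abelian_group (mod_dsum X Y)"
  proof (rule abelian_groupI)
    fix u assume u: "u \<in> carrier (mod_dsum X Y)"
    then show "\<exists>v\<in>carrier (mod_dsum X Y). v \<oplus>\<^bsub>mod_dsum X Y\<^esub> u = \<zero>\<^bsub>mod_dsum X Y\<^esub>"
      by (intro bexI[of _ "(\<ominus>\<^bsub>X\<^esub> fst u, \<ominus>\<^bsub>Y\<^esub> snd u)"]) (auto simp: X.l_neg Y.l_neg)
  qed (auto simp: X.a_ac Y.a_ac)
  then interpret D: abelian_group "mod_dsum X Y" .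
  show ?thesis
    by unfold_locales (auto simp: X.smult_l_distr X.smult_r_distr X.smult_assoc1
      Y.smult_l_distr Y.smult_r_distr Y.smult_assoc1)
qed

lemma dsum_fin_gen:
  assumes X: "left_module A X" "fin_gen A X" and Y: "left_module A Y" "fin_gen A Y"
  shows "fin_gen A (mod_dsum X Y)"
proof -
  interpret X: left_module A X by fact
  interpret Y: left_module A Y by fact
  note D = dsum_module[OF X(1) Y(1)]
  obtain S where S: "finite S" "S \<subseteq> carrier X" "\<And>N. subm A X N \<Longrightarrow> S \<subseteq> N \<Longrightarrow> N = carrier X"
    using X(2) unfolding fin_gen_iff[OF X(1)] by blast
  obtain T where T: "finite T" "T \<subseteq> carrier Y" "\<And>N. subm A Y N \<Longrightarrow> T \<subseteq> N \<Longrightarrow> N = carrier Y"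
    using Y(2) unfolding fin_gen_iff[OF Y(1)] by blast
  show ?thesis unfolding fin_gen_iff[OF D]
  proof (intro exI[of _ "S \<times> {\<zero>\<^bsub>Y\<^esub>} \<union> {\<zero>\<^bsub>X\<^esub>} \<times> T"] conjI allI impI)
    show "finite (S \<times> {\<zero>\<^bsub>Y\<^esub>} \<union> {\<zero>\<^bsub>X\<^esub>} \<times> T)" using S T by auto
    show "S \<times> {\<zero>\<^bsub>Y\<^esub>} \<union> {\<zero>\<^bsub>X\<^esub>} \<times> T \<subseteq> carrier (mod_dsum X Y)" using S T by auto
    fix N assume N: "subm A (mod_dsum X Y) N" "S \<times> {\<zero>\<^bsub>Y\<^esub>} \<union> {\<zero>\<^bsub>X\<^esub>} \<times> T \<subseteq> N"
    note N' = submD[OF N(1)]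
    have 1: "{x \<in> carrier X. (x, \<zero>\<^bsub>Y\<^esub>) \<in> N} = carrier X"
    proof (intro S(3) submI)
      show "\<zero>\<^bsub>X\<^esub> \<in> {x \<in> carrier X. (x, \<zero>\<^bsub>Y\<^esub>) \<in> N}" using N'(2) by auto
      show "x \<oplus>\<^bsub>X\<^esub> y \<in> {x \<in> carrier X. (x, \<zero>\<^bsub>Y\<^esub>) \<in> N}"
        if "x \<in> {x \<in> carrier X. (x, \<zero>\<^bsub>Y\<^esub>) \<in> N}" "y \<in> {x \<in> carrier X. (x, \<zero>\<^bsub>Y\<^esub>) \<in> N}" for x y
        using that N'(3)[of "(x, \<zero>\<^bsub>Y\<^esub>)" "(y, \<zero>\<^bsub>Y\<^esub>)"] by auto
      show "a \<odot>\<^bsub>X\<^esub> x \<in> {x \<in> carrier X. (x, \<zero>\<^bsub>Y\<^esub>) \<in> N}"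
        if "a \<in> carrier A" "x \<in> {x \<in> carrier X. (x, \<zero>\<^bsub>Y\<^esub>) \<in> N}" for a x
        using that N'(4)[of a "(x, \<zero>\<^bsub>Y\<^esub>)"] by (auto simp: Y.smult_r_null)
    qed (use N S in auto)
    have 2: "{y \<in> carrier Y. (\<zero>\<^bsub>X\<^esub>, y) \<in> N} = carrier Y"
    proof (intro T(3) submI)
      show "\<zero>\<^bsub>Y\<^esub> \<in> {y \<in> carrier Y. (\<zero>\<^bsub>X\<^esub>, y) \<in> N}" using N'(2) by auto
      show "x \<oplus>\<^bsub>Y\<^esub> y \<in> {y \<in> carrier Y. (\<zero>\<^bsub>X\<^esub>, y) \<in> N}"
        if "x \<in> {y \<in> carrier Y. (\<zero>\<^bsub>X\<^esub>, y) \<in> N}" "y \<in> {y \<in> carrier Y. (\<zero>\<^bsub>X\<^esub>, y) \<in> N}" for x y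
        using that N'(3)[of "(\<zero>\<^bsub>X\<^esub>, x)" "(\<zero>\<^bsub>X\<^esub>, y)"] by auto
      show "a \<odot>\<^bsub>Y\<^esub> x \<in> {y \<in> carrier Y. (\<zero>\<^bsub>X\<^esub>, y) \<in> N}"
        if "a \<in> carrier A" "x \<in> {y \<in> carrier Y. (\<zero>\<^bsub>X\<^esub>, y) \<in> N}" for a x
        using that N'(4)[of a "(\<zero>\<^bsub>X\<^esub>, x)"] by (auto simp: X.smult_r_null)
    qed (use N T in auto)
    have "(x, y) \<in> N" if xy: "x \<in> carrier X" "y \<in> carrier Y" for x y
    proof -
      have "(x, \<zero>\<^bsub>Y\<^esub>) \<in> N" "(\<zero>\<^bsub>X\<^esub>, y) \<in> N" using 1 2 xy by blast+
      from N'(3)[OF this] show ?thesis using xy by simp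
    qed
    then show "N = carrier (mod_dsum X Y)" using N'(1) by auto
  qed
qed

lemma iso_of_biprod:
  assumes D: "left_module A D" and X: "left_module A X" and Y: "left_module A Y" and b: "biprod A D X Y i j p q"
  shows "mod_isomorphic A D (mod_dsum X Y)"
proof -
  interpret D: left_module A D by fact
  interpret X: left_module A X by fact
  interpret Y: left_module A Y by fact
  note b = biprodD[OF b]
  note [simp] = hom_closed[OF b(1)] hom_closed[OF b(2)] hom_closed[OF b(3)] hom_closed[OF b(4)]
  let ?f = "\<lambda>d\<in>carrier D. (p d, q d)"
  have "?f \<in> mod_hom A D (mod_dsum X Y)"
    by (rule mod_hom_restrictI[OF D]) (auto simp: hom_add[OF b(3)] hom_add[OF b(4)] hom_smult[OF b(3)] hom_smult[OF b(4)])
  moreover have "bij_betw ?f (carrier D) (carrier (mod_dsum X Y))"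
  proof (rule bij_betw_byWitness[where f' = "\<lambda>u. i (fst u) \<oplus>\<^bsub>D\<^esub> j (snd u)"])
    show "\<forall>u\<in>carrier (mod_dsum X Y). ?f (i (fst u) \<oplus>\<^bsub>D\<^esub> j (snd u)) = u"
      using b(5-8) by (auto simp: hom_add[OF b(3)] hom_add[OF b(4)])
  qed (use b(9) in auto)
  ultimately show ?thesis unfolding mod_isomorphic_def by blast
qed

lemma biprod_of_iso:
  assumes D: "left_module A D" and X: "left_module A X" and Y: "left_module A Y"
    and iso: "mod_isomorphic A D (mod_dsum X Y)"
  obtains i j p q where "biprod A D X Y i j p q"
proof -
  interpret D: left_module A D by fact
  interpret X: left_module A X by fact
  interpret Y: left_module A Y by fact
  obtain f where f: "f \<in> mod_hom A D (mod_dsum X Y)" "inj_on f (carrier D)" "f ` carrier D = carrier X \<times> carrier Y"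
    using iso unfolding mod_isomorphic_def bij_betw_def by auto
  note fc = hom_closed[OF f(1)] and fa = hom_add[OF f(1)] and fs = hom_smult[OF f(1)]
  define g where "g = inv_into (carrier D) f"
  have g: "g u \<in> carrier D" "f (g u) = u" if "u \<in> carrier X \<times> carrier Y" for u
    using that f(3) by (auto simp: g_def inv_into_into f_inv_into_f)
  have gI: "g u = d" if "u \<in> carrier X \<times> carrier Y" "d \<in> carrier D" "f d = u" for u d
    using g[OF that(1)] that inj_onD[OF f(2)] by auto
  have ga: "g (u \<oplus>\<^bsub>mod_dsum X Y\<^esub> v) = g u \<oplus>\<^bsub>D\<^esub> g v" if "u \<in> carrier X \<times> carrier Y" "v \<in> carrier X \<times> carrier Y" for u v
    using that g[OF that(1)] g[OF that(2)] by (intro gI) (auto simp: fa)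
  have gs: "g (a \<odot>\<^bsub>mod_dsum X Y\<^esub> u) = a \<odot>\<^bsub>D\<^esub> g u" if "u \<in> carrier X \<times> carrier Y" "a \<in> carrier A" for u a
    using that g[OF that(1)] by (intro gI) (auto simp: fs)
  have "biprod A D X Y (\<lambda>x\<in>carrier X. g (x, \<zero>\<^bsub>Y\<^esub>)) (\<lambda>y\<in>carrier Y. g (\<zero>\<^bsub>X\<^esub>, y))
    (\<lambda>d\<in>carrier D. fst (f d)) (\<lambda>d\<in>carrier D. snd (f d))"
    unfolding biprod_def
  proof (intro conjI mod_hom_restrictI ballI X Y D)
    show "g (x \<oplus>\<^bsub>X\<^esub> y, \<zero>\<^bsub>Y\<^esub>) = g (x, \<zero>\<^bsub>Y\<^esub>) \<oplus>\<^bsub>D\<^esub> g (y, \<zero>\<^bsub>Y\<^esub>)" if "x \<in> carrier X" "y \<in> carrier X" for x y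
      using that ga[of "(x, \<zero>\<^bsub>Y\<^esub>)" "(y, \<zero>\<^bsub>Y\<^esub>)"] by simp
    show "g (\<zero>\<^bsub>X\<^esub>, x \<oplus>\<^bsub>Y\<^esub> y) = g (\<zero>\<^bsub>X\<^esub>, x) \<oplus>\<^bsub>D\<^esub> g (\<zero>\<^bsub>X\<^esub>, y)" if "x \<in> carrier Y" "y \<in> carrier Y" for x y
      using that ga[of "(\<zero>\<^bsub>X\<^esub>, x)" "(\<zero>\<^bsub>X\<^esub>, y)"] by simp
    show "g (a \<odot>\<^bsub>X\<^esub> x, \<zero>\<^bsub>Y\<^esub>) = a \<odot>\<^bsub>D\<^esub> g (x, \<zero>\<^bsub>Y\<^esub>)" if "a \<in> carrier A" "x \<in> carrier X" for a x
      using that gs[of "(x, \<zero>\<^bsub>Y\<^esub>)" a] by (simp add: Y.smult_r_null)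
    show "g (\<zero>\<^bsub>X\<^esub>, a \<odot>\<^bsub>Y\<^esub> y) = a \<odot>\<^bsub>D\<^esub> g (\<zero>\<^bsub>X\<^esub>, y)" if "a \<in> carrier A" "y \<in> carrier Y" for a y
      using that gs[of "(\<zero>\<^bsub>X\<^esub>, y)" a] by (simp add: X.smult_r_null)
    fix d assume d: "d \<in> carrier D"
    have "g (fst (f d), \<zero>\<^bsub>Y\<^esub>) \<oplus>\<^bsub>D\<^esub> g (\<zero>\<^bsub>X\<^esub>, snd (f d)) = g ((fst (f d), \<zero>\<^bsub>Y\<^esub>) \<oplus>\<^bsub>mod_dsum X Y\<^esub> (\<zero>\<^bsub>X\<^esub>, snd (f d)))"
      using fc[OF d] by (intro ga[symmetric]) auto
    also have "\<dots> = d" using fc[OF d] d by (intro gI) auto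
    finally show "(\<lambda>x\<in>carrier X. g (x, \<zero>\<^bsub>Y\<^esub>)) ((\<lambda>d\<in>carrier D. fst (f d)) d) \<oplus>\<^bsub>D\<^esub>
       (\<lambda>y\<in>carrier Y. g (\<zero>\<^bsub>X\<^esub>, y)) ((\<lambda>d\<in>carrier D. snd (f d)) d) = d"
      using d fc[OF d] by auto
  qed (use g fc in \<open>auto simp: fa fs mem_Times_iff\<close>)
  then show thesis by (rule that)
qed

lemma mod_isomorphic_inverse:
  assumes X: "left_module A X" and Y: "left_module A Y" and f: "f \<in> mod_hom A X Y" "inj_on f (carrier X)" "f ` carrier X = carrier Y"
  obtains g where "g \<in> mod_hom A Y X" "\<And>y. y \<in> carrier Y \<Longrightarrow> f (g y) = y" "\<And>x. x \<in> carrier X \<Longrightarrow> g (f x) = x"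
proof -
  obtain g where g: "g \<in> mod_hom A Y X" "\<And>y. y \<in> carrier Y \<Longrightarrow> f (g y) = y"
  proof (rule hom_choice[OF Y _ _ X, of "\<lambda>y x. f x = y"])
    show "\<exists>x\<in>carrier X. f x = y" if "y \<in> carrier Y" for y using f(3) that by (metis imageE)
    show "x = x'" if "x \<in> carrier X" "x' \<in> carrier X" "f x = y" "f x' = y" for y x x'
      using inj_onD[OF f(2)] that by simp
  qed (auto simp: hom_add[OF f(1)] hom_smult[OF f(1)])
  moreover have "g (f x) = x" if "x \<in> carrier X" for x
    using inj_onD[OF f(2)] g that hom_closed[OF f(1)] hom_closed[OF g(1)] by blast
  ultimately show thesis using that by blast
qed

lemma biprod_exists:
  assumes X: "X \<in> fg_modules A" and Y: "Y \<in> fg_modules A"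
  obtains D i j p q where "D \<in> fg_modules A" "biprod A D X Y i j p q"
proof -
  note X' = fgD[OF X] and Y' = fgD[OF Y]
  note D = dsum_module[OF X'(1) Y'(1)]
  obtain Z f where Z: "Z \<in> fg_modules A" "f \<in> mod_hom A (mod_dsum X Y) Z"
    "inj_on f (carrier (mod_dsum X Y))" "f ` carrier (mod_dsum X Y) = carrier Z"
    using representative[OF D dsum_fin_gen[OF X' Y']] by blast
  obtain g where g: "g \<in> mod_hom A Z (mod_dsum X Y)" "\<And>y. y \<in> carrier Z \<Longrightarrow> f (g y) = y"
     "\<And>x. x \<in> carrier (mod_dsum X Y) \<Longrightarrow> g (f x) = x"
    using mod_isomorphic_inverse[OF D fgD(1)[OF Z(1)] Z(2-4)] by blast
  have "bij_betw g (carrier Z) (carrier (mod_dsum X Y))"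
  proof (rule bij_betw_byWitness[where f' = f])
    show "g ` carrier Z \<subseteq> carrier (mod_dsum X Y)" using hom_closed[OF g(1)] by blast
    show "f ` carrier (mod_dsum X Y) \<subseteq> carrier Z" using hom_closed[OF Z(2)] by blast
  qed (use g in blast)+
  then have "mod_isomorphic A Z (mod_dsum X Y)" using g(1) unfolding mod_isomorphic_def by blast
  then show thesis using biprod_of_iso[OF fgD(1)[OF Z(1)] X'(1) Y'(1)] that[OF Z(1)] by blast
qed

text \<open>A surjection is a cokernel of its kernel: two elements of a fibre of \<open>c\<close>
  differ by an element of the kernel, so \<open>f\<close> is constant on fibres.\<close>

lemma hom_factor_surj:
  assumes X: "left_module A X" and C: "left_module A C" and Y: "left_module A Y"
    and c: "c \<in> mod_hom A X C" "c ` carrier X = carrier C" and f: "f \<in> mod_hom A X Y"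
    and ker: "\<And>x. x \<in> carrier X \<Longrightarrow> c x = \<zero>\<^bsub>C\<^esub> \<Longrightarrow> f x = \<zero>\<^bsub>Y\<^esub>"
  obtains g where "g \<in> mod_hom A C Y" "\<And>x. x \<in> carrier X \<Longrightarrow> g (c x) = f x"
proof -
  interpret X: left_module A X by fact
  interpret C: left_module A C by fact
  interpret Y: left_module A Y by fact
  note fc = hom_closed[OF f] and cc = hom_closed[OF c(1)]
  have eq: "f x = f x'" if "x \<in> carrier X" "x' \<in> carrier X" "c x = c x'" for x x'
  proof -
    have "c (x \<ominus>\<^bsub>X\<^esub> x') = \<zero>\<^bsub>C\<^esub>"
      using that cc by (simp add: hom_diff[OF X C c(1)] C.M.diff_eq_zero_iff)
    then have "f (x \<ominus>\<^bsub>X\<^esub> x') = \<zero>\<^bsub>Y\<^esub>" using that by (intro ker) simp_all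
    then show ?thesis using that fc by (simp add: hom_diff[OF X Y f] Y.M.diff_eq_zero_iff)
  qed
  obtain g where g: "g \<in> mod_hom A C Y" "\<And>u. u \<in> carrier C \<Longrightarrow> \<exists>x\<in>carrier X. c x = u \<and> f x = g u"
  proof (rule hom_choice[OF C _ _ Y, of "\<lambda>u y. \<exists>x\<in>carrier X. c x = u \<and> f x = y"])
    show "\<exists>y\<in>carrier Y. \<exists>x\<in>carrier X. c x = u \<and> f x = y" if "u \<in> carrier C" for u
    proof -
      obtain x where "x \<in> carrier X" "c x = u" using \<open>u \<in> carrier C\<close> c(2) by (metis imageE)
      then show ?thesis using fc by blast
    qed
    show "y = y'" if "\<exists>x\<in>carrier X. c x = u \<and> f x = y" "\<exists>x\<in>carrier X. c x = u \<and> f x = y'" for u y y'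
      using that eq by metis
    show "\<exists>x\<in>carrier X. c x = u \<oplus>\<^bsub>C\<^esub> u' \<and> f x = y \<oplus>\<^bsub>Y\<^esub> y'"
      if 1: "\<exists>x\<in>carrier X. c x = u \<and> f x = y" and 2: "\<exists>x\<in>carrier X. c x = u' \<and> f x = y'" for u u' y y'
    proof -
      obtain x where "x \<in> carrier X" "c x = u" "f x = y" using 1 by blast
      moreover obtain x' where "x' \<in> carrier X" "c x' = u'" "f x' = y'" using 2 by blast
      ultimately show ?thesis by (intro bexI[of _ "x \<oplus>\<^bsub>X\<^esub> x'"]) (simp_all add: hom_add[OF c(1)] hom_add[OF f])
    qed
    show "\<exists>x\<in>carrier X. c x = a \<odot>\<^bsub>C\<^esub> u \<and> f x = a \<odot>\<^bsub>Y\<^esub> y"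
      if a: "a \<in> carrier A" and 1: "\<exists>x\<in>carrier X. c x = u \<and> f x = y" for a u y
    proof -
      obtain x where "x \<in> carrier X" "c x = u" "f x = y" using 1 by blast
      then show ?thesis using a
        by (intro bexI[of _ "a \<odot>\<^bsub>X\<^esub> x"]) (simp_all add: hom_smult[OF c(1)] hom_smult[OF f])
    qed
  qed (rule that)
  have "g (c x) = f x" if x: "x \<in> carrier X" for x
    using g(2)[OF cc[OF x]] eq x by metis
  then show thesis by (rule that[OF g(1)])
qed

lemma hom_factor_inj:
  assumes W: "left_module A W" and X: "left_module A X"
    and j: "j \<in> mod_hom A X Y" "inj_on j (carrier X)" and f: "f \<in> mod_hom A W Y"
    and im: "\<And>w. w \<in> carrier W \<Longrightarrow> f w \<in> j ` carrier X"
  obtains g where "g \<in> mod_hom A W X" "\<And>w. w \<in> carrier W \<Longrightarrow> j (g w) = f w"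
proof (rule hom_choice[OF W _ _ X, of "\<lambda>w x. j x = f w"])
  show "\<exists>x\<in>carrier X. j x = f w" if "w \<in> carrier W" for w
    using im[OF that] by (metis imageE)
  show "x = x'" if "x \<in> carrier X" "x' \<in> carrier X" "j x = f w" "j x' = f w" for w x x'
    using inj_onD[OF j(2)] that by simp
qed (auto simp: hom_add[OF j(1)] hom_smult[OF j(1)] hom_add[OF f] hom_smult[OF f])

text \<open>An elementwise form of the universal property: compatible pairs come from
  \<open>E\<close>, and an element of \<open>E\<close> is determined by its two components. The
  common target enters only through the equation \<open>f x = g y\<close>.\<close>

definition is_pullback :: "('a, 'ax) ring_scheme \<Rightarrow> ('a, 'e, 'ex) module_scheme \<Rightarrow> ('a, 'm, 'mx) module_scheme \<Rightarrow>
    ('a, 'n, 'nx) module_scheme \<Rightarrow> ('e \<Rightarrow> 'm) \<Rightarrow> ('e \<Rightarrow> 'n) \<Rightarrow> ('m \<Rightarrow> 'z) \<Rightarrow> ('n \<Rightarrow> 'z) \<Rightarrow> bool" where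
  "is_pullback A E X Y p q f g \<longleftrightarrow> p \<in> mod_hom A E X \<and> q \<in> mod_hom A E Y \<and>
     (\<forall>u\<in>carrier E. f (p u) = g (q u)) \<and>
     (\<forall>x\<in>carrier X. \<forall>y\<in>carrier Y. f x = g y \<longrightarrow> (\<exists>u\<in>carrier E. p u = x \<and> q u = y)) \<and>
     (\<forall>u\<in>carrier E. \<forall>v\<in>carrier E. p u = p v \<longrightarrow> q u = q v \<longrightarrow> u = v)"

lemma pullbackD:
  assumes "is_pullback A E X Y p q f g"
  shows "p \<in> mod_hom A E X" "q \<in> mod_hom A E Y" "\<And>u. u \<in> carrier E \<Longrightarrow> f (p u) = g (q u)"
    "\<And>x y. x \<in> carrier X \<Longrightarrow> y \<in> carrier Y \<Longrightarrow> f x = g y \<Longrightarrow> \<exists>u\<in>carrier E. p u = x \<and> q u = y"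
    "\<And>u v. u \<in> carrier E \<Longrightarrow> v \<in> carrier E \<Longrightarrow> p u = p v \<Longrightarrow> q u = q v \<Longrightarrow> u = v"
  using assms by (simp_all add: is_pullback_def)

lemma pullback_lift:
  assumes pb: "is_pullback A E X Y p q f g" and E: "left_module A E" and W: "left_module A W"
    and v: "v \<in> mod_hom A W X" and w: "w \<in> mod_hom A W Y" and eq: "\<And>x. x \<in> carrier W \<Longrightarrow> f (v x) = g (w x)"
  obtains h where "h \<in> mod_hom A W E" "\<And>x. x \<in> carrier W \<Longrightarrow> p (h x) = v x" "\<And>x. x \<in> carrier W \<Longrightarrow> q (h x) = w x"
proof -
  note pb = pullbackD[OF pb]
  obtain h where h: "h \<in> mod_hom A W E" "\<And>x. x \<in> carrier W \<Longrightarrow> p (h x) = v x \<and> q (h x) = w x"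
  proof (rule hom_choice[OF W _ _ E, of "\<lambda>x u. p u = v x \<and> q u = w x"])
    show "\<exists>u\<in>carrier E. p u = v x \<and> q u = w x" if "x \<in> carrier W" for x
      using pb(4)[OF hom_closed[OF v that] hom_closed[OF w that] eq[OF that]] .
    show "u = u'" if "u \<in> carrier E" "u' \<in> carrier E" "p u = v x \<and> q u = w x" "p u' = v x \<and> q u' = w x" for x u u'
      using pb(5)[OF that(1,2)] that(3,4) by simp
  qed (simp_all add: hom_add[OF pb(1)] hom_add[OF pb(2)] hom_add[OF v] hom_add[OF w]
      hom_smult[OF pb(1)] hom_smult[OF pb(2)] hom_smult[OF v] hom_smult[OF w])
  then show thesis by (intro that[of h]) simp_all
qed

text \<open>The submodule of a biproduct on which the two maps to \<open>Z\<close> agree. Its finite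
  generation is where the Artin algebra enters.\<close>

lemma pullback_exists:
  assumes AA: "artin_algebra k A" and X: "X \<in> fg_modules A" and Y: "Y \<in> fg_modules A" and Z: "Z \<in> fg_modules A"
    and f: "f \<in> mod_hom A X Z" and g: "g \<in> mod_hom A Y Z"
  obtains E p q where "E \<in> fg_modules A" "is_pullback A E X Y p q f g"
proof -
  obtain D i j p q where D: "D \<in> fg_modules A" and b: "biprod A D X Y i j p q"
    by (rule biprod_exists[OF X Y]) (rule that)
  note b = biprodD[OF b]
  note D' = fgD(1)[OF D] and X' = fgD(1)[OF X] and Y' = fgD(1)[OF Y] and Z' = fgD(1)[OF Z]
  interpret D: left_module A D by fact
  interpret X: left_module A X by fact
  interpret Y: left_module A Y by fact
  interpret Z: left_module A Z by fact
  note cl [simp] = hom_closed[OF b(1)] hom_closed[OF b(2)] hom_closed[OF b(3)] hom_closed[OF b(4)]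
    hom_closed[OF f] hom_closed[OF g]
  have "subm A D {d \<in> carrier D. f (p d) = g (q d)}"
    by (intro submI) (auto simp: hom_zero[OF D' X' b(3)] hom_zero[OF D' Y' b(4)] hom_zero[OF X' Z' f] hom_zero[OF Y' Z' g]
        hom_add[OF b(3)] hom_add[OF b(4)] hom_add[OF f] hom_add[OF g]
        hom_smult[OF b(3)] hom_smult[OF b(4)] hom_smult[OF f] hom_smult[OF g])
  then obtain E e where E: "E \<in> fg_modules A" "e \<in> mod_hom A E D" "inj_on e (carrier E)"
    "e ` carrier E = {d \<in> carrier D. f (p d) = g (q d)}"
    by (rule subobject[OF AA D]) (rule that)
  note E' = fgD(1)[OF E(1)] and ec = hom_closed[OF E(2)]
  have "is_pullback A E X Y (compose (carrier E) p e) (compose (carrier E) q e) f g"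
    unfolding is_pullback_def
  proof (intro conjI ballI impI)
    show "compose (carrier E) p e \<in> mod_hom A E X" "compose (carrier E) q e \<in> mod_hom A E Y"
      by (rule hom_comp[OF E' E(2) b(3)], rule hom_comp[OF E' E(2) b(4)])
    show "f (compose (carrier E) p e u) = g (compose (carrier E) q e u)" if "u \<in> carrier E" for u
    proof -
      have "e u \<in> e ` carrier E" using that by blast
      then show ?thesis using that unfolding E(4) by (simp add: compose_eq)
    qed
    show "\<exists>u\<in>carrier E. compose (carrier E) p e u = x \<and> compose (carrier E) q e u = y"
      if xy: "x \<in> carrier X" "y \<in> carrier Y" "f x = g y" for x y
    proof -
      have pq: "p (i x \<oplus>\<^bsub>D\<^esub> j y) = x" "q (i x \<oplus>\<^bsub>D\<^esub> j y) = y"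
        using xy by (simp_all add: hom_add[OF b(3)] hom_add[OF b(4)] b(5-8))
      then have "i x \<oplus>\<^bsub>D\<^esub> j y \<in> e ` carrier E" unfolding E(4) using xy by simp
      then obtain u where "u \<in> carrier E" "e u = i x \<oplus>\<^bsub>D\<^esub> j y" by (metis imageE)
      then show ?thesis using pq by (intro bexI[of _ u]) (simp_all add: compose_eq)
    qed
    show "u = v" if uv: "u \<in> carrier E" "v \<in> carrier E" "compose (carrier E) p e u = compose (carrier E) p e v"
      "compose (carrier E) q e u = compose (carrier E) q e v" for u v
    proof -
      have "p (e u) = p (e v)" "q (e u) = q (e v)" using uv by (simp_all add: compose_eq)
      then have "i (p (e u)) \<oplus>\<^bsub>D\<^esub> j (q (e u)) = i (p (e v)) \<oplus>\<^bsub>D\<^esub> j (q (e v))" by (simp only:)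
      then have "e u = e v" unfolding b(9)[OF ec[OF uv(1)]] b(9)[OF ec[OF uv(2)]] .
      then show ?thesis using inj_onD[OF E(3)] uv by blast
    qed
  qed
  then show thesis by (rule that[OF E(1)])
qed

section \<open>Relatively injective extensions\<close>

text \<open>The image of \<open>j\<close> meets every nonzero submodule of \<open>J\<close>
  nontrivially; the condition on \<open>y\<close> says this for the cyclic submodule generated by
  \<open>y\<close>, which is enough.\<close>

definition essential :: "('a, 'ax) ring_scheme \<Rightarrow> ('a, 'm, 'mx) module_scheme \<Rightarrow> ('a, 'n, 'nx) module_scheme \<Rightarrow>
    ('m \<Rightarrow> 'n) \<Rightarrow> bool" where
  "essential A T J j \<longleftrightarrow> j \<in> mod_hom A T J \<and> inj_on j (carrier T) \<and>
     (\<forall>y\<in>carrier J. y \<noteq> \<zero>\<^bsub>J\<^esub> \<longrightarrow> (\<exists>a\<in>carrier A. a \<odot>\<^bsub>J\<^esub> y \<in> j ` carrier T \<and> a \<odot>\<^bsub>J\<^esub> y \<noteq> \<zero>\<^bsub>J\<^esub>))"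

text \<open>The image of \<open>k\<close> in \<open>A\<close> is central, so left multiplication by
  any \<open>a\<close> commutes with it. This is what makes ranks over \<open>k\<close> additive
  along multiplication by \<open>a\<close>.\<close>

lemma hom_scalar:
  assumes AA: "artin_algebra k A" and M: "left_module A M" and a: "a \<in> carrier A"
  shows "(\<lambda>x\<in>carrier M. a \<odot>\<^bsub>M\<^esub> x) \<in> mod_hom k (restr A M) (restr A M)"
proof -
  interpret artin_algebra k A by fact
  interpret M: left_module A M by fact
  have "a \<odot>\<^bsub>M\<^esub> ((c \<odot>\<^bsub>A\<^esub> \<one>\<^bsub>A\<^esub>) \<odot>\<^bsub>M\<^esub> x) = (c \<odot>\<^bsub>A\<^esub> \<one>\<^bsub>A\<^esub>) \<odot>\<^bsub>M\<^esub> (a \<odot>\<^bsub>M\<^esub> x)"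
    if "c \<in> carrier k" "x \<in> carrier M" for c x
    using that a by (simp add: smult_mult_left smult_mult_right flip: M.smult_assoc1)
  then have "restrict (\<lambda>x. a \<odot>\<^bsub>M\<^esub> x) (carrier (restr A M)) \<in> mod_hom k (restr A M) (restr A M)"
    using a by (intro mod_hom_restrictI restr_module[OF AA M]) (auto simp: M.smult_r_distr)
  then show ?thesis by simp
qed

text \<open>Put \<open>N\<^sub>L = {x \<in> J. L x = 0}\<close> for a left ideal \<open>L\<close>. If \<open>L' = L + A a\<close> is minimal over \<open>L\<close>, then
  multiplication by \<open>a\<close> embeds \<open>N\<^sub>L / N\<^sub>L'\<close> into \<open>T\<close>, because \<open>A a x\<close> is simple or zero.\<close>

lemma essential_rank_bound:
  fixes A :: "('k, 'a) module"
  assumes AA: "artin_algebra k A" and T: "T \<in> fg_modules A"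
  shows "\<exists>c. \<forall>J\<in>fg_modules A. \<forall>j. essential A T J j \<longrightarrow> ranked k (restr A J) (carrier J) c"
proof -
  interpret artin_algebra k A by fact
  note T' = fgD[OF T]
  have rA: "left_module A (reg A)" by (rule reg_module[OF artin_algebraD(1)[OF AA]])
  note mc = monoid.m_closed[OF ring.is_monoid[OF artin_algebraD(1)[OF AA]]]
  obtain t where t: "ranked k (restr A T) (carrier T) t" using rank_module[OF AA T'] by blast
  obtain n where "ranked k (restr A (reg A)) (carrier A) n" using rank_algebra[OF AA] by blast
  then obtain r where r: "\<And>U. subm k (restr A (reg A)) U \<Longrightarrow> r U \<le> n"
    "\<And>U V. subm k (restr A (reg A)) U \<Longrightarrow> subm k (restr A (reg A)) V \<Longrightarrow> U \<subseteq> V \<Longrightarrow> r U \<le> r V"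
    "\<And>U V. subm k (restr A (reg A)) U \<Longrightarrow> subm k (restr A (reg A)) V \<Longrightarrow> U \<subseteq> V \<Longrightarrow> r U = r V \<Longrightarrow> V \<inter> carrier A \<subseteq> U"
    by (elim rankedE) blast
  note sr = subm_restr[OF AA, of "reg A"]
  define N where "N J L = {x \<in> carrier J. \<forall>l\<in>L. l \<odot>\<^bsub>J\<^esub> x = \<zero>\<^bsub>J\<^esub>}" for J :: "'a amod" and L
  have "\<exists>c. \<forall>J\<in>fg_modules A. \<forall>j. essential A T J j \<longrightarrow> ranked k (restr A J) (N J L) c"
    if "subm A (reg A) L" for L
    using that
  \<comment> \<open>A descent from \<open>L = A\<close>, where \<open>\<one>\<close> kills the whole
    of \<open>N J L\<close>, to smaller left ideals: a larger ideal has a larger rank and a smaller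
    value of \<open>n - r L\<close>.\<close>
  proof (induction "n - r L" arbitrary: L rule: less_induct)
    case less
    note L = less.prems and L' = submD[OF less.prems, simplified]
    show ?case
    proof (cases "L = carrier A")
      case True
      have "N J L \<subseteq> {\<zero>\<^bsub>restr A J\<^esub>}" if "J \<in> fg_modules A" for J
      proof
        interpret J: left_module A J by (rule fgD(1)[OF that])
        fix x assume x: "x \<in> N J L"
        then have "\<one>\<^bsub>A\<^esub> \<odot>\<^bsub>J\<^esub> x = \<zero>\<^bsub>J\<^esub>" using True by (simp add: N_def)
        then show "x \<in> {\<zero>\<^bsub>restr A J\<^esub>}" using x by (simp add: N_def)
      qed
      then have "ranked k (restr A J) (N J L) 0" if "J \<in> fg_modules A" for J
        using that by (intro ranked_subset[OF ranked_zero])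
      then show ?thesis by blast
    next
      case False
      let ?P = "\<lambda>L'. subm A (reg A) L' \<and> L \<subset> L'"
      have "?P (carrier A)" using False L'(1) subm_carrier[OF rA] by auto
      then obtain M where M: "?P M" and min: "\<And>M'. ?P M' \<Longrightarrow> r M \<le> r M'"
        using ex_has_least_nat[of ?P "carrier A" r] by blast
      have MS: "subm A (reg A) M" and LM: "L \<subset> M" using M by auto
      note M' = submD[OF MS, simplified]
      \<comment> \<open>\<open>M\<close> has least rank among the left ideals strictly above
        \<open>L\<close>. The ideal \<open>L + A a\<close> is one of them and lies inside
        \<open>M\<close>, so the ranks agree and it equals \<open>M\<close>.\<close>
      have gen: "\<exists>l\<in>L. \<exists>c\<in>carrier A. m = l \<oplus>\<^bsub>A\<^esub> c \<otimes>\<^bsub>A\<^esub> a" if a: "a \<in> M" "a \<notin> L" and m: "m \<in> M" for a m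
      proof -
        let ?O = "(\<lambda>c\<in>carrier A. c \<odot>\<^bsub>reg A\<^esub> a) ` carrier A"
        have ac: "a \<in> carrier (reg A)" using a M'(5) by simp
        have O: "subm A (reg A) ?O"
          using subm_image[OF rA rA hom_orbit[OF rA ac] subm_carrier[OF rA]] by simp
        let ?S = "{x \<oplus>\<^bsub>reg A\<^esub> y | x y. x \<in> L \<and> y \<in> ?O}"
        note S = sum_subm[OF rA L O]
        have "a \<in> ?O" using ac by (auto intro!: image_eqI[of _ _ "\<one>\<^bsub>A\<^esub>"])
        then have aS: "a \<in> ?S" by (rule subsetD[OF S(3)])
        have "L \<noteq> ?S"
        proof
          assume eq: "L = ?S"
          show False using a(2) aS unfolding eq[symmetric] by (rule notE)
        qed
        then have "L \<subset> ?S" by (rule psubsetI[OF S(2)])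
        then have le: "r M \<le> r ?S" by (intro min conjI S(1))
        have SM: "?S \<subseteq> M" using LM M'(3,4) a(1) by auto
        have "r ?S = r M" using le r(2)[OF sr[OF S(1)] sr[OF MS] SM] by simp
        from r(3)[OF sr[OF S(1)] sr[OF MS] SM this] have "m \<in> ?S" using m M'(5) by blast
        then show ?thesis by auto
      qed
      have "r L \<noteq> r M" using r(3)[OF sr[OF L] sr[OF MS]] LM M'(1) by blast
      then have "n - r M < n - r L" using r(1)[OF sr[OF MS]] r(2)[OF sr[OF L] sr[OF MS]] LM
        by (simp add: psubset_eq)
      then obtain c where c: "\<And>J j. J \<in> fg_modules A \<Longrightarrow> essential A T J j \<Longrightarrow> ranked k (restr A J) (N J M) c"
        using less.hyps[of M] MS by blast
      obtain a where a: "a \<in> M" "a \<notin> L" using LM by blast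
      have ac: "a \<in> carrier A" using a M'(5) by blast
      \<comment> \<open>Multiplication by \<open>a\<close> on \<open>N J L\<close> has its kernel in
        \<open>N J M\<close>, whose rank is bounded by \<open>c\<close> by induction, and its image
        inside the copy of \<open>T\<close>, of rank at most \<open>t\<close>. Neither constant
        depends on \<open>J\<close>.\<close>
      have "ranked k (restr A J) (N J L) (c + t)" if J: "J \<in> fg_modules A" and j: "essential A T J j" for J j
      proof -
        interpret J: left_module A J by (rule fgD(1)[OF J])
        note J' = fgD(1)[OF J]
        have jh: "j \<in> mod_hom A T J" and ess: "\<And>y. y \<in> carrier J \<Longrightarrow> y \<noteq> \<zero>\<^bsub>J\<^esub> \<Longrightarrow>
            \<exists>a\<in>carrier A. a \<odot>\<^bsub>J\<^esub> y \<in> j ` carrier T \<and> a \<odot>\<^bsub>J\<^esub> y \<noteq> \<zero>\<^bsub>J\<^esub>"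
          using j by (simp_all add: essential_def)
        have jT: "subm A J (j ` carrier T)"
          by (rule subm_image[OF T'(1) J' jh subm_carrier[OF T'(1)]])
        have smul0: "b \<odot>\<^bsub>J\<^esub> \<zero>\<^bsub>J\<^esub> = \<zero>\<^bsub>J\<^esub>" if "b \<in> carrier A" for b using J.smult_r_null[OF that] .
        have NL: "subm k (restr A J) (N J L)"
        proof (rule submI)
          fix b x assume b: "b \<in> carrier k" and x: "x \<in> N J L"
          have "l \<odot>\<^bsub>J\<^esub> ((b \<odot>\<^bsub>A\<^esub> \<one>\<^bsub>A\<^esub>) \<odot>\<^bsub>J\<^esub> x) = \<zero>\<^bsub>J\<^esub>" if l: "l \<in> L" for l
          proof -
            have lc: "l \<in> carrier A" using l L'(5) by blast
            have "l \<odot>\<^bsub>J\<^esub> ((b \<odot>\<^bsub>A\<^esub> \<one>\<^bsub>A\<^esub>) \<odot>\<^bsub>J\<^esub> x) = (b \<odot>\<^bsub>A\<^esub> \<one>\<^bsub>A\<^esub>) \<odot>\<^bsub>J\<^esub> (l \<odot>\<^bsub>J\<^esub> x)"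
              using x b lc by (simp add: N_def smult_mult_left smult_mult_right flip: J.smult_assoc1)
            then show ?thesis using x l b by (simp add: N_def smul0)
          qed
          then show "b \<odot>\<^bsub>restr A J\<^esub> x \<in> N J L" using x b by (simp add: N_def)
        next
          fix x y assume "x \<in> N J L" "y \<in> N J L"
          then show "x \<oplus>\<^bsub>restr A J\<^esub> y \<in> N J L" using L'(5) by (simp add: N_def J.smult_r_distr)
        qed (use L'(5) in \<open>auto simp: N_def smul0\<close>)
        let ?h = "\<lambda>x\<in>carrier J. a \<odot>\<^bsub>J\<^esub> x"
        have "{x \<in> N J L. ?h x = \<zero>\<^bsub>restr A J\<^esub>} \<subseteq> N J M"
        proof
          fix x assume "x \<in> {x \<in> N J L. ?h x = \<zero>\<^bsub>restr A J\<^esub>}"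
          then have x: "x \<in> carrier J" "\<And>l. l \<in> L \<Longrightarrow> l \<odot>\<^bsub>J\<^esub> x = \<zero>\<^bsub>J\<^esub>" "a \<odot>\<^bsub>J\<^esub> x = \<zero>\<^bsub>J\<^esub>"
            by (auto simp: N_def)
          have "m \<odot>\<^bsub>J\<^esub> x = \<zero>\<^bsub>J\<^esub>" if "m \<in> M" for m
          proof -
            obtain l c where lc: "l \<in> L" "c \<in> carrier A" "m = l \<oplus>\<^bsub>A\<^esub> c \<otimes>\<^bsub>A\<^esub> a" using gen[OF a \<open>m \<in> M\<close>] by blast
            then show ?thesis using x ac L'(5)[OF lc(1)] by (simp add: J.smult_l_distr J.smult_assoc1 smul0)
          qed
          then show "x \<in> N J M" using x(1) by (simp add: N_def)
        qed
        then have k1: "ranked k (restr A J) {x \<in> N J L. ?h x = \<zero>\<^bsub>restr A J\<^esub>} c"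
          by (rule ranked_subset[OF c[OF J j]])
        have "?h ` N J L \<subseteq> j ` carrier T"
        proof
          fix z assume "z \<in> ?h ` N J L"
          then obtain x where x: "x \<in> carrier J" "\<And>l. l \<in> L \<Longrightarrow> l \<odot>\<^bsub>J\<^esub> x = \<zero>\<^bsub>J\<^esub>" "z = a \<odot>\<^bsub>J\<^esub> x"
            by (auto simp: N_def)
          show "z \<in> j ` carrier T"
          proof (cases "z = \<zero>\<^bsub>J\<^esub>")
            case True
            then show ?thesis using submD(2)[OF jT] by simp
          next
            case False
            have zc: "z \<in> carrier J" using x ac by simp
            obtain b where b: "b \<in> carrier A" "b \<odot>\<^bsub>J\<^esub> z \<in> j ` carrier T" "b \<odot>\<^bsub>J\<^esub> z \<noteq> \<zero>\<^bsub>J\<^esub>"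
              using ess[OF zc False] by blast
            \<comment> \<open>The multiple \<open>b z\<close> is nonzero and lies in the image of
              \<open>T\<close>. As \<open>L\<close> kills \<open>x\<close>, this keeps
              \<open>b \<otimes> a\<close> out of \<open>L\<close>; so \<open>a = l + c b a\<close>
              for some \<open>l\<close> in \<open>L\<close>, and \<open>z = a x = c (b z)\<close>
              lies in the image as well.\<close>
            have bz: "b \<odot>\<^bsub>J\<^esub> z = (b \<otimes>\<^bsub>A\<^esub> a) \<odot>\<^bsub>J\<^esub> x" using x ac b(1) by (simp add: J.smult_assoc1)
            have "b \<otimes>\<^bsub>A\<^esub> a \<notin> L" using b(3) x(2) bz by auto
            moreover have "b \<otimes>\<^bsub>A\<^esub> a \<in> M" using M'(4) b(1) a(1) by blast
            ultimately obtain l c where lc: "l \<in> L" "c \<in> carrier A" "a = l \<oplus>\<^bsub>A\<^esub> c \<otimes>\<^bsub>A\<^esub> (b \<otimes>\<^bsub>A\<^esub> a)"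
              using gen a(1) by blast
            have "a \<odot>\<^bsub>J\<^esub> x = (l \<oplus>\<^bsub>A\<^esub> c \<otimes>\<^bsub>A\<^esub> (b \<otimes>\<^bsub>A\<^esub> a)) \<odot>\<^bsub>J\<^esub> x" using lc(3) by simp
            also have "\<dots> = l \<odot>\<^bsub>J\<^esub> x \<oplus>\<^bsub>J\<^esub> c \<odot>\<^bsub>J\<^esub> ((b \<otimes>\<^bsub>A\<^esub> a) \<odot>\<^bsub>J\<^esub> x)"
              using lc(1,2) L'(5) ac b(1) x(1) by (simp only: J.smult_l_distr J.smult_assoc1 mc)
            also have "\<dots> = c \<odot>\<^bsub>J\<^esub> (b \<odot>\<^bsub>J\<^esub> z)"
              unfolding x(2)[OF lc(1)] bz[symmetric] using lc(2) b(1) zc by simp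
            finally show ?thesis using x(3) submD(4)[OF jT lc(2) b(2)] by simp
          qed
        qed
        moreover have "ranked k (restr A J) (j ` carrier T) t"
          using ranked_image[OF restr_module[OF AA T'(1)] restr_module[OF AA J'] hom_restr[OF AA jh]] t by simp
        ultimately have k2: "ranked k (restr A J) (?h ` N J L) t" by (rule ranked_subset[rotated])
        show ?thesis
          by (rule ranked_kernel_image[OF restr_module[OF AA J'] restr_module[OF AA J'] hom_scalar[OF AA J' ac] NL k1 k2])
      qed
      then show ?thesis by blast
    qed
  qed
  \<comment> \<open>The zero ideal kills everything, so the bound for \<open>L = 0\<close> is a
    bound for the whole of \<open>J\<close>.\<close>
  then obtain c where c: "\<forall>J\<in>fg_modules A. \<forall>j. essential A T J j \<longrightarrow> ranked k (restr A J) (N J {\<zero>\<^bsub>A\<^esub>}) c"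
    using subm_zero[OF rA] by auto
  have "N J {\<zero>\<^bsub>A\<^esub>} = carrier J" if "J \<in> fg_modules A" for J
    using left_module.smult_l_null[OF fgD(1)[OF that]] by (auto simp: N_def)
  then show ?thesis using c by auto
qed

text \<open>The lengths of essential extensions of \<open>T\<close> are bounded, so one of them,
  \<open>I\<close>, has greatest length. If \<open>I\<close> embedded properly into a further
  essential extension \<open>J\<close>, then \<open>I\<close> would be strictly shorter than
  \<open>J\<close>.\<close>

lemma maximal_essential:
  fixes A :: "('k, 'a) module"
  assumes AA: "artin_algebra k A" and T: "T \<in> fg_modules A"
  obtains I e where "I \<in> fg_modules A" "essential A T I e"
    "\<And>J g. J \<in> fg_modules A \<Longrightarrow> g \<in> mod_hom A I J \<Longrightarrow> inj_on g (carrier I) \<Longrightarrow>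
      essential A T J (compose (carrier T) g e) \<Longrightarrow> g ` carrier I = carrier J"
proof -
  obtain c where c: "\<And>J j. J \<in> fg_modules A \<Longrightarrow> essential A T J j \<Longrightarrow> ranked k (restr A J) (carrier J) c"
    using essential_rank_bound[OF AA T] by blast
  \<comment> \<open>The least admissible bound of a rank function, standing in for composition
    length over \<open>k\<close>.\<close>
  define len where "len J = (LEAST n. ranked k (restr A J) (carrier J) n)" for J :: "'a amod"
  let ?P = "\<lambda>u. fst u \<in> fg_modules A \<and> essential A T (fst u) (snd u)"
  interpret T: left_module A T by (rule fgD(1)[OF T])
  have "essential A T T (\<lambda>x\<in>carrier T. x)"
    unfolding essential_def
  proof (intro conjI ballI impI bexI)
    show "\<one>\<^bsub>A\<^esub> \<odot>\<^bsub>T\<^esub> y \<in> (\<lambda>x\<in>carrier T. x) ` carrier T" if "y \<in> carrier T" for y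
      using that by auto
  qed (auto simp: inj_on_def hom_id[OF fgD(1)[OF T]])
  then have "?P (T, \<lambda>x\<in>carrier T. x)" using T by simp
  moreover have "\<forall>u. ?P u \<longrightarrow> len (fst u) < Suc c"
    using c Least_le unfolding len_def less_Suc_eq_le by blast
  ultimately have "\<exists>u. ?P u \<and> (\<forall>v. ?P v \<longrightarrow> len (fst v) \<le> len (fst u))"
    by (rule Lattices_Big.ex_has_greatest_nat[where f = "\<lambda>u. len (fst u)"])
  then obtain u where u: "?P u" and max: "\<forall>v. ?P v \<longrightarrow> len (fst v) \<le> len (fst u)" by (elim exE conjE) simp
  obtain I e where "u = (I, e)" by force
  with u have I: "I \<in> fg_modules A" and e: "essential A T I e" by auto
  have max: "len J \<le> len I" if "J \<in> fg_modules A" "essential A T J j" for J j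
    using max[rule_format, of "(J, j)"] that \<open>u = (I, e)\<close> by simp
  show thesis
  proof (rule that[OF I e], rule ccontr)
    fix J g assume J: "J \<in> fg_modules A" and g: "g \<in> mod_hom A I J" "inj_on g (carrier I)"
      and ess: "essential A T J (compose (carrier T) g e)" and neq: "g ` carrier I \<noteq> carrier J"
    note I' = fgD(1)[OF I] and J' = fgD(1)[OF J]
    note rI = restr_module[OF AA I'] and rJ = restr_module[OF AA J'] and rg = hom_restr[OF AA g(1)]
    have "ranked k (restr A J) (carrier J) (len J)" 
      unfolding len_def using c[OF J ess] by (rule LeastI)
    then obtain r where r: "\<And>U. subm k (restr A J) U \<Longrightarrow> r U \<le> len J"
      "\<And>U V. subm k (restr A J) U \<Longrightarrow> subm k (restr A J) V \<Longrightarrow> U \<subseteq> V \<Longrightarrow> r U \<le> r V"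
      "\<And>U V. subm k (restr A J) U \<Longrightarrow> subm k (restr A J) V \<Longrightarrow> U \<subseteq> V \<Longrightarrow> r U = r V \<Longrightarrow> V \<inter> carrier J \<subseteq> U"
      by (elim rankedE) blast
    note im = subm_image[OF rI rJ rg]
    have gI: "subm k (restr A J) (g ` carrier I)" using im subm_carrier[OF rI] by simp
    have cJ: "subm k (restr A J) (carrier J)" using subm_carrier[OF rJ] by simp
    have sub: "g ` carrier I \<subseteq> carrier J" using hom_closed[OF g(1)] by blast
    have "r (g ` carrier I) \<noteq> r (carrier J)" using r(3)[OF gI cJ sub] neq sub by blast
    then have lt: "r (g ` carrier I) < len J" using r(1)[OF cJ] r(2)[OF gI cJ sub] by simp
    \<comment> \<open>Restricting an optimal rank function of \<open>J\<close> to the images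
      \<open>g W\<close> gives one for \<open>I\<close>. Its values are at most
      \<open>r (g I)\<close>, which is strictly below \<open>len J\<close>, so the subtraction of
      one is genuine.\<close>
    have "ranked k (restr A I) (carrier I) (len J - 1)"
    proof (rule rankedI[where r = "\<lambda>W. r (g ` W)"])
      fix U assume U: "subm k (restr A I) U"
      have "g ` U \<subseteq> g ` carrier I" using submD(1)[OF U] by auto
      then have "r (g ` U) \<le> r (g ` carrier I)" by (intro r(2) im[OF U] gI)
      then show "r (g ` U) \<le> len J - 1" using lt by simp
    next
      fix U V assume UV: "subm k (restr A I) U" "subm k (restr A I) V" "U \<subseteq> V"
      then show "r (g ` U) \<le> r (g ` V)" by (intro r(2) im) auto
      assume "r (g ` U) = r (g ` V)"
      then have *: "g ` V \<inter> carrier J \<subseteq> g ` U" using UV by (intro r(3) im) auto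
      have U: "U \<subseteq> carrier I" and V: "V \<subseteq> carrier I" using UV(1,2) submD(1) by fastforce+
      show "V \<inter> carrier I \<subseteq> U"
      proof
        fix v assume "v \<in> V \<inter> carrier I"
        then have v: "v \<in> V" "v \<in> carrier I" by auto
        then have "g v \<in> g ` U" using * hom_closed[OF g(1) v(2)] by blast
        then obtain u where "u \<in> U" "g v = g u" by (rule imageE)
        then show "v \<in> U" using inj_onD[OF g(2), of v u] v U by auto
      qed
    qed
    then have "len I \<le> len J - 1" unfolding len_def by (rule Least_le)
    then show False using max[OF J ess] lt by simp
  qed
qed

text \<open>Divide \<open>Y\<close> by a submodule \<open>N\<close> as large as possible subject to
  meeting \<open>g I\<close> in zero. Then \<open>I\<close> still embeds into the quotient
  \<open>C\<close>, and \<open>C\<close> is essential over \<open>T\<close>; by maximality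
  \<open>I\<close> is isomorphic to \<open>C\<close>, and the quotient map followed by the inverse
  is a retraction.\<close>

lemma maximal_essential_split:
  assumes AA: "artin_algebra k A" and T: "T \<in> fg_modules A" and I: "I \<in> fg_modules A" and e: "essential A T I e"
    and max: "\<And>J g. J \<in> fg_modules A \<Longrightarrow> g \<in> mod_hom A I J \<Longrightarrow> inj_on g (carrier I) \<Longrightarrow>
      essential A T J (compose (carrier T) g e) \<Longrightarrow> g ` carrier I = carrier J"
    and Y: "Y \<in> fg_modules A" and g: "g \<in> mod_hom A I Y" "inj_on g (carrier I)"
  obtains h where "h \<in> mod_hom A Y I" "\<And>x. x \<in> carrier I \<Longrightarrow> h (g x) = x"
proof -
  note I' = fgD(1)[OF I] and Y' = fgD[OF Y] and T' = fgD(1)[OF T]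
  interpret I: left_module A I by (rule I')
  interpret Y: left_module A Y by (rule Y'(1))
  interpret T: left_module A T by (rule T')
  have eh: "e \<in> mod_hom A T I" "inj_on e (carrier T)" and ess: "\<And>y. y \<in> carrier I \<Longrightarrow> y \<noteq> \<zero>\<^bsub>I\<^esub> \<Longrightarrow>
     \<exists>a\<in>carrier A. a \<odot>\<^bsub>I\<^esub> y \<in> e ` carrier T \<and> a \<odot>\<^bsub>I\<^esub> y \<noteq> \<zero>\<^bsub>I\<^esub>"
    using e by (simp_all add: essential_def)
  note ec = hom_closed[OF eh(1)] and gc = hom_closed[OF g(1)]
  have g0: "x = \<zero>\<^bsub>I\<^esub>" if "x \<in> carrier I" "g x = \<zero>\<^bsub>Y\<^esub>" for x
    using inj_on_iff_kernel[OF I' Y'(1) g(1)] g(2) that by blast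
  obtain n where "ranked k (restr A Y) (carrier Y) n" using rank_module[OF AA Y'] by blast
  then obtain r where r: "\<And>U. subm k (restr A Y) U \<Longrightarrow> r U \<le> n"
    "\<And>U V. subm k (restr A Y) U \<Longrightarrow> subm k (restr A Y) V \<Longrightarrow> U \<subseteq> V \<Longrightarrow> r U \<le> r V"
    "\<And>U V. subm k (restr A Y) U \<Longrightarrow> subm k (restr A Y) V \<Longrightarrow> U \<subseteq> V \<Longrightarrow> r U = r V \<Longrightarrow> V \<inter> carrier Y \<subseteq> U"
    by (elim rankedE) blast
  let ?P = "\<lambda>N. subm A Y N \<and> N \<inter> g ` carrier I \<subseteq> {\<zero>\<^bsub>Y\<^esub>}"
  have "?P {\<zero>\<^bsub>Y\<^esub>}" using subm_zero[OF Y'(1)] by blast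
  moreover have "\<forall>N. ?P N \<longrightarrow> r N < Suc n" using r(1)[OF subm_restr[OF AA]] by (simp add: less_Suc_eq_le)
  ultimately have "\<exists>N. ?P N \<and> (\<forall>N'. ?P N' \<longrightarrow> r N' \<le> r N)"
    by (rule Lattices_Big.ex_has_greatest_nat[where f = r])
  then obtain N where N: "subm A Y N" and N0: "N \<inter> g ` carrier I \<subseteq> {\<zero>\<^bsub>Y\<^esub>}"
    and Nmax: "\<forall>N'. ?P N' \<longrightarrow> r N' \<le> r N" by (elim exE conjE) simp
  obtain C c where C: "C \<in> fg_modules A" "c \<in> mod_hom A Y C" "c ` carrier Y = carrier C"
    and cN: "\<And>y. y \<in> carrier Y \<Longrightarrow> c y = \<zero>\<^bsub>C\<^esub> \<longleftrightarrow> y \<in> N"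
    by (rule cokernel[OF Y N]) (rule that)
  note C' = fgD(1)[OF C(1)] and cc = hom_closed[OF C(2)]
  interpret C: left_module A C by (rule C')
  let ?g = "compose (carrier I) c g"
  have gh: "?g \<in> mod_hom A I C" by (rule hom_comp[OF I' g(1) C(2)])
  have ga: "?g x = c (g x)" if "x \<in> carrier I" for x using that by (simp add: compose_eq)
  have gi0: "x = \<zero>\<^bsub>I\<^esub>" if x: "x \<in> carrier I" and 0: "?g x = \<zero>\<^bsub>C\<^esub>" for x
  proof -
    have "g x \<in> N" using 0 cN[OF gc[OF x]] ga[OF x] by simp
    then have "g x = \<zero>\<^bsub>Y\<^esub>" using N0 x by blast
    then show ?thesis using g0 x by blast
  qed
  then have gi: "inj_on ?g (carrier I)" using inj_on_iff_kernel[OF I' C' gh] by blast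
  have "essential A T C (compose (carrier T) ?g e)"
    unfolding essential_def
  proof (intro conjI ballI impI)
    show "compose (carrier T) ?g e \<in> mod_hom A T C" by (rule hom_comp[OF T' eh(1) gh])
    show "inj_on (compose (carrier T) ?g e) (carrier T)"
      using eh(2) gi ec by (auto simp: inj_on_def compose_eq)
    fix z assume z: "z \<in> carrier C" "z \<noteq> \<zero>\<^bsub>C\<^esub>"
    then obtain y where y: "y \<in> carrier Y" "z = c y" using C(3) by (metis imageE)
    have yN: "y \<notin> N" using cN[OF y(1)] z y by simp
    let ?O = "(\<lambda>a\<in>carrier A. a \<odot>\<^bsub>Y\<^esub> y) ` carrier A"
    have O: "subm A Y ?O"
      using subm_image[OF reg_module Y'(1) hom_orbit[OF Y'(1) y(1)] subm_carrier[OF reg_module]] artin_algebraD(1)[OF AA]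
      by simp
    let ?S = "{x \<oplus>\<^bsub>Y\<^esub> y | x y. x \<in> N \<and> y \<in> ?O}"
    note S = sum_subm[OF Y'(1) N O]
    have yO: "y \<in> ?O" using y by (auto intro!: image_eqI[of _ _ "\<one>\<^bsub>A\<^esub>"])
    \<comment> \<open>\<open>N\<close> has greatest rank among the submodules that meet the image of
      \<open>I\<close> in zero. If \<open>N + A y\<close> were another one, it would have the same
      rank as \<open>N\<close> and so contain no new element, although \<open>y\<close> is not in
      \<open>N\<close>.\<close>
    have "\<not> ?S \<inter> g ` carrier I \<subseteq> {\<zero>\<^bsub>Y\<^esub>}"
    proof
      assume "?S \<inter> g ` carrier I \<subseteq> {\<zero>\<^bsub>Y\<^esub>}"
      then have "r ?S \<le> r N" using Nmax S(1) by blast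
      then have "r N = r ?S" using r(2)[OF subm_restr[OF AA N] subm_restr[OF AA S(1)] S(2)] by simp
      from r(3)[OF subm_restr[OF AA N] subm_restr[OF AA S(1)] S(2) this] have "?S \<inter> carrier Y \<subseteq> N" .
      moreover have "y \<in> ?S" using S(3) yO by blast
      ultimately show False using yN y(1) by blast
    qed
    then obtain s where s: "s \<in> ?S" "s \<in> g ` carrier I" "s \<noteq> \<zero>\<^bsub>Y\<^esub>" by blast
    obtain i where i: "i \<in> carrier I" "s = g i" using s(2) by blast
    obtain m a where ma: "m \<in> N" "a \<in> carrier A" "s = m \<oplus>\<^bsub>Y\<^esub> a \<odot>\<^bsub>Y\<^esub> y" using s(1) by auto
    have mc: "m \<in> carrier Y" using ma(1) submD(5)[OF N] by blast
    have "?g i = c (m \<oplus>\<^bsub>Y\<^esub> a \<odot>\<^bsub>Y\<^esub> y)" unfolding ga[OF i(1)] i(2)[symmetric] ma(3) ..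
    also have "\<dots> = c m \<oplus>\<^bsub>C\<^esub> a \<odot>\<^bsub>C\<^esub> c y"
      using ma(2) mc y(1) by (simp add: hom_add[OF C(2)] hom_smult[OF C(2)])
    also have "c m = \<zero>\<^bsub>C\<^esub>" using ma(1) cN[OF mc] by simp
    finally have cs: "?g i = a \<odot>\<^bsub>C\<^esub> z" using ma(2) z(1) y(2) by simp
    have "i \<noteq> \<zero>\<^bsub>I\<^esub>" using s(3) i hom_zero[OF I' Y'(1) g(1)] by auto
    \<comment> \<open>Essentiality is transitive: \<open>a z\<close> is the image of
      \<open>i\<close>, and \<open>b i\<close> is a nonzero element of the image of
      \<open>T\<close>, so the coefficient \<open>b \<otimes> a\<close> works for
      \<open>z\<close>.\<close>
    then obtain b where b: "b \<in> carrier A" "b \<odot>\<^bsub>I\<^esub> i \<in> e ` carrier T" "b \<odot>\<^bsub>I\<^esub> i \<noteq> \<zero>\<^bsub>I\<^esub>"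
      using ess i by blast
    obtain t where t: "t \<in> carrier T" "b \<odot>\<^bsub>I\<^esub> i = e t" using b(2) by blast
    have "(b \<otimes>\<^bsub>A\<^esub> a) \<odot>\<^bsub>C\<^esub> z = b \<odot>\<^bsub>C\<^esub> ?g i" using cs b ma z by (simp add: C.smult_assoc1)
    also have "\<dots> = ?g (b \<odot>\<^bsub>I\<^esub> i)" using b i by (simp only: hom_smult[OF gh])
    finally have *: "(b \<otimes>\<^bsub>A\<^esub> a) \<odot>\<^bsub>C\<^esub> z = ?g (b \<odot>\<^bsub>I\<^esub> i)" .
    show "\<exists>a\<in>carrier A. a \<odot>\<^bsub>C\<^esub> z \<in> compose (carrier T) ?g e ` carrier T \<and> a \<odot>\<^bsub>C\<^esub> z \<noteq> \<zero>\<^bsub>C\<^esub>"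
    proof (intro bexI conjI)
      show "(b \<otimes>\<^bsub>A\<^esub> a) \<odot>\<^bsub>C\<^esub> z \<in> compose (carrier T) ?g e ` carrier T"
        unfolding * t(2) using t(1) by (auto simp: compose_eq)
      show "(b \<otimes>\<^bsub>A\<^esub> a) \<odot>\<^bsub>C\<^esub> z \<noteq> \<zero>\<^bsub>C\<^esub>" unfolding * using gi0[of "b \<odot>\<^bsub>I\<^esub> i"] b i by auto
    qed (use b ma in auto)
  qed
  from max[OF C(1) gh gi this] have im: "?g ` carrier I = carrier C" .
  obtain d where d: "d \<in> mod_hom A C I" "\<And>x. x \<in> carrier I \<Longrightarrow> d (?g x) = x"
    by (rule mod_isomorphic_inverse[OF I' C' gh gi im]) (rule that)
  show thesis
  proof (rule that)
    show "compose (carrier Y) d c \<in> mod_hom A Y I" by (rule hom_comp[OF Y'(1) C(2) d(1)])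
    show "compose (carrier Y) d c (g x) = x" if "x \<in> carrier I" for x
      using d(2)[OF that] gc[OF that] that by (simp add: compose_eq)
  qed
qed

text \<open>The extension property is stated for \<open>e\<close> along embeddings of
  \<open>T\<close>, the form in which it presents extensions by \<open>T\<close> as pull-backs.
  Given \<open>j\<close>, form the push-out \<open>C\<close> of \<open>e\<close> and
  \<open>j\<close>, the quotient of \<open>I \<oplus> Y\<close> by the elements
  \<open>(e x, - j x)\<close>. The map from \<open>I\<close> to \<open>C\<close> is injective
  because \<open>j\<close> is, hence it splits, and the retraction restricted to \<open>Y\<close>
  extends \<open>e\<close>.\<close>

theorem injective_extension:
  fixes A :: "('k, 'a) module"
  assumes AA: "artin_algebra k A" and T: "T \<in> fg_modules A"
  obtains I e where "I \<in> fg_modules A" "e \<in> mod_hom A T I" "inj_on e (carrier T)"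
    "\<And>Y j. Y \<in> fg_modules A \<Longrightarrow> j \<in> mod_hom A T Y \<Longrightarrow> inj_on j (carrier T) \<Longrightarrow>
      \<exists>h\<in>mod_hom A Y I. \<forall>x\<in>carrier T. h (j x) = e x"
proof -
  obtain I e where I: "I \<in> fg_modules A" and ess: "essential A T I e" and
    max: "\<And>J g. J \<in> fg_modules A \<Longrightarrow> g \<in> mod_hom A I J \<Longrightarrow> inj_on g (carrier I) \<Longrightarrow>
      essential A T J (compose (carrier T) g e) \<Longrightarrow> g ` carrier I = carrier J"
    by (rule maximal_essential[OF AA T]) (rule that)
  have e: "e \<in> mod_hom A T I" "inj_on e (carrier T)" using ess by (simp_all add: essential_def)
  note I' = fgD(1)[OF I] and T' = fgD(1)[OF T]
  interpret I: left_module A I by (rule I')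
  have "\<exists>h\<in>mod_hom A Y I. \<forall>x\<in>carrier T. h (j x) = e x"
    if Y: "Y \<in> fg_modules A" and j: "j \<in> mod_hom A T Y" "inj_on j (carrier T)" for Y j
  proof -
    note Y' = fgD(1)[OF Y]
    interpret Y: left_module A Y by (rule Y')
    obtain D i1 i2 p1 p2 where D: "D \<in> fg_modules A" and b: "biprod A D I Y i1 i2 p1 p2"
      by (rule biprod_exists[OF I Y]) (rule that)
    note b = biprodD[OF b] and D' = fgD(1)[OF D]
    interpret D: left_module A D by (rule D')
    note [simp] = hom_closed[OF b(1)] hom_closed[OF b(2)] hom_closed[OF e(1)] hom_closed[OF j(1)]
    let ?d = "hadd T D (compose (carrier T) i1 e) (hneg T D (compose (carrier T) i2 j))"
    have dh: "?d \<in> mod_hom A T D"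
      by (intro hom_hadd hom_hneg T' D' hom_comp[OF T' e(1) b(1)] hom_comp[OF T' j(1) b(2)])
    have da: "?d x = i1 (e x) \<ominus>\<^bsub>D\<^esub> i2 (j x)" if "x \<in> carrier T" for x
      using that by (simp add: hadd_apply hneg_apply compose_eq a_minus_def)
    obtain C c where C: "C \<in> fg_modules A" "c \<in> mod_hom A D C"
      and cN: "\<And>y. y \<in> carrier D \<Longrightarrow> c y = \<zero>\<^bsub>C\<^esub> \<longleftrightarrow> y \<in> ?d ` carrier T"
      by (rule cokernel[OF D subm_image[OF T' D' dh subm_carrier[OF T']]]) (rule that)
    note C' = fgD(1)[OF C(1)]
    interpret C: left_module A C by (rule C')
    note [simp] = hom_closed[OF C(2)]
    have gh: "compose (carrier I) c i1 \<in> mod_hom A I C" by (rule hom_comp[OF I' b(1) C(2)])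
    have "x = \<zero>\<^bsub>I\<^esub>" if x: "x \<in> carrier I" and 0: "compose (carrier I) c i1 x = \<zero>\<^bsub>C\<^esub>" for x
    proof -
      have "i1 x \<in> ?d ` carrier T" using 0 x cN[of "i1 x"] by (simp add: compose_eq)
      then obtain t where t: "t \<in> carrier T" "i1 x = i1 (e t) \<ominus>\<^bsub>D\<^esub> i2 (j t)" using da by auto
      have "p2 (i1 x) = p2 (i1 (e t) \<ominus>\<^bsub>D\<^esub> i2 (j t))" using t by simp
      also have "\<dots> = \<zero>\<^bsub>Y\<^esub> \<ominus>\<^bsub>Y\<^esub> j t" using t by (simp add: hom_diff[OF D' Y' b(4)] b(6,7))
      finally have "\<zero>\<^bsub>Y\<^esub> \<ominus>\<^bsub>Y\<^esub> j t = \<zero>\<^bsub>Y\<^esub>" using b(6)[OF x] by simp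
      then have jt: "j t = \<zero>\<^bsub>Y\<^esub>" using Y.M.diff_eq_zero_iff[of "\<zero>\<^bsub>Y\<^esub>" "j t"] t by simp
      then have "t = \<zero>\<^bsub>T\<^esub>" using inj_on_iff_kernel[OF T' Y' j(1)] j(2) t by blast
      then have "e t = \<zero>\<^bsub>I\<^esub>" using hom_zero[OF T' I' e(1)] by simp
      then have "i1 x = \<zero>\<^bsub>D\<^esub>" using t jt hom_zero[OF I' D' b(1)] hom_zero[OF Y' D' b(2)]
        D.M.diff_eq_zero_iff[of "\<zero>\<^bsub>D\<^esub>" "\<zero>\<^bsub>D\<^esub>"] by simp
      then show ?thesis using b(5)[OF x] hom_zero[OF D' I' b(3)] by simp
    qed
    then have gi: "inj_on (compose (carrier I) c i1) (carrier I)" using inj_on_iff_kernel[OF I' C' gh] by blast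
    obtain h where h: "h \<in> mod_hom A C I" "\<And>x. x \<in> carrier I \<Longrightarrow> h (compose (carrier I) c i1 x) = x"
    proof (rule maximal_essential_split[OF AA T I ess _ C(1) gh gi])
      show "g ` carrier I = carrier J" if "J \<in> fg_modules A" "g \<in> mod_hom A I J" "inj_on g (carrier I)"
        "essential A T J (compose (carrier T) g e)" for J g
        using that by (rule max)
    qed (rule that)
    show ?thesis
    proof (intro bexI ballI)
      show hh: "compose (carrier Y) h (compose (carrier Y) c i2) \<in> mod_hom A Y I"
        by (rule hom_comp[OF Y' hom_comp[OF Y' b(2) C(2)] h(1)])
      fix x assume x: "x \<in> carrier T"
      have "c (i1 (e x) \<ominus>\<^bsub>D\<^esub> i2 (j x)) = \<zero>\<^bsub>C\<^esub>"
        using cN[of "?d x"] x da hom_closed[OF dh x] by auto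
      then have "c (i1 (e x)) = c (i2 (j x))"
        using x by (simp add: hom_diff[OF D' C' C(2)] C.M.diff_eq_zero_iff)
      then show "compose (carrier Y) h (compose (carrier Y) c i2) (j x) = e x"
        using h(2)[of "e x"] x by (simp add: compose_eq)
    qed
  qed
  then show thesis using that[OF I e] by blast
qed

section \<open>Projective modules and additive closures\<close>

lemma projective_lift:
  assumes "projective A P" "X \<in> fg_modules A" "Y \<in> fg_modules A" "g \<in> mod_hom A X Y"
    "g ` carrier X = carrier Y" "f \<in> mod_hom A P Y"
  obtains h where "h \<in> mod_hom A P X" "\<And>x. x \<in> carrier P \<Longrightarrow> g (h x) = f x"
proof -
  obtain h where h: "h \<in> mod_hom A P X" "compose (carrier P) g h = f"
    using assms unfolding projective_def by blast
  have "g (h x) = f x" if "x \<in> carrier P" for x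
    using that unfolding h(2)[symmetric] by (simp add: compose_eq)
  then show thesis by (rule that[OF h(1)])
qed

lemma projectiveI:
  assumes P: "P \<in> fg_modules A"
    and lift: "\<And>X Y g f. X \<in> fg_modules A \<Longrightarrow> Y \<in> fg_modules A \<Longrightarrow> g \<in> mod_hom A X Y \<Longrightarrow>
      g ` carrier X = carrier Y \<Longrightarrow> f \<in> mod_hom A P Y \<Longrightarrow> \<exists>h\<in>mod_hom A P X. \<forall>x\<in>carrier P. g (h x) = f x"
  shows "projective A P"
  unfolding projective_def
proof (intro conjI P ballI impI)
  fix X Y g f assume *: "X \<in> fg_modules A" "Y \<in> fg_modules A" "g \<in> mod_hom A X Y"
    "f \<in> mod_hom A P Y" "g ` carrier X = carrier Y"
  obtain h where h: "h \<in> mod_hom A P X" "\<forall>x\<in>carrier P. g (h x) = f x"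
    using lift[OF *(1-3,5,4)] by blast
  have "compose (carrier P) g h = f"
    using h(2) by (intro hom_eqI[OF hom_comp[OF fgD(1)[OF P] h(1) *(3)] *(4)]) (simp add: compose_eq)
  then show "\<exists>h\<in>mod_hom A P X. compose (carrier P) g h = f" using h(1) by blast
qed

lemma zero_object:
  assumes "artin_algebra k A" "M \<in> fg_modules A"
  shows "M\<lparr>carrier := {\<zero>\<^bsub>M\<^esub>}\<rparr> \<in> zero_modules A"
  using sub_fg[OF assms subm_zero[OF fgD(1)[OF assms(2)]]] by (simp add: zero_modules_def)

lemma zero_modulesD: "Z \<in> zero_modules A \<Longrightarrow> Z \<in> fg_modules A" "Z \<in> zero_modules A \<Longrightarrow> carrier Z = {\<zero>\<^bsub>Z\<^esub>}"
  by (simp_all add: zero_modules_def)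

lemma projective_zero:
  assumes "Z \<in> zero_modules A"
  shows "projective A Z"
proof (rule projectiveI)
  note Z = zero_modulesD[OF assms]
  show "Z \<in> fg_modules A" by (rule Z(1))
  fix X Y g f assume *: "X \<in> fg_modules A" "Y \<in> fg_modules A" "g \<in> mod_hom A X Y" "f \<in> mod_hom A Z Y"
  show "\<exists>h\<in>mod_hom A Z X. \<forall>x\<in>carrier Z. g (h x) = f x"
  proof (intro bexI ballI)
    show "hzero Z X \<in> mod_hom A Z X" by (rule hom_hzero[OF fgD(1)[OF Z(1)] fgD(1)[OF *(1)]])
    fix x assume x: "x \<in> carrier Z"
    then have "x = \<zero>\<^bsub>Z\<^esub>" using Z(2) by simp
    then show "g (hzero Z X x) = f x"
      using x hom_zero[OF fgD(1)[OF Z(1)] fgD(1)[OF *(2)] *(4)] hom_zero[OF fgD(1)[OF *(1)] fgD(1)[OF *(2)] *(3)]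
      by (simp add: hzero_apply)
  qed
qed

lemma projective_biprod:
  assumes P: "projective A P" and Q: "projective A Q" and D: "D \<in> fg_modules A" and b: "biprod A D P Q i j p q"
  shows "projective A D"
proof (rule projectiveI[OF D])
  fix X Y g f assume *: "X \<in> fg_modules A" "Y \<in> fg_modules A" "g \<in> mod_hom A X Y"
    "g ` carrier X = carrier Y" "f \<in> mod_hom A D Y"
  have PQ: "P \<in> fg_modules A" "Q \<in> fg_modules A" using P Q by (simp_all add: projective_def)
  note P' = fgD(1)[OF PQ(1)] and Q' = fgD(1)[OF PQ(2)] and D' = fgD(1)[OF D] and X' = fgD(1)[OF *(1)]
  note b = biprodD[OF b]
  note [simp] = hom_closed[OF b(1)] hom_closed[OF b(2)] hom_closed[OF b(3)] hom_closed[OF b(4)]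
  obtain h1 where h1: "h1 \<in> mod_hom A P X" "\<And>x. x \<in> carrier P \<Longrightarrow> g (h1 x) = compose (carrier P) f i x"
    by (rule projective_lift[OF P *(1-4) hom_comp[OF P' b(1) *(5)]]) (rule that)
  obtain h2 where h2: "h2 \<in> mod_hom A Q X" "\<And>x. x \<in> carrier Q \<Longrightarrow> g (h2 x) = compose (carrier Q) f j x"
    by (rule projective_lift[OF Q *(1-4) hom_comp[OF Q' b(2) *(5)]]) (rule that)
  show "\<exists>h\<in>mod_hom A D X. \<forall>x\<in>carrier D. g (h x) = f x"
  proof (intro bexI ballI)
    show "hadd D X (compose (carrier D) h1 p) (compose (carrier D) h2 q) \<in> mod_hom A D X"
      by (intro hom_hadd D' X' hom_comp[OF D' b(3) h1(1)] hom_comp[OF D' b(4) h2(1)])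
    fix d assume d: "d \<in> carrier D"
    have "g (hadd D X (compose (carrier D) h1 p) (compose (carrier D) h2 q) d) = f (i (p d)) \<oplus>\<^bsub>Y\<^esub> f (j (q d))"
      using d h1(2) h2(2) hom_closed[OF h1(1)] hom_closed[OF h2(1)]
      by (simp add: hadd_apply compose_eq hom_add[OF *(3)])
    also have "\<dots> = f (i (p d) \<oplus>\<^bsub>D\<^esub> j (q d))" using d by (simp add: hom_add[OF *(5)])
    also have "\<dots> = f d" by (simp only: b(9)[OF d])
    finally show "g (hadd D X (compose (carrier D) h1 p) (compose (carrier D) h2 q) d) = f d" .
  qed
qed

text \<open>The complement is the kernel of \<open>p\<close>, with projection induced by
  \<open>y \<mapsto> y - i (p y)\<close>.\<close>

lemma retract_complement:
  assumes AA: "artin_algebra k A" and X: "X \<in> fg_modules A" and Y: "Y \<in> fg_modules A"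
    and i: "i \<in> mod_hom A X Y" and p: "p \<in> mod_hom A Y X" and pi: "\<And>x. x \<in> carrier X \<Longrightarrow> p (i x) = x"
  obtains Z j q where "Z \<in> fg_modules A" "biprod A Y X Z i j p q"
proof -
  note X' = fgD(1)[OF X] and Y' = fgD(1)[OF Y]
  interpret X: left_module A X by (rule X')
  interpret Y: left_module A Y by (rule Y')
  note [simp] = hom_closed[OF i] hom_closed[OF p]
  obtain Z j where Z: "Z \<in> fg_modules A" "j \<in> mod_hom A Z Y" "inj_on j (carrier Z)"
    "j ` carrier Z = {x \<in> carrier Y. p x = \<zero>\<^bsub>X\<^esub>}"
    by (rule subobject[OF AA Y subm_kernel[OF Y' X' p]]) (rule that)
  note Z' = fgD(1)[OF Z(1)]
  interpret Z: left_module A Z by (rule Z')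
  note [simp] = hom_closed[OF Z(2)]
  let ?c = "hadd Y Y (\<lambda>x\<in>carrier Y. x) (hneg Y Y (compose (carrier Y) i p))"
  have c: "?c \<in> mod_hom A Y Y" by (intro hom_hadd hom_hneg hom_id hom_comp[OF Y' p i] Y')
  have ca: "?c y = y \<ominus>\<^bsub>Y\<^esub> i (p y)" if "y \<in> carrier Y" for y
    using that by (simp add: hadd_apply hneg_apply compose_eq a_minus_def)
  have pj: "p (j z) = \<zero>\<^bsub>X\<^esub>" if "z \<in> carrier Z" for z
  proof -
    have "j z \<in> j ` carrier Z" using that by (rule imageI)
    then show ?thesis unfolding Z(4) by simp
  qed
  obtain q where q: "q \<in> mod_hom A Y Z" "\<And>y. y \<in> carrier Y \<Longrightarrow> j (q y) = ?c y"
  proof (rule hom_factor_inj[OF Y' Z' Z(2,3) c])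
    show "?c y \<in> j ` carrier Z" if y: "y \<in> carrier Y" for y
      unfolding Z(4) ca[OF y] using y by (simp add: hom_diff[OF Y' X' p] pi X.M.diff_eq_zero_iff)
  qed (rule that)
  note [simp] = hom_closed[OF q(1)]
  have jz: "z = z'" if "z \<in> carrier Z" "z' \<in> carrier Z" "j z = j z'" for z z'
    using inj_onD[OF Z(3) that(3,1,2)] .
  have "biprod A Y X Z i j p q"
    unfolding biprod_def
  proof (intro conjI ballI i Z(2) p q(1) pi pj)
    show "q (i x) = \<zero>\<^bsub>Z\<^esub>" if x: "x \<in> carrier X" for x
    proof (rule jz)
      show "j (q (i x)) = j \<zero>\<^bsub>Z\<^esub>"
        using x hom_zero[OF Z' Y' Z(2)] q(2)[of "i x"] ca[of "i x"] by (simp add: pi Y.M.diff_eq_zero_iff)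
    qed (use x in simp_all)
    show "q (j z) = z" if z: "z \<in> carrier Z" for z
    proof (rule jz)
      have "j (q (j z)) = j z \<ominus>\<^bsub>Y\<^esub> i (p (j z))" using z q(2)[of "j z"] ca[of "j z"] by simp
      also have "\<dots> = j z \<ominus>\<^bsub>Y\<^esub> \<zero>\<^bsub>Y\<^esub>" using z by (simp add: pj hom_zero[OF X' Y' i])
      also have "\<dots> = j z" using z Y.M.diff_add_cancel[of "j z" "\<zero>\<^bsub>Y\<^esub>"] by simp
      finally show "j (q (j z)) = j z" .
    qed (use z in simp_all)
    show "i (p y) \<oplus>\<^bsub>Y\<^esub> j (q y) = y" if y: "y \<in> carrier Y" for y
      using y q(2)[OF y] ca[OF y] Y.M.diff_add_cancel[of y "i (p y)"] Y.M.a_comm[of "i (p y)" "y \<ominus>\<^bsub>Y\<^esub> i (p y)"]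
      by simp
  qed
  then show thesis by (rule that[OF Z(1)])
qed

section \<open>Additive closures, free modules and enough projectives\<close>

lemma add_closure_fg: "X \<in> add_closure A \<T> \<Longrightarrow> X \<in> fg_modules A"
  by (induction rule: add_closure.induct) (simp_all add: zero_modules_def)

lemma add_closure_biprod:
  assumes "M \<in> add_closure A \<T>" "N \<in> add_closure A \<T>" "X \<in> fg_modules A" "biprod A X M N i j p q"
  shows "X \<in> add_closure A \<T>"
  using iso_of_biprod[OF fgD(1)[OF assms(3)] fgD(1)[OF add_closure_fg[OF assms(1)]]
      fgD(1)[OF add_closure_fg[OF assms(2)]] assms(4)]
  by (rule add_closure.direct_sum[OF assms(1-3)])

text \<open>The rule \<open>summand\<close> asks for a complement inside the category. The kernel of
  \<open>p\<close> is one, being finitely generated over an Artin algebra.\<close>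

lemma add_closure_retract:
  assumes AA: "artin_algebra k A" and Y: "Y \<in> add_closure A \<T>" and X: "X \<in> fg_modules A"
    and i: "i \<in> mod_hom A X Y" and p: "p \<in> mod_hom A Y X" and pi: "\<And>x. x \<in> carrier X \<Longrightarrow> p (i x) = x"
  shows "X \<in> add_closure A \<T>"
proof -
  note Y' = add_closure_fg[OF Y]
  obtain Z j q where Z: "Z \<in> fg_modules A" "biprod A Y X Z i j p q"
    by (rule retract_complement[OF AA X Y' i p pi]) (assumption, rule that)
  show ?thesis
    by (rule add_closure.summand[OF Y X Z(1) iso_of_biprod[OF fgD(1)[OF Y'] fgD(1)[OF X] fgD(1)[OF Z(1)] Z(2)]])
qed

lemma add_closure_least:
  assumes "\<S> \<subseteq> add_closure A \<T>"
  shows "add_closure A \<S> \<subseteq> add_closure A \<T>"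
proof
  fix X assume "X \<in> add_closure A \<S>"
  then show "X \<in> add_closure A \<T>"
  proof (induction rule: add_closure.induct)
    case (base X)
    then show ?case using assms by blast
  qed (auto intro: add_closure.empty_sum add_closure.direct_sum add_closure.summand)
qed

text \<open>\<open>P\<close> is free of rank one on \<open>u\<close>: a copy of the regular module
  on the type \<open>amod\<close>. The universal property replaces coordinates.\<close>

definition free_gen :: "('a, 'ax) ring_scheme \<Rightarrow> 'a amod \<Rightarrow> (nat \<Rightarrow> 'a) set \<Rightarrow> bool" where
  "free_gen A P u \<longleftrightarrow> P \<in> fg_modules A \<and> u \<in> carrier P \<and> (\<forall>y\<in>carrier P. \<exists>a\<in>carrier A. y = a \<odot>\<^bsub>P\<^esub> u) \<and>
     (\<forall>M\<in>fg_modules A. \<forall>s\<in>carrier M. \<exists>h\<in>mod_hom A P M. h u = s)"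

lemma free_genD:
  assumes "free_gen A P u"
  shows "P \<in> fg_modules A" "u \<in> carrier P" "\<And>y. y \<in> carrier P \<Longrightarrow> \<exists>a\<in>carrier A. y = a \<odot>\<^bsub>P\<^esub> u"
    "\<And>M s. M \<in> fg_modules A \<Longrightarrow> s \<in> carrier M \<Longrightarrow> \<exists>h\<in>mod_hom A P M. h u = s"
  using assms by (simp_all add: free_gen_def)

lemma free_gen_exists:
  fixes A :: "('a, 'ax) ring_scheme"
  assumes A: "ring A"
  shows "\<exists>P u. free_gen A P u"
proof -
  interpret A: ring A by fact
  note rA = reg_module[OF A]
  have "fin_gen A (reg A)"
    unfolding fin_gen_iff[OF rA]
  proof (intro exI[of _ "{\<one>\<^bsub>A\<^esub>}"] conjI allI impI)
    fix N assume N: "subm A (reg A) N" "{\<one>\<^bsub>A\<^esub>} \<subseteq> N"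
    have "a \<in> N" if "a \<in> carrier A" for a
      using submD(4)[OF N(1) that, of "\<one>\<^bsub>A\<^esub>"] N(2) that by simp
    then show "N = carrier (reg A)" using submD(1)[OF N(1)] by auto
  qed auto
  then obtain P f where P: "P \<in> fg_modules A" "f \<in> mod_hom A (reg A) P" "inj_on f (carrier (reg A))"
    "f ` carrier (reg A) = carrier P"
    using representative[OF rA] by metis
  note P' = fgD(1)[OF P(1)]
  obtain g where g: "g \<in> mod_hom A P (reg A)" "\<And>y. y \<in> carrier P \<Longrightarrow> f (g y) = y"
    "\<And>x. x \<in> carrier (reg A) \<Longrightarrow> g (f x) = x"
    by (rule mod_isomorphic_inverse[OF rA P' P(2-4)]) (rule that)
  have "free_gen A P (f \<one>\<^bsub>A\<^esub>)"
    unfolding free_gen_def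
  proof (intro conjI ballI P(1))
    show "f \<one>\<^bsub>A\<^esub> \<in> carrier P" using hom_closed[OF P(2)] by simp
    fix y assume "y \<in> carrier P"
    then obtain a where a: "a \<in> carrier A" "y = f a" using P(4) by auto
    have "f (a \<odot>\<^bsub>reg A\<^esub> \<one>\<^bsub>A\<^esub>) = a \<odot>\<^bsub>P\<^esub> f \<one>\<^bsub>A\<^esub>" using a by (intro hom_smult[OF P(2)]) auto
    then show "\<exists>a\<in>carrier A. y = a \<odot>\<^bsub>P\<^esub> f \<one>\<^bsub>A\<^esub>" using a by auto
  next
    fix M s assume M: "M \<in> fg_modules A" and s: "s \<in> carrier M"
    interpret M: left_module A M by (rule fgD(1)[OF M])
    let ?h = "compose (carrier P) (\<lambda>a\<in>carrier A. a \<odot>\<^bsub>M\<^esub> s) g"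
    have "?h (f \<one>\<^bsub>A\<^esub>) = s" using g(3)[of "\<one>\<^bsub>A\<^esub>"] s hom_closed[OF P(2), of "\<one>\<^bsub>A\<^esub>"] by (simp add: compose_eq)
    then show "\<exists>h\<in>mod_hom A P M. h (f \<one>\<^bsub>A\<^esub>) = s"
      using hom_comp[OF P' g(1) hom_orbit[OF fgD(1)[OF M] s]] by blast
  qed
  then show ?thesis by blast
qed

lemma free_gen_projective:
  assumes "free_gen A P u"
  shows "projective A P"
proof (rule projectiveI)
  show P: "P \<in> fg_modules A" using assms by (simp add: free_gen_def)
  have u: "u \<in> carrier P" using assms by (simp add: free_gen_def)
  fix X Y g f assume *: "X \<in> fg_modules A" "Y \<in> fg_modules A" "g \<in> mod_hom A X Y"
    "g ` carrier X = carrier Y" "f \<in> mod_hom A P Y"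
  obtain x where x: "x \<in> carrier X" "g x = f u" using *(4) hom_closed[OF *(5) u] by (metis imageE)
  obtain h where h: "h \<in> mod_hom A P X" "h u = x" using free_genD(4)[OF assms *(1) x(1)] by blast
  have "g (h y) = f y" if y: "y \<in> carrier P" for y
  proof -
    obtain a where a: "a \<in> carrier A" "y = a \<odot>\<^bsub>P\<^esub> u" using free_genD(3)[OF assms y] by blast
    have "g (h y) = a \<odot>\<^bsub>Y\<^esub> g x"
      unfolding a(2) hom_smult[OF h(1) a(1) u] h(2) by (rule hom_smult[OF *(3) a(1) x(1)])
    also have "\<dots> = f y" unfolding a(2) hom_smult[OF *(5) a(1) u] x(2) ..
    finally show ?thesis .
  qed
  then show "\<exists>h\<in>mod_hom A P X. \<forall>x\<in>carrier P. g (h x) = f x" using h(1) by blast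
qed

text \<open>One copy of \<open>P\<close> is added for each generator of \<open>M\<close>. That the
  cover lies in the additive closure of \<open>P\<close> is recorded because it locates all
  projectives there.\<close>

lemma enough_projectives:
  assumes AA: "artin_algebra k A" and P: "free_gen A P u" and M: "M \<in> fg_modules A"
  obtains Q q where "Q \<in> add_closure A {P}" "projective A Q" "q \<in> mod_hom A Q M" "q ` carrier Q = carrier M"
proof -
  note M' = fgD[OF M]
  interpret M: left_module A M by (rule M'(1))
  have Pfg: "P \<in> fg_modules A" and u: "u \<in> carrier P" using P by (simp_all add: free_gen_def)
  note P' = fgD(1)[OF Pfg]
  have Pa: "P \<in> add_closure A {P}" using Pfg by (intro add_closure.base) simp_all
  have "\<exists>Q q. Q \<in> add_closure A {P} \<and> projective A Q \<and> q \<in> mod_hom A Q M \<and> S \<subseteq> q ` carrier Q"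
    if "finite S" "S \<subseteq> carrier M" for S
    using that
  proof (induction S)
    case empty
    note Z = zero_object[OF AA M]
    show ?case
      using add_closure.empty_sum[OF Z] projective_zero[OF Z]
        hom_hzero[OF fgD(1)[OF zero_modulesD(1)[OF Z]] M'(1)] by blast
  next
    case (insert s S)
    then obtain Q q where Q: "Q \<in> add_closure A {P}" "projective A Q" "q \<in> mod_hom A Q M" "S \<subseteq> q ` carrier Q"
      by auto
    obtain h where h: "h \<in> mod_hom A P M" "h u = s" using free_genD(4)[OF P M, of s] insert.prems by blast
    note Qf = add_closure_fg[OF Q(1)] and Q' = fgD(1)[OF add_closure_fg[OF Q(1)]]
    obtain D i j p r where D: "D \<in> fg_modules A" and bp: "biprod A D Q P i j p r"
      by (rule biprod_exists[OF Qf Pfg]) (rule that)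
    note b = biprodD[OF bp] and D' = fgD(1)[OF D]
    interpret Q: left_module A Q by (rule Q')
    interpret P: left_module A P by (rule P')
    note [simp] = hom_closed[OF b(1)] hom_closed[OF b(2)] hom_closed[OF h(1)] hom_closed[OF Q(3)]
    let ?q = "hadd D M (compose (carrier D) q p) (compose (carrier D) h r)"
    have qh: "?q \<in> mod_hom A D M" by (intro hom_hadd hom_comp[OF D' b(3) Q(3)] hom_comp[OF D' b(4) h(1)] D' M'(1))
    \<comment> \<open>The new generator \<open>s\<close> is the image of \<open>j u\<close>, where
      \<open>u\<close> is the basis element of the added copy of \<open>P\<close>; the old
      generators are still reached through \<open>i\<close>.\<close>
    have "s \<in> ?q ` carrier D"
      using u h(2) b(7,8)[of u] hom_zero[OF Q' M'(1) Q(3)] insert.prems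
      by (intro image_eqI[of _ _ "j u"]) (simp_all add: hadd_apply compose_eq)
    moreover have "?q (i x) = q x" if "x \<in> carrier Q" for x
      using that b(5,6)[of x] hom_zero[OF P' M'(1) h(1)] by (simp add: hadd_apply compose_eq)
    then have "q x \<in> ?q ` carrier D" if "x \<in> carrier Q" for x
      using that by (intro image_eqI[of _ _ "i x"]) simp_all
    then have "S \<subseteq> ?q ` carrier D" using Q(4) by blast
    ultimately show ?case
      using add_closure_biprod[OF Q(1) Pa D bp] projective_biprod[OF Q(2) free_gen_projective[OF P] D bp] qh
      by (intro exI[of _ D] exI[of _ ?q]) simp
  qed
  note * = this
  obtain S where S: "finite S" "S \<subseteq> carrier M" "\<And>N. subm A M N \<Longrightarrow> S \<subseteq> N \<Longrightarrow> N = carrier M"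
    using M'(2) unfolding fin_gen_iff[OF M'(1)] by blast
  obtain Q q where Q: "Q \<in> add_closure A {P}" "projective A Q" "q \<in> mod_hom A Q M" "S \<subseteq> q ` carrier Q"
    using *[OF S(1,2)] by blast
  note Q' = fgD(1)[OF add_closure_fg[OF Q(1)]]
  have "q ` carrier Q = carrier M"
    by (rule S(3)[OF subm_image[OF Q' M'(1) Q(3) subm_carrier[OF Q']] Q(4)])
  then show thesis by (rule that[OF Q(1-3)])
qed

text \<open>A cover of \<open>Q\<close> by a module in the additive closure of \<open>P\<close>
  splits. So a class contains every projective as soon as it contains \<open>P\<close> and is closed
  under sums and summands.\<close>

lemma projective_in_add_closure:
  assumes AA: "artin_algebra k A" and P: "free_gen A P u" and Q: "projective A Q"
  shows "Q \<in> add_closure A {P}"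
proof -
  have Qf: "Q \<in> fg_modules A" using Q by (simp add: projective_def)
  note Q' = fgD(1)[OF Qf]
  obtain R r where R: "R \<in> add_closure A {P}" "projective A R" "r \<in> mod_hom A R Q" "r ` carrier R = carrier Q"
    by (rule enough_projectives[OF AA P Qf]) (rule that)
  obtain h where h: "h \<in> mod_hom A Q R" "\<And>x. x \<in> carrier Q \<Longrightarrow> r (h x) = (\<lambda>x\<in>carrier Q. x) x"
    by (rule projective_lift[OF Q add_closure_fg[OF R(1)] Qf R(3,4) hom_id[OF Q']]) (rule that)
  show ?thesis by (rule add_closure_retract[OF AA R(1) Qf h(1) R(3)]) (simp add: h(2))
qed

section \<open>Stable equality of homomorphisms\<close>

lemma proj_homE:
  assumes "d \<in> proj_hom A X Y"
  obtains P s r where "projective A P" "s \<in> mod_hom A X P" "r \<in> mod_hom A P Y" "d = compose (carrier X) r s"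
  using assms unfolding proj_hom_def by blast

lemma proj_homI:
  assumes "projective A P" "s \<in> mod_hom A X P" "r \<in> mod_hom A P Y"
  shows "compose (carrier X) r s \<in> proj_hom A X Y"
  using assms unfolding proj_hom_def by blast

lemma projective_fg: "projective A P \<Longrightarrow> P \<in> fg_modules A"
  by (simp add: projective_def)

lemma proj_hom_hom: "left_module A X \<Longrightarrow> d \<in> proj_hom A X Y \<Longrightarrow> d \<in> mod_hom A X Y"
  by (elim proj_homE) (simp add: hom_comp)

lemma proj_hom_zero:
  assumes AA: "artin_algebra k A" and X: "X \<in> fg_modules A" and Y: "Y \<in> fg_modules A"
  shows "hzero X Y \<in> proj_hom A X Y"
proof -
  note Z = zero_object[OF AA X]
  let ?Z = "X\<lparr>carrier := {\<zero>\<^bsub>X\<^esub>}\<rparr>"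
  note X' = fgD(1)[OF X] and Y' = fgD(1)[OF Y] and Z' = fgD(1)[OF zero_modulesD(1)[OF Z]]
  have "compose (carrier X) (hzero ?Z Y) (hzero X ?Z) = hzero X Y"
    by (rule hom_eqI[OF hom_comp[OF X' hom_hzero[OF X' Z'] hom_hzero[OF Z' Y']] hom_hzero[OF X' Y']])
      (simp add: compose_eq hzero_def)
  then show ?thesis using proj_homI[OF projective_zero[OF Z] hom_hzero[OF X' Z'] hom_hzero[OF Z' Y']] by simp
qed

text \<open>If the summands factor through \<open>P\<close> and \<open>Q\<close>, their sum factors
  through \<open>P \<oplus> Q\<close>, which is again projective.\<close>

lemma proj_hom_add:
  assumes X: "X \<in> fg_modules A" and Y: "Y \<in> fg_modules A" and d: "d \<in> proj_hom A X Y" and e: "e \<in> proj_hom A X Y"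
  shows "hadd X Y d e \<in> proj_hom A X Y"
proof -
  note X' = fgD(1)[OF X] and Y' = fgD(1)[OF Y]
  obtain P s r where 1: "projective A P" "s \<in> mod_hom A X P" "r \<in> mod_hom A P Y" "d = compose (carrier X) r s"
    using d by (rule proj_homE)
  obtain Q t v where 2: "projective A Q" "t \<in> mod_hom A X Q" "v \<in> mod_hom A Q Y" "e = compose (carrier X) v t"
    using e by (rule proj_homE)
  obtain D i j p q where D: "D \<in> fg_modules A" and bp: "biprod A D P Q i j p q"
    by (rule biprod_exists[OF projective_fg[OF 1(1)] projective_fg[OF 2(1)]]) (rule that)
  note b = biprodD[OF bp] and D' = fgD(1)[OF D]
  interpret P: left_module A P by (rule fgD(1)[OF projective_fg[OF 1(1)]])
  interpret Q: left_module A Q by (rule fgD(1)[OF projective_fg[OF 2(1)]])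
  note [simp] = hom_closed[OF b(1)] hom_closed[OF b(2)] hom_closed[OF b(3)] hom_closed[OF b(4)]
     hom_closed[OF 1(2)] hom_closed[OF 1(3)] hom_closed[OF 2(2)] hom_closed[OF 2(3)]
  let ?s = "hadd X D (compose (carrier X) i s) (compose (carrier X) j t)"
  let ?r = "hadd D Y (compose (carrier D) r p) (compose (carrier D) v q)"
  have s: "?s \<in> mod_hom A X D" by (intro hom_hadd X' D' hom_comp[OF X' 1(2) b(1)] hom_comp[OF X' 2(2) b(2)])
  have r: "?r \<in> mod_hom A D Y" by (intro hom_hadd Y' D' hom_comp[OF D' b(3) 1(3)] hom_comp[OF D' b(4) 2(3)])
  have dh: "hadd X Y d e \<in> mod_hom A X Y" using d e by (intro hom_hadd X' Y' proj_hom_hom[OF X'])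
  interpret D: left_module A D by (rule D')
  have "compose (carrier X) ?r ?s = hadd X Y d e"
    by (rule hom_eqI[OF hom_comp[OF X' s r] dh])
      (simp add: compose_eq hadd_apply 1(4) 2(4) hom_add[OF b(3)] hom_add[OF b(4)] b(5-8))
  then show ?thesis using proj_homI[OF projective_biprod[OF 1(1) 2(1) D bp] s r] by simp
qed

lemma proj_hom_comp_left:
  assumes X: "left_module A X" and d: "d \<in> proj_hom A X Y" and h: "h \<in> mod_hom A Y Z"
  shows "compose (carrier X) h d \<in> proj_hom A X Z"
proof -
  obtain P s r where 1: "projective A P" "s \<in> mod_hom A X P" "r \<in> mod_hom A P Y" "d = compose (carrier X) r s"
    using d by (rule proj_homE)
  have "s \<in> carrier X \<rightarrow> carrier P" using hom_closed[OF 1(2)] by auto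
  then have "compose (carrier X) h d = compose (carrier X) (compose (carrier P) h r) s"
    unfolding 1(4) by (rule compose_assoc)
  then show ?thesis using proj_homI[OF 1(1,2) hom_comp[OF fgD(1)[OF projective_fg[OF 1(1)]] 1(3) h]] by simp
qed

lemma proj_hom_comp_right:
  assumes W: "left_module A W" and d: "d \<in> proj_hom A X Y" and h: "h \<in> mod_hom A W X"
  shows "compose (carrier W) d h \<in> proj_hom A W Y"
proof -
  obtain P s r where 1: "projective A P" "s \<in> mod_hom A X P" "r \<in> mod_hom A P Y" "d = compose (carrier X) r s"
    using d by (rule proj_homE)
  have "h \<in> carrier W \<rightarrow> carrier X" using hom_closed[OF h] by auto
  then have "compose (carrier W) r (compose (carrier W) s h) = compose (carrier W) d h"
    unfolding 1(4) by (rule compose_assoc)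
  then show ?thesis using proj_homI[OF 1(1) hom_comp[OF W h 1(2)] 1(3)] by simp
qed

lemma proj_hom_neg:
  assumes X: "left_module A X" and Y: "left_module A Y" and d: "d \<in> proj_hom A X Y"
  shows "hneg X Y d \<in> proj_hom A X Y"
proof -
  note dh = proj_hom_hom[OF X d]
  note n = hom_hneg[OF Y Y hom_id[OF Y]]
  have "compose (carrier X) (hneg Y Y (\<lambda>x\<in>carrier Y. x)) d = hneg X Y d"
    using hom_closed[OF dh]
    by (intro hom_eqI[OF hom_comp[OF X dh n] hom_hneg[OF X Y dh]]) (simp add: compose_eq hneg_apply)
  then show ?thesis using proj_hom_comp_left[OF X d n] by simp
qed

text \<open>Equality in the stable category, stated on representatives. All later arguments compute
  with homomorphisms up to \<open>steq\<close> and leave cosets behind.\<close>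

definition steq :: "('a, 'ax) ring_scheme \<Rightarrow> 'a amod \<Rightarrow> 'a amod \<Rightarrow> ((nat \<Rightarrow> 'a) set \<Rightarrow> (nat \<Rightarrow> 'a) set) \<Rightarrow>
    ((nat \<Rightarrow> 'a) set \<Rightarrow> (nat \<Rightarrow> 'a) set) \<Rightarrow> bool" where
  "steq A X Y f g \<longleftrightarrow> f \<in> mod_hom A X Y \<and> g \<in> mod_hom A X Y \<and>
     (\<exists>d\<in>proj_hom A X Y. \<forall>x\<in>carrier X. f x = d x \<oplus>\<^bsub>Y\<^esub> g x)"

lemma steqE:
  assumes "steq A X Y f g"
  obtains d where "f \<in> mod_hom A X Y" "g \<in> mod_hom A X Y" "d \<in> proj_hom A X Y"
    "\<And>x. x \<in> carrier X \<Longrightarrow> f x = d x \<oplus>\<^bsub>Y\<^esub> g x"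
  using assms unfolding steq_def by blast

lemma steqI:
  assumes "f \<in> mod_hom A X Y" "g \<in> mod_hom A X Y" "d \<in> proj_hom A X Y"
    "\<And>x. x \<in> carrier X \<Longrightarrow> f x = d x \<oplus>\<^bsub>Y\<^esub> g x"
  shows "steq A X Y f g"
  using assms unfolding steq_def by blast

lemma steq_hom: "steq A X Y f g \<Longrightarrow> f \<in> mod_hom A X Y" "steq A X Y f g \<Longrightarrow> g \<in> mod_hom A X Y"
  by (simp_all add: steq_def)

lemma steq_refl:
  assumes "artin_algebra k A" "X \<in> fg_modules A" "Y \<in> fg_modules A" "f \<in> mod_hom A X Y"
  shows "steq A X Y f f"
proof -
  interpret Y: left_module A Y by (rule fgD(1)[OF assms(3)])
  show ?thesis using hom_closed[OF assms(4)]
    by (intro steqI[OF assms(4) assms(4) proj_hom_zero[OF assms(1-3)]]) (simp add: hzero_apply)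
qed

lemma steq_sym:
  assumes X: "X \<in> fg_modules A" and Y: "Y \<in> fg_modules A" and fg: "steq A X Y f g"
  shows "steq A X Y g f"
proof -
  note X' = fgD(1)[OF X] and Y' = fgD(1)[OF Y]
  interpret Y: left_module A Y by (rule Y')
  obtain d where d: "f \<in> mod_hom A X Y" "g \<in> mod_hom A X Y" "d \<in> proj_hom A X Y"
    "\<And>x. x \<in> carrier X \<Longrightarrow> f x = d x \<oplus>\<^bsub>Y\<^esub> g x"
    by (rule steqE[OF fg]) (rule that)
  show ?thesis
    using d(4) hom_closed[OF d(2)] hom_closed[OF proj_hom_hom[OF X' d(3)]]
    by (intro steqI[OF d(2,1) proj_hom_neg[OF X' Y' d(3)]]) (simp add: hneg_apply Y.M.r_neg1)
qed

lemma steq_trans: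
  assumes X: "X \<in> fg_modules A" and Y: "Y \<in> fg_modules A" and fg: "steq A X Y f g" and gh: "steq A X Y g h"
  shows "steq A X Y f h"
proof -
  note X' = fgD(1)[OF X] and Y' = fgD(1)[OF Y]
  interpret Y: left_module A Y by (rule Y')
  obtain d where d: "f \<in> mod_hom A X Y" "g \<in> mod_hom A X Y" "d \<in> proj_hom A X Y"
    "\<And>x. x \<in> carrier X \<Longrightarrow> f x = d x \<oplus>\<^bsub>Y\<^esub> g x"
    by (rule steqE[OF fg]) (rule that)
  obtain e where e: "g \<in> mod_hom A X Y" "h \<in> mod_hom A X Y" "e \<in> proj_hom A X Y"
    "\<And>x. x \<in> carrier X \<Longrightarrow> g x = e x \<oplus>\<^bsub>Y\<^esub> h x"
    by (rule steqE[OF gh]) (rule that)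
  show ?thesis
    using d(4) e(4) hom_closed[OF e(2)] hom_closed[OF proj_hom_hom[OF X' d(3)]] hom_closed[OF proj_hom_hom[OF X' e(3)]]
    by (intro steqI[OF d(1) e(2) proj_hom_add[OF X Y d(3) e(3)]]) (simp add: hadd_apply Y.M.a_assoc)
qed

lemma steq_hadd:
  assumes X: "X \<in> fg_modules A" and Y: "Y \<in> fg_modules A" and fg: "steq A X Y f g" and fg': "steq A X Y f' g'"
  shows "steq A X Y (hadd X Y f f') (hadd X Y g g')"
proof -
  note X' = fgD(1)[OF X] and Y' = fgD(1)[OF Y]
  interpret Y: left_module A Y by (rule Y')
  obtain d where d: "f \<in> mod_hom A X Y" "g \<in> mod_hom A X Y" "d \<in> proj_hom A X Y"
    "\<And>x. x \<in> carrier X \<Longrightarrow> f x = d x \<oplus>\<^bsub>Y\<^esub> g x"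
    by (rule steqE[OF fg]) (rule that)
  obtain e where e: "f' \<in> mod_hom A X Y" "g' \<in> mod_hom A X Y" "e \<in> proj_hom A X Y"
    "\<And>x. x \<in> carrier X \<Longrightarrow> f' x = e x \<oplus>\<^bsub>Y\<^esub> g' x"
    by (rule steqE[OF fg']) (rule that)
  show ?thesis
    using d(4) e(4) hom_closed[OF d(2)] hom_closed[OF e(2)]
      hom_closed[OF proj_hom_hom[OF X' d(3)]] hom_closed[OF proj_hom_hom[OF X' e(3)]]
    by (intro steqI[OF hom_hadd[OF X' Y' d(1) e(1)] hom_hadd[OF X' Y' d(2) e(2)] proj_hom_add[OF X Y d(3) e(3)]])
      (simp add: hadd_apply Y.M.a_ac)
qed

lemma steq_comp_left:
  assumes X: "X \<in> fg_modules A" and Y: "Y \<in> fg_modules A" and fg: "steq A X Y f g" and h: "h \<in> mod_hom A Y Z"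
  shows "steq A X Z (compose (carrier X) h f) (compose (carrier X) h g)"
proof -
  note X' = fgD(1)[OF X]
  obtain d where d: "f \<in> mod_hom A X Y" "g \<in> mod_hom A X Y" "d \<in> proj_hom A X Y"
    "\<And>x. x \<in> carrier X \<Longrightarrow> f x = d x \<oplus>\<^bsub>Y\<^esub> g x"
    by (rule steqE[OF fg]) (rule that)
  show ?thesis
    using d(4) hom_closed[OF d(2)] hom_closed[OF proj_hom_hom[OF X' d(3)]]
    by (intro steqI[OF hom_comp[OF X' d(1) h] hom_comp[OF X' d(2) h] proj_hom_comp_left[OF X' d(3) h]])
      (simp add: compose_eq hom_add[OF h])
qed

lemma steq_comp_right:
  assumes W: "W \<in> fg_modules A" and X: "X \<in> fg_modules A" and fg: "steq A X Y f g" and h: "h \<in> mod_hom A W X"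
  shows "steq A W Y (compose (carrier W) f h) (compose (carrier W) g h)"
proof -
  note W' = fgD(1)[OF W]
  obtain d where d: "f \<in> mod_hom A X Y" "g \<in> mod_hom A X Y" "d \<in> proj_hom A X Y"
    "\<And>x. x \<in> carrier X \<Longrightarrow> f x = d x \<oplus>\<^bsub>Y\<^esub> g x"
    by (rule steqE[OF fg]) (rule that)
  show ?thesis
    using d(4) hom_closed[OF h]
    by (intro steqI[OF hom_comp[OF W' h d(1)] hom_comp[OF W' h d(2)] proj_hom_comp_right[OF W' d(3) h]])
      (simp add: compose_eq)
qed

lemma steq_comp:
  assumes X: "X \<in> fg_modules A" and Y: "Y \<in> fg_modules A" and Z: "Z \<in> fg_modules A"
    and fg: "steq A X Y f f'" and h: "steq A Y Z g g'"
  shows "steq A X Z (compose (carrier X) g f) (compose (carrier X) g' f')"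
  by (rule steq_trans[OF X Z steq_comp_left[OF X Y fg steq_hom(1)[OF h]] steq_comp_right[OF X Y h steq_hom(2)[OF fg]]])

lemma comp_assoc:
  assumes "f \<in> mod_hom A W X"
  shows "compose (carrier W) h (compose (carrier W) g f) = compose (carrier W) (compose (carrier X) h g) f"
  using hom_closed[OF assms] by (intro compose_assoc) auto

lemma comp_id_right: "f \<in> mod_hom A X Y \<Longrightarrow> compose (carrier X) f (\<lambda>x\<in>carrier X. x) = f"
  using hom_ext[of f A X Y] by (auto simp: compose_def fun_eq_iff extensional_def)

lemma comp_id_left: "f \<in> mod_hom A X Y \<Longrightarrow> compose (carrier X) (\<lambda>y\<in>carrier Y. y) f = f"
  using hom_ext[of f A X Y] hom_closed[of f A X Y] by (auto simp: compose_def fun_eq_iff extensional_def)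

section \<open>Stable equivalences on representatives\<close>

text \<open>The bridge from the cosets of the stable category to \<open>steq\<close>: both describe
  the maps that differ from \<open>f\<close> by one factoring through a projective.\<close>

lemma stable_class_eq:
  fixes A :: "('k, 'a) module"
  assumes X: "X \<in> fg_modules A" and Y: "Y \<in> fg_modules A" and f: "f \<in> mod_hom A X Y"
  shows "stable_class A X Y f = {g. steq A X Y g f}"
proof -
  note X' = fgD(1)[OF X] and Y' = fgD(1)[OF Y]
  have "stable_class A X Y f = (\<lambda>d. hadd X Y d f) ` proj_hom A X Y"
    by (auto simp: stable_class_def a_r_coset_def' hom_module_def hadd_def)
  also have "\<dots> = {g. steq A X Y g f}"
  proof (intro equalityI subsetI)
    fix g assume "g \<in> (\<lambda>d. hadd X Y d f) ` proj_hom A X Y"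
    then obtain d where d: "d \<in> proj_hom A X Y" "g = hadd X Y d f" by blast
    show "g \<in> {g. steq A X Y g f}" unfolding d(2) mem_Collect_eq
      by (rule steqI[OF hom_hadd[OF X' Y' proj_hom_hom[OF X' d(1)] f] f d(1)]) (simp add: hadd_apply)
  next
    fix g assume "g \<in> {g. steq A X Y g f}"
    then have "steq A X Y g f" by simp
    then obtain d where d: "g \<in> mod_hom A X Y" "d \<in> proj_hom A X Y" "\<And>x. x \<in> carrier X \<Longrightarrow> g x = d x \<oplus>\<^bsub>Y\<^esub> f x"
      by (rule steqE) (rule that)
    have "g = hadd X Y d f"
      by (rule hom_eqI[OF d(1) hom_hadd[OF X' Y' proj_hom_hom[OF X' d(2)] f]]) (simp add: d(3) hadd_apply)
    then show "g \<in> (\<lambda>d. hadd X Y d f) ` proj_hom A X Y" using d(2) by blast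
  qed
  finally show ?thesis .
qed

lemma stable_class_eq_iff:
  assumes AA: "artin_algebra k A" and X: "X \<in> fg_modules A" and Y: "Y \<in> fg_modules A"
    and f: "f \<in> mod_hom A X Y" and g: "g \<in> mod_hom A X Y"
  shows "stable_class A X Y f = stable_class A X Y g \<longleftrightarrow> steq A X Y f g"
proof
  assume eq: "stable_class A X Y f = stable_class A X Y g"
  have "f \<in> stable_class A X Y f" using steq_refl[OF AA X Y f] by (simp add: stable_class_eq[OF X Y f])
  then show "steq A X Y f g" unfolding eq by (simp add: stable_class_eq[OF X Y g])
next
  assume "steq A X Y f g"
  then show "stable_class A X Y f = stable_class A X Y g"
    unfolding stable_class_eq[OF X Y f] stable_class_eq[OF X Y g]
    using steq_trans[OF X Y] steq_sym[OF X Y] by blast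
qed

lemma stable_hom_carrier: "carrier (Hom (stable_cat A) X Y) = stable_class A X Y ` mod_hom A X Y"
  by (auto simp: stable_cat_def stable_hom_def stable_class_def A_RCOSETS_def' hom_module_def)

lemma stable_obj: "Obj (stable_cat A) = fg_modules A"
  by (simp add: stable_cat_def)

lemma stable_ident: "Ident (stable_cat A) X = stable_class A X X (\<lambda>x\<in>carrier X. x)"
  by (simp add: stable_cat_def)

lemma stable_hom_add:
  fixes A :: "('k, 'a) module"
  assumes AA: "artin_algebra k A" and X: "X \<in> fg_modules A" and Y: "Y \<in> fg_modules A"
    and f: "f \<in> mod_hom A X Y" and g: "g \<in> mod_hom A X Y"
  shows "stable_class A X Y f \<oplus>\<^bsub>Hom (stable_cat A) X Y\<^esub> stable_class A X Y g = stable_class A X Y (hadd X Y f g)"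
proof -
  note X' = fgD(1)[OF X] and Y' = fgD(1)[OF Y]
  have fg: "hadd X Y f g \<in> mod_hom A X Y" by (rule hom_hadd[OF X' Y' f g])
  have "stable_class A X Y f \<oplus>\<^bsub>Hom (stable_cat A) X Y\<^esub> stable_class A X Y g =
    {hadd X Y u v | u v. steq A X Y u f \<and> steq A X Y v g}"
    unfolding stable_class_eq[OF X Y f] stable_class_eq[OF X Y g]
    by (auto simp: stable_cat_def stable_hom_def set_add_def' hom_module_def hadd_def)
  also have "\<dots> = {h. steq A X Y h (hadd X Y f g)}"
  proof (intro equalityI subsetI)
    fix h assume "h \<in> {h. steq A X Y h (hadd X Y f g)}"
    then have "steq A X Y h (hadd X Y f g)" by simp
    then obtain d where d: "h \<in> mod_hom A X Y" "d \<in> proj_hom A X Y"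
      "\<And>x. x \<in> carrier X \<Longrightarrow> h x = d x \<oplus>\<^bsub>Y\<^esub> hadd X Y f g x"
      by (rule steqE) (rule that)
    interpret Y: left_module A Y by (rule Y')
    note dh = proj_hom_hom[OF X' d(2)]
    note [simp] = hom_closed[OF dh] hom_closed[OF f] hom_closed[OF g]
    \<comment> \<open>The projective difference \<open>d\<close> is absorbed into the first summand,
      so every member of the coset of the sum is a sum of members of the two cosets.\<close>
    have "h = hadd X Y (hadd X Y d f) g"
      by (rule hom_eqI[OF d(1)]) (auto intro!: hom_hadd X' Y' dh f g simp: d(3) hadd_apply Y.M.a_assoc)
    moreover have "steq A X Y (hadd X Y d f) f"
      by (auto intro!: steqI[OF _ f d(2)] hom_hadd X' Y' f dh simp: hadd_apply)
    ultimately show "h \<in> {hadd X Y u v | u v. steq A X Y u f \<and> steq A X Y v g}"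
      using steq_refl[OF AA X Y g] by blast
  next
    fix h assume "h \<in> {hadd X Y u v | u v. steq A X Y u f \<and> steq A X Y v g}"
    then show "h \<in> {h. steq A X Y h (hadd X Y f g)}" using steq_hadd[OF X Y] by blast
  qed
  finally show ?thesis unfolding stable_class_eq[OF X Y fg] .
qed

lemma stable_comp:
  fixes A :: "('k, 'a) module"
  assumes AA: "artin_algebra k A" and X: "X \<in> fg_modules A" and Y: "Y \<in> fg_modules A" and Z: "Z \<in> fg_modules A"
    and f: "f \<in> mod_hom A X Y" and g: "g \<in> mod_hom A Y Z"
  shows "Comp (stable_cat A) X Y Z (stable_class A Y Z g) (stable_class A X Y f) =
    stable_class A X Z (compose (carrier X) g f)"
proof -
  have gf: "compose (carrier X) g f \<in> mod_hom A X Z" by (rule hom_comp[OF fgD(1)[OF X] f g])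
  have eq: "stable_class A X Z (compose (carrier X) g' f') = stable_class A X Z (compose (carrier X) g f)"
    if "g' \<in> stable_class A Y Z g" "f' \<in> stable_class A X Y f" for g' f'
  proof -
    have "steq A Y Z g' g" "steq A X Y f' f"
      using that by (simp_all add: stable_class_eq[OF Y Z g] stable_class_eq[OF X Y f])
    from steq_comp[OF X Y Z this(2,1)] show ?thesis
      using stable_class_eq_iff[OF AA X Z _ gf] steq_hom(1) by blast
  qed
  have mem: "g \<in> stable_class A Y Z g" "f \<in> stable_class A X Y f"
    using steq_refl[OF AA Y Z g] steq_refl[OF AA X Y f]
    by (simp_all add: stable_class_eq[OF Y Z g] stable_class_eq[OF X Y f])
  have "Comp (stable_cat A) X Y Z (stable_class A Y Z g) (stable_class A X Y f) =
    (\<Union>g'\<in>stable_class A Y Z g. \<Union>f'\<in>stable_class A X Y f. stable_class A X Z (compose (carrier X) g' f'))"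
    by (simp add: stable_cat_def)
  also have "\<dots> = (\<Union>g'\<in>stable_class A Y Z g. \<Union>f'\<in>stable_class A X Y f. stable_class A X Z (compose (carrier X) g f))"
    by (intro SUP_cong refl eq)
  also have "\<dots> = stable_class A X Z (compose (carrier X) g f)" using mem by blast
  finally show ?thesis .
qed

text \<open>A functor between stable categories in terms of homomorphisms. \<open>Fm\<close> picks
  one representative of each value, so additivity, identities and composition can hold only up to
  \<open>steq\<close>.\<close>

definition stable_functor :: "('a, 'ax) ring_scheme \<Rightarrow> ('b, 'bx) ring_scheme \<Rightarrow> ('a amod \<Rightarrow> 'b amod) \<Rightarrow>
    ('a amod \<Rightarrow> 'a amod \<Rightarrow> ((nat \<Rightarrow> 'a) set \<Rightarrow> (nat \<Rightarrow> 'a) set) \<Rightarrow> ((nat \<Rightarrow> 'b) set \<Rightarrow> (nat \<Rightarrow> 'b) set)) \<Rightarrow> bool" where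
  "stable_functor A B Fo Fm \<longleftrightarrow>
    (\<forall>X\<in>fg_modules A. Fo X \<in> fg_modules B) \<and>
    (\<forall>X\<in>fg_modules A. \<forall>Y\<in>fg_modules A. \<forall>f\<in>mod_hom A X Y. Fm X Y f \<in> mod_hom B (Fo X) (Fo Y)) \<and>
    (\<forall>X\<in>fg_modules A. \<forall>Y\<in>fg_modules A. \<forall>f g. steq A X Y f g \<longrightarrow> steq B (Fo X) (Fo Y) (Fm X Y f) (Fm X Y g)) \<and>
    (\<forall>X\<in>fg_modules A. \<forall>Y\<in>fg_modules A. \<forall>f\<in>mod_hom A X Y. \<forall>g\<in>mod_hom A X Y.
      steq B (Fo X) (Fo Y) (Fm X Y (hadd X Y f g)) (hadd (Fo X) (Fo Y) (Fm X Y f) (Fm X Y g))) \<and>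
    (\<forall>X\<in>fg_modules A. steq B (Fo X) (Fo X) (Fm X X (\<lambda>x\<in>carrier X. x)) (\<lambda>x\<in>carrier (Fo X). x)) \<and>
    (\<forall>X\<in>fg_modules A. \<forall>Y\<in>fg_modules A. \<forall>Z\<in>fg_modules A. \<forall>f\<in>mod_hom A X Y. \<forall>g\<in>mod_hom A Y Z.
      steq B (Fo X) (Fo Z) (Fm X Z (compose (carrier X) g f)) (compose (carrier (Fo X)) (Fm Y Z g) (Fm X Y f)))"

lemma stable_functorD:
  assumes "stable_functor A B Fo Fm" "X \<in> fg_modules A"
  shows "Fo X \<in> fg_modules B"
    "\<And>Y f. Y \<in> fg_modules A \<Longrightarrow> f \<in> mod_hom A X Y \<Longrightarrow> Fm X Y f \<in> mod_hom B (Fo X) (Fo Y)"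
    "\<And>Y f g. Y \<in> fg_modules A \<Longrightarrow> steq A X Y f g \<Longrightarrow> steq B (Fo X) (Fo Y) (Fm X Y f) (Fm X Y g)"
    "\<And>Y f g. Y \<in> fg_modules A \<Longrightarrow> f \<in> mod_hom A X Y \<Longrightarrow> g \<in> mod_hom A X Y \<Longrightarrow>
      steq B (Fo X) (Fo Y) (Fm X Y (hadd X Y f g)) (hadd (Fo X) (Fo Y) (Fm X Y f) (Fm X Y g))"
    "steq B (Fo X) (Fo X) (Fm X X (\<lambda>x\<in>carrier X. x)) (\<lambda>x\<in>carrier (Fo X). x)"
    "\<And>Y Z f g. Y \<in> fg_modules A \<Longrightarrow> Z \<in> fg_modules A \<Longrightarrow> f \<in> mod_hom A X Y \<Longrightarrow> g \<in> mod_hom A Y Z \<Longrightarrow>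
      steq B (Fo X) (Fo Z) (Fm X Z (compose (carrier X) g f)) (compose (carrier (Fo X)) (Fm Y Z g) (Fm X Y f))"
  using assms unfolding stable_functor_def by blast+

text \<open>\<open>Fm X Y f\<close> is any representative of the value of the functor on the class
  of \<open>f\<close>. Equality of classes and \<open>steq\<close> of representatives are
  equivalent, so each law for \<open>F\<close> becomes a law for \<open>Fm\<close>.\<close>

lemma functor_representatives:
  fixes A :: "('k, 'a) module" and B :: "('k, 'b) module"
  assumes AA: "artin_algebra k A" and BB: "artin_algebra k B" and F: "k_functor k (stable_cat A) (stable_cat B) F"
  obtains Fm where "stable_functor A B (omap F) Fm"
    "\<And>X Y f. X \<in> fg_modules A \<Longrightarrow> Y \<in> fg_modules A \<Longrightarrow> f \<in> mod_hom A X Y \<Longrightarrow>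
      amap F X Y (stable_class A X Y f) = stable_class B (omap F X) (omap F Y) (Fm X Y f)"
proof -
  let ?o = "omap F"
  note F = F[unfolded k_functor_def stable_obj stable_hom_carrier stable_ident]
  have obj: "?o X \<in> fg_modules B" if "X \<in> fg_modules A" for X by (rule F[THEN conjunct1, rule_format, OF that])
  have F1: "amap F X Y (stable_class A X Y f) \<in> stable_class B (?o X) (?o Y) ` mod_hom B (?o X) (?o Y)"
    if "X \<in> fg_modules A" "Y \<in> fg_modules A" "f \<in> mod_hom A X Y" for X Y f
    by (rule F[THEN conjunct2, THEN conjunct1, rule_format, OF that(1,2) imageI[OF that(3)]])
  have F2: "amap F X Y (stable_class A X Y f \<oplus>\<^bsub>Hom (stable_cat A) X Y\<^esub> stable_class A X Y g) =
     amap F X Y (stable_class A X Y f) \<oplus>\<^bsub>Hom (stable_cat B) (?o X) (?o Y)\<^esub> amap F X Y (stable_class A X Y g)"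
    if "X \<in> fg_modules A" "Y \<in> fg_modules A" "f \<in> mod_hom A X Y" "g \<in> mod_hom A X Y" for X Y f g
    by (rule F[THEN conjunct2, THEN conjunct2, THEN conjunct1, rule_format, OF that(1,2) imageI[OF that(3)] imageI[OF that(4)]])
  have F3: "amap F X X (stable_class A X X (\<lambda>x\<in>carrier X. x)) = stable_class B (?o X) (?o X) (\<lambda>x\<in>carrier (?o X). x)"
    if "X \<in> fg_modules A" for X
    by (rule F[THEN conjunct2, THEN conjunct2, THEN conjunct2, THEN conjunct2, THEN conjunct1, rule_format, OF that])
  have F4: "amap F X Z (Comp (stable_cat A) X Y Z (stable_class A Y Z g) (stable_class A X Y f)) =
     Comp (stable_cat B) (?o X) (?o Y) (?o Z) (amap F Y Z (stable_class A Y Z g)) (amap F X Y (stable_class A X Y f))"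
    if "X \<in> fg_modules A" "Y \<in> fg_modules A" "Z \<in> fg_modules A" "f \<in> mod_hom A X Y" "g \<in> mod_hom A Y Z" for X Y Z f g
    by (rule F[THEN conjunct2, THEN conjunct2, THEN conjunct2, THEN conjunct2, THEN conjunct2, rule_format, OF that(1-3) imageI[OF that(4)] imageI[OF that(5)]])
  define Fm where "Fm X Y f = (SOME g. g \<in> mod_hom B (?o X) (?o Y) \<and>
     amap F X Y (stable_class A X Y f) = stable_class B (?o X) (?o Y) g)" for X Y f
  have Fm: "Fm X Y f \<in> mod_hom B (?o X) (?o Y) \<and>
     amap F X Y (stable_class A X Y f) = stable_class B (?o X) (?o Y) (Fm X Y f)"
    if XYf: "X \<in> fg_modules A" "Y \<in> fg_modules A" "f \<in> mod_hom A X Y" for X Y f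
  proof -
    obtain g where "amap F X Y (stable_class A X Y f) = stable_class B (?o X) (?o Y) g" "g \<in> mod_hom B (?o X) (?o Y)"
      using F1[OF XYf] by (rule imageE)
    then have "g \<in> mod_hom B (?o X) (?o Y) \<and> amap F X Y (stable_class A X Y f) = stable_class B (?o X) (?o Y) g"
      by simp
    from someI[where P = "\<lambda>g. g \<in> mod_hom B (?o X) (?o Y) \<and>
        amap F X Y (stable_class A X Y f) = stable_class B (?o X) (?o Y) g", OF this]
    show ?thesis unfolding Fm_def .
  qed
  note Fh = Fm[THEN conjunct1] and Fc = Fm[THEN conjunct2]
  have "stable_functor A B ?o Fm"
    unfolding stable_functor_def
  proof (intro conjI ballI allI impI obj Fh)
    fix X Y f g assume X: "X \<in> fg_modules A" and Y: "Y \<in> fg_modules A" and fg: "steq A X Y f g"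
    note f = steq_hom(1)[OF fg] and g = steq_hom(2)[OF fg]
    have "stable_class A X Y f = stable_class A X Y g" using stable_class_eq_iff[OF AA X Y f g] fg by simp
    then have "stable_class B (?o X) (?o Y) (Fm X Y f) = stable_class B (?o X) (?o Y) (Fm X Y g)"
      unfolding Fc[OF X Y f, symmetric] Fc[OF X Y g, symmetric] by (rule arg_cong)
    then show "steq B (?o X) (?o Y) (Fm X Y f) (Fm X Y g)"
      using stable_class_eq_iff[OF BB obj[OF X] obj[OF Y] Fh[OF X Y f] Fh[OF X Y g]] by simp
  next
    fix X Y f g assume X: "X \<in> fg_modules A" and Y: "Y \<in> fg_modules A" and f: "f \<in> mod_hom A X Y" and g: "g \<in> mod_hom A X Y"
    note fg = hom_hadd[OF fgD(1)[OF X] fgD(1)[OF Y] f g]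
    note Ffg = hom_hadd[OF fgD(1)[OF obj[OF X]] fgD(1)[OF obj[OF Y]] Fh[OF X Y f] Fh[OF X Y g]]
    have "stable_class B (?o X) (?o Y) (Fm X Y (hadd X Y f g)) = stable_class B (?o X) (?o Y) (hadd (?o X) (?o Y) (Fm X Y f) (Fm X Y g))"
      unfolding Fc[OF X Y fg, symmetric] stable_hom_add[OF AA X Y f g, symmetric] F2[OF X Y f g] Fc[OF X Y f] Fc[OF X Y g]
      by (rule stable_hom_add[OF BB obj[OF X] obj[OF Y] Fh[OF X Y f] Fh[OF X Y g]])
    then show "steq B (?o X) (?o Y) (Fm X Y (hadd X Y f g)) (hadd (?o X) (?o Y) (Fm X Y f) (Fm X Y g))"
      using stable_class_eq_iff[OF BB obj[OF X] obj[OF Y] Fh[OF X Y fg] Ffg] by simp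
  next
    fix X assume X: "X \<in> fg_modules A"
    note i = hom_id[OF fgD(1)[OF X]] and j = hom_id[OF fgD(1)[OF obj[OF X]]]
    show "steq B (?o X) (?o X) (Fm X X (\<lambda>x\<in>carrier X. x)) (\<lambda>x\<in>carrier (?o X). x)"
      using stable_class_eq_iff[OF BB obj[OF X] obj[OF X] Fh[OF X X i] j] F3[OF X] Fc[OF X X i] by simp
  next
    fix X Y Z f g assume X: "X \<in> fg_modules A" and Y: "Y \<in> fg_modules A" and Z: "Z \<in> fg_modules A"
      and f: "f \<in> mod_hom A X Y" and g: "g \<in> mod_hom A Y Z"
    note gf = hom_comp[OF fgD(1)[OF X] f g] and Fgf = hom_comp[OF fgD(1)[OF obj[OF X]] Fh[OF X Y f] Fh[OF Y Z g]]
    have "stable_class B (?o X) (?o Z) (Fm X Z (compose (carrier X) g f)) =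
       stable_class B (?o X) (?o Z) (compose (carrier (?o X)) (Fm Y Z g) (Fm X Y f))"
      unfolding Fc[OF X Z gf, symmetric] stable_comp[OF AA X Y Z f g, symmetric] F4[OF X Y Z f g] Fc[OF X Y f] Fc[OF Y Z g]
      by (rule stable_comp[OF BB obj[OF X] obj[OF Y] obj[OF Z] Fh[OF X Y f] Fh[OF Y Z g]])
    then show "steq B (?o X) (?o Z) (Fm X Z (compose (carrier X) g f)) (compose (carrier (?o X)) (Fm Y Z g) (Fm X Y f))"
      using stable_class_eq_iff[OF BB obj[OF X] obj[OF Z] Fh[OF X Z gf] Fgf] by simp
  qed
  then show thesis using Fc by (rule that)
qed

lemma natural_iso_representatives:
  fixes A :: "('k, 'a) module" and B :: "('k, 'b) module"
  assumes AA: "artin_algebra k A" and F: "stable_functor A B (omap F) Fm" and G: "stable_functor B A (omap G) Gm"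
    and Fc: "\<And>X Y f. X \<in> fg_modules A \<Longrightarrow> Y \<in> fg_modules A \<Longrightarrow> f \<in> mod_hom A X Y \<Longrightarrow>
      amap F X Y (stable_class A X Y f) = stable_class B (omap F X) (omap F Y) (Fm X Y f)"
    and Gc: "\<And>X Y f. X \<in> fg_modules B \<Longrightarrow> Y \<in> fg_modules B \<Longrightarrow> f \<in> mod_hom B X Y \<Longrightarrow>
      amap G X Y (stable_class B X Y f) = stable_class A (omap G X) (omap G Y) (Gm X Y f)"
    and iso: "naturally_isomorphic (stable_cat A) (stable_cat A) (comp_functor G F) id_functor"
  obtains s t where
    "\<And>X. X \<in> fg_modules A \<Longrightarrow> s X \<in> mod_hom A (omap G (omap F X)) X"
    "\<And>X. X \<in> fg_modules A \<Longrightarrow> t X \<in> mod_hom A X (omap G (omap F X))"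
    "\<And>X. X \<in> fg_modules A \<Longrightarrow> steq A (omap G (omap F X)) (omap G (omap F X))
       (compose (carrier (omap G (omap F X))) (t X) (s X)) (\<lambda>x\<in>carrier (omap G (omap F X)). x)"
    "\<And>X. X \<in> fg_modules A \<Longrightarrow> steq A X X (compose (carrier X) (s X) (t X)) (\<lambda>x\<in>carrier X. x)"
    "\<And>X Y f. X \<in> fg_modules A \<Longrightarrow> Y \<in> fg_modules A \<Longrightarrow> f \<in> mod_hom A X Y \<Longrightarrow>
      steq A (omap G (omap F X)) Y (compose (carrier (omap G (omap F X))) (s Y) (Gm (omap F X) (omap F Y) (Fm X Y f)))
        (compose (carrier (omap G (omap F X))) f (s X))"
proof -
  let ?H = "\<lambda>X. omap G (omap F X)"
  have obj: "?H X \<in> fg_modules A" "omap F X \<in> fg_modules B" if "X \<in> fg_modules A" for X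
    using stable_functorD(1)[OF F that] stable_functorD(1)[OF G] by auto
  obtain \<eta> where e: "(\<forall>X\<in>fg_modules A. cat_iso (stable_cat A) (?H X) X (\<eta> X)) \<and>
      (\<forall>X\<in>fg_modules A. \<forall>Y\<in>fg_modules A. \<forall>f\<in>stable_class A X Y ` mod_hom A X Y.
       Comp (stable_cat A) (?H X) (?H Y) Y (\<eta> Y) (amap G (omap F X) (omap F Y) (amap F X Y f)) =
       Comp (stable_cat A) (?H X) X Y f (\<eta> X))"
    using iso unfolding naturally_isomorphic_def stable_obj stable_hom_carrier comp_functor_def id_functor_def cat_map.simps
    by (elim exE)
  note e1 = e[THEN conjunct1, rule_format] and e2 = e[THEN conjunct2, rule_format]
  have "\<exists>s t. s \<in> mod_hom A (?H X) X \<and> t \<in> mod_hom A X (?H X) \<and> \<eta> X = stable_class A (?H X) X s \<and>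
      steq A (?H X) (?H X) (compose (carrier (?H X)) t s) (\<lambda>x\<in>carrier (?H X). x) \<and>
      steq A X X (compose (carrier X) s t) (\<lambda>x\<in>carrier X. x)" if X: "X \<in> fg_modules A" for X
  proof -
    note HX = obj(1)[OF X]
    obtain s where s: "s \<in> mod_hom A (?H X) X" "\<eta> X = stable_class A (?H X) X s"
      using e1[OF X] unfolding cat_iso_def stable_hom_carrier by blast
    obtain t where t: "t \<in> mod_hom A X (?H X)"
      "Comp (stable_cat A) (?H X) X (?H X) (stable_class A X (?H X) t) (\<eta> X) = stable_class A (?H X) (?H X) (\<lambda>x\<in>carrier (?H X). x)"
      "Comp (stable_cat A) X (?H X) X (\<eta> X) (stable_class A X (?H X) t) = stable_class A X X (\<lambda>x\<in>carrier X. x)"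
      using e1[OF X] unfolding cat_iso_def stable_hom_carrier stable_ident by blast
    note X' = fgD(1)[OF X] and HX' = fgD(1)[OF HX]
    have "steq A (?H X) (?H X) (compose (carrier (?H X)) t s) (\<lambda>x\<in>carrier (?H X). x)"
      using t(2) unfolding s(2) stable_comp[OF AA HX X HX s(1) t(1)]
        stable_class_eq_iff[OF AA HX HX hom_comp[OF HX' s(1) t(1)] hom_id[OF HX']] .
    moreover have "steq A X X (compose (carrier X) s t) (\<lambda>x\<in>carrier X. x)"
      using t(3) unfolding s(2) stable_comp[OF AA X HX X t(1) s(1)]
        stable_class_eq_iff[OF AA X X hom_comp[OF X' t(1) s(1)] hom_id[OF X']] .
    ultimately show ?thesis using s t(1) by blast
  qed
  then obtain s t where st: "\<And>X. X \<in> fg_modules A \<Longrightarrow> s X \<in> mod_hom A (?H X) X \<and> t X \<in> mod_hom A X (?H X) \<and>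
      \<eta> X = stable_class A (?H X) X (s X) \<and>
      steq A (?H X) (?H X) (compose (carrier (?H X)) (t X) (s X)) (\<lambda>x\<in>carrier (?H X). x) \<and>
      steq A X X (compose (carrier X) (s X) (t X)) (\<lambda>x\<in>carrier X. x)"
    by metis
  have "steq A (?H X) Y (compose (carrier (?H X)) (s Y) (Gm (omap F X) (omap F Y) (Fm X Y f)))
      (compose (carrier (?H X)) f (s X))"
    if X: "X \<in> fg_modules A" and Y: "Y \<in> fg_modules A" and f: "f \<in> mod_hom A X Y" for X Y f
  proof -
    note sX = st[OF X, THEN conjunct1] and sY = st[OF Y, THEN conjunct1]
    note eX = st[OF X, THEN conjunct2, THEN conjunct2, THEN conjunct1] and eY = st[OF Y, THEN conjunct2, THEN conjunct2, THEN conjunct1]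
    note Ff = stable_functorD(2)[OF F X Y f]
    note GFf = stable_functorD(2)[OF G obj(2)[OF X] obj(2)[OF Y] Ff]
    have "stable_class A (?H X) Y (compose (carrier (?H X)) (s Y) (Gm (omap F X) (omap F Y) (Fm X Y f))) =
       stable_class A (?H X) Y (compose (carrier (?H X)) f (s X))"
      using e2[OF X Y imageI[OF f]]
      unfolding Fc[OF X Y f] Gc[OF obj(2)[OF X] obj(2)[OF Y] Ff] eX eY
        stable_comp[OF AA obj(1)[OF X] obj(1)[OF Y] Y GFf sY] stable_comp[OF AA obj(1)[OF X] X Y sX f] .
    then show ?thesis
      using stable_class_eq_iff[OF AA obj(1)[OF X] Y hom_comp[OF fgD(1)[OF obj(1)[OF X]] GFf sY]
        hom_comp[OF fgD(1)[OF obj(1)[OF X]] sX f]] by simp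
  qed
  then show thesis using that[of s t] st by blast
qed

text \<open>Faithful, full and dense on representatives. Density is given in the form in which it is
  applied: every \<open>V\<close> is a stable retract of some value of the functor.\<close>

definition stable_equivalence :: "('a, 'ax) ring_scheme \<Rightarrow> ('b, 'bx) ring_scheme \<Rightarrow> ('a amod \<Rightarrow> 'b amod) \<Rightarrow>
    ('a amod \<Rightarrow> 'a amod \<Rightarrow> ((nat \<Rightarrow> 'a) set \<Rightarrow> (nat \<Rightarrow> 'a) set) \<Rightarrow> ((nat \<Rightarrow> 'b) set \<Rightarrow> (nat \<Rightarrow> 'b) set)) \<Rightarrow> bool" where
  "stable_equivalence A B Fo Fm \<longleftrightarrow> stable_functor A B Fo Fm \<and>
    (\<forall>X\<in>fg_modules A. \<forall>Y\<in>fg_modules A. \<forall>f\<in>mod_hom A X Y. \<forall>g\<in>mod_hom A X Y.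
      steq B (Fo X) (Fo Y) (Fm X Y f) (Fm X Y g) \<longrightarrow> steq A X Y f g) \<and>
    (\<forall>X\<in>fg_modules A. \<forall>Y\<in>fg_modules A. \<forall>h\<in>mod_hom B (Fo X) (Fo Y).
      \<exists>f\<in>mod_hom A X Y. steq B (Fo X) (Fo Y) (Fm X Y f) h) \<and>
    (\<forall>Y\<in>fg_modules B. \<exists>X\<in>fg_modules A. \<exists>s\<in>mod_hom B (Fo X) Y. \<exists>t\<in>mod_hom B Y (Fo X).
      steq B Y Y (compose (carrier Y) s t) (\<lambda>y\<in>carrier Y. y))"

text \<open>By naturality \<open>f \<sim> f s t \<sim> s (G F f) t\<close>, so the stable class of
  \<open>f\<close> is recovered from that of \<open>F f\<close>. With the functors exchanged the
  same argument gives faithfulness of \<open>G\<close>.\<close>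

lemma faithful_of_natural_iso:
  assumes AA: "artin_algebra k A"
    and F: "stable_functor A B Fo Fm" and G: "stable_functor B A Go Gm"
    and s: "\<And>X. X \<in> fg_modules A \<Longrightarrow> s X \<in> mod_hom A (Go (Fo X)) X"
    and t: "\<And>X. X \<in> fg_modules A \<Longrightarrow> t X \<in> mod_hom A X (Go (Fo X))"
    and st: "\<And>X. X \<in> fg_modules A \<Longrightarrow> steq A X X (compose (carrier X) (s X) (t X)) (\<lambda>x\<in>carrier X. x)"
    and nat: "\<And>X Y f. X \<in> fg_modules A \<Longrightarrow> Y \<in> fg_modules A \<Longrightarrow> f \<in> mod_hom A X Y \<Longrightarrow>
      steq A (Go (Fo X)) Y (compose (carrier (Go (Fo X))) (s Y) (Gm (Fo X) (Fo Y) (Fm X Y f)))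
        (compose (carrier (Go (Fo X))) f (s X))"
    and X: "X \<in> fg_modules A" and Y: "Y \<in> fg_modules A" and f: "f \<in> mod_hom A X Y" and g: "g \<in> mod_hom A X Y"
    and eq: "steq B (Fo X) (Fo Y) (Fm X Y f) (Fm X Y g)"
  shows "steq A X Y f g"
proof -
  note FX = stable_functorD(1)[OF F X] and FY = stable_functorD(1)[OF F Y]
  note H = stable_functorD(1)[OF G FX] and HY = stable_functorD(1)[OF G FY]
  let ?H = "carrier (Go (Fo X))"
  have *: "steq A X Y u (compose (carrier X) (compose ?H (s Y) (Gm (Fo X) (Fo Y) (Fm X Y u))) (t X))"
    if u: "u \<in> mod_hom A X Y" for u
  proof -
    have "steq A X Y (compose (carrier X) u (compose (carrier X) (s X) (t X))) (compose (carrier X) u (\<lambda>x\<in>carrier X. x))"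
      by (rule steq_comp_left[OF X X st[OF X] u])
    then have "steq A X Y (compose (carrier X) (compose ?H u (s X)) (t X)) u"
      unfolding comp_id_right[OF u] comp_assoc[OF t[OF X]] .
    then have 1: "steq A X Y u (compose (carrier X) (compose ?H u (s X)) (t X))" by (rule steq_sym[OF X Y])
    have 2: "steq A X Y (compose (carrier X) (compose ?H u (s X)) (t X))
       (compose (carrier X) (compose ?H (s Y) (Gm (Fo X) (Fo Y) (Fm X Y u))) (t X))"
      by (rule steq_comp_right[OF X H steq_sym[OF H Y nat[OF X Y u]] t[OF X]])
    show ?thesis by (rule steq_trans[OF X Y 1 2])
  qed
  have "steq A X Y (compose (carrier X) (compose ?H (s Y) (Gm (Fo X) (Fo Y) (Fm X Y f))) (t X))
     (compose (carrier X) (compose ?H (s Y) (Gm (Fo X) (Fo Y) (Fm X Y g))) (t X))"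
    by (rule steq_comp_right[OF X H steq_comp_left[OF H HY stable_functorD(3)[OF G FX FY eq] s[OF Y]] t[OF X]])
  from steq_trans[OF X Y *[OF f] steq_trans[OF X Y this steq_sym[OF X Y *[OF g]]]] show ?thesis .
qed

text \<open>Fullness: for \<open>h\<close> between values of \<open>F\<close> put
  \<open>f = s (G h) t\<close>. Cancelling the stable isomorphisms \<open>s\<close> and
  \<open>t\<close> in the naturality square gives \<open>G F f \<sim> G h\<close>, and
  \<open>G\<close> is faithful, so \<open>F f \<sim> h\<close>. Density is witnessed by
  \<open>G V\<close> and the second natural isomorphism.\<close>

theorem stable_equivalence_exists:
  fixes A :: "('k, 'a) module" and B :: "('k, 'b) module"
  assumes AA: "artin_algebra k A" and BB: "artin_algebra k B" and AB: "stably_equivalent k A B"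
  obtains Fo Fm where "stable_equivalence A B Fo Fm"
proof -
  obtain F G where F: "k_functor k (stable_cat A) (stable_cat B) F" and G: "k_functor k (stable_cat B) (stable_cat A) G"
    and GF: "naturally_isomorphic (stable_cat A) (stable_cat A) (comp_functor G F) id_functor"
    and FG: "naturally_isomorphic (stable_cat B) (stable_cat B) (comp_functor F G) id_functor"
    using AB unfolding stably_equivalent_def k_equivalent_def by blast
  let ?F = "omap F" and ?G = "omap G"
  obtain Fm where Fm: "stable_functor A B ?F Fm" and Fc: "\<And>X Y f. X \<in> fg_modules A \<Longrightarrow> Y \<in> fg_modules A \<Longrightarrow> f \<in> mod_hom A X Y \<Longrightarrow>
      amap F X Y (stable_class A X Y f) = stable_class B (?F X) (?F Y) (Fm X Y f)"
    by (rule functor_representatives[OF AA BB F]) (rule that)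
  obtain Gm where Gm: "stable_functor B A ?G Gm" and Gc: "\<And>X Y f. X \<in> fg_modules B \<Longrightarrow> Y \<in> fg_modules B \<Longrightarrow> f \<in> mod_hom B X Y \<Longrightarrow>
      amap G X Y (stable_class B X Y f) = stable_class A (?G X) (?G Y) (Gm X Y f)"
    by (rule functor_representatives[OF BB AA G]) (rule that)
  obtain s t where s: "\<And>X. X \<in> fg_modules A \<Longrightarrow> s X \<in> mod_hom A (?G (?F X)) X"
    and t: "\<And>X. X \<in> fg_modules A \<Longrightarrow> t X \<in> mod_hom A X (?G (?F X))"
    and ts: "\<And>X. X \<in> fg_modules A \<Longrightarrow> steq A (?G (?F X)) (?G (?F X))
       (compose (carrier (?G (?F X))) (t X) (s X)) (\<lambda>x\<in>carrier (?G (?F X)). x)"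
    and st: "\<And>X. X \<in> fg_modules A \<Longrightarrow> steq A X X (compose (carrier X) (s X) (t X)) (\<lambda>x\<in>carrier X. x)"
    and nat: "\<And>X Y f. X \<in> fg_modules A \<Longrightarrow> Y \<in> fg_modules A \<Longrightarrow> f \<in> mod_hom A X Y \<Longrightarrow>
      steq A (?G (?F X)) Y (compose (carrier (?G (?F X))) (s Y) (Gm (?F X) (?F Y) (Fm X Y f)))
        (compose (carrier (?G (?F X))) f (s X))"
    by (rule natural_iso_representatives[OF AA Fm Gm Fc Gc GF]) (assumption+, rule that)
  obtain s' t' where s': "\<And>X. X \<in> fg_modules B \<Longrightarrow> s' X \<in> mod_hom B (?F (?G X)) X"
    and t': "\<And>X. X \<in> fg_modules B \<Longrightarrow> t' X \<in> mod_hom B X (?F (?G X))"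
    and ts': "\<And>X. X \<in> fg_modules B \<Longrightarrow> steq B (?F (?G X)) (?F (?G X))
       (compose (carrier (?F (?G X))) (t' X) (s' X)) (\<lambda>x\<in>carrier (?F (?G X)). x)"
    and st': "\<And>X. X \<in> fg_modules B \<Longrightarrow> steq B X X (compose (carrier X) (s' X) (t' X)) (\<lambda>x\<in>carrier X. x)"
    and nat': "\<And>X Y f. X \<in> fg_modules B \<Longrightarrow> Y \<in> fg_modules B \<Longrightarrow> f \<in> mod_hom B X Y \<Longrightarrow>
      steq B (?F (?G X)) Y (compose (carrier (?F (?G X))) (s' Y) (Fm (?G X) (?G Y) (Gm X Y f)))
        (compose (carrier (?F (?G X))) f (s' X))"
    by (rule natural_iso_representatives[OF BB Gm Fm Gc Fc FG]) (assumption+, rule that)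
  have "stable_equivalence A B ?F Fm"
    unfolding stable_equivalence_def
  proof (intro conjI ballI impI Fm)
    fix X Y f g assume *: "X \<in> fg_modules A" "Y \<in> fg_modules A" "f \<in> mod_hom A X Y" "g \<in> mod_hom A X Y"
      "steq B (?F X) (?F Y) (Fm X Y f) (Fm X Y g)"
    show "steq A X Y f g"
      by (rule faithful_of_natural_iso[where s = s and t = t, OF AA Fm Gm s t st nat *])
  next
    fix X Y h assume X: "X \<in> fg_modules A" and Y: "Y \<in> fg_modules A" and h: "h \<in> mod_hom B (?F X) (?F Y)"
    note FX = stable_functorD(1)[OF Fm X] and FY = stable_functorD(1)[OF Fm Y]
    note HX = stable_functorD(1)[OF Gm FX] and HY = stable_functorD(1)[OF Gm FY]
    note X' = fgD(1)[OF X] and Y' = fgD(1)[OF Y] and HX' = fgD(1)[OF HX] and HY' = fgD(1)[OF HY]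
    let ?H = "carrier (?G (?F X))"
    note Gh = stable_functorD(2)[OF Gm FX FY h]
    define f where "f = compose (carrier X) (compose ?H (s Y) (Gm (?F X) (?F Y) h)) (t X)"
    note sG = hom_comp[OF HX' Gh s[OF Y]]
    have f: "f \<in> mod_hom A X Y" unfolding f_def by (rule hom_comp[OF X' t[OF X] sG])
    note Ff = stable_functorD(2)[OF Fm X Y f]
    note GFf = stable_functorD(2)[OF Gm FX FY Ff]
    \<comment> \<open>\<open>t s \<sim> 1\<close> at \<open>Y\<close> lets \<open>s\<close> be
      cancelled on the left of any \<open>v\<close>.\<close>
    have red: "steq A (?G (?F X)) (?G (?F Y)) (compose ?H (t Y) (compose ?H (s Y) v)) v"
      if v: "v \<in> mod_hom A (?G (?F X)) (?G (?F Y))" for v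
    proof -
      have "steq A (?G (?F X)) (?G (?F Y)) (compose ?H (compose (carrier (?G (?F Y))) (t Y) (s Y)) v)
         (compose ?H (\<lambda>x\<in>carrier (?G (?F Y)). x) v)"
        by (rule steq_comp_right[OF HX HY ts[OF Y] v])
      then show ?thesis unfolding comp_id_left[OF v] comp_assoc[OF v, symmetric] .
    qed
    have fs: "steq A (?G (?F X)) Y (compose ?H f (s X)) (compose ?H (s Y) (Gm (?F X) (?F Y) h))"
    proof -
      have "steq A (?G (?F X)) Y (compose ?H (compose ?H (s Y) (Gm (?F X) (?F Y) h)) (compose ?H (t X) (s X)))
        (compose ?H (compose ?H (s Y) (Gm (?F X) (?F Y) h)) (\<lambda>x\<in>?H. x))"
        by (rule steq_comp_left[OF HX HX ts[OF X] sG])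
      then show ?thesis unfolding comp_id_right[OF sG] comp_assoc[OF s[OF X]] f_def .
    qed
    from steq_trans[OF HX Y nat[OF X Y f] fs]
    have "steq A (?G (?F X)) Y (compose ?H (s Y) (Gm (?F X) (?F Y) (Fm X Y f))) (compose ?H (s Y) (Gm (?F X) (?F Y) h))" .
    from steq_comp_left[OF HX Y this t[OF Y]]
    have 1: "steq A (?G (?F X)) (?G (?F Y)) (compose ?H (t Y) (compose ?H (s Y) (Gm (?F X) (?F Y) (Fm X Y f))))
      (compose ?H (t Y) (compose ?H (s Y) (Gm (?F X) (?F Y) h)))" .
    have "steq A (?G (?F X)) (?G (?F Y)) (Gm (?F X) (?F Y) (Fm X Y f)) (Gm (?F X) (?F Y) h)"
      by (rule steq_trans[OF HX HY steq_sym[OF HX HY red[OF GFf]] steq_trans[OF HX HY 1 red[OF Gh]]])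
    then have "steq B (?F X) (?F Y) (Fm X Y f) h"
      by (intro faithful_of_natural_iso[where s = s' and t = t' and Fo = ?G and Fm = Gm and Go = ?F and Gm = Fm,
            OF BB Gm Fm s' t' st' nat' FX FY Ff h])
    then show "\<exists>f\<in>mod_hom A X Y. steq B (?F X) (?F Y) (Fm X Y f) h" using f by blast
  next
    fix Y assume Y: "Y \<in> fg_modules B"
    show "\<exists>X\<in>fg_modules A. \<exists>s\<in>mod_hom B (?F X) Y. \<exists>t\<in>mod_hom B Y (?F X).
      steq B Y Y (compose (carrier Y) s t) (\<lambda>y\<in>carrier Y. y)"
      using stable_functorD(1)[OF Gm Y] s'[OF Y] t'[OF Y] st'[OF Y] by blast
  qed
  then show thesis by (rule that)
qed

lemma stably_equivalent_sym: "stably_equivalent k A B \<Longrightarrow> stably_equivalent k B A"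
  unfolding stably_equivalent_def k_equivalent_def by blast

section \<open>Classes of modules closed under stable retracts\<close>

text \<open>Closure under sums and retracts becomes closure under stable retracts once all
  projectives are present. The iterated extension classes on the side of \<open>B\<close> have these
  properties, which makes membership in them a stable question.\<close>

definition sclosed :: "('a, 'ax) ring_scheme \<Rightarrow> 'a amod set \<Rightarrow> bool" where
  "sclosed A \<S> \<longleftrightarrow> \<S> \<subseteq> fg_modules A \<and> (\<forall>P. projective A P \<longrightarrow> P \<in> \<S>) \<and>
    (\<forall>M\<in>\<S>. \<forall>N\<in>\<S>. \<forall>X\<in>fg_modules A. \<forall>i j p q. biprod A X M N i j p q \<longrightarrow> X \<in> \<S>) \<and>
    (\<forall>Y\<in>\<S>. \<forall>X\<in>fg_modules A. \<forall>i\<in>mod_hom A X Y. \<forall>p\<in>mod_hom A Y X.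
       (\<forall>x\<in>carrier X. p (i x) = x) \<longrightarrow> X \<in> \<S>)"

lemma sclosedD:
  assumes "sclosed A \<S>"
  shows "X \<in> \<S> \<Longrightarrow> X \<in> fg_modules A" "projective A P \<Longrightarrow> P \<in> \<S>"
    "M \<in> \<S> \<Longrightarrow> N \<in> \<S> \<Longrightarrow> X \<in> fg_modules A \<Longrightarrow> biprod A X M N i j p q \<Longrightarrow> X \<in> \<S>"
    "Y \<in> \<S> \<Longrightarrow> X \<in> fg_modules A \<Longrightarrow> i \<in> mod_hom A X Y \<Longrightarrow> p \<in> mod_hom A Y X \<Longrightarrow>
       (\<And>x. x \<in> carrier X \<Longrightarrow> p (i x) = x) \<Longrightarrow> X \<in> \<S>"
proof -
  note S = assms[unfolded sclosed_def]
  show "X \<in> \<S> \<Longrightarrow> X \<in> fg_modules A" using S[THEN conjunct1] by (rule subsetD)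
  show "projective A P \<Longrightarrow> P \<in> \<S>" using S[THEN conjunct2, THEN conjunct1] by simp
  show "M \<in> \<S> \<Longrightarrow> N \<in> \<S> \<Longrightarrow> X \<in> fg_modules A \<Longrightarrow> biprod A X M N i j p q \<Longrightarrow> X \<in> \<S>"
    by (rule S[THEN conjunct2, THEN conjunct2, THEN conjunct1, rule_format])
  show "Y \<in> \<S> \<Longrightarrow> X \<in> fg_modules A \<Longrightarrow> i \<in> mod_hom A X Y \<Longrightarrow> p \<in> mod_hom A Y X \<Longrightarrow>
       (\<And>x. x \<in> carrier X \<Longrightarrow> p (i x) = x) \<Longrightarrow> X \<in> \<S>"
    by (rule S[THEN conjunct2, THEN conjunct2, THEN conjunct2, rule_format])
qed

lemma sclosed_add_closure:
  assumes AA: "artin_algebra k A" and P: "free_gen A P u" and PT: "P \<in> add_closure A \<T>"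
  shows "sclosed A (add_closure A \<T>)"
  unfolding sclosed_def
proof (intro conjI allI ballI impI subsetI)
  show "X \<in> fg_modules A" if "X \<in> add_closure A \<T>" for X using that by (rule add_closure_fg)
  have "add_closure A {P} \<subseteq> add_closure A \<T>" using PT by (intro add_closure_least) simp
  then show "Q \<in> add_closure A \<T>" if "projective A Q" for Q
    using projective_in_add_closure[OF AA P that] by (rule subsetD)
  show "X \<in> add_closure A \<T>"
    if "M \<in> add_closure A \<T>" "N \<in> add_closure A \<T>" "X \<in> fg_modules A" "biprod A X M N i j p q" for M N X i j p q
    using that by (rule add_closure_biprod)
  show "X \<in> add_closure A \<T>"
    if "Y \<in> add_closure A \<T>" "X \<in> fg_modules A" "i \<in> mod_hom A X Y" "p \<in> mod_hom A Y X" "\<forall>x\<in>carrier X. p (i x) = x"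
    for X Y i p
    using that(5) by (intro add_closure_retract[OF AA that(1-4)]) simp
qed

lemma sclosed_proj_id:
  assumes S: "sclosed A \<S>" and X: "X \<in> fg_modules A" and d: "(\<lambda>x\<in>carrier X. x) \<in> proj_hom A X X"
  shows "X \<in> \<S>"
proof -
  obtain P s r where 1: "projective A P" "s \<in> mod_hom A X P" "r \<in> mod_hom A P X" "(\<lambda>x\<in>carrier X. x) = compose (carrier X) r s"
    using d by (rule proj_homE)
  have "r (s x) = x" if "x \<in> carrier X" for x using fun_cong[OF 1(4), of x] that by (simp add: compose_eq)
  then show ?thesis by (rule sclosedD(4)[OF S sclosedD(2)[OF S 1(1)] X 1(2,3)])
qed

text \<open>If \<open>1 = d + b a + b' a'\<close> and \<open>d = r s\<close> factors through a
  projective \<open>P\<close>, then \<open>(s, (a, a'))\<close> and the sum of \<open>r\<close>,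
  \<open>b\<close> and \<open>b'\<close> make \<open>M\<close> an honest retract of
  \<open>P \<oplus> (E \<oplus> E')\<close>. Two composites are allowed because direct sums and
  middle terms of extensions both present the identity in this way.\<close>

lemma sclosed_stable_retract2:
  assumes S: "sclosed A \<S>" and E: "E \<in> \<S>" "E' \<in> \<S>" and M: "M \<in> fg_modules A"
    and a: "a \<in> mod_hom A M E" and b: "b \<in> mod_hom A E M" and a': "a' \<in> mod_hom A M E'" and b': "b' \<in> mod_hom A E' M"
    and eq: "steq A M M (\<lambda>x\<in>carrier M. x) (hadd M M (compose (carrier M) b a) (compose (carrier M) b' a'))"
  shows "M \<in> \<S>"
proof -
  note Ef = sclosedD(1)[OF S E(1)] and Ef' = sclosedD(1)[OF S E(2)]
  obtain d where d: "d \<in> proj_hom A M M"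
    "\<And>x. x \<in> carrier M \<Longrightarrow> (\<lambda>x\<in>carrier M. x) x = d x \<oplus>\<^bsub>M\<^esub> hadd M M (compose (carrier M) b a) (compose (carrier M) b' a') x"
    by (rule steqE[OF eq]) (rule that)
  obtain P s r where 1: "projective A P" "s \<in> mod_hom A M P" "r \<in> mod_hom A P M" "d = compose (carrier M) r s"
    using d(1) by (rule proj_homE)
  obtain D i j p q where D: "D \<in> fg_modules A" and bp: "biprod A D E E' i j p q"
    by (rule biprod_exists[OF Ef Ef']) (rule that)
  obtain D2 i2 j2 p2 q2 where D2: "D2 \<in> fg_modules A" and bp2: "biprod A D2 P D i2 j2 p2 q2"
    by (rule biprod_exists[OF projective_fg[OF 1(1)] D]) (rule that)
  note b1 = biprodD[OF bp] and b2 = biprodD[OF bp2]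
  note M' = fgD(1)[OF M] and D' = fgD(1)[OF D] and D2' = fgD(1)[OF D2]
  interpret M: left_module A M by (rule M')
  interpret D: left_module A D by (rule D')
  interpret D2: left_module A D2 by (rule D2')
  interpret E: left_module A E by (rule fgD(1)[OF Ef])
  interpret E': left_module A E' by (rule fgD(1)[OF Ef'])
  interpret P: left_module A P by (rule fgD(1)[OF projective_fg[OF 1(1)]])
  note [simp] = hom_closed[OF a] hom_closed[OF b] hom_closed[OF a'] hom_closed[OF b'] hom_closed[OF 1(2)] hom_closed[OF 1(3)]
    hom_closed[OF b1(1)] hom_closed[OF b1(2)] hom_closed[OF b1(3)] hom_closed[OF b1(4)]
    hom_closed[OF b2(1)] hom_closed[OF b2(2)] hom_closed[OF b2(3)] hom_closed[OF b2(4)]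
  let ?e = "hadd M D (compose (carrier M) i a) (compose (carrier M) j a')"
  let ?f = "hadd D M (compose (carrier D) b p) (compose (carrier D) b' q)"
  have e: "?e \<in> mod_hom A M D" by (intro hom_hadd M' D' hom_comp[OF M' a b1(1)] hom_comp[OF M' a' b1(2)])
  have f: "?f \<in> mod_hom A D M" by (intro hom_hadd M' D' hom_comp[OF D' b1(3) b] hom_comp[OF D' b1(4) b'])
  have fe: "?f (?e x) = b (a x) \<oplus>\<^bsub>M\<^esub> b' (a' x)" if "x \<in> carrier M" for x
    using that by (simp add: hadd_apply compose_eq hom_add[OF b1(3)] hom_add[OF b1(4)] b1(5-8))
  let ?i = "hadd M D2 (compose (carrier M) i2 s) (compose (carrier M) j2 ?e)"
  let ?p = "hadd D2 M (compose (carrier D2) r p2) (compose (carrier D2) ?f q2)"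
  have ii: "?i \<in> mod_hom A M D2" by (intro hom_hadd M' D2' hom_comp[OF M' 1(2) b2(1)] hom_comp[OF M' e b2(2)])
  have pp: "?p \<in> mod_hom A D2 M" by (intro hom_hadd M' D2' hom_comp[OF D2' b2(3) 1(3)] hom_comp[OF D2' b2(4) f])
  have "?p (?i x) = x" if x: "x \<in> carrier M" for x
  proof -
    note ex = hom_closed[OF e x]
    have ix: "?i x = i2 (s x) \<oplus>\<^bsub>D2\<^esub> j2 (?e x)" using x by (simp add: hadd_apply compose_eq)
    have c: "i2 (s x) \<in> carrier D2" "j2 (?e x) \<in> carrier D2" using x ex by simp_all
    have "p2 (?i x) = s x" unfolding ix hom_add[OF b2(3) c] using x b2(5)[of "s x"] b2(8)[OF ex] by simp
    moreover have "q2 (?i x) = ?e x" unfolding ix hom_add[OF b2(4) c] using x b2(6)[of "s x"] b2(7)[OF ex] ex by simp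
    ultimately have "?p (?i x) = r (s x) \<oplus>\<^bsub>M\<^esub> ?f (?e x)"
      using hom_closed[OF ii x] by (simp add: hadd_apply[of _ D2] compose_eq[of _ "carrier D2"])
    also have "\<dots> = x" using d(2)[OF x] x unfolding fe[OF x] 1(4) by (simp add: hadd_apply compose_eq)
    finally show ?thesis .
  qed
  then show ?thesis
    by (rule sclosedD(4)[OF S sclosedD(3)[OF S sclosedD(2)[OF S 1(1)] sclosedD(3)[OF S E D bp] D2 bp2] M ii pp])
qed

lemma sclosed_stable_retract:
  assumes S: "sclosed A \<S>" and E: "E \<in> \<S>" and M: "M \<in> fg_modules A"
    and a: "a \<in> mod_hom A M E" and b: "b \<in> mod_hom A E M"
    and eq: "steq A M M (compose (carrier M) b a) (\<lambda>x\<in>carrier M. x)"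
  shows "M \<in> \<S>"
proof -
  note Ef = sclosedD(1)[OF S E] and M' = fgD(1)[OF M]
  note E' = fgD(1)[OF Ef]
  interpret M: left_module A M by (rule M')
  note z = hom_hzero[OF E' M']
  have "hadd M M (compose (carrier M) b a) (compose (carrier M) (hzero E M) a) = compose (carrier M) b a"
    using hom_closed[OF a] hom_closed[OF b]
    by (intro hom_eqI[OF hom_hadd[OF M' M' hom_comp[OF M' a b] hom_comp[OF M' a z]] hom_comp[OF M' a b]])
      (simp add: hadd_apply compose_eq hzero_apply)
  then have "steq A M M (\<lambda>x\<in>carrier M. x) (hadd M M (compose (carrier M) b a) (compose (carrier M) (hzero E M) a))"
    using steq_sym[OF M M eq] by simp
  then show ?thesis by (rule sclosed_stable_retract2[OF S E E M a b a z])
qed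

lemma functor_stable_retract:
  assumes F: "stable_functor A B Fo Fm" and S: "sclosed B \<S>" and X: "X \<in> fg_modules A" and Y: "Y \<in> fg_modules A"
    and i: "i \<in> mod_hom A X Y" and p: "p \<in> mod_hom A Y X" and eq: "steq A X X (compose (carrier X) p i) (\<lambda>x\<in>carrier X. x)"
    and FY: "Fo Y \<in> \<S>"
  shows "Fo X \<in> \<S>"
proof -
  note FX = stable_functorD(1)[OF F X] and FYf = stable_functorD(1)[OF F Y]
  note Fi = stable_functorD(2)[OF F X Y i] and Fp = stable_functorD(2)[OF F Y X p]
  have "steq B (Fo X) (Fo X) (compose (carrier (Fo X)) (Fm Y X p) (Fm X Y i)) (\<lambda>x\<in>carrier (Fo X). x)"
    by (rule steq_trans[OF FX FX steq_sym[OF FX FX stable_functorD(6)[OF F X Y X i p]]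
        steq_trans[OF FX FX stable_functorD(3)[OF F X X eq] stable_functorD(5)[OF F X]]])
  then show ?thesis by (rule sclosed_stable_retract[OF S FY FX Fi Fp])
qed

lemma functor_stable_retract2:
  assumes F: "stable_functor A B Fo Fm" and S: "sclosed B \<S>"
    and X: "X \<in> fg_modules A" and Y: "Y \<in> fg_modules A" and Y': "Y' \<in> fg_modules A"
    and i: "i \<in> mod_hom A X Y" and p: "p \<in> mod_hom A Y X" and i': "i' \<in> mod_hom A X Y'" and p': "p' \<in> mod_hom A Y' X"
    and eq: "steq A X X (\<lambda>x\<in>carrier X. x) (hadd X X (compose (carrier X) p i) (compose (carrier X) p' i'))"
    and FY: "Fo Y \<in> \<S>" "Fo Y' \<in> \<S>"
  shows "Fo X \<in> \<S>"
proof -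
  note FX = stable_functorD(1)[OF F X] and X' = fgD(1)[OF X]
  note Fi = stable_functorD(2)[OF F X Y i] and Fp = stable_functorD(2)[OF F Y X p]
  note Fi' = stable_functorD(2)[OF F X Y' i'] and Fp' = stable_functorD(2)[OF F Y' X p']
  note pi = hom_comp[OF X' i p] and pi' = hom_comp[OF X' i' p']
  note 1 = steq_sym[OF FX FX stable_functorD(5)[OF F X]]
  note 2 = stable_functorD(3)[OF F X X eq]
  note 3 = stable_functorD(4)[OF F X X pi pi']
  note 4 = steq_hadd[OF FX FX stable_functorD(6)[OF F X Y X i p] stable_functorD(6)[OF F X Y' X i' p']]
  from steq_trans[OF FX FX 1 steq_trans[OF FX FX 2 steq_trans[OF FX FX 3 4]]]
  show ?thesis by (rule sclosed_stable_retract2[OF S FY FX Fi Fp Fi' Fp'])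
qed

text \<open>On a zero module \<open>1 + 1 = 1\<close>. The functor preserves this stably, so with
  \<open>j\<close> the identity of \<open>F X\<close> one has \<open>j \<sim> j + j\<close>. Hence
  \<open>j\<close> itself factors through a projective, and \<open>F X\<close> is a retract of that
  projective.\<close>

lemma functor_zero:
  assumes F: "stable_functor A B Fo Fm" and S: "sclosed B \<S>"
    and X: "X \<in> zero_modules A"
  shows "Fo X \<in> \<S>"
proof -
  note X0 = zero_modulesD[OF X]
  note FX = stable_functorD(1)[OF F X0(1)] and X' = fgD(1)[OF X0(1)]
  note FX' = fgD(1)[OF FX]
  interpret X: left_module A X by (rule X')
  interpret FX: left_module B "Fo X" by (rule FX')
  let ?i = "\<lambda>x\<in>carrier X. x" and ?j = "\<lambda>x\<in>carrier (Fo X). x"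
  note i = hom_id[OF X'] and j = hom_id[OF FX']
  have "hadd X X ?i ?i = ?i"
  proof (rule hom_eqI[OF hom_hadd[OF X' X' i i] i])
    fix x assume x: "x \<in> carrier X"
    then have "x = \<zero>\<^bsub>X\<^esub>" using X0(2) by blast
    then show "hadd X X ?i ?i x = ?i x" by (simp add: hadd_apply)
  qed
  then have 1: "steq B (Fo X) (Fo X) (Fm X X ?i) (hadd (Fo X) (Fo X) (Fm X X ?i) (Fm X X ?i))"
    using stable_functorD(4)[OF F X0(1) X0(1) i i] by simp
  note 2 = stable_functorD(5)[OF F X0(1)]
  have "steq B (Fo X) (Fo X) ?j (hadd (Fo X) (Fo X) ?j ?j)"
    by (rule steq_trans[OF FX FX steq_sym[OF FX FX 2] steq_trans[OF FX FX 1 steq_hadd[OF FX FX 2 2]]])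
  then obtain d where d: "d \<in> proj_hom B (Fo X) (Fo X)" "\<And>x. x \<in> carrier (Fo X) \<Longrightarrow> ?j x = d x \<oplus>\<^bsub>Fo X\<^esub> hadd (Fo X) (Fo X) ?j ?j x"
    by (rule steqE) (rule that)
  note dh = proj_hom_hom[OF FX' d(1)]
  have "hneg (Fo X) (Fo X) d = ?j"
  proof (rule hom_eqI[OF hom_hneg[OF FX' FX' dh] j])
    fix x assume x: "x \<in> carrier (Fo X)"
    note dx = hom_closed[OF dh x]
    have "x = d x \<oplus>\<^bsub>Fo X\<^esub> (x \<oplus>\<^bsub>Fo X\<^esub> x)" using d(2)[OF x] x by (simp add: hadd_apply)
    then have "\<zero>\<^bsub>Fo X\<^esub> \<oplus>\<^bsub>Fo X\<^esub> x = (d x \<oplus>\<^bsub>Fo X\<^esub> x) \<oplus>\<^bsub>Fo X\<^esub> x" using x dx by (simp add: FX.M.a_assoc)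
    then have "d x \<oplus>\<^bsub>Fo X\<^esub> x = \<zero>\<^bsub>Fo X\<^esub>" using x dx by simp
    then have "x \<oplus>\<^bsub>Fo X\<^esub> d x = \<zero>\<^bsub>Fo X\<^esub>" using x dx by (simp add: FX.M.a_comm)
    then have "\<ominus>\<^bsub>Fo X\<^esub> d x = x" using FX.M.minus_equality x dx by blast
    then show "hneg (Fo X) (Fo X) d x = ?j x" using x by (simp add: hneg_apply)
  qed
  then have "?j \<in> proj_hom B (Fo X) (Fo X)" using proj_hom_neg[OF FX' FX' d(1)] by simp
  then show ?thesis by (rule sclosed_proj_id[OF S FX])
qed

text \<open>Sums and summands are described by composites that give the identity:
  \<open>i p + j q = 1\<close> for a sum and \<open>p i = 1\<close> for a summand. An additive
  functor keeps these equations up to \<open>steq\<close>, and \<open>sclosed\<close> absorbs the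
  difference.\<close>

lemma functor_add_closure:
  assumes AA: "artin_algebra k A" and F: "stable_functor A B Fo Fm" and S: "sclosed B \<S>"
    and T: "\<And>X. X \<in> \<T> \<Longrightarrow> X \<in> fg_modules A \<Longrightarrow> Fo X \<in> \<S>"
    and X: "X \<in> add_closure A \<T>"
  shows "Fo X \<in> \<S>"
  using X
proof (induction rule: add_closure.induct)
  case (base X)
  then show ?case by (rule T)
next
  case (empty_sum X)
  then show ?case by (rule functor_zero[OF F S])
next
  case (direct_sum M N X)
  note M = add_closure_fg[OF direct_sum.hyps(1)] and N = add_closure_fg[OF direct_sum.hyps(2)] and X = direct_sum.hyps(3)
  note X' = fgD(1)[OF X]
  obtain i j p q where bp: "biprod A X M N i j p q"
    by (rule biprod_of_iso[OF X' fgD(1)[OF M] fgD(1)[OF N] direct_sum.hyps(4)]) (rule that)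
  note b = biprodD[OF bp]
  note ip = hom_comp[OF X' b(3) b(1)] and jq = hom_comp[OF X' b(4) b(2)]
  have eq: "hadd X X (compose (carrier X) i p) (compose (carrier X) j q) = (\<lambda>x\<in>carrier X. x)"
    by (rule hom_eqI[OF hom_hadd[OF X' X' ip jq] hom_id[OF X']]) (simp add: hadd_apply compose_eq b(9))
  have "steq A X X (\<lambda>x\<in>carrier X. x) (hadd X X (compose (carrier X) i p) (compose (carrier X) j q))"
    unfolding eq by (rule steq_refl[OF AA X X hom_id[OF X']])
  then show ?case
    by (rule functor_stable_retract2[OF F S X M N b(3,1,4,2) _ direct_sum.IH])
next
  case (summand Y X Z)
  note Y = add_closure_fg[OF summand.hyps(1)] and X = summand.hyps(2) and Z = summand.hyps(3)
  note X' = fgD(1)[OF X]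
  obtain i j p q where bp: "biprod A Y X Z i j p q"
    by (rule biprod_of_iso[OF fgD(1)[OF Y] X' fgD(1)[OF Z] summand.hyps(4)]) (rule that)
  note b = biprodD[OF bp]
  have eq: "compose (carrier X) p i = (\<lambda>x\<in>carrier X. x)"
    by (rule hom_eqI[OF hom_comp[OF X' b(1) b(3)] hom_id[OF X']]) (simp add: compose_eq b(5))
  have "steq A X X (compose (carrier X) p i) (\<lambda>x\<in>carrier X. x)"
    unfolding eq by (rule steq_refl[OF AA X X hom_id[OF X']])
  then show ?case by (rule functor_stable_retract[OF F S X Y b(1,3) _ summand.IH])
qed

section \<open>Transport of extensions\<close>

definition factors :: "('a, 'ax) ring_scheme \<Rightarrow> 'a amod \<Rightarrow> 'a amod \<Rightarrow> ((nat \<Rightarrow> 'a) set \<Rightarrow> 'z) \<Rightarrow>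
    ((nat \<Rightarrow> 'a) set \<Rightarrow> 'z) \<Rightarrow> bool" where
  "factors A W Y p w \<longleftrightarrow> (\<exists>v\<in>mod_hom A W Y. \<forall>x\<in>carrier W. p (v x) = w x)"

lemma factorsI: "v \<in> mod_hom A W Y \<Longrightarrow> (\<And>x. x \<in> carrier W \<Longrightarrow> p (v x) = w x) \<Longrightarrow> factors A W Y p w"
  unfolding factors_def by blast

lemma factorsE:
  assumes "factors A W Y p w"
  obtains v where "v \<in> mod_hom A W Y" "\<And>x. x \<in> carrier W \<Longrightarrow> p (v x) = w x"
  using assms unfolding factors_def by blast

text \<open>Since projectives lift along surjections, factoring through a surjection only depends on
  the stable class.\<close>

lemma factors_steq:
  assumes W: "W \<in> fg_modules A" and Y: "Y \<in> fg_modules A" and Z: "Z \<in> fg_modules A"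
    and p: "p \<in> mod_hom A Y Z" "p ` carrier Y = carrier Z" and eq: "steq A W Z w w'" and f: "factors A W Y p w'"
  shows "factors A W Y p w"
proof -
  obtain v where v: "v \<in> mod_hom A W Y" "\<And>x. x \<in> carrier W \<Longrightarrow> p (v x) = w' x"
    by (rule factorsE[OF f]) (rule that)
  obtain d where d: "d \<in> proj_hom A W Z" "\<And>x. x \<in> carrier W \<Longrightarrow> w x = d x \<oplus>\<^bsub>Z\<^esub> w' x"
    by (rule steqE[OF eq]) (rule that)
  obtain P s r where 1: "projective A P" "s \<in> mod_hom A W P" "r \<in> mod_hom A P Z" "d = compose (carrier W) r s"
    using d(1) by (rule proj_homE)
  obtain h where h: "h \<in> mod_hom A P Y" "\<And>x. x \<in> carrier P \<Longrightarrow> p (h x) = r x"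
    by (rule projective_lift[OF 1(1) Y Z p 1(3)]) (rule that)
  note W' = fgD(1)[OF W] and Y' = fgD(1)[OF Y]
  show ?thesis
  proof (rule factorsI)
    show "hadd W Y (compose (carrier W) h s) v \<in> mod_hom A W Y"
      by (rule hom_hadd[OF W' Y' hom_comp[OF W' 1(2) h(1)] v(1)])
    fix x assume x: "x \<in> carrier W"
    then show "p (hadd W Y (compose (carrier W) h s) v x) = w x"
      using hom_closed[OF 1(2)] hom_closed[OF h(1)] hom_closed[OF v(1)] d(2)[OF x]
      by (simp add: hadd_apply compose_eq hom_add[OF p(1)] h(2) v(2) 1(4))
  qed
qed

text \<open>A lift of \<open>g w\<close> along \<open>f\<close>, paired with \<open>w\<close>, is a
  map into the pull-back. Base change of an extension therefore pulls its set of factoring maps back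
  along \<open>g\<close>.\<close>

lemma factors_pullback_base:
  assumes pb: "is_pullback A E X Y p q f g" and E: "E \<in> fg_modules A" and W: "W \<in> fg_modules A" and w: "w \<in> mod_hom A W Y"
  shows "factors A W E q w \<longleftrightarrow> factors A W X f (compose (carrier W) g w)"
proof
  note W' = fgD(1)[OF W] and b = pullbackD[OF pb]
  assume "factors A W E q w"
  then obtain v where v: "v \<in> mod_hom A W E" "\<And>x. x \<in> carrier W \<Longrightarrow> q (v x) = w x"
    by (rule factorsE) (rule that)
  show "factors A W X f (compose (carrier W) g w)"
    using b(3) v(2) hom_closed[OF v(1)]
    by (intro factorsI[OF hom_comp[OF W' v(1) b(1)]]) (simp add: compose_eq)
next
  assume "factors A W X f (compose (carrier W) g w)"
  then obtain v where v: "v \<in> mod_hom A W X" "\<And>x. x \<in> carrier W \<Longrightarrow> f (v x) = compose (carrier W) g w x"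
    by (rule factorsE) (rule that)
  have fv: "f (v x) = g (w x)" if "x \<in> carrier W" for x using v(2)[OF that] that by (simp add: compose_eq)
  obtain h where h: "h \<in> mod_hom A W E" "\<And>x. x \<in> carrier W \<Longrightarrow> q (h x) = w x"
    by (rule pullback_lift[OF pb fgD(1)[OF E] fgD(1)[OF W] v(1) w fv]) (assumption, rule that)
  show "factors A W E q w" using h(2) by (intro factorsI[OF h(1)])
qed

text \<open>Lifts of the same \<open>w\<close> along \<open>f\<close> and along \<open>g\<close>
  agree over the base and glue. A fibre product thus realizes the intersection of two sets of
  factoring maps.\<close>

lemma factors_pullback_both:
  assumes pb: "is_pullback A E X Y p q f g" and E: "E \<in> fg_modules A" and W: "W \<in> fg_modules A"
    and r: "\<And>u. u \<in> carrier E \<Longrightarrow> r u = f (p u)"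
  shows "factors A W E r w \<longleftrightarrow> factors A W X f w \<and> factors A W Y g w"
proof
  note W' = fgD(1)[OF W] and b = pullbackD[OF pb]
  assume "factors A W E r w"
  then obtain v where v: "v \<in> mod_hom A W E" "\<And>x. x \<in> carrier W \<Longrightarrow> r (v x) = w x"
    by (rule factorsE) (rule that)
  have "f (p (v x)) = w x" "g (q (v x)) = w x" if "x \<in> carrier W" for x
    using r[OF hom_closed[OF v(1) that]] b(3)[OF hom_closed[OF v(1) that]] v(2)[OF that] by simp_all
  then have "factors A W X f w" "factors A W Y g w"
    by (auto intro!: factorsI[OF hom_comp[OF W' v(1) b(1)]] factorsI[OF hom_comp[OF W' v(1) b(2)]] simp: compose_eq)
  then show "factors A W X f w \<and> factors A W Y g w" ..
next
  assume "factors A W X f w \<and> factors A W Y g w"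
  then have *: "factors A W X f w" "factors A W Y g w" by simp_all
  obtain v where v: "v \<in> mod_hom A W X" "\<And>x. x \<in> carrier W \<Longrightarrow> f (v x) = w x" by (rule factorsE[OF *(1)]) (rule that)
  obtain v' where v': "v' \<in> mod_hom A W Y" "\<And>x. x \<in> carrier W \<Longrightarrow> g (v' x) = w x" by (rule factorsE[OF *(2)]) (rule that)
  have fv: "f (v x) = g (v' x)" if "x \<in> carrier W" for x using v(2)[OF that] v'(2)[OF that] by simp
  obtain h where h: "h \<in> mod_hom A W E" "\<And>x. x \<in> carrier W \<Longrightarrow> p (h x) = v x"
    by (rule pullback_lift[OF pb fgD(1)[OF E] fgD(1)[OF W] v(1) v'(1) fv]) (assumption, rule that)
  show "factors A W E r w"
    using r hom_closed[OF h(1)] h(2) v(2) by (intro factorsI[OF h(1)]) simp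
qed

section \<open>Short exact sequences under pull-back\<close>

lemma short_exactD:
  assumes "short_exact A L M N f g"
  shows "f \<in> mod_hom A L M" "g \<in> mod_hom A M N" "inj_on f (carrier L)" "g ` carrier M = carrier N"
    "\<And>x. x \<in> carrier L \<Longrightarrow> g (f x) = \<zero>\<^bsub>N\<^esub>" "\<And>y. y \<in> carrier M \<Longrightarrow> g y = \<zero>\<^bsub>N\<^esub> \<Longrightarrow> \<exists>x\<in>carrier L. f x = y"
proof -
  note s = assms[unfolded short_exact_def]
  show "f \<in> mod_hom A L M" "g \<in> mod_hom A M N" "inj_on f (carrier L)" "g ` carrier M = carrier N"
    using s by simp_all
  have e: "f ` carrier L = {x \<in> carrier M. g x = \<zero>\<^bsub>N\<^esub>}" using s by simp
  show "g (f x) = \<zero>\<^bsub>N\<^esub>" if "x \<in> carrier L" for x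
  proof -
    have "f x \<in> f ` carrier L" using that by (rule imageI)
    then show ?thesis unfolding e by simp
  qed
  show "\<exists>x\<in>carrier L. f x = y" if "y \<in> carrier M" "g y = \<zero>\<^bsub>N\<^esub>" for y
  proof -
    have "y \<in> f ` carrier L" unfolding e using that by simp
    then show ?thesis by (metis imageE)
  qed
qed

lemma short_exactI:
  assumes "f \<in> mod_hom A L M" "g \<in> mod_hom A M N" "inj_on f (carrier L)" "g ` carrier M = carrier N"
    "\<And>x. x \<in> carrier L \<Longrightarrow> g (f x) = \<zero>\<^bsub>N\<^esub>" "\<And>y. y \<in> carrier M \<Longrightarrow> g y = \<zero>\<^bsub>N\<^esub> \<Longrightarrow> \<exists>x\<in>carrier L. f x = y"
  shows "short_exact A L M N f g"
  unfolding short_exact_def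
proof (intro conjI assms(1-4) equalityI subsetI)
  show "y \<in> {x \<in> carrier M. g x = \<zero>\<^bsub>N\<^esub>}" if "y \<in> f ` carrier L" for y
    using that assms(5) hom_closed[OF assms(1)] by auto
  show "y \<in> f ` carrier L" if "y \<in> {x \<in> carrier M. g x = \<zero>\<^bsub>N\<^esub>}" for y
    using assms(6)[of y] that by auto
qed

text \<open>Base change leaves the kernel untouched: the new inclusion is the map into the pull-back
  with components \<open>\<kappa>\<close> and zero.\<close>

lemma short_exact_pullback:
  assumes K: "left_module A K" and D: "left_module A D" and E: "left_module A E" and Z: "left_module A Z" and C: "left_module A C"
    and se: "short_exact A K D C \<kappa> \<delta>" and pb: "is_pullback A E D Z u e \<delta> g" and g: "g \<in> mod_hom A Z C"
  obtains \<kappa>' where "short_exact A K E Z \<kappa>' e"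
proof -
  interpret D: left_module A D by (rule D)
  interpret Z: left_module A Z by (rule Z)
  interpret E: left_module A E by (rule E)
  note s = short_exactD[OF se] and b = pullbackD[OF pb]
  have eq: "\<delta> (\<kappa> x) = g (hzero K Z x)" if "x \<in> carrier K" for x
    using that s(5) hom_zero[OF Z C g] by (simp add: hzero_apply)
  obtain h where h: "h \<in> mod_hom A K E" "\<And>x. x \<in> carrier K \<Longrightarrow> u (h x) = \<kappa> x" "\<And>x. x \<in> carrier K \<Longrightarrow> e (h x) = hzero K Z x"
    by (rule pullback_lift[OF pb E K s(1) hom_hzero[OF K Z] eq]) (assumption, rule that)
  have "short_exact A K E Z h e"
  proof (rule short_exactI[OF h(1) b(2)])
    show "inj_on h (carrier K)"
    proof (rule inj_onI)
      fix x y assume xy: "x \<in> carrier K" "y \<in> carrier K" "h x = h y"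
      then have "\<kappa> x = \<kappa> y" using h(2)[of x] h(2)[of y] by simp
      then show "x = y" using inj_onD[OF s(3)] xy by blast
    qed
    show "e ` carrier E = carrier Z"
    proof (intro equalityI subsetI)
      fix z assume z: "z \<in> carrier Z"
      have "g z \<in> \<delta> ` carrier D" unfolding s(4) using hom_closed[OF g z] .
      then obtain d where "d \<in> carrier D" "\<delta> d = g z" by (metis imageE)
      then obtain v where "v \<in> carrier E" "e v = z" using b(4)[of d z] z by blast
      then show "z \<in> e ` carrier E" by blast
    qed (use hom_closed[OF b(2)] in auto)
    show "e (h x) = \<zero>\<^bsub>Z\<^esub>" if "x \<in> carrier K" for x using h(3)[OF that] that by (simp add: hzero_apply)
    fix y assume y: "y \<in> carrier E" "e y = \<zero>\<^bsub>Z\<^esub>"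
    have "\<delta> (u y) = \<zero>\<^bsub>C\<^esub>" using b(3)[OF y(1)] y(2) hom_zero[OF Z C g] by simp
    then obtain x where x: "x \<in> carrier K" "\<kappa> x = u y" using s(6)[OF hom_closed[OF b(1) y(1)]] by blast
    have "h x = y" using x y h(2)[OF x(1)] h(3)[OF x(1)] by (intro b(5) hom_closed[OF h(1)]) (simp_all add: hzero_apply)
    then show "\<exists>x\<in>carrier K. h x = y" using x(1) by blast
  qed
  then show thesis by (rule that)
qed

text \<open>An element of the fibre product over zero is a pair of elements of the two kernels, so
  the kernel is their direct sum.\<close>

lemma short_exact_pullback_sum:
  assumes K: "left_module A K" and K1: "left_module A K1" and K2: "left_module A K2"
    and E1: "left_module A E1" and E2: "left_module A E2" and E: "left_module A E" and Z: "left_module A Z"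
    and bp: "biprod A K K1 K2 i j p q"
    and se1: "short_exact A K1 E1 Z \<kappa>1 e1" and se2: "short_exact A K2 E2 Z \<kappa>2 e2"
    and pb: "is_pullback A E E1 E2 u v e1 e2"
  obtains \<kappa> where "short_exact A K E Z \<kappa> (compose (carrier E) e1 u)"
proof -
  interpret E1: left_module A E1 by (rule E1)
  interpret E2: left_module A E2 by (rule E2)
  interpret K: left_module A K by (rule K)
  interpret K1: left_module A K1 by (rule K1)
  interpret K2: left_module A K2 by (rule K2)
  note s1 = short_exactD[OF se1] and s2 = short_exactD[OF se2] and b = pullbackD[OF pb] and c = biprodD[OF bp]
  note [simp] = hom_closed[OF c(1)] hom_closed[OF c(2)] hom_closed[OF c(3)] hom_closed[OF c(4)]
  have eq: "e1 (compose (carrier K) \<kappa>1 p x) = e2 (compose (carrier K) \<kappa>2 q x)" if "x \<in> carrier K" for x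
    using that s1(5) s2(5) by (simp add: compose_eq)
  obtain h where h: "h \<in> mod_hom A K E" "\<And>x. x \<in> carrier K \<Longrightarrow> u (h x) = compose (carrier K) \<kappa>1 p x"
    "\<And>x. x \<in> carrier K \<Longrightarrow> v (h x) = compose (carrier K) \<kappa>2 q x"
    by (rule pullback_lift[OF pb E K hom_comp[OF K c(3) s1(1)] hom_comp[OF K c(4) s2(1)] eq]) (assumption, rule that)
  have "short_exact A K E Z h (compose (carrier E) e1 u)"
  proof (rule short_exactI[OF h(1) hom_comp[OF E b(1) s1(2)]])
    show "inj_on h (carrier K)"
    proof (rule inj_onI)
      fix x y assume xy: "x \<in> carrier K" "y \<in> carrier K" "h x = h y"
      then have "\<kappa>1 (p x) = \<kappa>1 (p y)" "\<kappa>2 (q x) = \<kappa>2 (q y)"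
        using h(2)[of x] h(2)[of y] h(3)[of x] h(3)[of y] by (simp_all add: compose_eq)
      then have "p x = p y" "q x = q y" using inj_onD[OF s1(3)] inj_onD[OF s2(3)] xy by simp_all
      then have "i (p x) \<oplus>\<^bsub>K\<^esub> j (q x) = i (p y) \<oplus>\<^bsub>K\<^esub> j (q y)" by (simp only:)
      then show "x = y" unfolding c(9)[OF xy(1)] c(9)[OF xy(2)] .
    qed
    show "compose (carrier E) e1 u ` carrier E = carrier Z"
    proof (intro equalityI subsetI)
      fix z assume z: "z \<in> carrier Z"
      then have "z \<in> e1 ` carrier E1" "z \<in> e2 ` carrier E2" unfolding s1(4) s2(4) by simp_all
      then obtain x y where xy: "x \<in> carrier E1" "e1 x = z" "y \<in> carrier E2" "e2 y = z" by (metis imageE)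
      then obtain w where "w \<in> carrier E" "u w = x" using b(4)[of x y] by auto
      then show "z \<in> compose (carrier E) e1 u ` carrier E" using xy by (intro image_eqI[of _ _ w]) (simp_all add: compose_eq)
    qed (use hom_closed[OF hom_comp[OF E b(1) s1(2)]] in auto)
    show "compose (carrier E) e1 u (h x) = \<zero>\<^bsub>Z\<^esub>" if "x \<in> carrier K" for x
      using h(2)[OF that] that hom_closed[OF h(1) that] s1(5) by (simp add: compose_eq)
    fix y assume y: "y \<in> carrier E" "compose (carrier E) e1 u y = \<zero>\<^bsub>Z\<^esub>"
    then have "e1 (u y) = \<zero>\<^bsub>Z\<^esub>" "e2 (v y) = \<zero>\<^bsub>Z\<^esub>" using b(3)[OF y(1)] by (simp_all add: compose_eq)
    then obtain x1 x2 where x: "x1 \<in> carrier K1" "\<kappa>1 x1 = u y" "x2 \<in> carrier K2" "\<kappa>2 x2 = v y"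
      using s1(6)[OF hom_closed[OF b(1) y(1)]] s2(6)[OF hom_closed[OF b(2) y(1)]] by blast
    let ?x = "i x1 \<oplus>\<^bsub>K\<^esub> j x2"
    have xc: "?x \<in> carrier K" using x by simp
    have "p ?x = x1" "q ?x = x2" using x by (simp_all add: hom_add[OF c(3)] hom_add[OF c(4)] c(5-8))
    then have "h ?x = y" using x y h(2)[OF xc] h(3)[OF xc] xc by (intro b(5) hom_closed[OF h(1)]) (simp_all add: compose_eq)
    then show "\<exists>x\<in>carrier K. h x = y" using xc by blast
  qed
  then show thesis by (rule that)
qed

text \<open>The stable functor only sees which maps \<open>W \<rightarrow> Z\<close> factor through the extension \<open>Y \<rightarrow> Z\<close>, so this
  is all that the extension \<open>E\<close> of \<open>F Z\<close> is required to share with \<open>Y\<close>.\<close>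

definition liftable where
  "liftable A B Fo Fm \<K> M \<longleftrightarrow> (\<forall>Y\<in>fg_modules A. \<forall>Z\<in>fg_modules A. \<forall>f p. short_exact A M Y Z f p \<longrightarrow>
    (\<exists>K E \<kappa> e. K \<in> \<K> \<and> E \<in> fg_modules B \<and> short_exact B K E (Fo Z) \<kappa> e \<and>
      (\<forall>W\<in>fg_modules A. \<forall>w\<in>mod_hom A W Z. factors A W Y p w \<longleftrightarrow> factors B (Fo W) E e (Fm W Z w))))"

lemma liftableE:
  assumes "liftable A B Fo Fm \<K> M" "Y \<in> fg_modules A" "Z \<in> fg_modules A" "short_exact A M Y Z f p"
  obtains K E \<kappa> e where "K \<in> \<K>" "E \<in> fg_modules B" "short_exact B K E (Fo Z) \<kappa> e"
    "\<And>W w. W \<in> fg_modules A \<Longrightarrow> w \<in> mod_hom A W Z \<Longrightarrow> factors A W Y p w \<longleftrightarrow> factors B (Fo W) E e (Fm W Z w)"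
proof -
  obtain K E \<kappa> e where *: "K \<in> \<K> \<and> E \<in> fg_modules B \<and> short_exact B K E (Fo Z) \<kappa> e \<and>
      (\<forall>W\<in>fg_modules A. \<forall>w\<in>mod_hom A W Z. factors A W Y p w \<longleftrightarrow> factors B (Fo W) E e (Fm W Z w))"
    using assms(1)[unfolded liftable_def, rule_format, OF assms(2-4)] by (elim exE)
  show thesis by (rule that[of K E \<kappa> e]) (use * in simp_all)
qed

text \<open>An extension by zero is an isomorphism, through which every map factors. The identity of
  \<open>F Z\<close> has the same property, with a zero kernel.\<close>

lemma liftable_zero:
  assumes BB: "artin_algebra k B" and F: "stable_functor A B Fo Fm"
    and K: "zero_modules B \<subseteq> \<K>" and X: "X \<in> zero_modules A"
  shows "liftable A B Fo Fm \<K> X"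
  unfolding liftable_def
proof (intro ballI allI impI)
  fix Y Z f p assume Y: "Y \<in> fg_modules A" and Z: "Z \<in> fg_modules A" and se: "short_exact A X Y Z f p"
  note s = short_exactD[OF se] and X0 = zero_modulesD[OF X]
  note Y' = fgD(1)[OF Y] and Z' = fgD(1)[OF Z] and X' = fgD(1)[OF X0(1)]
  have "y = \<zero>\<^bsub>Y\<^esub>" if y: "y \<in> carrier Y" "p y = \<zero>\<^bsub>Z\<^esub>" for y
  proof -
    obtain x where "x \<in> carrier X" "f x = y" using s(6)[OF y] by blast
    moreover from this have "x = \<zero>\<^bsub>X\<^esub>" using X0(2) by blast
    ultimately show ?thesis using hom_zero[OF X' Y' s(1)] by simp
  qed
  then have inj: "inj_on p (carrier Y)" using inj_on_iff_kernel[OF Y' Z' s(2)] by blast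
  obtain g where g: "g \<in> mod_hom A Z Y" "\<And>z. z \<in> carrier Z \<Longrightarrow> p (g z) = z"
    by (rule mod_isomorphic_inverse[OF Y' Z' s(2) inj s(4)]) (rule that)
  note FZ = stable_functorD(1)[OF F Z]
  note FZ' = fgD(1)[OF FZ]
  let ?K = "Fo Z\<lparr>carrier := {\<zero>\<^bsub>Fo Z\<^esub>}\<rparr>" and ?e = "\<lambda>x\<in>carrier (Fo Z). x"
  note K0 = zero_object[OF BB FZ]
  note K' = fgD(1)[OF zero_modulesD(1)[OF K0]]
  interpret FZ: left_module B "Fo Z" by (rule FZ')
  have "short_exact B ?K (Fo Z) (Fo Z) (hzero ?K (Fo Z)) ?e"
    by (rule short_exactI[OF hom_hzero[OF K' FZ'] hom_id[OF FZ']]) (auto simp: inj_on_def hzero_def)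
  moreover have "factors A W Y p w \<longleftrightarrow> factors B (Fo W) (Fo Z) ?e (Fm W Z w)"
    if W: "W \<in> fg_modules A" and w: "w \<in> mod_hom A W Z" for W w
  proof -
    have "factors A W Y p w"
      using g(2) hom_closed[OF w] by (intro factorsI[OF hom_comp[OF fgD(1)[OF W] w g(1)]]) (simp add: compose_eq)
    moreover have "factors B (Fo W) (Fo Z) ?e (Fm W Z w)"
      using hom_closed[OF stable_functorD(2)[OF F W Z w]] by (intro factorsI[OF stable_functorD(2)[OF F W Z w]]) simp
    ultimately show ?thesis by simp
  qed
  moreover have "?K \<in> \<K>" using K K0 by (rule subsetD)
  ultimately show "\<exists>K E \<kappa> e. K \<in> \<K> \<and> E \<in> fg_modules B \<and> short_exact B K E (Fo Z) \<kappa> e \<and>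
      (\<forall>W\<in>fg_modules A. \<forall>w\<in>mod_hom A W Z. factors A W Y p w \<longleftrightarrow> factors B (Fo W) E e (Fm W Z w))"
    using FZ by (intro exI[of _ ?K] exI[of _ "Fo Z"] exI[of _ "hzero ?K (Fo Z)"] exI[of _ ?e]) simp
qed

text \<open>Adding the complement \<open>X2\<close> to the kernel and to the middle term turns an
  extension by \<open>X\<close> into one by \<open>M\<close>. The summand \<open>X2\<close> maps to
  zero in \<open>Z\<close>, so the maps that factor are the same before and after.\<close>

lemma liftable_summand:
  assumes M: "M \<in> fg_modules A" and X: "X \<in> fg_modules A" and X2: "X2 \<in> fg_modules A"
    and bp: "biprod A M X X2 i j r q" and lift: "liftable A B Fo Fm \<K> M"
  shows "liftable A B Fo Fm \<K> X"
  unfolding liftable_def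
proof (intro ballI allI impI)
  fix Y Z f p assume Y: "Y \<in> fg_modules A" and Z: "Z \<in> fg_modules A" and se: "short_exact A X Y Z f p"
  obtain D a b c d where D: "D \<in> fg_modules A" and bd: "biprod A D Y X2 a b c d"
    by (rule biprod_exists[OF Y X2]) (rule that)
  note s = short_exactD[OF se] and m = biprodD[OF bp] and n = biprodD[OF bd]
  note Y' = fgD(1)[OF Y] and Z' = fgD(1)[OF Z] and X' = fgD(1)[OF X] and D' = fgD(1)[OF D] and M' = fgD(1)[OF M] and X2' = fgD(1)[OF X2]
  interpret M: left_module A M by (rule M')
  interpret D: left_module A D by (rule D')
  interpret Y: left_module A Y by (rule Y')
  interpret Z: left_module A Z by (rule Z')
  interpret X: left_module A X by (rule X')
  interpret X2: left_module A X2 by (rule X2')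
  note [simp] = hom_closed[OF s(1)] hom_closed[OF s(2)] hom_closed[OF m(1)] hom_closed[OF m(2)] hom_closed[OF m(3)] hom_closed[OF m(4)]
    hom_closed[OF n(1)] hom_closed[OF n(2)] hom_closed[OF n(3)] hom_closed[OF n(4)]
  let ?f = "hadd M D (compose (carrier M) a (compose (carrier M) f r)) (compose (carrier M) b q)"
  let ?p = "compose (carrier D) p c"
  have fh: "?f \<in> mod_hom A M D" by (intro hom_hadd M' D' hom_comp[OF M' hom_comp[OF M' m(3) s(1)] n(1)] hom_comp[OF M' m(4) n(2)])
  have ph: "?p \<in> mod_hom A D Z" by (rule hom_comp[OF D' n(3) s(2)])
  have fa: "?f x = a (f (r x)) \<oplus>\<^bsub>D\<^esub> b (q x)" if "x \<in> carrier M" for x using that by (simp add: hadd_apply compose_eq)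
  have cf: "c (?f x) = f (r x)" "d (?f x) = q x" if "x \<in> carrier M" for x
    unfolding fa[OF that] using that by (simp_all add: hom_add[OF n(3)] hom_add[OF n(4)] n(5-8))
  have "short_exact A M D Z ?f ?p"
  proof (rule short_exactI[OF fh ph])
    show "inj_on ?f (carrier M)"
    proof (rule inj_onI)
      fix x y assume xy: "x \<in> carrier M" "y \<in> carrier M" "?f x = ?f y"
      have "f (r x) = f (r y)" unfolding cf(1)[OF xy(1), symmetric] cf(1)[OF xy(2), symmetric] xy(3) ..
      then have "r x = r y" using inj_onD[OF s(3)] xy by simp
      moreover have "q x = q y" unfolding cf(2)[OF xy(1), symmetric] cf(2)[OF xy(2), symmetric] xy(3) ..
      ultimately have "i (r x) \<oplus>\<^bsub>M\<^esub> j (q x) = i (r y) \<oplus>\<^bsub>M\<^esub> j (q y)" by (simp only:)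
      then show "x = y" unfolding m(9)[OF xy(1)] m(9)[OF xy(2)] .
    qed
    show "?p ` carrier D = carrier Z"
    proof (intro equalityI subsetI)
      fix z assume "z \<in> carrier Z"
      then obtain y where "y \<in> carrier Y" "p y = z" using s(4) by (metis imageE)
      then show "z \<in> ?p ` carrier D" by (intro image_eqI[of _ _ "a y"]) (simp_all add: compose_eq n(5))
    qed (use hom_closed[OF ph] in auto)
    show "?p (?f x) = \<zero>\<^bsub>Z\<^esub>" if "x \<in> carrier M" for x
      using cf(1)[OF that] hom_closed[OF fh that] s(5)[of "r x"] that by (simp add: compose_eq)
    fix y assume y: "y \<in> carrier D" "?p y = \<zero>\<^bsub>Z\<^esub>"
    then obtain x where x: "x \<in> carrier X" "f x = c y" using s(6)[of "c y"] by (auto simp: compose_eq)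
    let ?x = "i x \<oplus>\<^bsub>M\<^esub> j (d y)"
    have xc: "?x \<in> carrier M" using x y by simp
    have "r ?x = x" "q ?x = d y" using x y by (simp_all add: hom_add[OF m(3)] hom_add[OF m(4)] m(5-8))
    then have "?f ?x = a (c y) \<oplus>\<^bsub>D\<^esub> b (d y)" unfolding fa[OF xc] using x(2) by simp
    then have "?f ?x = y" unfolding n(9)[OF y(1)] .
    then show "\<exists>x\<in>carrier M. ?f x = y" using xc by blast
  qed
  then obtain K E \<kappa> e where KE: "K \<in> \<K>" "E \<in> fg_modules B" "short_exact B K E (Fo Z) \<kappa> e"
    "\<And>W w. W \<in> fg_modules A \<Longrightarrow> w \<in> mod_hom A W Z \<Longrightarrow> factors A W D ?p w \<longleftrightarrow> factors B (Fo W) E e (Fm W Z w)"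
    by (rule liftableE[OF lift D Z]) (rule that)
  have "factors A W Y p w \<longleftrightarrow> factors A W D ?p w" if W: "W \<in> fg_modules A" for W w
  proof
    assume "factors A W Y p w"
    then obtain v where v: "v \<in> mod_hom A W Y" "\<And>x. x \<in> carrier W \<Longrightarrow> p (v x) = w x" by (rule factorsE) (rule that)
    then show "factors A W D ?p w" using hom_closed[OF v(1)]
      by (intro factorsI[OF hom_comp[OF fgD(1)[OF W] v(1) n(1)]]) (simp add: compose_eq n(5))
  next
    assume "factors A W D ?p w"
    then obtain v where v: "v \<in> mod_hom A W D" "\<And>x. x \<in> carrier W \<Longrightarrow> ?p (v x) = w x" by (rule factorsE) (rule that)
    have "p (c (v x)) = w x" if "x \<in> carrier W" for x using v(2)[OF that] hom_closed[OF v(1) that] by (simp add: compose_eq)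
    then show "factors A W Y p w"
      by (intro factorsI[OF hom_comp[OF fgD(1)[OF W] v(1) n(3)]]) (simp add: compose_eq)
  qed
  then show "\<exists>K E \<kappa> e. K \<in> \<K> \<and> E \<in> fg_modules B \<and> short_exact B K E (Fo Z) \<kappa> e \<and>
      (\<forall>W\<in>fg_modules A. \<forall>w\<in>mod_hom A W Z. factors A W Y p w \<longleftrightarrow> factors B (Fo W) E e (Fm W Z w))"
    using KE by (intro exI[of _ K] exI[of _ E] exI[of _ \<kappa>] exI[of _ e]) simp
qed

text \<open>The push-out along the projection \<open>X \<rightarrow> M\<close>, realized as the
  quotient of \<open>Y\<close> by the image of \<open>N\<close>. The kernel of \<open>c\<close> is
  recorded as well, since \<open>Y\<close> has to be recovered from its two push-outs.\<close>

lemma short_exact_quotient_summand: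
  assumes X: "X \<in> fg_modules A" and M: "M \<in> fg_modules A" and N: "N \<in> fg_modules A"
    and Y: "Y \<in> fg_modules A" and Z: "Z \<in> fg_modules A"
    and bp: "biprod A X M N i j p q" and se: "short_exact A X Y Z f g"
  obtains Y1 c g1 where "Y1 \<in> fg_modules A" "c \<in> mod_hom A Y Y1" "c ` carrier Y = carrier Y1"
    "\<And>y. y \<in> carrier Y \<Longrightarrow> c y = \<zero>\<^bsub>Y1\<^esub> \<Longrightarrow> \<exists>n\<in>carrier N. y = f (j n)"
    "\<And>n. n \<in> carrier N \<Longrightarrow> c (f (j n)) = \<zero>\<^bsub>Y1\<^esub>"
    "\<And>y. y \<in> carrier Y \<Longrightarrow> g1 (c y) = g y"
    "short_exact A M Y1 Z (compose (carrier M) c (compose (carrier M) f i)) g1"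
proof -
  note s = short_exactD[OF se] and b = biprodD[OF bp]
  note Y' = fgD(1)[OF Y] and Z' = fgD(1)[OF Z] and X' = fgD(1)[OF X] and M' = fgD(1)[OF M] and N' = fgD(1)[OF N]
  interpret Y: left_module A Y by (rule Y')
  interpret Z: left_module A Z by (rule Z')
  interpret X: left_module A X by (rule X')
  interpret M: left_module A M by (rule M')
  interpret N: left_module A N by (rule N')
  note [simp] = hom_closed[OF s(1)] hom_closed[OF s(2)] hom_closed[OF b(1)] hom_closed[OF b(2)] hom_closed[OF b(3)] hom_closed[OF b(4)]
  let ?fj = "compose (carrier N) f j"
  have fj: "?fj \<in> mod_hom A N Y" by (rule hom_comp[OF N' b(2) s(1)])
  obtain Y1 c where Y1: "Y1 \<in> fg_modules A" "c \<in> mod_hom A Y Y1" "c ` carrier Y = carrier Y1"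
    "\<And>y. y \<in> carrier Y \<Longrightarrow> c y = \<zero>\<^bsub>Y1\<^esub> \<longleftrightarrow> y \<in> ?fj ` carrier N"
    by (rule cokernel[OF Y subm_image[OF N' Y' fj subm_carrier[OF N']]]) (rule that)
  note Y1' = fgD(1)[OF Y1(1)]
  interpret Y1: left_module A Y1 by (rule Y1')
  note [simp] = hom_closed[OF Y1(2)]
  have ker: "\<exists>n\<in>carrier N. y = f (j n)" if y: "y \<in> carrier Y" "c y = \<zero>\<^bsub>Y1\<^esub>" for y
    using Y1(4)[OF y(1)] y(2) by (auto simp: compose_eq)
  have ker': "c (f (j n)) = \<zero>\<^bsub>Y1\<^esub>" if "n \<in> carrier N" for n
    using Y1(4)[of "f (j n)"] that by (auto simp: compose_eq)
  have "g y = \<zero>\<^bsub>Z\<^esub>" if y: "y \<in> carrier Y" "c y = \<zero>\<^bsub>Y1\<^esub>" for y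
    using ker[OF y] s(5) by auto
  then obtain g1 where g1: "g1 \<in> mod_hom A Y1 Z" "\<And>y. y \<in> carrier Y \<Longrightarrow> g1 (c y) = g y"
    by (rule hom_factor_surj[OF Y' Y1' Z' Y1(2,3) s(2)]) (assumption, assumption, rule that)
  let ?k = "compose (carrier M) c (compose (carrier M) f i)"
  have kh: "?k \<in> mod_hom A M Y1" by (rule hom_comp[OF M' hom_comp[OF M' b(1) s(1)] Y1(2)])
  have ka: "?k x = c (f (i x))" if "x \<in> carrier M" for x using that by (simp add: compose_eq)
  have "short_exact A M Y1 Z ?k g1"
  proof (rule short_exactI[OF kh g1(1)])
    have "x = \<zero>\<^bsub>M\<^esub>" if x: "x \<in> carrier M" and 0: "?k x = \<zero>\<^bsub>Y1\<^esub>" for x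
    proof -
      have "c (f (i x)) = \<zero>\<^bsub>Y1\<^esub>" using 0 ka[OF x] by simp
      then obtain n where n: "n \<in> carrier N" "f (i x) = f (j n)" using ker[of "f (i x)"] x by auto
      then have "i x = j n" using inj_onD[OF s(3)] x by simp
      then have "p (i x) = p (j n)" by simp
      then show ?thesis using b(5)[OF x] b(8)[OF n(1)] by simp
    qed
    then show "inj_on ?k (carrier M)" using inj_on_iff_kernel[OF M' Y1' kh] by blast
    show "g1 ` carrier Y1 = carrier Z"
      unfolding Y1(3)[symmetric] image_image s(4)[symmetric] using g1(2) by (intro image_cong refl)
    show "g1 (?k x) = \<zero>\<^bsub>Z\<^esub>" if "x \<in> carrier M" for x unfolding ka[OF that] using that g1(2)[of "f (i x)"] s(5) by simp
    fix u assume u: "u \<in> carrier Y1" "g1 u = \<zero>\<^bsub>Z\<^esub>"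
    obtain y where y: "y \<in> carrier Y" "u = c y" using u(1) Y1(3) by (metis imageE)
    then have "g y = \<zero>\<^bsub>Z\<^esub>" using g1(2) u(2) by simp
    then obtain x where x: "x \<in> carrier X" "f x = y" using s(6)[OF y(1)] by blast
    have "u = c (f (i (p x) \<oplus>\<^bsub>X\<^esub> j (q x)))" unfolding b(9)[OF x(1)] using x y by simp
    also have "\<dots> = c (f (i (p x))) \<oplus>\<^bsub>Y1\<^esub> c (f (j (q x)))" using x by (simp add: hom_add[OF s(1)] hom_add[OF Y1(2)])
    also have "c (f (j (q x))) = \<zero>\<^bsub>Y1\<^esub>" using x by (intro ker') simp
    finally have "u = c (f (i (p x)))" using x by simp
    then show "\<exists>x\<in>carrier M. ?k x = u" using ka[of "p x"] x by (intro bexI[of _ "p x"]) simp_all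
  qed
  note se1 = this
  show thesis by (rule that[OF Y1(1-3)]) (fact ker, fact ker', fact g1(2), fact se1)
qed

lemma biprod_swap:
  assumes X: "left_module A X" and bp: "biprod A X M N i j p q"
  shows "biprod A X N M j i q p"
proof -
  interpret X: left_module A X by (rule X)
  note b = biprodD[OF bp]
  show ?thesis unfolding biprod_def
  proof (intro conjI ballI b)
    fix d assume d: "d \<in> carrier X"
    have "j (q d) \<oplus>\<^bsub>X\<^esub> i (p d) = i (p d) \<oplus>\<^bsub>X\<^esub> j (q d)"
      by (rule X.M.a_comm[OF hom_closed[OF b(2) hom_closed[OF b(4) d]] hom_closed[OF b(1) hom_closed[OF b(3) d]]])
    then show "j (q d) \<oplus>\<^bsub>X\<^esub> i (p d) = d" unfolding b(9)[OF d] .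
  qed
qed

text \<open>An extension of \<open>Z\<close> by \<open>M \<oplus> N\<close> is the fibre product of its push-outs to \<open>M\<close> and \<open>N\<close>.\<close>

lemma liftable_sum:
  assumes BB: "artin_algebra k B" and F: "stable_functor A B Fo Fm" and Kf: "\<K> \<subseteq> fg_modules B"
    and Ks: "\<And>K1 K2 K i j p q. K1 \<in> \<K> \<Longrightarrow> K2 \<in> \<K> \<Longrightarrow> K \<in> fg_modules B \<Longrightarrow> biprod B K K1 K2 i j p q \<Longrightarrow> K \<in> \<K>"
    and X: "X \<in> fg_modules A" and M: "M \<in> fg_modules A" and N: "N \<in> fg_modules A" and bp: "biprod A X M N i j p q"
    and lM: "liftable A B Fo Fm \<K> M" and lN: "liftable A B Fo Fm \<K> N"
  shows "liftable A B Fo Fm \<K> X"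
  unfolding liftable_def
proof (intro ballI allI impI)
  fix Y Z f g assume Y: "Y \<in> fg_modules A" and Z: "Z \<in> fg_modules A" and se: "short_exact A X Y Z f g"
  note s = short_exactD[OF se] and b = biprodD[OF bp]
  note Y' = fgD(1)[OF Y] and Z' = fgD(1)[OF Z] and X' = fgD(1)[OF X] and M' = fgD(1)[OF M] and N' = fgD(1)[OF N]
  interpret Y: left_module A Y by (rule Y')
  interpret X: left_module A X by (rule X')
  interpret M: left_module A M by (rule M')
  interpret N: left_module A N by (rule N')
  note [simp] = hom_closed[OF s(1)] hom_closed[OF s(2)] hom_closed[OF b(1)] hom_closed[OF b(2)] hom_closed[OF b(3)] hom_closed[OF b(4)]
  obtain Y1 c1 g1 where Y1: "Y1 \<in> fg_modules A" "c1 \<in> mod_hom A Y Y1" "c1 ` carrier Y = carrier Y1"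
    "\<And>y. y \<in> carrier Y \<Longrightarrow> c1 y = \<zero>\<^bsub>Y1\<^esub> \<Longrightarrow> \<exists>n\<in>carrier N. y = f (j n)"
    "\<And>n. n \<in> carrier N \<Longrightarrow> c1 (f (j n)) = \<zero>\<^bsub>Y1\<^esub>"
    "\<And>y. y \<in> carrier Y \<Longrightarrow> g1 (c1 y) = g y"
    "short_exact A M Y1 Z (compose (carrier M) c1 (compose (carrier M) f i)) g1"
    by (rule short_exact_quotient_summand[OF X M N Y Z bp se]) (rule that)
  obtain Y2 c2 g2 where Y2: "Y2 \<in> fg_modules A" "c2 \<in> mod_hom A Y Y2" "c2 ` carrier Y = carrier Y2"
    "\<And>y. y \<in> carrier Y \<Longrightarrow> c2 y = \<zero>\<^bsub>Y2\<^esub> \<Longrightarrow> \<exists>n\<in>carrier M. y = f (i n)"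
    "\<And>n. n \<in> carrier M \<Longrightarrow> c2 (f (i n)) = \<zero>\<^bsub>Y2\<^esub>"
    "\<And>y. y \<in> carrier Y \<Longrightarrow> g2 (c2 y) = g y"
    "short_exact A N Y2 Z (compose (carrier N) c2 (compose (carrier N) f j)) g2"
    by (rule short_exact_quotient_summand[OF X N M Y Z biprod_swap[OF X' bp] se]) (rule that)
  note Y1' = fgD(1)[OF Y1(1)] and Y2' = fgD(1)[OF Y2(1)]
  interpret Y1: left_module A Y1 by (rule Y1')
  interpret Y2: left_module A Y2 by (rule Y2')
  note [simp] = hom_closed[OF Y1(2)] hom_closed[OF Y2(2)]
  have pbY: "is_pullback A Y Y1 Y2 c1 c2 g1 g2"
    unfolding is_pullback_def
  proof (intro conjI ballI impI Y1(2) Y2(2))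
    show "g1 (c1 u) = g2 (c2 u)" if "u \<in> carrier Y" for u using Y1(6)[OF that] Y2(6)[OF that] by simp
    show "\<exists>u\<in>carrier Y. c1 u = x \<and> c2 u = y" if xy: "x \<in> carrier Y1" "y \<in> carrier Y2" "g1 x = g2 y" for x y
    proof -
      obtain y1 where y1: "y1 \<in> carrier Y" "c1 y1 = x" using xy(1) Y1(3) by (metis imageE)
      obtain y2 where y2: "y2 \<in> carrier Y" "c2 y2 = y" using xy(2) Y2(3) by (metis imageE)
      have "g y1 = g y2" using Y1(6)[OF y1(1)] Y2(6)[OF y2(1)] y1 y2 xy(3) by simp
      then have "g (y1 \<ominus>\<^bsub>Y\<^esub> y2) = \<zero>\<^bsub>Z\<^esub>"
        using y1 y2 abelian_group.diff_eq_zero_iff[of Z] Z' by (simp add: hom_diff[OF Y' Z' s(2)] left_module_def)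
      then obtain \<xi> where xi: "\<xi> \<in> carrier X" "f \<xi> = y1 \<ominus>\<^bsub>Y\<^esub> y2" using s(6)[of "y1 \<ominus>\<^bsub>Y\<^esub> y2"] y1 y2 by auto
      have fx: "f \<xi> = f (i (p \<xi>)) \<oplus>\<^bsub>Y\<^esub> f (j (q \<xi>))"
      proof -
        have "f (i (p \<xi>) \<oplus>\<^bsub>X\<^esub> j (q \<xi>)) = f (i (p \<xi>)) \<oplus>\<^bsub>Y\<^esub> f (j (q \<xi>))" using xi(1) by (intro hom_add[OF s(1)]) simp_all
        then show ?thesis unfolding b(9)[OF xi(1)] .
      qed
      \<comment> \<open>\<open>y1\<close> and \<open>y2\<close> differ by \<open>f \<xi>\<close>.
        Its part in \<open>M\<close> is added to \<open>y2\<close>, which \<open>c2\<close> does not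
        notice; its part in \<open>N\<close> is all that separates \<open>?u\<close> from
        \<open>y1\<close>, which \<open>c1\<close> does not notice.\<close>
      let ?u = "f (i (p \<xi>)) \<oplus>\<^bsub>Y\<^esub> y2"
      have "y1 = f \<xi> \<oplus>\<^bsub>Y\<^esub> y2" unfolding xi(2) using y1 y2 by (simp add: Y.M.diff_add_cancel)
      then have y1u: "y1 = ?u \<oplus>\<^bsub>Y\<^esub> f (j (q \<xi>))" unfolding fx using xi(1) y2 by (simp add: Y.M.a_ac)
      have uc: "?u \<in> carrier Y" using xi(1) y2 by simp
      have "c1 y1 = c1 ?u \<oplus>\<^bsub>Y1\<^esub> c1 (f (j (q \<xi>)))" unfolding y1u using xi(1) uc by (intro hom_add[OF Y1(2)]) simp_all
      then have "c1 ?u = x" using Y1(5)[of "q \<xi>"] xi(1) uc y1(2) by simp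
      moreover have "c2 ?u = y"
        using Y2(5)[of "p \<xi>"] xi(1) y2 xy(2) by (simp add: hom_add[OF Y2(2)])
      ultimately show ?thesis using uc by blast
    qed
    show "u = v" if uv: "u \<in> carrier Y" "v \<in> carrier Y" "c1 u = c1 v" "c2 u = c2 v" for u v
    proof -
      have d: "u \<ominus>\<^bsub>Y\<^esub> v \<in> carrier Y" using uv by simp
      have "c1 (u \<ominus>\<^bsub>Y\<^esub> v) = \<zero>\<^bsub>Y1\<^esub>" "c2 (u \<ominus>\<^bsub>Y\<^esub> v) = \<zero>\<^bsub>Y2\<^esub>"
        using uv by (simp_all add: hom_diff[OF Y' Y1' Y1(2)] hom_diff[OF Y' Y2' Y2(2)] Y1.M.diff_eq_zero_iff Y2.M.diff_eq_zero_iff)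
      \<comment> \<open>The kernels of \<open>c1\<close> and \<open>c2\<close> are the images of
        \<open>N\<close> and \<open>M\<close>, and these meet only in zero.\<close>
      then obtain n m where nm: "n \<in> carrier N" "u \<ominus>\<^bsub>Y\<^esub> v = f (j n)" "m \<in> carrier M" "u \<ominus>\<^bsub>Y\<^esub> v = f (i m)"
        using Y1(4)[OF d] Y2(4)[OF d] by blast
      have "f (j n) = f (i m)" using nm(2,4) by simp
      then have "j n = i m" using inj_onD[OF s(3)] nm(1,3) by simp
      then have "q (j n) = q (i m)" by simp
      then have "n = \<zero>\<^bsub>N\<^esub>" using b(7)[OF nm(1)] b(6)[OF nm(3)] by simp
      then have "u \<ominus>\<^bsub>Y\<^esub> v = \<zero>\<^bsub>Y\<^esub>" using nm(2) hom_zero[OF N' X' b(2)] hom_zero[OF X' Y' s(1)] by simp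
      then show ?thesis using uv by (simp add: Y.M.diff_eq_zero_iff)
    qed
  qed
  obtain K1 E1 \<kappa>1 e1 where 1: "K1 \<in> \<K>" "E1 \<in> fg_modules B" "short_exact B K1 E1 (Fo Z) \<kappa>1 e1"
    "\<And>W w. W \<in> fg_modules A \<Longrightarrow> w \<in> mod_hom A W Z \<Longrightarrow> factors A W Y1 g1 w \<longleftrightarrow> factors B (Fo W) E1 e1 (Fm W Z w)"
    by (rule liftableE[OF lM Y1(1) Z Y1(7)]) (rule that)
  obtain K2 E2 \<kappa>2 e2 where 2: "K2 \<in> \<K>" "E2 \<in> fg_modules B" "short_exact B K2 E2 (Fo Z) \<kappa>2 e2"
    "\<And>W w. W \<in> fg_modules A \<Longrightarrow> w \<in> mod_hom A W Z \<Longrightarrow> factors A W Y2 g2 w \<longleftrightarrow> factors B (Fo W) E2 e2 (Fm W Z w)"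
    by (rule liftableE[OF lN Y2(1) Z Y2(7)]) (rule that)
  note FZ = stable_functorD(1)[OF F Z]
  have K12: "K1 \<in> fg_modules B" "K2 \<in> fg_modules B" using Kf 1(1) 2(1) by blast+
  obtain K i' j' p' q' where K: "K \<in> fg_modules B" and bK: "biprod B K K1 K2 i' j' p' q'"
    by (rule biprod_exists[OF K12]) (rule that)
  obtain E u v where E: "E \<in> fg_modules B" and pbE: "is_pullback B E E1 E2 u v e1 e2"
    by (rule pullback_exists[OF BB 1(2) 2(2) FZ short_exactD(2)[OF 1(3)] short_exactD(2)[OF 2(3)]]) (rule that)
  obtain \<kappa> where ses: "short_exact B K E (Fo Z) \<kappa> (compose (carrier E) e1 u)"
    by (rule short_exact_pullback_sum[OF fgD(1)[OF K] fgD(1)[OF K12(1)] fgD(1)[OF K12(2)] fgD(1)[OF 1(2)]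
        fgD(1)[OF 2(2)] fgD(1)[OF E] fgD(1)[OF FZ] bK 1(3) 2(3) pbE]) (rule that)
  have "factors A W Y g w \<longleftrightarrow> factors B (Fo W) E (compose (carrier E) e1 u) (Fm W Z w)"
    if W: "W \<in> fg_modules A" and w: "w \<in> mod_hom A W Z" for W w
  proof -
    have "factors A W Y g w \<longleftrightarrow> factors A W Y1 g1 w \<and> factors A W Y2 g2 w"
      by (rule factors_pullback_both[OF pbY Y W]) (simp add: Y1(6))
    also have "\<dots> \<longleftrightarrow> factors B (Fo W) E1 e1 (Fm W Z w) \<and> factors B (Fo W) E2 e2 (Fm W Z w)"
      unfolding 1(4)[OF W w] 2(4)[OF W w] ..
    also have "\<dots> \<longleftrightarrow> factors B (Fo W) E (compose (carrier E) e1 u) (Fm W Z w)"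
      by (rule factors_pullback_both[OF pbE E stable_functorD(1)[OF F W], symmetric]) (simp add: compose_eq)
    finally show ?thesis .
  qed
  moreover have "K \<in> \<K>" by (rule Ks[OF 1(1) 2(1) K bK])
  ultimately show "\<exists>K E \<kappa> e. K \<in> \<K> \<and> E \<in> fg_modules B \<and> short_exact B K E (Fo Z) \<kappa> e \<and>
      (\<forall>W\<in>fg_modules A. \<forall>w\<in>mod_hom A W Z. factors A W Y g w \<longleftrightarrow> factors B (Fo W) E e (Fm W Z w))"
    using E ses by (intro exI[of _ K] exI[of _ E] exI[of _ \<kappa>] exI[of _ "compose (carrier E) e1 u"]) simp
qed

lemma liftable_add_closure:
  assumes BB: "artin_algebra k B" and F: "stable_functor A B Fo Fm" and S: "sclosed B \<K>"
    and T: "liftable A B Fo Fm \<K> T" and X: "X \<in> add_closure A {T}"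
  shows "liftable A B Fo Fm \<K> X"
  using X
proof (induction rule: add_closure.induct)
  case (base X)
  then show ?case using T by simp
next
  case (empty_sum X)
  have "zero_modules B \<subseteq> \<K>" using sclosedD(2)[OF S] projective_zero by blast
  then show ?case using empty_sum by (rule liftable_zero[OF BB F])
next
  case (direct_sum M N X)
  note M = add_closure_fg[OF direct_sum.hyps(1)] and N = add_closure_fg[OF direct_sum.hyps(2)] and X = direct_sum.hyps(3)
  obtain i j p q where bp: "biprod A X M N i j p q"
    by (rule biprod_of_iso[OF fgD(1)[OF X] fgD(1)[OF M] fgD(1)[OF N] direct_sum.hyps(4)]) (rule that)
  show ?case
  proof (rule liftable_sum[OF BB F _ _ X M N bp direct_sum.IH])
    show "\<K> \<subseteq> fg_modules B" using sclosedD(1)[OF S] by blast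
  qed (rule sclosedD(3)[OF S])
next
  case (summand Y X Z)
  note Y = add_closure_fg[OF summand.hyps(1)] and X = summand.hyps(2) and Z = summand.hyps(3)
  obtain i j p q where bp: "biprod A Y X Z i j p q"
    by (rule biprod_of_iso[OF fgD(1)[OF Y] fgD(1)[OF X] fgD(1)[OF Z] summand.hyps(4)]) (rule that)
  show ?case by (rule liftable_summand[OF Y X Z bp summand.IH])
qed

lemma stable_equivalenceD:
  assumes "stable_equivalence A B Fo Fm"
  shows "stable_functor A B Fo Fm"
    "X \<in> fg_modules A \<Longrightarrow> Y \<in> fg_modules A \<Longrightarrow> f \<in> mod_hom A X Y \<Longrightarrow> g \<in> mod_hom A X Y \<Longrightarrow>
      steq B (Fo X) (Fo Y) (Fm X Y f) (Fm X Y g) \<Longrightarrow> steq A X Y f g"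
    "X \<in> fg_modules A \<Longrightarrow> Y \<in> fg_modules A \<Longrightarrow> h \<in> mod_hom B (Fo X) (Fo Y) \<Longrightarrow>
      \<exists>f\<in>mod_hom A X Y. steq B (Fo X) (Fo Y) (Fm X Y f) h"
    "V \<in> fg_modules B \<Longrightarrow> \<exists>X\<in>fg_modules A. \<exists>s\<in>mod_hom B (Fo X) V. \<exists>t\<in>mod_hom B V (Fo X).
      steq B V V (compose (carrier V) s t) (\<lambda>y\<in>carrier V. y)"
proof -
  note S = assms[unfolded stable_equivalence_def]
  show "stable_functor A B Fo Fm" using S[THEN conjunct1] .
  show "X \<in> fg_modules A \<Longrightarrow> Y \<in> fg_modules A \<Longrightarrow> f \<in> mod_hom A X Y \<Longrightarrow> g \<in> mod_hom A X Y \<Longrightarrow>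
      steq B (Fo X) (Fo Y) (Fm X Y f) (Fm X Y g) \<Longrightarrow> steq A X Y f g"
    by (rule S[THEN conjunct2, THEN conjunct1, rule_format])
  show "X \<in> fg_modules A \<Longrightarrow> Y \<in> fg_modules A \<Longrightarrow> h \<in> mod_hom B (Fo X) (Fo Y) \<Longrightarrow>
      \<exists>f\<in>mod_hom A X Y. steq B (Fo X) (Fo Y) (Fm X Y f) h"
    by (rule S[THEN conjunct2, THEN conjunct2, THEN conjunct1, rule_format])
  show "V \<in> fg_modules B \<Longrightarrow> \<exists>X\<in>fg_modules A. \<exists>s\<in>mod_hom B (Fo X) V. \<exists>t\<in>mod_hom B V (Fo X).
      steq B V V (compose (carrier V) s t) (\<lambda>y\<in>carrier V. y)"
    by (rule S[THEN conjunct2, THEN conjunct2, THEN conjunct2, rule_format])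
qed

text \<open>\<open>D\<close> is \<open>F I \<oplus> Q\<close> and \<open>\<delta>\<close> has the
  components \<open>F \<pi>\<close> and \<open>q\<close>. The projective summand \<open>Q\<close>
  contributes only maps that are stably zero, so factoring through \<open>\<delta>\<close> means
  factoring stably through \<open>F \<pi>\<close>; as \<open>F\<close> is full and faithful, this is
  factoring stably through \<open>\<pi>\<close>. Both \<open>\<delta>\<close> and
  \<open>\<pi>\<close> are onto, so that stable and actual factorizations coincide.\<close>

lemma factors_presentation:
  assumes eq: "stable_equivalence A B Fo Fm"
    and I: "I \<in> fg_modules A" and C: "C \<in> fg_modules A" and pi: "\<pi> \<in> mod_hom A I C" "\<pi> ` carrier I = carrier C"
    and Q: "projective B Q" and q: "q \<in> mod_hom B Q (Fo C)"
    and D: "D \<in> fg_modules B" and bp: "biprod B D (Fo I) Q a b c d"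
    and delta: "\<delta> = hadd D (Fo C) (compose (carrier D) (Fm I C \<pi>) c) (compose (carrier D) q d)"
    and onto: "\<delta> ` carrier D = carrier (Fo C)"
    and W: "W \<in> fg_modules A" and w: "w \<in> mod_hom A W C"
  shows "factors A W I \<pi> w \<longleftrightarrow> factors B (Fo W) D \<delta> (Fm W C w)"
proof
  note F = stable_equivalenceD(1)[OF eq]
  note FI = stable_functorD(1)[OF F I] and FC = stable_functorD(1)[OF F C] and FW = stable_functorD(1)[OF F W]
  note bb = biprodD[OF bp] and D' = fgD(1)[OF D] and FC' = fgD(1)[OF FC] and FW' = fgD(1)[OF FW] and W' = fgD(1)[OF W]
  note Qf = projective_fg[OF Q]
  note Fpi = stable_functorD(2)[OF F I C pi(1)]
  interpret FC: left_module B "Fo C" by (rule FC')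
  interpret Q: left_module B Q by (rule fgD(1)[OF Qf])
  note [simp] = hom_closed[OF bb(1)] hom_closed[OF bb(3)] hom_closed[OF bb(4)] hom_closed[OF Fpi] hom_closed[OF q]
  have dh: "\<delta> \<in> mod_hom B D (Fo C)"
    unfolding delta by (intro hom_hadd D' FC' hom_comp[OF D' bb(3) Fpi] hom_comp[OF D' bb(4) q])
  have da: "\<delta> x = Fm I C \<pi> (c x) \<oplus>\<^bsub>Fo C\<^esub> q (d x)" if "x \<in> carrier D" for x
    using that by (simp add: delta hadd_apply compose_eq)
  {
    assume "factors A W I \<pi> w"
    then obtain v where v: "v \<in> mod_hom A W I" "\<And>x. x \<in> carrier W \<Longrightarrow> \<pi> (v x) = w x"
      by (rule factorsE) (rule that)
    have wv: "w = compose (carrier W) \<pi> v"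
      using v(2) by (intro hom_eqI[OF w hom_comp[OF W' v(1) pi(1)]]) (simp add: compose_eq)
    note Fv = stable_functorD(2)[OF F W I v(1)]
    have "steq B (Fo W) (Fo C) (Fm W C w) (compose (carrier (Fo W)) (Fm I C \<pi>) (Fm W I v))"
      unfolding wv by (rule stable_functorD(6)[OF F W I C v(1) pi(1)])
    moreover have "factors B (Fo W) D \<delta> (compose (carrier (Fo W)) (Fm I C \<pi>) (Fm W I v))"
      using hom_closed[OF Fv] hom_zero[OF fgD(1)[OF Qf] FC' q]
      by (intro factorsI[OF hom_comp[OF FW' Fv bb(1)]]) (simp add: compose_eq da bb(5,6))
    ultimately show "factors B (Fo W) D \<delta> (Fm W C w)" by (rule factors_steq[OF FW D FC dh onto])
  next
    assume "factors B (Fo W) D \<delta> (Fm W C w)"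
    then obtain v where v: "v \<in> mod_hom B (Fo W) D" "\<And>x. x \<in> carrier (Fo W) \<Longrightarrow> \<delta> (v x) = Fm W C w x"
      by (rule factorsE) (rule that)
    note cv = hom_comp[OF FW' v(1) bb(3)] and dv = hom_comp[OF FW' v(1) bb(4)]
    note Fw = stable_functorD(2)[OF F W C w]
    have 1: "steq B (Fo W) (Fo C) (Fm W C w) (compose (carrier (Fo W)) (Fm I C \<pi>) (compose (carrier (Fo W)) c v))"
    proof (rule steqI[OF Fw hom_comp[OF FW' cv Fpi] proj_homI[OF Q dv q]])
      fix x assume x: "x \<in> carrier (Fo W)"
      note vx = hom_closed[OF v(1) x]
      have "Fm W C w x = Fm I C \<pi> (c (v x)) \<oplus>\<^bsub>Fo C\<^esub> q (d (v x))" unfolding v(2)[OF x, symmetric] by (rule da[OF vx])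
      also have "\<dots> = q (d (v x)) \<oplus>\<^bsub>Fo C\<^esub> Fm I C \<pi> (c (v x))" using vx by (intro FC.M.a_comm) simp_all
      finally show "Fm W C w x = compose (carrier (Fo W)) q (compose (carrier (Fo W)) d v) x \<oplus>\<^bsub>Fo C\<^esub>
         compose (carrier (Fo W)) (Fm I C \<pi>) (compose (carrier (Fo W)) c v) x"
        using x by (simp add: compose_eq)
    qed
    obtain v' where v': "v' \<in> mod_hom A W I" "steq B (Fo W) (Fo I) (Fm W I v') (compose (carrier (Fo W)) c v)"
      using stable_equivalenceD(3)[OF eq W I cv] by blast
    note piv = hom_comp[OF W' v'(1) pi(1)]
    have "steq B (Fo W) (Fo C) (Fm W C w) (Fm W C (compose (carrier W) \<pi> v'))"
      by (rule steq_trans[OF FW FC 1 steq_trans[OF FW FC steq_sym[OF FW FC steq_comp_left[OF FW FI v'(2) Fpi]]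
            steq_sym[OF FW FC stable_functorD(6)[OF F W I C v'(1) pi(1)]]]])
    then have "steq A W C w (compose (carrier W) \<pi> v')" by (rule stable_equivalenceD(2)[OF eq W C w piv])
    moreover have "factors A W I \<pi> (compose (carrier W) \<pi> v')"
      by (intro factorsI[OF v'(1)]) (simp add: compose_eq)
    ultimately show "factors A W I \<pi> w" by (rule factors_steq[OF W I C pi])
  }
qed

text \<open>Every extension of \<open>Z\<close> by \<open>T\<close> is a pull-back of \<open>0 \<rightarrow> T \<rightarrow> I \<rightarrow> C \<rightarrow> 0\<close>, and the latter is
  transported by lifting the stable map \<open>F I \<rightarrow> F C\<close> to a surjection with kernel \<open>K\<close>.\<close>

lemma liftable_single:
  fixes A :: "('k, 'a) module" and B :: "('k, 'b) module"
  assumes AA: "artin_algebra k A" and BB: "artin_algebra k B" and eq: "stable_equivalence A B Fo Fm"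
    and T: "T \<in> fg_modules A"
  obtains K where "K \<in> fg_modules B" "\<And>\<K>. K \<in> \<K> \<Longrightarrow> liftable A B Fo Fm \<K> T"
proof -
  note F = stable_equivalenceD(1)[OF eq]
  obtain I \<iota> where I: "I \<in> fg_modules A" "\<iota> \<in> mod_hom A T I" "inj_on \<iota> (carrier T)"
    and ext: "\<And>Y j. Y \<in> fg_modules A \<Longrightarrow> j \<in> mod_hom A T Y \<Longrightarrow> inj_on j (carrier T) \<Longrightarrow>
      \<exists>h\<in>mod_hom A Y I. \<forall>x\<in>carrier T. h (j x) = \<iota> x"
    by (rule injective_extension[OF AA T]) (rule that)
  note T' = fgD(1)[OF T] and I' = fgD(1)[OF I(1)]
  obtain C \<pi> where C: "C \<in> fg_modules A" "\<pi> \<in> mod_hom A I C" "\<pi> ` carrier I = carrier C"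
    "\<And>x. x \<in> carrier I \<Longrightarrow> \<pi> x = \<zero>\<^bsub>C\<^esub> \<longleftrightarrow> x \<in> \<iota> ` carrier T"
    by (rule cokernel[OF I(1) subm_image[OF T' I' I(2) subm_carrier[OF T']]]) (rule that)
  note C' = fgD(1)[OF C(1)]
  interpret C: left_module A C by (rule C')
  interpret I: left_module A I by (rule I')
  interpret T: left_module A T by (rule T')
  note FI = stable_functorD(1)[OF F I(1)] and FC = stable_functorD(1)[OF F C(1)]
  note Fpi = stable_functorD(2)[OF F I(1) C(1,2)]
  obtain P u where P: "free_gen B P u" using free_gen_exists[OF artin_algebraD(1)[OF BB]] by blast
  obtain Q q where Q: "projective B Q" "q \<in> mod_hom B Q (Fo C)" "q ` carrier Q = carrier (Fo C)"
    by (rule enough_projectives[OF BB P FC]) (rule that)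
  note Qf = projective_fg[OF Q(1)]
  obtain D a b c d where D: "D \<in> fg_modules B" and bp: "biprod B D (Fo I) Q a b c d"
    by (rule biprod_exists[OF FI Qf]) (rule that)
  note bb = biprodD[OF bp] and D' = fgD(1)[OF D] and FC' = fgD(1)[OF FC]
  interpret FC: left_module B "Fo C" by (rule FC')
  define \<delta> where "\<delta> = hadd D (Fo C) (compose (carrier D) (Fm I C \<pi>) c) (compose (carrier D) q d)"
  have dh: "\<delta> \<in> mod_hom B D (Fo C)"
    unfolding \<delta>_def by (intro hom_hadd D' FC' hom_comp[OF D' bb(3) Fpi] hom_comp[OF D' bb(4) Q(2)])
  have onto: "\<delta> ` carrier D = carrier (Fo C)"
  proof (intro equalityI subsetI)
    fix y assume "y \<in> carrier (Fo C)"
    then obtain x where x: "x \<in> carrier Q" "q x = y" using Q(3) by (metis imageE)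
    have "\<delta> (b x) = y"
      using x hom_closed[OF bb(2) x(1)] hom_closed[OF Q(2)] hom_zero[OF fgD(1)[OF FI] FC' Fpi]
      by (auto simp: \<delta>_def hadd_apply compose_eq bb(7,8))
    then show "y \<in> \<delta> ` carrier D" using hom_closed[OF bb(2) x(1)] by blast
  qed (use hom_closed[OF dh] in auto)
  \<comment> \<open>\<open>K\<close> is fixed before any extension by \<open>T\<close> is
    considered: it comes from the one sequence that starts with
    \<open>T \<rightarrow> I\<close>.\<close>
  obtain K \<kappa> where K: "K \<in> fg_modules B" "\<kappa> \<in> mod_hom B K D" "inj_on \<kappa> (carrier K)"
    "\<kappa> ` carrier K = {x \<in> carrier D. \<delta> x = \<zero>\<^bsub>Fo C\<^esub>}"
    by (rule subobject[OF BB D subm_kernel[OF D' FC' dh]]) (rule that)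
  have seK: "short_exact B K D (Fo C) \<kappa> \<delta>" using K(2-4) dh onto by (simp add: short_exact_def)
  have "liftable A B Fo Fm \<K> T" if KK: "K \<in> \<K>" for \<K>
    unfolding liftable_def
  proof (intro ballI allI impI)
    fix Y Z f p assume Y: "Y \<in> fg_modules A" and Z: "Z \<in> fg_modules A" and se: "short_exact A T Y Z f p"
    note s = short_exactD[OF se] and Y' = fgD(1)[OF Y] and Z' = fgD(1)[OF Z]
    interpret Y: left_module A Y by (rule Y')
    interpret Z: left_module A Z by (rule Z')
    obtain h where h: "h \<in> mod_hom A Y I" "\<And>x. x \<in> carrier T \<Longrightarrow> h (f x) = \<iota> x" using ext[OF Y s(1,3)] by blast
    note [simp] = hom_closed[OF s(1)] hom_closed[OF s(2)] hom_closed[OF h(1)] hom_closed[OF C(2)] hom_closed[OF I(2)]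
    have "compose (carrier Y) \<pi> h y = \<zero>\<^bsub>C\<^esub>" if y: "y \<in> carrier Y" "p y = \<zero>\<^bsub>Z\<^esub>" for y
    proof -
      obtain x where x: "x \<in> carrier T" "f x = y" using s(6)[OF y] by blast
      have "h y \<in> \<iota> ` carrier T" using h(2)[OF x(1)] x by auto
      then show ?thesis using C(4)[of "h y"] y by (simp add: compose_eq)
    qed
    then obtain g where g: "g \<in> mod_hom A Z C" "\<And>y. y \<in> carrier Y \<Longrightarrow> g (p y) = compose (carrier Y) \<pi> h y"
      by (rule hom_factor_surj[OF Y' Z' C' s(2,4) hom_comp[OF Y' h(1) C(2)]]) (assumption, assumption, rule that)
    have ga: "g (p y) = \<pi> (h y)" if "y \<in> carrier Y" for y using g(2)[OF that] that by (simp add: compose_eq)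
    \<comment> \<open>The map \<open>h\<close> over \<open>g\<close> induces the identity on the
      kernels \<open>T\<close>, and this makes the square over \<open>C\<close> a pull-back.\<close>
    have pbY: "is_pullback A Y I Z h p \<pi> g"
      unfolding is_pullback_def
    proof (intro conjI ballI impI h(1) s(2))
      show "\<pi> (h u) = g (p u)" if "u \<in> carrier Y" for u using ga[OF that] by simp
      show "\<exists>u\<in>carrier Y. h u = x \<and> p u = z" if xz: "x \<in> carrier I" "z \<in> carrier Z" "\<pi> x = g z" for x z
      proof -
        obtain y where y: "y \<in> carrier Y" "p y = z" using xz(2) s(4) by (metis imageE)
        have "\<pi> (x \<ominus>\<^bsub>I\<^esub> h y) = \<zero>\<^bsub>C\<^esub>"
          using xz y ga[OF y(1)] by (simp add: hom_diff[OF I' C' C(2)] C.M.diff_eq_zero_iff)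
        then have "x \<ominus>\<^bsub>I\<^esub> h y \<in> \<iota> ` carrier T" using C(4)[of "x \<ominus>\<^bsub>I\<^esub> h y"] xz y by simp
        then obtain t where t: "t \<in> carrier T" "x \<ominus>\<^bsub>I\<^esub> h y = \<iota> t" by blast
        have "h (f t \<oplus>\<^bsub>Y\<^esub> y) = \<iota> t \<oplus>\<^bsub>I\<^esub> h y" using t y by (simp add: hom_add[OF h(1)] h(2))
        also have "\<dots> = x" unfolding t(2)[symmetric] using xz y by (simp add: I.M.diff_add_cancel)
        finally have "h (f t \<oplus>\<^bsub>Y\<^esub> y) = x" .
        moreover have "p (f t \<oplus>\<^bsub>Y\<^esub> y) = z" using t y xz(2) by (simp add: hom_add[OF s(2)] s(5))
        ultimately show ?thesis using t(1) y(1) by (intro bexI[of _ "f t \<oplus>\<^bsub>Y\<^esub> y"]) simp_all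
      qed
      show "u = v" if uv: "u \<in> carrier Y" "v \<in> carrier Y" "h u = h v" "p u = p v" for u v
      proof -
        have "p (u \<ominus>\<^bsub>Y\<^esub> v) = \<zero>\<^bsub>Z\<^esub>" using uv by (simp add: hom_diff[OF Y' Z' s(2)] Z.M.diff_eq_zero_iff)
        then obtain t where t: "t \<in> carrier T" "f t = u \<ominus>\<^bsub>Y\<^esub> v" using s(6)[of "u \<ominus>\<^bsub>Y\<^esub> v"] uv by auto
        have "h (u \<ominus>\<^bsub>Y\<^esub> v) = \<zero>\<^bsub>I\<^esub>" using uv by (simp add: hom_diff[OF Y' I' h(1)] I.M.diff_eq_zero_iff)
        then have "\<iota> t = \<zero>\<^bsub>I\<^esub>" using h(2)[OF t(1)] t(2) by simp
        then have "t = \<zero>\<^bsub>T\<^esub>" using inj_on_iff_kernel[OF T' I' I(2)] I(3) t(1) by blast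
        then have "u \<ominus>\<^bsub>Y\<^esub> v = \<zero>\<^bsub>Y\<^esub>" using t(2) hom_zero[OF T' Y' s(1)] by simp
        then show ?thesis using uv by (simp add: Y.M.diff_eq_zero_iff)
      qed
    qed
    note FZ = stable_functorD(1)[OF F Z] and Fg = stable_functorD(2)[OF F Z C(1) g(1)]
    obtain E u e where E: "E \<in> fg_modules B" and pbE: "is_pullback B E D (Fo Z) u e \<delta> (Fm Z C g)"
      by (rule pullback_exists[OF BB D FZ FC dh Fg]) (rule that)
    obtain \<kappa>' where ses: "short_exact B K E (Fo Z) \<kappa>' e"
      by (rule short_exact_pullback[OF fgD(1)[OF K(1)] D' fgD(1)[OF E] fgD(1)[OF FZ] FC' seK pbE Fg]) (rule that)
    have "factors A W Y p w \<longleftrightarrow> factors B (Fo W) E e (Fm W Z w)"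
      if W: "W \<in> fg_modules A" and w: "w \<in> mod_hom A W Z" for W w
    proof -
      note FW = stable_functorD(1)[OF F W] and Fw = stable_functorD(2)[OF F W Z w] and W' = fgD(1)[OF W]
      note FW' = fgD(1)[OF FW]
      note gw = hom_comp[OF W' w g(1)]
      note st = stable_functorD(6)[OF F W Z C(1) w g(1)]
      have "factors A W Y p w \<longleftrightarrow> factors A W I \<pi> (compose (carrier W) g w)"
        by (rule factors_pullback_base[OF pbY Y W w])
      also have "\<dots> \<longleftrightarrow> factors B (Fo W) D \<delta> (Fm W C (compose (carrier W) g w))"
        by (rule factors_presentation[where w = "compose (carrier W) g w" and \<pi> = \<pi> and \<delta> = \<delta>,
              OF eq I(1) C(1-3) Q(1,2) D bp \<delta>_def onto W gw])
      \<comment> \<open>\<open>F\<close> respects the composite of \<open>g\<close> and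
        \<open>w\<close> only up to \<open>steq\<close>, which does not affect factoring through the
        surjection \<open>\<delta>\<close>.\<close>
      also have "\<dots> \<longleftrightarrow> factors B (Fo W) D \<delta> (compose (carrier (Fo W)) (Fm Z C g) (Fm W Z w))"
        using factors_steq[OF FW D FC dh onto st] factors_steq[OF FW D FC dh onto steq_sym[OF FW FC st]] by blast
      also have "\<dots> \<longleftrightarrow> factors B (Fo W) E e (Fm W Z w)"
        by (rule factors_pullback_base[OF pbE E FW Fw, symmetric])
      finally show ?thesis .
    qed
    then show "\<exists>K E \<kappa> e. K \<in> \<K> \<and> E \<in> fg_modules B \<and> short_exact B K E (Fo Z) \<kappa> e \<and>
      (\<forall>W\<in>fg_modules A. \<forall>w\<in>mod_hom A W Z. factors A W Y p w \<longleftrightarrow> factors B (Fo W) E e (Fm W Z w))"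
      using KK E ses by (intro exI[of _ K] exI[of _ E] exI[of _ \<kappa>'] exI[of _ e]) simp
  qed
  then show thesis by (rule that[OF K(1)])
qed

text \<open>Among the endomorphisms \<open>h\<close> of \<open>Y\<close> with \<open>p h = p\<close> stably, one with smallest image and
  largest kernel splits \<open>Y\<close> as \<open>Y\<^sub>0 \<oplus> ker h\<close>, and then every endomorphism \<open>g\<close> of \<open>Y\<^sub>0\<close> with
  \<open>p i g = p i\<close> stably is invertible.\<close>

lemma stably_right_minimal_part:
  fixes A :: "('k, 'a) module"
  assumes AA: "artin_algebra k A" and Y: "Y \<in> fg_modules A" and Z: "Z \<in> fg_modules A" and p: "p \<in> mod_hom A Y Z"
  obtains Y0 i q where "Y0 \<in> fg_modules A" "i \<in> mod_hom A Y0 Y" "q \<in> mod_hom A Y Y0"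
    "\<And>y. y \<in> carrier Y0 \<Longrightarrow> q (i y) = y" "steq A Y Z (compose (carrier Y) p (compose (carrier Y) i q)) p"
    "\<And>g. g \<in> mod_hom A Y0 Y0 \<Longrightarrow> steq A Y0 Z (compose (carrier Y0) p (compose (carrier Y0) i g)) (compose (carrier Y0) p i) \<Longrightarrow>
      \<exists>g'\<in>mod_hom A Y0 Y0. \<forall>y\<in>carrier Y0. g' (g y) = y"
proof -
  note Y' = fgD[OF Y] and Z' = fgD(1)[OF Z]
  note Yl = Y'(1)
  interpret Y: left_module A Y by (rule Yl)
  obtain n where "ranked k (restr A Y) (carrier Y) n" using rank_module[OF AA Y'] by blast
  then obtain r where r: "\<And>U. subm k (restr A Y) U \<Longrightarrow> r U \<le> n"
    "\<And>U V. subm k (restr A Y) U \<Longrightarrow> subm k (restr A Y) V \<Longrightarrow> U \<subseteq> V \<Longrightarrow> r U \<le> r V"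
    "\<And>U V. subm k (restr A Y) U \<Longrightarrow> subm k (restr A Y) V \<Longrightarrow> U \<subseteq> V \<Longrightarrow> r U = r V \<Longrightarrow> V \<inter> carrier Y \<subseteq> U"
    by (elim rankedE) blast
  have rs: "U = V" if U: "subm A Y U" and V: "subm A Y V" and "U \<subseteq> V" "r U = r V" for U V
    using r(3)[OF subm_restr[OF AA U] subm_restr[OF AA V] that(3,4)] that(3) submD(1)[OF V] by blast
  define H where "H = {h. h \<in> mod_hom A Y Y \<and> steq A Y Z (compose (carrier Y) p h) p}"
  define im where "im h = h ` carrier Y" for h :: "(nat \<Rightarrow> 'a) set \<Rightarrow> (nat \<Rightarrow> 'a) set"
  define kr where "kr h = {y \<in> carrier Y. h y = \<zero>\<^bsub>Y\<^esub>}" for h :: "(nat \<Rightarrow> 'a) set \<Rightarrow> (nat \<Rightarrow> 'a) set"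
  \<comment> \<open>A single number to minimize: it grows with the image and shrinks as the kernel
    grows. All ranks are at most \<open>n\<close>, so the subtraction is never truncated.\<close>
  define m where "m h = r (im h) + (n - r (kr h))" for h
  have imS: "subm A Y (im h)" if "h \<in> mod_hom A Y Y" for h
    unfolding im_def by (rule subm_image[OF Yl Yl that subm_carrier[OF Yl]])
  have krS: "subm A Y (kr h)" if "h \<in> mod_hom A Y Y" for h
    unfolding kr_def by (rule subm_kernel[OF Yl Yl that])
  have "(\<lambda>y\<in>carrier Y. y) \<in> H"
    using hom_id[OF Yl] steq_refl[OF AA Y Z p] by (simp add: H_def comp_id_right[OF p])
  then obtain h where hH: "h \<in> H" and min: "\<And>h'. h' \<in> H \<Longrightarrow> m h \<le> m h'"
    using ex_has_least_nat[of "\<lambda>h. h \<in> H" _ m] by blast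
  have h: "h \<in> mod_hom A Y Y" and ph: "steq A Y Z (compose (carrier Y) p h) p" using hH by (simp_all add: H_def)
  note [simp] = hom_closed[OF h] hom_closed[OF p]
  have extremal: "im h' = im h \<and> kr h' = kr h" if h': "h' \<in> H" and sub: "im h' \<subseteq> im h" "kr h \<subseteq> kr h'" for h'
  proof -
    have hh: "h' \<in> mod_hom A Y Y" using h' by (simp add: H_def)
    have le: "r (im h') \<le> r (im h)" "r (kr h) \<le> r (kr h')" "r (kr h') \<le> n"
      using r(2)[OF subm_restr[OF AA imS[OF hh]] subm_restr[OF AA imS[OF h]] sub(1)]
        r(2)[OF subm_restr[OF AA krS[OF h]] subm_restr[OF AA krS[OF hh]] sub(2)]
        r(1)[OF subm_restr[OF AA krS[OF hh]]] by simp_all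
    have "r (im h) + (n - r (kr h)) \<le> r (im h') + (n - r (kr h'))" using min[OF h'] by (simp add: m_def)
    then have "r (im h') = r (im h)" "r (kr h) = r (kr h')" using le by linarith+
    then show ?thesis using rs[OF imS[OF hh] imS[OF h] sub(1)] rs[OF krS[OF h] krS[OF hh] sub(2)] by simp
  qed
  have hh: "compose (carrier Y) h h \<in> H"
  proof -
    have "steq A Y Z (compose (carrier Y) p (compose (carrier Y) h h)) (compose (carrier Y) p h)"
      using steq_comp_right[OF Y Y ph h] unfolding comp_assoc[OF h] .
    then show ?thesis using hom_comp[OF Yl h h] steq_trans[OF Y Z _ ph] by (simp add: H_def)
  qed
  \<comment> \<open>As in Fitting's lemma: \<open>h h\<close> is again admissible, its image is no
    larger and its kernel no smaller. By extremality both agree with those of \<open>h\<close>, so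
    \<open>h\<close> is bijective on its own image.\<close>
  have hh2: "im (compose (carrier Y) h h) = im h \<and> kr (compose (carrier Y) h h) = kr h"
  proof (rule extremal[OF hh])
    show "im (compose (carrier Y) h h) \<subseteq> im h" by (auto simp: im_def compose_eq)
    show "kr h \<subseteq> kr (compose (carrier Y) h h)" using hom_zero[OF Yl Yl h] by (auto simp: kr_def compose_eq)
  qed
  obtain Y0 i where Y0: "Y0 \<in> fg_modules A" "i \<in> mod_hom A Y0 Y" "inj_on i (carrier Y0)" "i ` carrier Y0 = im h"
    by (rule subobject[OF AA Y imS[OF h]]) (rule that)
  note Y0l = fgD(1)[OF Y0(1)]
  interpret Y0: left_module A Y0 by (rule Y0l)
  note [simp] = hom_closed[OF Y0(2)]
  have i0: "y = \<zero>\<^bsub>Y0\<^esub>" if "y \<in> carrier Y0" "i y = \<zero>\<^bsub>Y\<^esub>" for y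
    using inj_on_iff_kernel[OF Y0l Yl Y0(2)] Y0(3) that by blast
  obtain h0 where h0: "h0 \<in> mod_hom A Y Y0" "\<And>y. y \<in> carrier Y \<Longrightarrow> i (h0 y) = h y"
  proof (rule hom_factor_inj[OF Yl Y0l Y0(2,3) h])
    show "h y \<in> i ` carrier Y0" if "y \<in> carrier Y" for y unfolding Y0(4) im_def using that by (rule imageI)
  qed (rule that)
  note [simp] = hom_closed[OF h0(1)]
  let ?\<phi> = "compose (carrier Y0) h0 i"
  have phi: "?\<phi> \<in> mod_hom A Y0 Y0" by (rule hom_comp[OF Y0l Y0(2) h0(1)])
  have phi_inj: "inj_on ?\<phi> (carrier Y0)"
  proof -
    have "y = \<zero>\<^bsub>Y0\<^esub>" if y: "y \<in> carrier Y0" and 0: "?\<phi> y = \<zero>\<^bsub>Y0\<^esub>" for y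
    proof -
      have "h0 (i y) = \<zero>\<^bsub>Y0\<^esub>" using 0 y by (simp add: compose_eq)
      then have hi: "h (i y) = \<zero>\<^bsub>Y\<^esub>" using h0(2)[of "i y"] y hom_zero[OF Y0l Yl Y0(2)] by simp
      have "i y \<in> im h" using y unfolding Y0(4)[symmetric] by (rule imageI)
      then obtain z where z: "z \<in> carrier Y" "i y = h z" by (auto simp: im_def)
      then have "z \<in> kr (compose (carrier Y) h h)" using hi by (simp add: kr_def compose_eq)
      then have "z \<in> kr h" using hh2 by simp
      then show ?thesis using z i0[OF y] by (simp add: kr_def)
    qed
    then show ?thesis using inj_on_iff_kernel[OF Y0l Y0l phi] by blast
  qed
  have phi_onto: "?\<phi> ` carrier Y0 = carrier Y0"
  proof (intro equalityI subsetI)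
    fix y assume y: "y \<in> carrier Y0"
    have "i y \<in> im h" using y unfolding Y0(4)[symmetric] by (rule imageI)
    then have "i y \<in> im (compose (carrier Y) h h)" using hh2 by simp
    then obtain z where z: "z \<in> carrier Y" "i y = h (h z)" by (auto simp: im_def compose_eq)
    have "i (?\<phi> (h0 z)) = i y" using z h0(2)[of "i (h0 z)"] h0(2)[of z] by (simp add: compose_eq)
    then have "?\<phi> (h0 z) = y" using inj_onD[OF Y0(3)] y z hom_closed[OF phi] by simp
    then show "y \<in> ?\<phi> ` carrier Y0" using z by (intro image_eqI[of _ _ "h0 z"]) simp_all
  qed (use hom_closed[OF phi] in auto)
  obtain \<psi> where psi: "\<psi> \<in> mod_hom A Y0 Y0" "\<And>y. y \<in> carrier Y0 \<Longrightarrow> ?\<phi> (\<psi> y) = y" "\<And>y. y \<in> carrier Y0 \<Longrightarrow> \<psi> (?\<phi> y) = y"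
    by (rule mod_isomorphic_inverse[OF Y0l Y0l phi phi_inj phi_onto]) (rule that)
  note [simp] = hom_closed[OF psi(1)]
  \<comment> \<open>\<open>\<psi>\<close> inverts the restriction of \<open>h\<close> to its image
    \<open>Y0\<close>. Composing it with the corestriction \<open>h0\<close> of \<open>h\<close>
    gives a projection onto that image.\<close>
  let ?q = "compose (carrier Y) \<psi> h0"
  have q: "?q \<in> mod_hom A Y Y0" by (rule hom_comp[OF Yl h0(1) psi(1)])
  note [simp] = hom_closed[OF q]
  have qi: "?q (i y) = y" if "y \<in> carrier Y0" for y using psi(3)[OF that] that by (simp add: compose_eq)
  have iq: "compose (carrier Y) i ?q \<in> mod_hom A Y Y" by (rule hom_comp[OF Yl q Y0(2)])
  have hiq: "compose (carrier Y) h (compose (carrier Y) i ?q) = h"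
  proof (rule hom_eqI[OF hom_comp[OF Yl iq h] h])
    fix y assume y: "y \<in> carrier Y"
    have "h (i (\<psi> (h0 y))) = i (h0 (i (\<psi> (h0 y))))" using y h0(2)[of "i (\<psi> (h0 y))"] by simp
    also have "\<dots> = h y" using y psi(2)[of "h0 y"] h0(2)[of y] by (simp add: compose_eq)
    finally show "compose (carrier Y) h (compose (carrier Y) i ?q) y = h y" using y by (simp add: compose_eq)
  qed
  \<comment> \<open>Since \<open>h i q = h\<close>, one has
    \<open>p i q \<sim> p h i q = p h \<sim> p\<close>.\<close>
  have piq: "steq A Y Z (compose (carrier Y) p (compose (carrier Y) i ?q)) p"
  proof -
    have "steq A Y Z (compose (carrier Y) (compose (carrier Y) p h) (compose (carrier Y) i ?q)) (compose (carrier Y) p (compose (carrier Y) i ?q))"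
      by (rule steq_comp_right[OF Y Y ph iq])
    then have "steq A Y Z (compose (carrier Y) p h) (compose (carrier Y) p (compose (carrier Y) i ?q))"
      unfolding comp_assoc[OF iq, symmetric] hiq .
    then show ?thesis using steq_trans[OF Y Z steq_sym[OF Y Z] ph] by blast
  qed
  have "\<exists>g'\<in>mod_hom A Y0 Y0. \<forall>y\<in>carrier Y0. g' (g y) = y"
    if g: "g \<in> mod_hom A Y0 Y0" and eq: "steq A Y0 Z (compose (carrier Y0) p (compose (carrier Y0) i g)) (compose (carrier Y0) p i)" for g
  proof -
    note [simp] = hom_closed[OF g]
    \<comment> \<open>Extending \<open>g\<close> to \<open>Y\<close> by \<open>i g q\<close> gives a
      competitor of \<open>h\<close> with no larger image and no smaller kernel. Extremality makes
      both equal, and this forces \<open>g\<close> to be bijective.\<close>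
    let ?g = "compose (carrier Y) (compose (carrier Y0) i g) ?q"
    have ig: "compose (carrier Y0) i g \<in> mod_hom A Y0 Y" by (rule hom_comp[OF Y0l g Y0(2)])
    have gh: "?g \<in> mod_hom A Y Y" by (rule hom_comp[OF Yl q ig])
    have ga: "?g y = i (g (?q y))" if "y \<in> carrier Y" for y
      using that hom_closed[OF q that] by (simp add: compose_eq[of _ "carrier Y0"] compose_eq[of _ "carrier Y" "compose (carrier Y0) i g"])
    have "steq A Y Z (compose (carrier Y) (compose (carrier Y0) p (compose (carrier Y0) i g)) ?q) (compose (carrier Y) (compose (carrier Y0) p i) ?q)"
      by (rule steq_comp_right[OF Y Y0(1) eq q])
    then have "steq A Y Z (compose (carrier Y) p ?g) (compose (carrier Y) p (compose (carrier Y) i ?q))"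
      unfolding comp_assoc[OF q, symmetric] .
    then have "?g \<in> H" using gh steq_trans[OF Y Z _ piq] by (simp add: H_def)
    moreover have "im ?g \<subseteq> im h"
    proof
      fix x assume "x \<in> im ?g"
      then obtain y where y: "y \<in> carrier Y" "x = ?g y" unfolding im_def by blast
      have "g (?q y) \<in> carrier Y0" using y by simp
      then have "i (g (?q y)) \<in> i ` carrier Y0" by (rule imageI)
      then show "x \<in> im h" unfolding y(2) ga[OF y(1)] Y0(4) .
    qed
    moreover have "kr h \<subseteq> kr ?g"
    proof
      fix y assume "y \<in> kr h"
      then have y: "y \<in> carrier Y" "h y = \<zero>\<^bsub>Y\<^esub>" by (simp_all add: kr_def)
      have "h0 y = \<zero>\<^bsub>Y0\<^esub>" using i0[of "h0 y"] h0(2)[OF y(1)] y by simp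
      then have "?q y = \<zero>\<^bsub>Y0\<^esub>" using y hom_zero[OF Y0l Y0l psi(1)] by (simp add: compose_eq)
      then have "?g y = \<zero>\<^bsub>Y\<^esub>" using ga[OF y(1)] hom_zero[OF Y0l Y0l g] hom_zero[OF Y0l Yl Y0(2)] by simp
      then show "y \<in> kr ?g" using y by (simp add: kr_def)
    qed
    ultimately have ext: "im ?g = im h" "kr ?g = kr h" using extremal by blast+
    have inj: "inj_on g (carrier Y0)"
    proof -
      have "y = \<zero>\<^bsub>Y0\<^esub>" if y: "y \<in> carrier Y0" and 0: "g y = \<zero>\<^bsub>Y0\<^esub>" for y
      proof -
        have "?g (i y) = \<zero>\<^bsub>Y\<^esub>" using ga[of "i y"] qi[OF y] y 0 hom_zero[OF Y0l Yl Y0(2)] by simp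
        then have "i y \<in> kr ?g" using y by (simp add: kr_def)
        then have "h (i y) = \<zero>\<^bsub>Y\<^esub>" unfolding ext(2) by (simp add: kr_def)
        then have "h0 (i y) = \<zero>\<^bsub>Y0\<^esub>" using i0[of "h0 (i y)"] h0(2)[of "i y"] y by simp
        then have "?q (i y) = \<zero>\<^bsub>Y0\<^esub>" using y hom_zero[OF Y0l Y0l psi(1)] by (simp add: compose_eq)
        then show ?thesis using qi[OF y] by simp
      qed
      then show ?thesis using inj_on_iff_kernel[OF Y0l Y0l g] by blast
    qed
    have onto: "g ` carrier Y0 = carrier Y0"
    proof (intro equalityI subsetI)
      fix y assume y: "y \<in> carrier Y0"
      have "i y \<in> im ?g" unfolding ext(1) Y0(4)[symmetric] using y by (rule imageI)
      then obtain z where z: "z \<in> carrier Y" "i y = ?g z" unfolding im_def by blast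
      then have "i y = i (g (?q z))" using ga by simp
      then have "y = g (?q z)" using inj_onD[OF Y0(3)] y z(1) hom_closed[OF q z(1)] by simp
      then show "y \<in> g ` carrier Y0" using hom_closed[OF q z(1)] by blast
    qed (use hom_closed[OF g] in auto)
    obtain g' where "g' \<in> mod_hom A Y0 Y0" "\<And>y. y \<in> carrier Y0 \<Longrightarrow> g' (g y) = y"
      by (rule mod_isomorphic_inverse[OF Y0l Y0l g inj onto]) (rule that)
    then show ?thesis by blast
  qed
  note last = this
  show thesis by (rule that[OF Y0(1,2) q qi piq]) (assumption, rule last)
qed

text \<open>Split off the right minimal part \<open>Y0\<close> of \<open>p\<close>. The maps
  \<open>F (p i)\<close> and \<open>e\<close> factor through each other stably, up to replacing
  \<open>E\<close> by a value of \<open>F\<close>: this gives \<open>a\<close> from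
  \<open>F Y0\<close> to \<open>E\<close> and \<open>b\<close> back. Minimality makes
  \<open>b a\<close> stably invertible, so \<open>F Y0\<close> is a stable retract of
  \<open>E\<close>. What \<open>Y0\<close> leaves of \<open>Y\<close> is stably a retract of
  \<open>X\<close>, and \<open>F X\<close> is in the class by assumption.\<close>

lemma middle_term_transport:
  fixes A :: "('k, 'a) module" and B :: "('k, 'b) module"
  assumes AA: "artin_algebra k A" and eq: "stable_equivalence A B Fo Fm"
    and S: "sclosed B \<S>" and X: "X \<in> fg_modules A" and Y: "Y \<in> fg_modules A" and Z: "Z \<in> fg_modules A"
    and se: "short_exact A X Y Z f p" and FX: "Fo X \<in> \<S>" and E: "E \<in> \<S>"
    and e: "e \<in> mod_hom B E (Fo Z)" "e ` carrier E = carrier (Fo Z)"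
    and fac: "\<And>W w. W \<in> fg_modules A \<Longrightarrow> w \<in> mod_hom A W Z \<Longrightarrow> factors A W Y p w \<longleftrightarrow> factors B (Fo W) E e (Fm W Z w)"
  shows "Fo Y \<in> \<S>"
proof -
  note F = stable_equivalenceD(1)[OF eq] and s = short_exactD[OF se]
  note X' = fgD(1)[OF X] and Y' = fgD(1)[OF Y] and Z' = fgD(1)[OF Z]
  interpret Y: left_module A Y by (rule Y')
  interpret Z: left_module A Z by (rule Z')
  obtain Y0 i q where Y0: "Y0 \<in> fg_modules A" "i \<in> mod_hom A Y0 Y" "q \<in> mod_hom A Y Y0"
    "\<And>y. y \<in> carrier Y0 \<Longrightarrow> q (i y) = y" "steq A Y Z (compose (carrier Y) p (compose (carrier Y) i q)) p"
    "\<And>g. g \<in> mod_hom A Y0 Y0 \<Longrightarrow> steq A Y0 Z (compose (carrier Y0) p (compose (carrier Y0) i g)) (compose (carrier Y0) p i) \<Longrightarrow>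
      \<exists>g'\<in>mod_hom A Y0 Y0. \<forall>y\<in>carrier Y0. g' (g y) = y"
    by (rule stably_right_minimal_part[OF AA Y Z s(2)]) (rule that)
  note Y0' = fgD(1)[OF Y0(1)]
  note [simp] = hom_closed[OF s(1)] hom_closed[OF s(2)] hom_closed[OF Y0(2)] hom_closed[OF Y0(3)]
  note iq = hom_comp[OF Y' Y0(3,2)]
  note FY0 = stable_functorD(1)[OF F Y0(1)] and FY = stable_functorD(1)[OF F Y] and FZ = stable_functorD(1)[OF F Z]
  note Ef = sclosedD(1)[OF S E]
  note FY0' = fgD(1)[OF FY0] and E' = fgD(1)[OF Ef]
  let ?M = "carrier (Fo Y0)"
  have FY0S: "Fo Y0 \<in> \<S>"
  proof -
    note pi = hom_comp[OF Y0' Y0(2) s(2)]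
    note Fpi = stable_functorD(2)[OF F Y0(1) Z pi]
    have "factors A Y0 Y p (compose (carrier Y0) p i)" by (rule factorsI[OF Y0(2)]) (simp add: compose_eq)
    then have "factors B (Fo Y0) E e (Fm Y0 Z (compose (carrier Y0) p i))" using fac[OF Y0(1) pi] by simp
    then obtain a where a: "a \<in> mod_hom B (Fo Y0) E" "\<And>x. x \<in> ?M \<Longrightarrow> e (a x) = Fm Y0 Z (compose (carrier Y0) p i) x"
      by (rule factorsE) (rule that)
    have ea: "compose ?M e a = Fm Y0 Z (compose (carrier Y0) p i)"
      using a(2) by (intro hom_eqI[OF hom_comp[OF FY0' a(1) e(1)] Fpi]) (simp add: compose_eq)
    \<comment> \<open>The factoring hypothesis only concerns maps out of values of \<open>F\<close>.
      As \<open>E\<close> need not be one, it is replaced by an \<open>F W\<close> of which it is a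
      stable retract.\<close>
    obtain W \<sigma> t where W: "W \<in> fg_modules A" "\<sigma> \<in> mod_hom B (Fo W) E" "t \<in> mod_hom B E (Fo W)"
      "steq B E E (compose (carrier E) \<sigma> t) (\<lambda>y\<in>carrier E. y)"
      using stable_equivalenceD(4)[OF eq Ef] by blast
    note FW = stable_functorD(1)[OF F W(1)] and W' = fgD(1)[OF W(1)]
    note FW' = fgD(1)[OF FW]
    note es = hom_comp[OF FW' W(2) e(1)]
    obtain w where w: "w \<in> mod_hom A W Z" "steq B (Fo W) (Fo Z) (Fm W Z w) (compose (carrier (Fo W)) e \<sigma>)"
      using stable_equivalenceD(3)[OF eq W(1) Z es] by blast
    have "factors B (Fo W) E e (compose (carrier (Fo W)) e \<sigma>)" by (rule factorsI[OF W(2)]) (simp add: compose_eq)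
    then have "factors B (Fo W) E e (Fm W Z w)" by (rule factors_steq[OF FW Ef FZ e w(2)])
    then have "factors A W Y p w" using fac[OF W(1) w(1)] by simp
    then obtain v where v: "v \<in> mod_hom A W Y" "\<And>x. x \<in> carrier W \<Longrightarrow> p (v x) = w x" by (rule factorsE) (rule that)
    note qv = hom_comp[OF W' v(1) Y0(3)]
    note Fqv = stable_functorD(2)[OF F W(1) Y0(1) qv]
    let ?b = "compose (carrier E) (Fm W Y0 (compose (carrier W) q v)) t"
    have b: "?b \<in> mod_hom B E (Fo Y0)" by (rule hom_comp[OF E' W(3) Fqv])
    note ba = hom_comp[OF FY0' a(1) b]
    note ta = hom_comp[OF FY0' a(1) W(3)]
    \<comment> \<open>Fullness lifts \<open>b a\<close> to an endomorphism \<open>g\<close> of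
      \<open>Y0\<close>. Below, \<open>F (p i) b a \<sim> F (p i)\<close> and faithfulness give
      \<open>p i g \<sim> p i\<close>, so the minimality of \<open>Y0\<close> applies to
      \<open>g\<close>.\<close>
    obtain g where g: "g \<in> mod_hom A Y0 Y0" "steq B (Fo Y0) (Fo Y0) (Fm Y0 Y0 g) (compose ?M ?b a)"
      using stable_equivalenceD(3)[OF eq Y0(1) Y0(1) ba] by blast
    have wv: "compose (carrier W) p v = w"
      using v(2) by (intro hom_eqI[OF hom_comp[OF W' v(1) s(2)] w(1)]) (simp add: compose_eq)
    \<comment> \<open>\<open>F(p i) F(q v) \<sim> F(p i q v) \<sim> F(p v) = F w \<sim> e \<sigma>\<close>\<close>
    have "steq A W Z (compose (carrier W) (compose (carrier Y0) p i) (compose (carrier W) q v)) w"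
      using steq_comp_right[OF W(1) Y Y0(5) v(1)]
      unfolding wv comp_assoc[OF qv, symmetric] comp_assoc[OF v(1), symmetric] .
    from steq_trans[OF FW FZ steq_sym[OF FW FZ stable_functorD(6)[OF F W(1) Y0(1) Z qv pi]]
        steq_trans[OF FW FZ stable_functorD(3)[OF F W(1) Z this] w(2)]]
    have 1: "steq B (Fo W) (Fo Z) (compose (carrier (Fo W)) (Fm Y0 Z (compose (carrier Y0) p i)) (Fm W Y0 (compose (carrier W) q v)))
       (compose (carrier (Fo W)) e \<sigma>)" .
    have 2: "steq B (Fo Y0) (Fo Z) (compose ?M (Fm Y0 Z (compose (carrier Y0) p i)) (compose ?M ?b a)) (Fm Y0 Z (compose (carrier Y0) p i))"
    proof -
      have "steq B (Fo Y0) (Fo Z) (compose ?M (compose (carrier (Fo W)) (Fm Y0 Z (compose (carrier Y0) p i)) (Fm W Y0 (compose (carrier W) q v))) (compose ?M t a))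
          (compose ?M (compose (carrier (Fo W)) e \<sigma>) (compose ?M t a))"
        by (rule steq_comp_right[OF FY0 FW 1 ta])
      then have A1: "steq B (Fo Y0) (Fo Z) (compose ?M (Fm Y0 Z (compose (carrier Y0) p i)) (compose ?M ?b a))
          (compose ?M e (compose ?M (compose (carrier E) \<sigma> t) a))"
        unfolding comp_assoc[OF ta, symmetric] comp_assoc[OF a(1), symmetric] .
      have "steq B (Fo Y0) E (compose ?M (compose (carrier E) \<sigma> t) a) (compose ?M (\<lambda>y\<in>carrier E. y) a)"
        by (rule steq_comp_right[OF FY0 Ef W(4) a(1)])
      then have "steq B (Fo Y0) E (compose ?M (compose (carrier E) \<sigma> t) a) a" unfolding comp_id_left[OF a(1)] .
      from steq_comp_left[OF FY0 Ef this e(1)]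
      have A2: "steq B (Fo Y0) (Fo Z) (compose ?M e (compose ?M (compose (carrier E) \<sigma> t) a)) (Fm Y0 Z (compose (carrier Y0) p i))"
        unfolding ea .
      show ?thesis by (rule steq_trans[OF FY0 FZ A1 A2])
    qed
    note pig = hom_comp[OF Y0' g(1) pi]
    have "steq B (Fo Y0) (Fo Z) (Fm Y0 Z (compose (carrier Y0) (compose (carrier Y0) p i) g)) (Fm Y0 Z (compose (carrier Y0) p i))"
      by (rule steq_trans[OF FY0 FZ stable_functorD(6)[OF F Y0(1) Y0(1) Z g(1) pi]
            steq_trans[OF FY0 FZ steq_comp_left[OF FY0 FY0 g(2) Fpi] 2]])
    then have "steq A Y0 Z (compose (carrier Y0) (compose (carrier Y0) p i) g) (compose (carrier Y0) p i)"
      by (rule stable_equivalenceD(2)[OF eq Y0(1) Z pig pi])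
    then have "steq A Y0 Z (compose (carrier Y0) p (compose (carrier Y0) i g)) (compose (carrier Y0) p i)"
      unfolding comp_assoc[OF g(1)] .
    then obtain g' where g': "g' \<in> mod_hom A Y0 Y0" "\<forall>y\<in>carrier Y0. g' (g y) = y" using Y0(6)[OF g(1)] by blast
    note Fg' = stable_functorD(2)[OF F Y0(1) Y0(1) g'(1)]
    have gg: "compose (carrier Y0) g' g = (\<lambda>y\<in>carrier Y0. y)"
      using g'(2) by (intro hom_eqI[OF hom_comp[OF Y0' g(1) g'(1)] hom_id[OF Y0']]) (simp add: compose_eq)
    have "steq B (Fo Y0) (Fo Y0) (compose ?M (Fm Y0 Y0 g') (compose ?M ?b a)) (compose ?M (Fm Y0 Y0 g') (Fm Y0 Y0 g))"
      by (rule steq_comp_left[OF FY0 FY0 steq_sym[OF FY0 FY0 g(2)] Fg'])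
    moreover have "steq B (Fo Y0) (Fo Y0) (compose ?M (Fm Y0 Y0 g') (Fm Y0 Y0 g)) (\<lambda>y\<in>?M. y)"
      using steq_trans[OF FY0 FY0 steq_sym[OF FY0 FY0 stable_functorD(6)[OF F Y0(1) Y0(1) Y0(1) g(1) g'(1)]]]
        stable_functorD(5)[OF F Y0(1)] unfolding gg by blast
    ultimately have "steq B (Fo Y0) (Fo Y0) (compose ?M (Fm Y0 Y0 g') (compose ?M ?b a)) (\<lambda>y\<in>?M. y)"
      by (rule steq_trans[OF FY0 FY0])
    then have "steq B (Fo Y0) (Fo Y0) (compose ?M (compose (carrier E) (Fm Y0 Y0 g') ?b) a) (\<lambda>y\<in>?M. y)"
      unfolding comp_assoc[OF a(1)] .
    then show ?thesis by (rule sclosed_stable_retract[OF S E FY0 a(1) hom_comp[OF E' b Fg']])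
  qed
  \<comment> \<open>The part of \<open>Y\<close> killed by \<open>p\<close> stably is a stable retract of \<open>X\<close>.\<close>
  obtain d where d: "d \<in> proj_hom A Y Z" "\<And>y. y \<in> carrier Y \<Longrightarrow> p y = d y \<oplus>\<^bsub>Z\<^esub> compose (carrier Y) p (compose (carrier Y) i q) y"
    by (rule steqE[OF steq_sym[OF Y Z Y0(5)]]) (rule that)
  obtain P \<sigma> \<rho> where P: "projective A P" "\<sigma> \<in> mod_hom A Y P" "\<rho> \<in> mod_hom A P Z" "d = compose (carrier Y) \<rho> \<sigma>"
    using d(1) by (rule proj_homE)
  obtain \<tau> where tau: "\<tau> \<in> mod_hom A P Y" "\<And>x. x \<in> carrier P \<Longrightarrow> p (\<tau> x) = \<rho> x"
    by (rule projective_lift[OF P(1) Y Z s(2,4) P(3)]) (rule that)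
  note [simp] = hom_closed[OF P(2)] hom_closed[OF tau(1)] hom_closed[OF P(3)]
  note ts = hom_comp[OF Y' P(2) tau(1)]
  \<comment> \<open>\<open>p\<close> and \<open>p i q\<close> differ by a map
    \<open>\<rho> \<sigma>\<close> through the projective \<open>P\<close>, and
    \<open>\<tau>\<close> lifts \<open>\<rho>\<close> along \<open>p\<close>. So
    \<open>1 - \<tau> \<sigma> - i q\<close> is killed by \<open>p\<close> itself and takes values
    in the image of \<open>X\<close>.\<close>
  let ?c = "hadd Y Y (\<lambda>y\<in>carrier Y. y) (hneg Y Y (hadd Y Y (compose (carrier Y) \<tau> \<sigma>) (compose (carrier Y) i q)))"
  have ch: "?c \<in> mod_hom A Y Y" by (intro hom_hadd hom_hneg hom_id Y' ts iq)
  have ca: "?c y = y \<ominus>\<^bsub>Y\<^esub> (\<tau> (\<sigma> y) \<oplus>\<^bsub>Y\<^esub> i (q y))" if "y \<in> carrier Y" for y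
    using that by (simp add: hadd_apply hneg_apply compose_eq a_minus_def)
  obtain l where l: "l \<in> mod_hom A Y X" "\<And>y. y \<in> carrier Y \<Longrightarrow> f (l y) = ?c y"
  proof (rule hom_factor_inj[OF Y' X' s(1,3) ch])
    fix y assume y: "y \<in> carrier Y"
    have "p (?c y) = p y \<ominus>\<^bsub>Z\<^esub> (\<rho> (\<sigma> y) \<oplus>\<^bsub>Z\<^esub> p (i (q y)))"
      unfolding ca[OF y] using y by (simp add: hom_diff[OF Y' Z' s(2)] hom_add[OF s(2)] tau(2))
    also have "\<dots> = \<zero>\<^bsub>Z\<^esub>" using d(2)[OF y] y by (simp add: P(4) compose_eq Z.M.diff_eq_zero_iff)
    finally have "p (?c y) = \<zero>\<^bsub>Z\<^esub>" .
    then obtain x where "x \<in> carrier X" "f x = ?c y" using s(6)[OF hom_closed[OF ch y]] by blast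
    then show "?c y \<in> f ` carrier X" by (metis imageI)
  qed (rule that)
  note [simp] = hom_closed[OF l(1)]
  have "steq A Y Y (\<lambda>y\<in>carrier Y. y) (hadd Y Y (compose (carrier Y) i q) (compose (carrier Y) f l))"
  proof (rule steqI[OF hom_id[OF Y'] hom_hadd[OF Y' Y' iq hom_comp[OF Y' l(1) s(1)]] proj_homI[OF P(1,2) tau(1)]])
    fix y assume y: "y \<in> carrier Y"
    have "?c y \<oplus>\<^bsub>Y\<^esub> (\<tau> (\<sigma> y) \<oplus>\<^bsub>Y\<^esub> i (q y)) = y"
      unfolding ca[OF y] using y by (intro Y.M.diff_add_cancel) simp_all
    then have "f (l y) \<oplus>\<^bsub>Y\<^esub> (\<tau> (\<sigma> y) \<oplus>\<^bsub>Y\<^esub> i (q y)) = y" unfolding l(2)[OF y] .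
    then have "\<tau> (\<sigma> y) \<oplus>\<^bsub>Y\<^esub> (i (q y) \<oplus>\<^bsub>Y\<^esub> f (l y)) = y" using y by (simp add: Y.M.a_ac)
    then show "(\<lambda>y\<in>carrier Y. y) y = compose (carrier Y) \<tau> \<sigma> y \<oplus>\<^bsub>Y\<^esub> hadd Y Y (compose (carrier Y) i q) (compose (carrier Y) f l) y"
      using y by (simp add: compose_eq hadd_apply)
  qed
  then show ?thesis
    by (rule functor_stable_retract2[OF F S Y Y0(1) X Y0(3,2) l(1) s(1) _ FY0S FX])
qed

section \<open>Extension dimension\<close>

lemma short_exact_id:
  assumes AA: "artin_algebra k A" and X: "X \<in> fg_modules A"
  obtains O' f where "O' \<in> zero_modules A" "short_exact A O' X X f (\<lambda>x\<in>carrier X. x)"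
proof -
  note Z = zero_object[OF AA X] and X' = fgD(1)[OF X]
  note Z' = fgD(1)[OF zero_modulesD(1)[OF Z]]
  interpret X: left_module A X by (rule X')
  have "short_exact A (X\<lparr>carrier := {\<zero>\<^bsub>X\<^esub>}\<rparr>) X X (hzero (X\<lparr>carrier := {\<zero>\<^bsub>X\<^esub>}\<rparr>) X) (\<lambda>x\<in>carrier X. x)"
    by (rule short_exactI[OF hom_hzero[OF Z' X'] hom_id[OF X']]) (auto simp: inj_on_def hzero_def)
  then show thesis by (rule that[OF Z])
qed

section \<open>The iterated extension classes and their transport\<close>

lemma ext_power_fg: "X \<in> ext_power A T (Suc n) \<Longrightarrow> X \<in> fg_modules A"
  by (cases n) (auto simp: ext_product_def dest: add_closure_fg)

text \<open>Every \<open>X\<close> is an extension of itself by a zero module, and zero modules lie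
  in every additive closure.\<close>

lemma ext_power_Suc_mono:
  assumes AA: "artin_algebra k A"
  shows "ext_power A T (Suc n) \<subseteq> ext_power A T (Suc (Suc n))"
proof
  fix X assume X: "X \<in> ext_power A T (Suc n)"
  note Xf = ext_power_fg[OF X]
  obtain O' f where O': "O' \<in> zero_modules A" "short_exact A O' X X f (\<lambda>x\<in>carrier X. x)"
    by (rule short_exact_id[OF AA Xf]) (rule that)
  have "O' \<in> add_closure A {T}" using O'(1) by (rule add_closure.empty_sum)
  then show "X \<in> ext_power A T (Suc (Suc n))"
    unfolding ext_power.simps ext_product_def using Xf X O'(2) by (intro add_closure.base CollectI conjI) blast+
qed

lemma add_closure_ext_power:
  assumes AA: "artin_algebra k A"
  shows "add_closure A {T} \<subseteq> ext_power A T (Suc n)"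
proof (induction n)
  case (Suc n)
  then show ?case using ext_power_Suc_mono[OF AA] by (rule subset_trans)
qed simp

lemma sclosed_ext_power:
  assumes AA: "artin_algebra k A" and P: "free_gen A P u" and PT: "P \<in> add_closure A {T}"
  shows "sclosed A (ext_power A T (Suc n))"
proof -
  have "P \<in> ext_power A T (Suc n)" using add_closure_ext_power[OF AA] PT by (rule subsetD)
  then show ?thesis
    by (cases n) (simp_all add: ext_product_def sclosed_add_closure[OF AA P])
qed

lemma functor_add_closure_single:
  assumes AA: "artin_algebra k A" and F: "stable_functor A B Fo Fm" and S: "sclosed B \<S>"
    and T: "Fo T \<in> \<S>" and X: "X \<in> add_closure A {T}"
  shows "Fo X \<in> \<S>"
proof (rule functor_add_closure[OF AA F S _ X])
  fix V assume "V \<in> {T}"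
  then show "Fo V \<in> \<S>" using T by simp
qed

text \<open>The conditions on \<open>T'\<close> cover the three contributions: \<open>P\<close> the
  projective differences, \<open>Fo T\<close> the images of kernel terms, and
  \<open>liftable\<close> the transported kernels. The exponent does not grow, since an extension of
  \<open>Z\<close> by a module in the additive closure of \<open>T\<close> is matched by an
  extension of \<open>F Z\<close> by a \<open>K\<close> in the additive closure of
  \<open>T'\<close>.\<close>

lemma ext_power_transport:
  fixes A :: "('k, 'a) module" and B :: "('k, 'b) module"
  assumes AA: "artin_algebra k A" and BB: "artin_algebra k B" and eq: "stable_equivalence A B Fo Fm"
    and P: "free_gen B P u" and PT: "P \<in> add_closure B {T'}" and FT: "Fo T \<in> add_closure B {T'}"
    and lift: "liftable A B Fo Fm (add_closure B {T'}) T"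
    and X: "X \<in> ext_power A T (Suc n)"
  shows "Fo X \<in> ext_power B T' (Suc n)"
  using X
proof (induction n arbitrary: X)
  note F = stable_equivalenceD(1)[OF eq]
  case 0
  then have "X \<in> add_closure A {T}" by simp
  then have "Fo X \<in> add_closure B {T'}"
    by (rule functor_add_closure_single[OF AA F sclosed_add_closure[OF BB P PT] FT])
  then show ?case by simp
next
  note F = stable_equivalenceD(1)[OF eq]
  case (Suc n)
  let ?S = "ext_power B T' (Suc (Suc n))"
  note S = sclosed_ext_power[OF BB P PT, of "Suc n"]
  have "X \<in> add_closure A {X \<in> fg_modules A. \<exists>T1\<in>add_closure A {T}. \<exists>T2\<in>ext_power A T (Suc n). \<exists>f g. short_exact A T1 X T2 f g}"
    using Suc.prems by (simp add: ext_product_def)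
  then show ?case
  proof (rule functor_add_closure[OF AA F S, rotated])
    fix Y assume "Y \<in> {X \<in> fg_modules A. \<exists>T1\<in>add_closure A {T}. \<exists>T2\<in>ext_power A T (Suc n). \<exists>f g. short_exact A T1 X T2 f g}"
    then obtain V Z f g where Y: "Y \<in> fg_modules A" and V: "V \<in> add_closure A {T}" and ZS: "Z \<in> ext_power A T (Suc n)"
      and se: "short_exact A V Y Z f g" by blast
    note Vf = add_closure_fg[OF V] and Z = ext_power_fg[OF ZS]
    have lV: "liftable A B Fo Fm (add_closure B {T'}) V"
      by (rule liftable_add_closure[OF BB F sclosed_add_closure[OF BB P PT] lift V])
    obtain K E \<kappa> e where K: "K \<in> add_closure B {T'}" and E: "E \<in> fg_modules B" and seE: "short_exact B K E (Fo Z) \<kappa> e"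
      and fac: "\<And>W w. W \<in> fg_modules A \<Longrightarrow> w \<in> mod_hom A W Z \<Longrightarrow> factors A W Y g w \<longleftrightarrow> factors B (Fo W) E e (Fm W Z w)"
      by (rule liftableE[OF lV Y Z se]) (rule that)
    \<comment> \<open>\<open>K\<close> lies in the first power of \<open>T'\<close>, and
      \<open>Fo Z\<close> lies in the power \<open>Suc n\<close> by induction.\<close>
    have ES: "E \<in> ?S"
      unfolding ext_power.simps ext_product_def
      using E K Suc.IH[OF ZS] seE by (intro add_closure.base CollectI conjI) blast+
    have "Fo V \<in> add_closure B {T'}"
      by (rule functor_add_closure_single[OF AA F sclosed_add_closure[OF BB P PT] FT V])
    then have FV: "Fo V \<in> ?S" using add_closure_ext_power[OF BB] by blast
    show "Fo Y \<in> ?S"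
      by (rule middle_term_transport[OF AA eq S Vf Y Z se FV ES short_exactD(2,4)[OF seE] fac])
  qed
qed

text \<open>Every \<open>B\<close>-module is a stable retract of some \<open>Fo X\<close>, and the
  class that contains all \<open>Fo X\<close> is closed under stable retracts.\<close>

lemma ext_power_covers_transport:
  fixes A :: "('k, 'a) module" and B :: "('k, 'b) module"
  assumes AA: "artin_algebra k A" and BB: "artin_algebra k B" and AB: "stably_equivalent k A B"
    and T: "T \<in> fg_modules A" and cover: "fg_modules A = ext_power A T (Suc n)"
  shows "\<exists>T'\<in>fg_modules B. fg_modules B = ext_power B T' (Suc n)"
proof -
  obtain Fo Fm where eq: "stable_equivalence A B Fo Fm"
    by (rule stable_equivalence_exists[OF AA BB AB]) (rule that)
  note F = stable_equivalenceD(1)[OF eq]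
  obtain P u where P: "free_gen B P u" using free_gen_exists[OF artin_algebraD(1)[OF BB]] by blast
  note Pf = free_genD(1)[OF P] and FT = stable_functorD(1)[OF F T]
  obtain K where K: "K \<in> fg_modules B" and lift: "\<And>\<K>. K \<in> \<K> \<Longrightarrow> liftable A B Fo Fm \<K> T"
    by (rule liftable_single[OF AA BB eq T]) (rule that)
  \<comment> \<open>\<open>T'\<close> is the sum of \<open>Fo T\<close>, the free module
    \<open>P\<close> and \<open>K\<close>. Each of the three is a retract of \<open>T'\<close> and
    so lies in its additive closure.\<close>
  obtain D i1 j1 p1 q1 where D: "D \<in> fg_modules B" and b1: "biprod B D (Fo T) P i1 j1 p1 q1"
    by (rule biprod_exists[OF FT Pf]) (rule that)
  obtain T' i2 j2 p2 q2 where T': "T' \<in> fg_modules B" and b2: "biprod B T' D K i2 j2 p2 q2"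
    by (rule biprod_exists[OF D K]) (rule that)
  note b1 = biprodD[OF b1] and b2 = biprodD[OF b2]
  have T'a: "T' \<in> add_closure B {T'}" using T' by (intro add_closure.base) simp_all
  have Da: "D \<in> add_closure B {T'}" by (rule add_closure_retract[OF BB T'a D b2(1,3)]) (rule b2(5))
  have Ka: "K \<in> add_closure B {T'}" by (rule add_closure_retract[OF BB T'a K b2(2,4)]) (rule b2(7))
  have FTa: "Fo T \<in> add_closure B {T'}" by (rule add_closure_retract[OF BB Da FT b1(1,3)]) (rule b1(5))
  have Pa: "P \<in> add_closure B {T'}" by (rule add_closure_retract[OF BB Da Pf b1(2,4)]) (rule b1(7))
  have "V \<in> ext_power B T' (Suc n)" if V: "V \<in> fg_modules B" for V
  proof -
    obtain X s t where X: "X \<in> fg_modules A" "s \<in> mod_hom B (Fo X) V" "t \<in> mod_hom B V (Fo X)"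
      "steq B V V (compose (carrier V) s t) (\<lambda>y\<in>carrier V. y)"
      using stable_equivalenceD(4)[OF eq V] by blast
    have "Fo X \<in> ext_power B T' (Suc n)"
      using X(1) cover by (intro ext_power_transport[OF AA BB eq P Pa FTa lift[OF Ka]]) simp
    then show ?thesis by (rule sclosed_stable_retract[OF sclosed_ext_power[OF BB P Pa] _ V X(3,2,4)])
  qed
  then have "fg_modules B = ext_power B T' (Suc n)" using ext_power_fg by blast
  then show ?thesis using T' by blast
qed

theorem theorem1p2:
  fixes k :: "'k ring" and A :: "('k, 'a) module" and B :: "('k, 'b) module"
  assumes "artin_algebra k A" and "artin_algebra k B"
    and "stably_equivalent k A B"
  shows "ext_dim A = ext_dim B"
proof -
  \<comment> \<open>Both extension dimensions are infima over the same set of exponents, the second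
    inclusion coming from the inverse equivalence.\<close>
  have "(\<exists>T\<in>fg_modules A. fg_modules A = ext_power A T (Suc n)) \<longleftrightarrow>
    (\<exists>T\<in>fg_modules B. fg_modules B = ext_power B T (Suc n))" for n
    using ext_power_covers_transport[OF assms] ext_power_covers_transport[OF assms(2,1) stably_equivalent_sym[OF assms(3)]]
    by blast
  then show ?thesis by (simp add: ext_dim_def)
qed

end
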